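(* The $\tilde{\mathcal{A}}$-module $V_{\tilde{\mathcal{A}}}$ with the vector ${\bf 1}$ is a vacuum $\tilde{\mathcal{A}}$-module which is universal (for every vacuum $\tilde{\mathcal{A}}$-module $(W,v)$ there is a unique $\tilde{\mathcal{A}}$-module homomorphism $V_{\tilde{\mathcal{A}}}\to W$ sending ${\bf 1}$ to $v$), and there exists a weak quantum vertex algebra structure on $V_{\tilde{\mathcal{A}}}$, which is uniquely determined by the condition that ${\bf 1}$ is the vacuum vector and $Y(\tilde{a},z)=\tilde{Y}(z)$, $Y(\tilde{b},z)=\tilde{Y}^{*}(z)$. Furthermore, for every restricted $\tilde{\mathcal{A}}$-module $W$, there exists a $V_{\tilde{\mathcal{A}}}$-module structure $Y_W(\cdot,z)$ on $W$, which is uniquely determined by $Y_W(\tilde{a},z)=\tilde{Y}(z)$, $Y_W(\tilde{b},z)=\tilde{Y}^{*}(z)$.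
   Context: All spaces are over $\mathbb{C}$; $\delta(z)=\sum_{n\in\mathbb{Z}}z^n$; expressions $(x_1-x_2)^n$ are expanded in nonnegative powers of the second variable. $\tilde{\mathcal{A}}$ is the associative algebra with identity generated by $\tilde{Y}_n,\tilde{Y}_n^{*}$ ($n\in\mathbb{Z}$) subject to $$\tilde{Y}(z)\tilde{Y}(w)+e^{w-z}\tilde{Y}(w)\tilde{Y}(z)=0,\quad \tilde{Y}^{*}(z)\tilde{Y}^{*}(w)+e^{w-z}\tilde{Y}^{*}(w)\tilde{Y}^{*}(z)=0,$$ $$\tilde{Y}(z)\tilde{Y}^{*}(w)+e^{z-w}\tilde{Y}^{*}(w)\tilde{Y}(z)=w^{-1}\delta\left(\tfrac{z}{w}\right),$$ where $\tilde{Y}(z)=\sum_n\tilde{Y}_nz^{-n-1}$, $\tilde{Y}^{*}(z)=\sum_n\tilde{Y}_n^{*}z^{-n-1}$. In components, for $m,n\in\mathbb{Z}$: $$\tilde{Y}_{m}\tilde{Y}_{n}+\sum_{k,i\ge0}\tfrac{1}{k!}\tbinom{k}{i}(-1)^{i}\tilde{Y}_{n+k-i}\tilde{Y}_{m+i}=0,\quad \tilde{Y}^{*}_{m}\tilde{Y}^{*}_{n}+\sum_{k,i\ge0}\tfrac{1}{k!}\tbinom{k}{i}(-1)^{i}\tilde{Y}^{*}_{n+k-i}\tilde{Y}^{*}_{m+i}=0,$$ $$\tilde{Y}_{m}\tilde{Y}^{*}_{n}+\sum_{k,i\ge0}\tfrac{1}{k!}\tbinom{k}{i}(-1)^{i}\tilde{Y}^{*}_{n+i}\tilde{Y}_{m+k-i}=\delta_{m+n+1,0}.$$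 As these are infinite sums, $\tilde{\mathcal{A}}$ is understood as a topological algebra: an $\tilde{\mathcal{A}}$-module is a vector space $W$ with operators $\tilde{Y}_n,\tilde{Y}_n^{*}\in\mathrm{End}(W)$ such that, applied to each vector of $W$, these sums are finite and the relations hold. It is restricted if for every $w\in W$, $\tilde{Y}_nw=0=\tilde{Y}_n^{*}w$ for $n$ sufficiently large. A vacuum vector is a nonzero $v\in W$ with $\tilde{Y}_nv=0=\tilde{Y}_n^{*}v$ for $n\ge0$; a vacuum $\tilde{\mathcal{A}}$-module is an $\tilde{\mathcal{A}}$-module $W$ together with a vacuum vector $v$ generating it, $W=\tilde{\mathcal{A}}v$. Construction of $V_{\tilde{\mathcal{A}}}$: let $T$ be the free unital associative algebra on $\bar{Y}_n,\bar{Y}_n^{*}$ ($n\in\mathbb{Z}$), $T_+$ the span of the words $a^{(1)}_{n_1}\cdots a^{(r)}_{n_r}$ with $r\ge1$, $a^{(i)}\in\{\bar{Y},\bar{Y}^{*}\}$, $n_1+\cdots+n_r\ge0$, and $V_T=T/TT_+$ (a left $T$-module, on each vector of which $\bar{Y}_n,\bar{Y}^{*}_n$ vanish for $n$ large). $V_{\tilde{\mathcal{A}}}$ is the quotient $T$-module of $V_T$ by the relations $$\bar{Y}_{m}\bar{Y}_{n}+\sum_{k,i\ge0}\tfrac{1}{k!}\tbinom{k}{i}(-1)^{i}\bar{Y}_{n+k-i}\bar{Y}_{m+i}=0,\quad \bar{Y}^{*}_{m}\bar{Y}^{*}_{n}+\sum_{k,i\ge0}\tfrac{1}{k!}\tbinom{k}{i}(-1)^{i}\bar{Y}^{*}_{n+k-i}\bar{Y}^{*}_{m+i}=0,$$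 $$\bar{Y}_{m}\bar{Y}^{*}_{n}+\sum_{k,i\ge0}\tfrac{1}{k!}\tbinom{k}{i}(-1)^{i}\bar{Y}^{*}_{n+i}\bar{Y}_{m+k-i}=\delta_{m+n+1,0}$$ for $m,n\in\mathbb{Z}$, imposed on all vectors; it is naturally an $\tilde{\mathcal{A}}$-module, with $\tilde{Y}_n,\tilde{Y}_n^{*}$ acting as $\bar{Y}_n,\bar{Y}_n^{*}$. ${\bf 1}$ is the image of $1$, $\tilde{a}=\tilde{Y}_{-1}{\bf 1}$, $\tilde{b}=\tilde{Y}_{-1}^{*}{\bf 1}$. A weak quantum vertex algebra is a vector space $V$ with a linear map $Y(\cdot,x):V\to\mathrm{Hom}(V,V((x)))$, $v\mapsto Y(v,x)=\sum_nv_nx^{-n-1}$, and a vector ${\bf 1}\in V$ (the vacuum vector) such that $Y({\bf 1},x)v=v$, $Y(v,x){\bf 1}\in V[[x]]$, $\lim_{x\to0}Y(v,x){\bf 1}=v$ for $v\in V$, and for $u,v\in V$ there exists $\sum_{i=1}^rv^{(i)}\otimes u^{(i)}\otimes f_i(x)\in V\otimes V\otimes\mathbb{C}((x))$ with $$x_0^{-1}\delta\left(\tfrac{x_1-x_2}{x_0}\right)Y(u,x_1)Y(v,x_2)-x_0^{-1}\delta\left(\tfrac{x_2-x_1}{-x_0}\right)\sum_{i=1}^rf_i(-x_0)Y(v^{(i)},x_2)Y(u^{(i)},x_1)=x_2^{-1}\delta\left(\tfrac{x_1-x_0}{x_2}\right)Y(Y(u,x_0)v,x_2).$$ A $V$-module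 is a vector space $W$ with a linear map $Y_W(\cdot,x):V\to\mathrm{Hom}(W,W((x)))$ such that $Y_W({\bf 1},x)=1_W$ and for $u,v\in V$, $w\in W$ there is $l\in\mathbb{N}$ with $(x_0+x_2)^lY_W(u,x_0+x_2)Y_W(v,x_2)w=(x_0+x_2)^lY_W(Y(u,x_0)v,x_2)w$. *)

theory Defs
  imports Complex_Main "HOL-Library.Poly_Mapping"
    "HOL-Computational_Algebra.Formal_Laurent_Series"
begin

text \<open>
  A module is a complex vector space (the whole of a type, with explicit scalar multiplication)
  with two families of operators \<open>Y\<close>, \<open>Ys\<close>.  The algebra itself is only a topological algebra,
  so it occurs only through its modules.  In the two terms below \<open>(k, i)\<close> is the summation index;
  they vanish for \<open>i > k\<close>, so that \<open>k - i\<close> may be computed in the integers.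
\<close>

definition same_term ::
  "(complex \<Rightarrow> 'w \<Rightarrow> 'w) \<Rightarrow> (int \<Rightarrow> 'w \<Rightarrow> 'w) \<Rightarrow> int \<Rightarrow> int \<Rightarrow> 'w \<Rightarrow> nat \<times> nat \<Rightarrow> 'w" where
  "same_term s A m n w = (\<lambda>(k, i).
     s (1 / fact k * of_nat (k choose i) * (-1) ^ i) (A (n + int k - int i) (A (m + int i) w)))"

definition mixed_term ::
  "(complex \<Rightarrow> 'w \<Rightarrow> 'w) \<Rightarrow> (int \<Rightarrow> 'w \<Rightarrow> 'w) \<Rightarrow> (int \<Rightarrow> 'w \<Rightarrow> 'w) \<Rightarrow> int \<Rightarrow> int \<Rightarrow> 'w \<Rightarrow> nat \<times> nat \<Rightarrow> 'w" where
  "mixed_term s A B m n w = (\<lambda>(k, i).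
     s (1 / fact k * of_nat (k choose i) * (-1) ^ i) (B (n + int i) (A (m + int k - int i) w)))"

text \<open>
  \<^const>\<open>Sum_any\<close> is the sum of all nonzero values of a family when there are finitely many of them.
\<close>

definition same_rel ::
  "(complex \<Rightarrow> 'w::ab_group_add \<Rightarrow> 'w) \<Rightarrow> (int \<Rightarrow> 'w \<Rightarrow> 'w) \<Rightarrow> int \<Rightarrow> int \<Rightarrow> 'w \<Rightarrow> 'w" where
  "same_rel s A m n w = A m (A n w) + Sum_any (same_term s A m n w)"

definition mixed_rel ::
  "(complex \<Rightarrow> 'w::ab_group_add \<Rightarrow> 'w) \<Rightarrow> (int \<Rightarrow> 'w \<Rightarrow> 'w) \<Rightarrow> (int \<Rightarrow> 'w \<Rightarrow> 'w) \<Rightarrow> int \<Rightarrow> int \<Rightarrow> 'w \<Rightarrow> 'w" where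
  "mixed_rel s A B m n w =
     A m (B n w) + Sum_any (mixed_term s A B m n w) - (if m + n + 1 = 0 then w else 0)"

locale A_module = vector_space scale
  for scale :: "complex \<Rightarrow> 'w::ab_group_add \<Rightarrow> 'w" +
  fixes Y Ys :: "int \<Rightarrow> 'w \<Rightarrow> 'w"
  assumes linear_Y: "Vector_Spaces.linear scale scale (Y n)"
    and linear_Ys: "Vector_Spaces.linear scale scale (Ys n)"
    and finite_YY: "finite {p. same_term scale Y m n w p \<noteq> 0}"
    and finite_YsYs: "finite {p. same_term scale Ys m n w p \<noteq> 0}"
    and finite_YYs: "finite {p. mixed_term scale Y Ys m n w p \<noteq> 0}"
    and rel_YY: "same_rel scale Y m n w = 0"
    and rel_YsYs: "same_rel scale Ys m n w = 0"
    and rel_YYs: "mixed_rel scale Y Ys m n w = 0"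

locale restricted_A_module = A_module scale Y Ys
  for scale :: "complex \<Rightarrow> 'w::ab_group_add \<Rightarrow> 'w" and Y Ys +
  assumes restricted: "\<exists>N. \<forall>n\<ge>N. Y n w = 0 \<and> Ys n w = 0"

datatype letter = Yl | Ysl

text \<open>A word \<open>[(a1, n1), \<dots>, (ar, nr)]\<close> stands for the product \<open>a1_n1 \<cdots> ar_nr\<close>.\<close>

type_synonym wrd = "(letter \<times> int) list"

fun letter_act :: "(int \<Rightarrow> 'w \<Rightarrow> 'w) \<Rightarrow> (int \<Rightarrow> 'w \<Rightarrow> 'w) \<Rightarrow> letter \<times> int \<Rightarrow> 'w \<Rightarrow> 'w" where
  "letter_act Y Ys (Yl, n) = Y n"
| "letter_act Y Ys (Ysl, n) = Ys n"

definition word_act :: "(int \<Rightarrow> 'w \<Rightarrow> 'w) \<Rightarrow> (int \<Rightarrow> 'w \<Rightarrow> 'w) \<Rightarrow> wrd \<Rightarrow> 'w \<Rightarrow> 'w" where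
  "word_act Y Ys ws w = foldr (letter_act Y Ys) ws w"

locale vacuum_A_module = A_module scale Y Ys
  for scale :: "complex \<Rightarrow> 'w::ab_group_add \<Rightarrow> 'w" and Y Ys +
  fixes v :: 'w
  assumes vac_nonzero: "v \<noteq> 0"
    and vac_Y: "n \<ge> 0 \<Longrightarrow> Y n v = 0"
    and vac_Ys: "n \<ge> 0 \<Longrightarrow> Ys n v = 0"
    and generated: "span {word_act Y Ys ws v | ws. True} = UNIV"

definition A_module_hom ::
  "(complex \<Rightarrow> 'v::ab_group_add \<Rightarrow> 'v) \<Rightarrow> (int \<Rightarrow> 'v \<Rightarrow> 'v) \<Rightarrow> (int \<Rightarrow> 'v \<Rightarrow> 'v) \<Rightarrow>
   (complex \<Rightarrow> 'w::ab_group_add \<Rightarrow> 'w) \<Rightarrow> (int \<Rightarrow> 'w \<Rightarrow> 'w) \<Rightarrow> (int \<Rightarrow> 'w \<Rightarrow> 'w) \<Rightarrow>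
   ('v \<Rightarrow> 'w) \<Rightarrow> bool" where
  "A_module_hom s Y Ys s' Y' Ys' f \<longleftrightarrow>
     Vector_Spaces.linear s s' f \<and>
     (\<forall>n w. f (Y n w) = Y' n (f w)) \<and> (\<forall>n w. f (Ys n w) = Ys' n (f w))"

text \<open>
  The map \<open>Y(\<cdot>, x)\<close> is given by its modes: \<open>Y v n w\<close> is \<open>v_n w\<close>, the coefficient of
  \<open>x^(-n-1)\<close> in \<open>Y(v, x)w\<close>.  A formal series in three variables is given by the
  function sending a triple of exponents to its coefficient.
\<close>

text \<open>Coefficient of \<open>y^b z^c\<close> in \<open>(y + e z)^n\<close>, expanded in nonnegative powers of \<open>z\<close>.\<close>

definition binexp :: "complex \<Rightarrow> int \<Rightarrow> int \<Rightarrow> int \<Rightarrow> complex" where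
  "binexp e n b c =
     (if 0 \<le> c \<and> b + c = n then (of_int n gchoose nat c) * e ^ nat c else 0)"

text \<open>
  Coefficient of \<open>x^a y^b z^c\<close> in
  \<open>x^(-1) \<delta>((y - z)/x) = \<Sum>n. x^(-n-1) (y - z)^n\<close>.
\<close>

definition delta3 :: "int \<Rightarrow> int \<Rightarrow> int \<Rightarrow> complex" where
  "delta3 a b c = binexp (-1) (- a - 1) b c"

text \<open>
  Coefficients of the three delta functions at \<open>x0^a x1^b x2^c\<close>.  The second one,
  \<open>x0^(-1) \<delta>((x2 - x1)/(-x0))\<close>, is minus the result of substituting \<open>-x0\<close> for \<open>x\<close>
  in the expression above.
\<close>

definition delta_L1 :: "int \<Rightarrow> int \<Rightarrow> int \<Rightarrow> complex" where
  "delta_L1 a b c = delta3 a b c"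

definition delta_L2 :: "int \<Rightarrow> int \<Rightarrow> int \<Rightarrow> complex" where
  "delta_L2 a b c = - ((-1) powi a) * delta3 a c b"

definition delta_R :: "int \<Rightarrow> int \<Rightarrow> int \<Rightarrow> complex" where
  "delta_R a b c = delta3 c b a"

text \<open>
  Product of a scalar series and a vector-valued series; in all uses below only finitely many terms
  contribute to each coefficient.
\<close>

definition fprod3 ::
  "(complex \<Rightarrow> 'v::ab_group_add \<Rightarrow> 'v) \<Rightarrow> (int \<Rightarrow> int \<Rightarrow> int \<Rightarrow> complex) \<Rightarrow>
   (int \<Rightarrow> int \<Rightarrow> int \<Rightarrow> 'v) \<Rightarrow> int \<Rightarrow> int \<Rightarrow> int \<Rightarrow> 'v" where
  "fprod3 s D F a b c = Sum_any (\<lambda>(p, q, r). s (D p q r) (F (a - p) (b - q) (c - r)))"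

text \<open>
  The coefficients at \<open>x0^a x1^b x2^c\<close> of \<open>Y(u, x1)Y(v, x2)w\<close>, of
  \<open>\<Sum>i. f_i(-x0) Y(v_i, x2)Y(u_i, x1)w\<close>, where the tensor \<open>\<Sum>i. v_i \<otimes> u_i \<otimes> f_i\<close> is given by
  a list of triples representing it, and of \<open>Y(Y(u, x0)v, x2)w\<close>.
\<close>

definition prod_series ::
  "('v \<Rightarrow> int \<Rightarrow> 'v \<Rightarrow> 'v::ab_group_add) \<Rightarrow> 'v \<Rightarrow> 'v \<Rightarrow> 'v \<Rightarrow> int \<Rightarrow> int \<Rightarrow> int \<Rightarrow> 'v" where
  "prod_series Y u v w a b c = (if a = 0 then Y u (- b - 1) (Y v (- c - 1) w) else 0)"

definition opp_series ::
  "(complex \<Rightarrow> 'v \<Rightarrow> 'v) \<Rightarrow> ('v \<Rightarrow> int \<Rightarrow> 'v \<Rightarrow> 'v::ab_group_add) \<Rightarrow>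
   ('v \<times> 'v \<times> complex fls) list \<Rightarrow> 'v \<Rightarrow> int \<Rightarrow> int \<Rightarrow> int \<Rightarrow> 'v" where
  "opp_series s Y ts w a b c =
     (\<Sum>(v', u', f) \<leftarrow> ts. s ((-1) powi a * fls_nth f a) (Y v' (- c - 1) (Y u' (- b - 1) w)))"

definition iter_series ::
  "('v \<Rightarrow> int \<Rightarrow> 'v \<Rightarrow> 'v::ab_group_add) \<Rightarrow> 'v \<Rightarrow> 'v \<Rightarrow> 'v \<Rightarrow> int \<Rightarrow> int \<Rightarrow> int \<Rightarrow> 'v" where
  "iter_series Y u v w a b c = (if b = 0 then Y (Y u (- a - 1) v) (- c - 1) w else 0)"

locale weak_quantum_vertex_algebra = vector_space scale
  for scale :: "complex \<Rightarrow> 'v::ab_group_add \<Rightarrow> 'v" +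
  fixes Y :: "'v \<Rightarrow> int \<Rightarrow> 'v \<Rightarrow> 'v" and vac :: 'v
  assumes linear_left: "Vector_Spaces.linear scale scale (\<lambda>v. Y v n w)"
    and linear_right: "Vector_Spaces.linear scale scale (Y v n)"
    and truncation: "\<exists>N. \<forall>n\<ge>N. Y v n w = 0"
    and vacuum: "Y vac n v = (if n = -1 then v else 0)"
    and creation_regular: "n \<ge> 0 \<Longrightarrow> Y v n vac = 0"
    and creation_limit: "Y v (-1) vac = v"
    and jacobi: "\<exists>ts :: ('v \<times> 'v \<times> complex fls) list. \<forall>w a b c.
      fprod3 scale delta_L1 (prod_series Y u v w) a b c
      - fprod3 scale delta_L2 (opp_series scale Y ts w) a b c
      = fprod3 scale delta_R (iter_series Y u v w) a b c"

text \<open>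
  Coefficients at \<open>x0^a x2^b\<close> of \<open>Y(u, x0 + x2)Y(v, x2)w\<close>, of \<open>Y(Y(u, x0)v, x2)w\<close>, and of
  the product of \<open>(x0 + x2)^l\<close> with a series.
\<close>

definition shifted_prod ::
  "(complex \<Rightarrow> 'w \<Rightarrow> 'w) \<Rightarrow> ('v \<Rightarrow> int \<Rightarrow> 'w \<Rightarrow> 'w::ab_group_add) \<Rightarrow>
   'v \<Rightarrow> 'v \<Rightarrow> 'w \<Rightarrow> int \<Rightarrow> int \<Rightarrow> 'w" where
  "shifted_prod s YW u v w a b =
     Sum_any (\<lambda>(m, n). s (binexp 1 (- m - 1) a (b + n + 1)) (YW u m (YW v n w)))"

definition shifted_iter ::
  "('v \<Rightarrow> int \<Rightarrow> 'v \<Rightarrow> 'v) \<Rightarrow> ('v \<Rightarrow> int \<Rightarrow> 'w \<Rightarrow> 'w) \<Rightarrow> 'v \<Rightarrow> 'v \<Rightarrow> 'w \<Rightarrow> int \<Rightarrow> int \<Rightarrow> 'w" where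
  "shifted_iter Y YW u v w a b = YW (Y u (- a - 1) v) (- b - 1) w"

definition mult_pow ::
  "(complex \<Rightarrow> 'w::ab_group_add \<Rightarrow> 'w) \<Rightarrow> nat \<Rightarrow> (int \<Rightarrow> int \<Rightarrow> 'w) \<Rightarrow> int \<Rightarrow> int \<Rightarrow> 'w" where
  "mult_pow s l F a b =
     (\<Sum>j\<le>l. s (of_nat (l choose j)) (F (a - int (l - j)) (b - int j)))"

locale weak_quantum_vertex_algebra_module =
  V: weak_quantum_vertex_algebra scale Y vac + W: vector_space scaleW
  for scale :: "complex \<Rightarrow> 'v::ab_group_add \<Rightarrow> 'v" and Y vac
    and scaleW :: "complex \<Rightarrow> 'w::ab_group_add \<Rightarrow> 'w" +
  fixes YW :: "'v \<Rightarrow> int \<Rightarrow> 'w \<Rightarrow> 'w"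
  assumes module_linear_left: "Vector_Spaces.linear scale scaleW (\<lambda>v. YW v n w)"
    and module_linear_right: "Vector_Spaces.linear scaleW scaleW (YW v n)"
    and module_truncation: "\<exists>N. \<forall>n\<ge>N. YW v n w = 0"
    and module_vacuum: "YW vac n w = (if n = -1 then w else 0)"
    and weak_associativity: "\<exists>l. \<forall>a b.
      mult_pow scaleW l (shifted_prod scaleW YW u v w) a b
      = mult_pow scaleW l (shifted_iter Y YW u v w) a b"

text \<open>
  \<open>T\<close> is the monoid algebra of the free monoid of words: with concatenation as the
  (additively written) monoid operation on lists, multiplication of finitely supported functions
  is the multiplication of the free algebra.
\<close>

instantiation list :: (type) monoid_add
begin

definition zero_list :: "'a list" where "zero_list = []"

definition plus_list :: "'a list \<Rightarrow> 'a list \<Rightarrow> 'a list" where "plus_list = (@)"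

instance by standard (simp_all add: zero_list_def plus_list_def)

end

type_synonym T = "wrd \<Rightarrow>\<^sub>0 complex"

definition T_scale :: "complex \<Rightarrow> T \<Rightarrow> T" where
  "T_scale c x = Poly_Mapping.single 0 c * x"

definition T_gen :: "letter \<Rightarrow> int \<Rightarrow> T" where
  "T_gen a n = Poly_Mapping.single [(a, n)] 1"

definition T_plus :: "T set" where
  "T_plus = module.span T_scale
     {Poly_Mapping.single ws 1 | ws. ws \<noteq> [] \<and> sum_list (map snd ws) \<ge> 0}"

definition TT_plus :: "T set" where
  "TT_plus = module.span T_scale {x * y | x y. y \<in> T_plus}"

lemma T_central: "Poly_Mapping.single 0 c * x = x * Poly_Mapping.single 0 (c::complex)" for x :: T
proof (induction x rule: update_induct)
  case (update f k v)
  have "Poly_Mapping.update k v f = f + Poly_Mapping.single k v"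
    using update.hyps
    by (intro poly_mapping_eqI) (auto simp: lookup_update lookup_add lookup_single when_def in_keys_iff)
  with update.IH show ?case by (simp add: distrib_left distrib_right mult_single mult.commute)
qed simp

interpretation T: vector_space T_scale
proof
  show "T_scale (a + b) x = T_scale a x + T_scale b x" for a b x
    by (simp add: T_scale_def single_add distrib_right)
  show "T_scale a (T_scale b x) = T_scale (a * b) x" for a b x
    by (simp add: T_scale_def mult.assoc [symmetric] mult_single)
qed (simp_all add: T_scale_def distrib_left)

lemma T_mult_scale: "x * T_scale c y = T_scale c (x * y)"
  unfolding T_scale_def by (metis T_central mult.assoc)

lemma subspace_TT_plus: "T.subspace TT_plus"
  by (simp add: TT_plus_def)

lemma TT_plus_left_ideal:
  assumes "y \<in> TT_plus"
  shows "x * y \<in> TT_plus"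
  using assms unfolding TT_plus_def
proof (induction rule: T.span_induct_alt)
  case base
  then show ?case by (simp add: T.span_zero)
next
  case (step c b y)
  then obtain x' z where "b = x' * z" "z \<in> T_plus" by blast
  then have "x * b \<in> {x * y | x y. y \<in> T_plus}"
    by (metis (mono_tags, lifting) mem_Collect_eq mult.assoc)
  with step show ?case
    by (simp add: distrib_left T_mult_scale T.span_add T.span_base T.span_scale)
qed

definition VT_eq :: "T \<Rightarrow> T \<Rightarrow> bool" where
  "VT_eq x y \<longleftrightarrow> x - y \<in> TT_plus"

quotient_type VT = T / VT_eq
proof (rule equivpI)
  show "reflp VT_eq"
    by (simp add: reflp_def VT_eq_def T.subspace_0 [OF subspace_TT_plus])
  show "symp VT_eq"
    unfolding symp_def VT_eq_def using T.subspace_neg [OF subspace_TT_plus] by fastforce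
  show "transp VT_eq"
    unfolding transp_def VT_eq_def using T.subspace_add [OF subspace_TT_plus] by fastforce
qed

instantiation VT :: ab_group_add
begin

lift_definition zero_VT :: VT is 0 .

lift_definition plus_VT :: "VT \<Rightarrow> VT \<Rightarrow> VT" is "(+)"
  unfolding VT_eq_def by (metis T.subspace_add [OF subspace_TT_plus] add_diff_add)

lift_definition uminus_VT :: "VT \<Rightarrow> VT" is uminus
  unfolding VT_eq_def using T.subspace_neg [OF subspace_TT_plus] by fastforce

definition minus_VT :: "VT \<Rightarrow> VT \<Rightarrow> VT" where
  "minus_VT x y = x + - y"

instance
  by (standard; (unfold minus_VT_def)?; transfer)
    (simp_all add: VT_eq_def T.subspace_0 [OF subspace_TT_plus] algebra_simps)

end

lift_definition VT_scale :: "complex \<Rightarrow> VT \<Rightarrow> VT" is T_scale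
  unfolding VT_eq_def
  by (metis T.scale_right_diff_distrib T.subspace_scale [OF subspace_TT_plus])

lifting_forget poly_mapping.lifting

lift_definition VT_act :: "T \<Rightarrow> VT \<Rightarrow> VT" is "(*)"
  unfolding VT_eq_def by (metis TT_plus_left_ideal right_diff_distrib)

lift_definition VT_one :: VT is 1 .

definition VT_Y :: "int \<Rightarrow> VT \<Rightarrow> VT" where "VT_Y n = VT_act (T_gen Yl n)"

definition VT_Ys :: "int \<Rightarrow> VT \<Rightarrow> VT" where "VT_Ys n = VT_act (T_gen Ysl n)"

lemma VT_eq_refl: "VT_eq x x"
  by (simp add: VT_eq_def T.subspace_0 [OF subspace_TT_plus])

interpretation VT: vector_space VT_scale
  by (standard; transfer)
    (simp_all add: VT_eq_refl T.scale_right_distrib T.scale_left_distrib)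

lemma VT_act_add: "VT_act x (u + v) = VT_act x u + VT_act x v"
  by transfer (simp add: VT_eq_refl distrib_left)

lemma VT_act_scale: "VT_act x (VT_scale c u) = VT_scale c (VT_act x u)"
  by transfer (simp add: VT_eq_refl T_mult_scale)

lemma VT_act_mult: "VT_act (x * y) u = VT_act x (VT_act y u)"
  by transfer (simp add: VT_eq_refl mult.assoc)

lemma VT_act_zero: "VT_act x 0 = 0"
  by transfer (simp add: VT_eq_refl)

text \<open>The \<open>T\<close>-submodule of \<open>V_T\<close> generated by all relations applied to all vectors.\<close>

definition VT_relators :: "VT set" where
  "VT_relators =
     {same_rel VT_scale VT_Y m n u | m n u. True} \<union>
     {same_rel VT_scale VT_Ys m n u | m n u. True} \<union>
     {mixed_rel VT_scale VT_Y VT_Ys m n u | m n u. True}"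

definition VT_relsub :: "VT set" where
  "VT_relsub = module.span VT_scale {VT_act x r | x r. r \<in> VT_relators}"

lemma subspace_VT_relsub: "VT.subspace VT_relsub"
  by (simp add: VT_relsub_def)

lemma VT_relsub_act:
  assumes "u \<in> VT_relsub"
  shows "VT_act x u \<in> VT_relsub"
  using assms unfolding VT_relsub_def
proof (induction rule: VT.span_induct_alt)
  case base
  then show ?case by (simp add: VT.span_zero VT_act_zero)
next
  case (step c b y)
  then obtain x' z where "b = VT_act x' z" "z \<in> VT_relators" by blast
  then have "VT_act x b \<in> {VT_act x r | x r. r \<in> VT_relators}"
    by (metis (mono_tags, lifting) mem_Collect_eq VT_act_mult)
  with step show ?case
    by (simp add: VT_act_add VT_act_scale VT.span_add VT.span_base VT.span_scale)
qed

lemma VT_act_diff: "VT_act x (u - v) = VT_act x u - VT_act x v"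
  by (metis VT_act_add diff_add_cancel add_diff_cancel_right')

definition VA_eq :: "VT \<Rightarrow> VT \<Rightarrow> bool" where
  "VA_eq u v \<longleftrightarrow> u - v \<in> VT_relsub"

quotient_type VA = VT / VA_eq
proof (rule equivpI)
  show "reflp VA_eq"
    by (simp add: reflp_def VA_eq_def VT.subspace_0 [OF subspace_VT_relsub])
  show "symp VA_eq"
    unfolding symp_def VA_eq_def using VT.subspace_neg [OF subspace_VT_relsub] by fastforce
  show "transp VA_eq"
    unfolding transp_def VA_eq_def using VT.subspace_add [OF subspace_VT_relsub] by fastforce
qed

instantiation VA :: ab_group_add
begin

lift_definition zero_VA :: VA is 0 .

lift_definition plus_VA :: "VA \<Rightarrow> VA \<Rightarrow> VA" is "(+)"
  unfolding VA_eq_def by (metis VT.subspace_add [OF subspace_VT_relsub] add_diff_add)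

lift_definition uminus_VA :: "VA \<Rightarrow> VA" is uminus
  unfolding VA_eq_def using VT.subspace_neg [OF subspace_VT_relsub] by fastforce

definition minus_VA :: "VA \<Rightarrow> VA \<Rightarrow> VA" where
  "minus_VA x y = x + - y"

instance
  by (standard; (unfold minus_VA_def)?; transfer)
    (simp_all add: VA_eq_def VT.subspace_0 [OF subspace_VT_relsub] algebra_simps)

end

lift_definition VA_scale :: "complex \<Rightarrow> VA \<Rightarrow> VA" is VT_scale
  unfolding VA_eq_def
  by (metis VT.scale_right_diff_distrib VT.subspace_scale [OF subspace_VT_relsub])

lift_definition VA_Y :: "int \<Rightarrow> VA \<Rightarrow> VA" is VT_Y
  unfolding VA_eq_def VT_Y_def by (metis VT_act_diff VT_relsub_act)

lift_definition VA_Ys :: "int \<Rightarrow> VA \<Rightarrow> VA" is VT_Ys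
  unfolding VA_eq_def VT_Ys_def by (metis VT_act_diff VT_relsub_act)

lift_definition VA_one :: VA is VT_one .

definition VA_a :: VA where "VA_a = VA_Y (-1) VA_one"

definition VA_b :: VA where "VA_b = VA_Ys (-1) VA_one"

end

theory Submission
  imports Defs "HOL-Library.FSet"
begin

text \<open>
  Let \<open>p = 1\<close> for \<open>Y\<close>, \<open>p = -1\<close> for \<open>Ys\<close>, and let \<open>N\<close> be an operator that counts charges.  Replacing
  \<open>a(x)\<close> by \<open>a(x) e^(s (p N + 1/2) x)\<close> with \<open>s = 1\<close> or \<open>s = -1\<close> absorbs, respectively creates, the exponential
  factors in the relations, and so exchanges graded modules of the algebra with graded modules of a Clifford algebra.
  In this way the Fock space of the Clifford algebra becomes a vacuum module, whence \<open>1 \<noteq> 0\<close> in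
  \<open>V\<close>, and the loop space \<open>W[t, 1/t]\<close> of a restricted module \<open>W\<close>, graded by the powers of \<open>t\<close>, becomes
  a Clifford module.  The fields of the Fock space on \<open>W[t, 1/t]\<close>, given by normally ordered products,
  are pulled back along the canonical map from \<open>V\<close> to the Fock space and untwisted; the result is
  \<open>Y_W(u, x)\<close>.

  For \<open>u\<close>, \<open>v\<close> of charges \<open>p\<close>, \<open>q\<close>, the product \<open>Y_W(u, x1) Y_W(v, x2)\<close>, the opposite product with the
  braiding factor \<open>e^(p q x)\<close>, and the iterate are expansions of one and the same \<open>(x1 - x2)^(-k) G(x1, x2)\<close> in
  three domains.  The Jacobi identity and weak associativity follow by comparing residues.
  Both structures are unique because associativity determines the fields of \<open>a_n u\<close> by those of \<open>a\<close>
  and \<open>u\<close>.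
\<close>

section \<open>Series in one and two variables, given by their modes\<close>

text \<open>A restricted module \<open>W\<close> has no operator counting charges, and the twist
  cannot do without one; in \<open>W[t, 1/t]\<close> the exponent of \<open>t\<close> takes its
  place. The price: \<open>Y_W(v, x)w\<close> lies in degree q, the charge of v, while
  \<open>Y_W(u, x)\<close> is defined from degree 0. Returning to degree 0 is a spectral flow, which
  acts on states by an automorphism \<open>theta\<close> of the Fock space and multiplies fields of
  charge p by e^(- p q x).

  The constants are forced. Passing a letter of charge q across one of charge p changes N by q and
  so alters the exchange factor; the two summands 1/2 compensate p q = -1 for the pair with a delta
  function. The correction e^(- p^2 x / 2) gives the right generators for p = 1 and p = -1, and -(p
  + q)^2 / 2 = - p^2 / 2 - p q - q^2 / 2 makes it compatible with x1 = x2 + x0.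

  The shifts by \<open>theta\<close> remain visible in the braiding: the tensor in the Jacobi
  identity for u and v is v' \<otimes> u' with a multiple of an exponential, where u' and v' are
  preimages of the shifted images of u and v. Hence the canonical map to the Fock space has to be
  onto.\<close>

locale complex_vs = vector_space scale
  for scale :: "complex \<Rightarrow> 'w::ab_group_add \<Rightarrow> 'w"

lemma linearD:
  assumes "Vector_Spaces.linear s t f"
  shows linear_addD: "f (x + y) = f x + f y"
    and linear_scaleD: "f (s c x) = t c (f x)"
    and linear_zeroD: "f 0 = 0"
    and linear_diffD: "f (x - y) = f x - f y"
    and linear_negD: "f (- x) = - f x"
    and linear_sumD: "f (sum h A) = (\<Sum>i\<in>A. f (h i))"
proof -
  interpret Vector_Spaces.linear s t f by fact
  show "f (x + y) = f x + f y" "f (s c x) = t c (f x)" "f 0 = 0" "f (x - y) = f x - f y"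
    "f (- x) = - f x" "f (sum h A) = (\<Sum>i\<in>A. f (h i))"
    by (fact add scale zero diff neg sum)+
qed

lemma linearI:
  assumes "vector_space s" "vector_space t"
    and "\<And>x y. f (x + y) = f x + f y" "\<And>c x. f (s c x) = t c (f x)"
  shows "Vector_Spaces.linear s t f"
  using assms unfolding Vector_Spaces.linear_iff by blast

lemma linear_Sum_any:
  assumes "Vector_Spaces.linear s t f" "finite {i. h i \<noteq> 0}"
  shows "f (Sum_any h) = Sum_any (\<lambda>i. f (h i))"
proof -
  have "{i. f (h i) \<noteq> 0} \<subseteq> {i. h i \<noteq> 0}"
    using linear_zeroD [OF assms(1)] by auto
  then show ?thesis
    using assms by (simp add: Sum_any.expand_superset [of "{i. h i \<noteq> 0}"] linear_sumD)
qed

lemma Sum_any_lessThan: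
  fixes f :: "nat \<Rightarrow> 'a::comm_monoid_add"
  assumes "\<And>i. i \<ge> K \<Longrightarrow> f i = 0"
  shows "Sum_any f = (\<Sum>i<K. f i)"
  proof (rule Sum_any.expand_superset)
  show "{i. f i \<noteq> 0} \<subseteq> {..<K}" by (metis (mono_tags) assms lessThan_iff mem_Collect_eq not_le subsetI)
qed simp

lemma Sum_any_Suc:
  fixes f :: "nat \<Rightarrow> 'a::comm_monoid_add"
  assumes "\<And>i. i \<ge> K \<Longrightarrow> f i = 0"
  shows "Sum_any f = f 0 + Sum_any (\<lambda>i. f (Suc i))"
proof -
  have "Sum_any f = (\<Sum>i<Suc K. f i)"
    using assms by (intro Sum_any_lessThan) auto
  moreover have "Sum_any (\<lambda>i. f (Suc i)) = (\<Sum>i<K. f (Suc i))"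
    using assms by (intro Sum_any_lessThan) auto
  ultimately show ?thesis
    by (simp add: sum.lessThan_Suc_shift del: sum.lessThan_Suc)
qed

text \<open>The square of side \<open>K\<close> lies inside the triangle
  \<open>i + j < 2 * K\<close>, and outside the square \<open>H\<close> vanishes. This turns
  products of two exponential series into sums over the total degree.\<close>

lemma sum_square_triangle:
  fixes H :: "nat \<Rightarrow> nat \<Rightarrow> 'a::comm_monoid_add"
  assumes "\<And>i j. i \<ge> K \<or> j \<ge> K \<Longrightarrow> H i j = 0"
  shows "(\<Sum>i<K. \<Sum>j<K. H i j) = (\<Sum>k<2*K. \<Sum>i\<le>k. H i (k - i))"
proof -
  have "(\<Sum>k<2*K. \<Sum>i\<le>k. H i (k - i)) = (\<Sum>(i, j)\<in>{(i, j). i + j < 2*K}. H i j)"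
    by (rule sum.triangle_reindex [symmetric])
  also have "\<dots> = (\<Sum>(i, j)\<in>{..<K} \<times> {..<K}. H i j)"
  proof (rule sum.mono_neutral_right)
    show "finite {(i, j). i + j < 2*K}"
      by (rule finite_subset [of _ "{..<2*K} \<times> {..<2*K}"]) auto
  qed (auto intro!: assms)
  finally show ?thesis by (simp add: sum.cartesian_product)
qed

text \<open>The support already lies in the triangle \<open>i + j < K\<close>, so the bound is not
  doubled.\<close>

lemma sum_square_triangle1:
  fixes H :: "nat \<Rightarrow> nat \<Rightarrow> 'a::comm_monoid_add"
  assumes "\<And>i j. i + j \<ge> K \<Longrightarrow> H i j = 0"
  shows "(\<Sum>i<K. \<Sum>j<K. H i j) = (\<Sum>k<K. \<Sum>i\<le>k. H i (k - i))"
proof -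
  have "(\<Sum>k<K. \<Sum>i\<le>k. H i (k - i)) = (\<Sum>(i, j)\<in>{(i, j). i + j < K}. H i j)"
    by (rule sum.triangle_reindex [symmetric])
  also have "\<dots> = (\<Sum>(i, j)\<in>{..<K} \<times> {..<K}. H i j)"
    by (rule sum.mono_neutral_left) (auto intro!: assms)
  finally show ?thesis by (simp add: sum.cartesian_product)
qed

section \<open>Truncation conditions and multiplication by exponentials\<close>

definition trunc :: "(int \<Rightarrow> 'w::zero) \<Rightarrow> bool" where
  "trunc f \<longleftrightarrow> (\<exists>N. \<forall>n\<ge>N. f n = 0)"

text \<open>Products \<open>\<phi> m (\<psi> n w)\<close> vanish for large \<open>n\<close>
  uniformly in \<open>m\<close>, but for large \<open>m\<close> only with a bound that depends on
  \<open>n\<close>. What holds in either order is finiteness of the support in each quadrant; this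
  suffices for exponentials in two variables.\<close>

definition trunc2 :: "(int \<Rightarrow> int \<Rightarrow> 'w::zero) \<Rightarrow> bool" where
  "trunc2 H \<longleftrightarrow> (\<forall>m n. \<exists>K::nat. \<forall>i j::nat. i \<ge> K \<or> j \<ge> K \<longrightarrow> H (m + int i) (n + int j) = 0)"

text \<open>Bounded in the first variable alone, uniformly in the second: the domain on which (x2 -
  e x1)^(-j-1), expanded in nonnegative powers of x1, may be multiplied.\<close>

definition utrunc :: "(int \<Rightarrow> int \<Rightarrow> 'w::zero) \<Rightarrow> bool" where
  "utrunc H \<longleftrightarrow> (\<exists>N. \<forall>m n. m \<ge> N \<longrightarrow> H m n = 0)"

text \<open>The space W((x1, x2)), where the numerators common to both products and the iterate
  live.\<close>

definition bounded2 :: "(int \<Rightarrow> int \<Rightarrow> 'w::zero) \<Rightarrow> bool" where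
  "bounded2 H \<longleftrightarrow> (\<exists>N. \<forall>m n. m \<ge> N \<or> n \<ge> N \<longrightarrow> H m n = 0)"

text \<open>
  A series is given by its modes, the coefficients of \<open>x^(-n-1)\<close>, so that multiplication by \<open>x\<close>
  shifts \<open>n\<close> to \<open>n + 1\<close>.  Thus \<open>exps s c\<close> is multiplication by \<open>e^(c x)\<close>, and \<open>dif\<close> and \<open>delt s e\<close> below
  are multiplication by \<open>x1 - x2\<close> and by \<open>x2 - e x1\<close>.
\<close>

definition exps :: "(complex \<Rightarrow> 'w \<Rightarrow> 'w::comm_monoid_add) \<Rightarrow> complex \<Rightarrow> (int \<Rightarrow> 'w) \<Rightarrow> int \<Rightarrow> 'w" where
  "exps s c f n = Sum_any (\<lambda>k. s (c ^ k / fact k) (f (n + int k)))"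

definition exps2 :: "(complex \<Rightarrow> 'w \<Rightarrow> 'w::comm_monoid_add) \<Rightarrow> complex \<Rightarrow> complex \<Rightarrow>
    (int \<Rightarrow> int \<Rightarrow> 'w) \<Rightarrow> int \<Rightarrow> int \<Rightarrow> 'w" where
  "exps2 s c d H m n = exps s c (\<lambda>m. exps s d (H m) n) m"

lemma truncE:
  assumes "trunc f"
  obtains K :: nat where "\<And>k. k \<ge> K \<Longrightarrow> f (n + int k) = 0"
proof -
  obtain N where "\<forall>n\<ge>N. f n = 0" using assms by (auto simp: trunc_def)
  then show thesis by (intro that [of "nat (N - n)"]) auto
qed

lemma trunc2E:
  assumes "trunc2 H"
  obtains K :: nat where "\<And>i j. i \<ge> K \<or> j \<ge> K \<Longrightarrow> H (m + int i) (n + int j) = 0"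
  using assms unfolding trunc2_def by meson

lemma bounded2_trunc2: "bounded2 H \<Longrightarrow> trunc2 H"
  unfolding trunc2_def
proof (intro allI)
  fix m n
  assume "bounded2 H"
  then obtain N where N: "\<And>m n. m \<ge> N \<or> n \<ge> N \<Longrightarrow> H m n = 0" by (auto simp: bounded2_def)
  show "\<exists>K::nat. \<forall>i j::nat. i \<ge> K \<or> j \<ge> K \<longrightarrow> H (m + int i) (n + int j) = 0"
    by (rule exI [of _ "nat (max (N - m) (N - n))"]) (auto intro!: N)
qed

lemma trunc2_row: assumes "trunc2 H" shows "trunc (H m)"
proof -
  obtain K where K: "\<And>i j. i \<ge> K \<or> j \<ge> K \<Longrightarrow> H (m + int i) (0 + int j) = 0"
    using trunc2E [OF assms] by metis
  show ?thesis unfolding trunc_def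
  proof (rule exI [of _ "int K"], intro allI impI)
    fix n assume "n \<ge> int K"
    then have "nat n \<ge> K" by linarith
    then show "H m n = 0" using K [of 0 "nat n"] \<open>n \<ge> int K\<close> by simp
  qed
qed

lemma trunc2_col: assumes "trunc2 H" shows "trunc (\<lambda>m. H m n)"
proof -
  obtain K where K: "\<And>i j. i \<ge> K \<or> j \<ge> K \<Longrightarrow> H (0 + int i) (n + int j) = 0"
    using trunc2E [OF assms] by metis
  show ?thesis unfolding trunc_def
  proof (rule exI [of _ "int K"], intro allI impI)
    fix m assume "m \<ge> int K"
    then have "nat m \<ge> K" by linarith
    then show "H m n = 0" using K [of "nat m" 0] \<open>m \<ge> int K\<close> by simp
  qed
qed

lemma trunc2_flip: assumes "trunc2 H" shows "trunc2 (\<lambda>m n. H n m)"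
  unfolding trunc2_def
proof (intro allI)
  fix m n
  obtain K where "\<And>i j. i \<ge> K \<or> j \<ge> K \<Longrightarrow> H (n + int i) (m + int j) = 0"
    using trunc2E [OF assms] by metis
  then show "\<exists>K. \<forall>i j. i \<ge> K \<or> j \<ge> K \<longrightarrow> H (n + int j) (m + int i) = 0" by blast
qed

lemma exp_coeff_add:
  "(\<Sum>i\<le>k. (c::complex) ^ i / fact i * (d ^ (k - i) / fact (k - i))) = (c + d) ^ k / fact k"
proof -
  have "(c + d) ^ k / fact k = (\<Sum>i\<le>k. of_nat (k choose i) * c ^ i * d ^ (k - i) / fact k)"
    by (simp add: binomial_ring sum_divide_distrib)
  also have "\<dots> = (\<Sum>i\<le>k. c ^ i / fact i * (d ^ (k - i) / fact (k - i)))"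
    by (rule sum.cong) (simp_all add: binomial_fact)
  finally show ?thesis by simp
qed

context complex_vs
begin

lemma exps_eq:
  assumes "\<And>k. k \<ge> K \<Longrightarrow> f (n + int k) = 0"
  shows "exps scale c f n = (\<Sum>k<K. scale (c ^ k / fact k) (f (n + int k)))"
  unfolding exps_def by (rule Sum_any_lessThan) (simp add: assms)

lemma exps_0 [simp]: "exps scale 0 f n = f n"
proof -
  have "exps scale 0 f n = (\<Sum>k<Suc 0. scale (0 ^ k / fact k) (f (n + int k)))"
    unfolding exps_def by (rule Sum_any_lessThan) auto
  then show ?thesis by simp
qed

lemma exps_zero [simp]: "exps scale c (\<lambda>_. 0) n = 0"
  by (simp add: exps_def)

lemma exps_vanish: "(\<And>m. m \<ge> n \<Longrightarrow> f m = 0) \<Longrightarrow> exps scale c f n = 0"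
  by (simp add: exps_def)

lemma trunc_exps: "trunc f \<Longrightarrow> trunc (exps scale c f)"
  unfolding trunc_def by (meson exps_vanish order_trans)

lemma exps_add:
  assumes "trunc f" "trunc g"
  shows "exps scale c (\<lambda>n. f n + g n) n = exps scale c f n + exps scale c g n"
proof -
  obtain K where K: "\<And>k. k \<ge> K \<Longrightarrow> f (n + int k) = 0" using truncE [OF assms(1)] by metis
  obtain L where L: "\<And>k. k \<ge> L \<Longrightarrow> g (n + int k) = 0" using truncE [OF assms(2)] by metis
  show ?thesis
    using K L
    by (subst (1 2 3) exps_eq [where K = "max K L"]) (simp_all add: scale_right_distrib sum.distrib)
qed

lemma exps_scale: "trunc f \<Longrightarrow> exps scale c (\<lambda>n. scale a (f n)) n = scale a (exps scale c f n)"
proof -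
  assume "trunc f"
  then obtain K where K: "\<And>k. k \<ge> K \<Longrightarrow> f (n + int k) = 0" using truncE by metis
  then show ?thesis
    by (subst (1 2) exps_eq [where K = K]) (simp_all add: scale_sum_right mult.commute)
qed

lemma exps_exps:
  assumes "trunc f"
  shows "exps scale c (exps scale d f) n = exps scale (c + d) f n"
proof -
  obtain K where K: "\<And>k. k \<ge> K \<Longrightarrow> f (n + int k) = 0" using truncE [OF assms] by metis
  have "exps scale c (exps scale d f) n
      = (\<Sum>i<K. scale (c ^ i / fact i) (exps scale d f (n + int i)))"
  proof (intro exps_eq exps_vanish)
    fix k m assume "k \<ge> K" "m \<ge> n + int k"
    then show "f m = 0" using K [of "nat (m - n)"] by simp
  qed
  also have "\<dots> = (\<Sum>i<K. \<Sum>j<K. scale (c ^ i / fact i * (d ^ j / fact j)) (f (n + int (i + j))))"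
  proof (rule sum.cong)
    fix i
    have "exps scale d f (n + int i) = (\<Sum>j<K. scale (d ^ j / fact j) (f (n + int i + int j)))"
      using K [of "i + _"] by (intro exps_eq) (simp add: add.assoc)
    then show "scale (c ^ i / fact i) (exps scale d f (n + int i))
        = (\<Sum>j<K. scale (c ^ i / fact i * (d ^ j / fact j)) (f (n + int (i + j))))"
      by (simp add: scale_sum_right add.assoc)
  qed simp
  also have "\<dots> = (\<Sum>k<K. \<Sum>i\<le>k. scale (c ^ i / fact i * (d ^ (k - i) / fact (k - i))) (f (n + int (i + (k - i)))))"
    by (rule sum_square_triangle1) (metis K scale_zero_right)
  also have "\<dots> = (\<Sum>k<K. scale (\<Sum>i\<le>k. c ^ i / fact i * (d ^ (k - i) / fact (k - i))) (f (n + int k)))"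
    by (simp add: scale_sum_left)
  also have "\<dots> = exps scale (c + d) f n"
    using K by (simp only: exps_eq [where f = f and n = n and K = K] exp_coeff_add)
  finally show ?thesis .
qed

lemma exps2_vanish:
  assumes "\<And>i j. i \<ge> m \<Longrightarrow> j \<ge> n \<Longrightarrow> H i j = 0"
  shows "exps2 scale c d H m n = 0"
  unfolding exps2_def by (intro exps_vanish assms)

lemma exps2_eq:
  assumes "\<And>i j. i \<ge> K \<or> j \<ge> K \<Longrightarrow> H (m + int i) (n + int j) = 0"
  shows "exps2 scale c d H m n =
    (\<Sum>i<K. \<Sum>j<K. scale (c ^ i / fact i * (d ^ j / fact j)) (H (m + int i) (n + int j)))"
proof -
  have "exps2 scale c d H m n = (\<Sum>i<K. scale (c ^ i / fact i) (exps scale d (H (m + int i)) n))"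
    unfolding exps2_def
    by (intro exps_eq exps_vanish) (metis assms zle_iff_zadd)
  also have "\<dots> = (\<Sum>i<K. scale (c ^ i / fact i) (\<Sum>j<K. scale (d ^ j / fact j) (H (m + int i) (n + int j))))"
    by (subst exps_eq) (auto simp: assms)
  finally show ?thesis by (simp add: scale_sum_right)
qed

lemma exps2_swap:
  assumes "trunc2 H"
  shows "exps scale d (\<lambda>n. exps scale c (\<lambda>m. H m n) m) n = exps2 scale c d H m n"
proof -
  obtain K where K: "\<And>i j. i \<ge> K \<or> j \<ge> K \<Longrightarrow> H (m + int i) (n + int j) = 0"
    using trunc2E [OF assms] by metis
  have "exps2 scale d c (\<lambda>m n. H n m) n m = exps2 scale c d H m n"
    by (subst (1 2) exps2_eq [where K = K]) (use K in \<open>auto simp: mult.commute intro: sum.swap [THEN trans]\<close>)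
  then show ?thesis by (simp add: exps2_def)
qed

lemma trunc2_exps2:
  assumes "trunc2 H"
  shows "trunc2 (exps2 scale c d H)"
  unfolding trunc2_def
proof (intro allI)
  fix m n
  obtain K where K: "\<And>i j. i \<ge> K \<or> j \<ge> K \<Longrightarrow> H (m + int i) (n + int j) = 0"
    using trunc2E [OF assms] by metis
  have "exps2 scale c d H (m + int i) (n + int j) = 0" if "i \<ge> K \<or> j \<ge> K" for i j
  proof (rule exps2_vanish)
    fix i' j' assume "i' \<ge> m + int i" "j' \<ge> n + int j"
    then show "H i' j' = 0"
      using K [of "nat (i' - m)" "nat (j' - n)"] that by force
  qed
  then show "\<exists>K. \<forall>i j. i \<ge> K \<or> j \<ge> K \<longrightarrow> exps2 scale c d H (m + int i) (n + int j) = 0"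
    by blast
qed

lemma bounded2_exps2:
  assumes "bounded2 H"
  shows "bounded2 (exps2 scale c d H)"
proof -
  obtain N where N: "\<And>m n. m \<ge> N \<or> n \<ge> N \<Longrightarrow> H m n = 0" using assms by (auto simp: bounded2_def)
  show ?thesis unfolding bounded2_def
    by (rule exI [of _ N]) (auto intro!: exps2_vanish N)
qed

lemma exps2_exps2:
  assumes "trunc2 H"
  shows "exps2 scale c d (exps2 scale c' d' H) m n = exps2 scale (c + c') (d + d') H m n"
proof -
  let ?H = "\<lambda>m n. exps scale d' (H m) n"
  have H': "trunc2 ?H" using trunc2_exps2 [OF assms, of 0 d'] by (simp add: exps2_def [abs_def])
  have 1: "exps scale d (exps2 scale c' d' H m) n = exps scale c' (\<lambda>m. exps scale d (?H m) n) m" for m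
    using exps2_swap [OF H', of d c' m n] by (simp add: exps2_def [abs_def])
  have "exps2 scale c d (exps2 scale c' d' H) m n
      = exps scale c (exps scale c' (\<lambda>m. exps scale d (exps scale d' (H m)) n)) m"
    unfolding exps2_def [of _ c d] 1 by simp
  also have "\<dots> = exps scale c (exps scale c' (\<lambda>m. exps scale (d + d') (H m) n)) m"
    by (simp add: exps_exps trunc2_row [OF assms])
  also have "\<dots> = exps2 scale (c + c') (d + d') H m n"
    using trunc2_col [OF trunc2_exps2 [OF assms, of 0 "d + d'"]]
    by (subst exps_exps) (simp_all add: exps2_def)
  finally show ?thesis .
qed

lemma exps2_0 [simp]: "exps2 scale 0 0 H m n = H m n"
  by (simp add: exps2_def)

lemma exps2_add:
  assumes "trunc2 G" "trunc2 H"
  shows "exps2 scale c d (\<lambda>m n. G m n + H m n) m n = exps2 scale c d G m n + exps2 scale c d H m n"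
proof -
  have "exps2 scale c d (\<lambda>m n. G m n + H m n) m n
      = exps scale c (\<lambda>m. exps scale d (G m) n + exps scale d (H m) n) m"
    unfolding exps2_def using assms by (simp add: exps_add trunc2_row)
  also have "\<dots> = exps2 scale c d G m n + exps2 scale c d H m n"
    using trunc2_col [OF trunc2_exps2 [OF assms(1), of 0 d]]
      trunc2_col [OF trunc2_exps2 [OF assms(2), of 0 d]]
    by (simp add: exps2_def exps_add)
  finally show ?thesis .
qed

lemma exps2_scale:
  assumes "trunc2 G"
  shows "exps2 scale c d (\<lambda>m n. scale a (G m n)) m n = scale a (exps2 scale c d G m n)"
proof -
  have "exps2 scale c d (\<lambda>m n. scale a (G m n)) m n
      = exps scale c (\<lambda>m. scale a (exps scale d (G m) n)) m"
    unfolding exps2_def using assms by (simp add: exps_scale trunc2_row)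
  also have "\<dots> = scale a (exps2 scale c d G m n)"
    using trunc2_col [OF trunc2_exps2 [OF assms(1), of 0 d]] by (simp add: exps2_def exps_scale)
  finally show ?thesis .
qed

lemma exps2_left: "exps2 scale c 0 H m n = exps scale c (\<lambda>m. H m n) m"
  by (simp add: exps2_def)

lemma exps2_right: "exps2 scale 0 d H m n = exps scale d (H m) n"
  by (simp add: exps2_def)

lemma exps2_flip:
  assumes "trunc2 H"
  shows "exps2 scale d c (\<lambda>m n. H n m) n m = exps2 scale c d H m n"
  using exps2_swap [OF assms, of d c m n] by (simp add: exps2_def)

lemma exps2_shift:
  "exps2 scale c d (\<lambda>m n. H (m + a) (n + b)) m n = exps2 scale c d H (m + a) (n + b)"
  by (simp add: exps2_def exps_def algebra_simps)

text \<open>The index \<open>(k, i)\<close> of the defining relations is split into \<open>i\<close> and \<open>k - i\<close>.\<close>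

lemma Sum_any_exps2:
  fixes H :: "int \<Rightarrow> int \<Rightarrow> 'w" and m n :: int
  assumes "trunc2 H"
  defines "f \<equiv> \<lambda>(k, i). scale (1 / fact k * of_nat (k choose i) * (-1) ^ i) (H (m + int i) (n + int k - int i))"
  shows "Sum_any f = exps2 scale (-1) 1 H m n" and "finite {p. f p \<noteq> 0}"
proof -
  obtain K where K: "\<And>i j. i \<ge> K \<or> j \<ge> K \<Longrightarrow> H (m + int i) (n + int j) = 0"
    using trunc2E [OF assms(1)] by metis
  have sub: "{p. f p \<noteq> 0} \<subseteq> Sigma {..<2*K} (\<lambda>k. {..k})"
  proof
    fix p assume "p \<in> {p. f p \<noteq> 0}"
    then obtain k i where p: "p = (k, i)"
      and nz: "scale (1 / fact k * of_nat (k choose i) * (- 1) ^ i) (H (m + int i) (n + int k - int i)) \<noteq> 0"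
      by (cases p) (auto simp: f_def)
    then have "i \<le> k" using leI by fastforce
    moreover have "\<not> (i \<ge> K \<or> k - i \<ge> K)"
    proof
      assume "i \<ge> K \<or> k - i \<ge> K"
      from K [OF this] \<open>i \<le> k\<close> nz show False by (simp add: of_nat_diff algebra_simps)
    qed
    ultimately show "p \<in> Sigma {..<2*K} (\<lambda>k. {..k})" by (auto simp: p)
  qed
  then show "finite {p. f p \<noteq> 0}" by (rule finite_subset) simp
  have "Sum_any f = (\<Sum>p\<in>Sigma {..<2*K} (\<lambda>k. {..k}). f p)"
    by (rule Sum_any.expand_superset) (use sub in auto)
  also have "\<dots> = (\<Sum>k<2*K. \<Sum>i\<le>k. f (k, i))"
    by (simp add: sum.Sigma)
  also have "\<dots> = (\<Sum>k<2*K. \<Sum>i\<le>k. scale ((-1) ^ i / fact i * (1 ^ (k - i) / fact (k - i)))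
      (H (m + int i) (n + int (k - i))))"
  proof (intro sum.cong refl)
    fix k i :: nat
    assume "i \<in> {..k}"
    then show "f (k, i) = scale ((-1) ^ i / fact i * (1 ^ (k - i) / fact (k - i)))
      (H (m + int i) (n + int (k - i)))"
      by (simp add: f_def binomial_fact of_nat_diff algebra_simps)
  qed
  also have "\<dots> = (\<Sum>i<K. \<Sum>j<K. scale ((-1) ^ i / fact i * (1 ^ j / fact j)) (H (m + int i) (n + int j)))"
    by (rule sum_square_triangle [symmetric]) (auto simp: K)
  also have "\<dots> = exps2 scale (-1) 1 H m n"
    by (rule exps2_eq [symmetric]) (rule K)
  finally show "Sum_any f = exps2 scale (-1) 1 H m n" .
qed

end

lemma linear_exps:
  assumes "Vector_Spaces.linear s t L" "trunc f"
  shows "L (exps s c f n) = exps t c (\<lambda>n. L (f n)) n"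
proof -
  interpret V: vector_space s using assms(1) by (simp add: Vector_Spaces.linear_iff)
  obtain K where K: "\<And>k. k \<ge> K \<Longrightarrow> f (n + int k) = 0" using truncE [OF assms(2)] by metis
  have "{k. s (c ^ k / fact k) (f (n + int k)) \<noteq> 0} \<subseteq> {..<K}"
  proof
    fix k assume "k \<in> {k. s (c ^ k / fact k) (f (n + int k)) \<noteq> 0}"
    then show "k \<in> {..<K}" using K [of k] by (cases "k < K") auto
  qed
  then have "finite {k. s (c ^ k / fact k) (f (n + int k)) \<noteq> 0}" using finite_subset by blast
  then show ?thesis
    unfolding exps_def by (simp add: linear_Sum_any [OF assms(1)] linear_scaleD [OF assms(1)])
qed

lemma linear_exps2:
  assumes "Vector_Spaces.linear s t L" "trunc2 H"
  shows "L (exps2 s c d H m n) = exps2 t c d (\<lambda>m n. L (H m n)) m n"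
proof -
  interpret V: complex_vs s using assms(1) by (simp add: Vector_Spaces.linear_iff complex_vs_def)
  have "trunc (\<lambda>m. exps s d (H m) n)"
    using trunc2_col [OF V.trunc2_exps2 [OF assms(2), of 0 d]] by (simp add: exps2_def)
  then show ?thesis
    by (simp add: exps2_def linear_exps [OF assms(1)] trunc2_row [OF assms(2)])
qed


section \<open>Multiplication by x1 - x2, its inverses, and the substitution x1 = x2 + x0\<close>

definition dif :: "(int \<Rightarrow> int \<Rightarrow> 'w::ab_group_add) \<Rightarrow> int \<Rightarrow> int \<Rightarrow> 'w" where
  "dif H m n = H (m + 1) n - H m (n + 1)"

definition delt :: "(complex \<Rightarrow> 'w \<Rightarrow> 'w) \<Rightarrow> complex \<Rightarrow> (int \<Rightarrow> int \<Rightarrow> 'w::ab_group_add) \<Rightarrow>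
    int \<Rightarrow> int \<Rightarrow> 'w" where
  "delt s e H m n = H m (n + 1) - s e (H (m + 1) n)"

text \<open>\<open>zop s e j\<close> is multiplication by \<open>(x2 - e x1)^(-j-1)\<close>, expanded in nonnegative powers of \<open>x1\<close>.\<close>

definition zop :: "(complex \<Rightarrow> 'w \<Rightarrow> 'w) \<Rightarrow> complex \<Rightarrow> nat \<Rightarrow> (int \<Rightarrow> int \<Rightarrow> 'w::ab_group_add) \<Rightarrow>
    int \<Rightarrow> int \<Rightarrow> 'w" where
  "zop s e j H m n = Sum_any (\<lambda>t. s (e ^ t * of_nat ((t + j) choose j)) (H (m + int t) (n - int t - int j - 1)))"

text \<open>Multiplication by (x1 - x2)^(-j-1), expanded in nonnegative powers of x2; together with
  \<open>zop\<close> at \<open>e = 1\<close> it gives the two expansions of the same pole, up to the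
  sign (-1)^(j+1).\<close>

definition kop :: "(complex \<Rightarrow> 'w \<Rightarrow> 'w) \<Rightarrow> nat \<Rightarrow> (int \<Rightarrow> int \<Rightarrow> 'w::ab_group_add) \<Rightarrow>
    int \<Rightarrow> int \<Rightarrow> 'w" where
  "kop s j H m n = zop s 1 j (\<lambda>m n. H n m) n m"

text \<open>\<open>subst2 s G\<close> is \<open>G(x2 + x0, x2)\<close>, expanded in nonnegative powers of \<open>x0\<close>.\<close>

definition subst2 :: "(complex \<Rightarrow> 'w \<Rightarrow> 'w) \<Rightarrow> (int \<Rightarrow> int \<Rightarrow> 'w::ab_group_add) \<Rightarrow> int \<Rightarrow> int \<Rightarrow> 'w" where
  "subst2 s G a b = (if a < 0 then
     Sum_any (\<lambda>m::int. s ((- of_int m - 1) gchoose nat (- a - 1)) (G m (b - m + a))) else 0)"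

lemma utruncE:
  assumes "utrunc H"
  obtains K :: nat where "\<And>k n. k \<ge> K \<Longrightarrow> H (m + int k) n = 0"
proof -
  obtain N where "\<And>m n. m \<ge> N \<Longrightarrow> H m n = 0" using assms by (auto simp: utrunc_def)
  then show thesis by (intro that [of "nat (N - m)"]) auto
qed

lemma bounded2_dif:
  assumes "bounded2 H" shows "bounded2 (dif H)"
proof -
  obtain N where "\<And>m n. m \<ge> N \<or> n \<ge> N \<Longrightarrow> H m n = 0" using assms by (auto simp: bounded2_def)
  then show ?thesis unfolding bounded2_def dif_def by (intro exI [of _ N]) auto
qed

lemma bounded2_dif_pow: "bounded2 H \<Longrightarrow> bounded2 ((dif ^^ k) H)"
  by (induction k) (auto intro: bounded2_dif)

lemma bounded2E:
  assumes "bounded2 H"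
  obtains N where "\<And>m n. m \<ge> N \<or> n \<ge> N \<Longrightarrow> H m n = 0"
  using assms unfolding bounded2_def by blast

lemma bounded2_add:
  fixes G H :: "int \<Rightarrow> int \<Rightarrow> 'w::monoid_add"
  assumes "bounded2 G" "bounded2 H" shows "bounded2 (\<lambda>m n. G m n + H m n)"
proof -
  obtain N M where "\<And>m n. m \<ge> N \<or> n \<ge> N \<Longrightarrow> G m n = 0" "\<And>m n. m \<ge> M \<or> n \<ge> M \<Longrightarrow> H m n = 0"
    using bounded2E [OF assms(1)] bounded2E [OF assms(2)] by metis
  then show ?thesis unfolding bounded2_def by (intro exI [of _ "max N M"]) auto
qed

lemma bounded2_0: "bounded2 (\<lambda>m n. 0)"
  by (simp add: bounded2_def)

lemma bounded2_sum:
  "finite A \<Longrightarrow> (\<And>i. i \<in> A \<Longrightarrow> bounded2 (G i)) \<Longrightarrow> bounded2 (\<lambda>m n. \<Sum>i\<in>A. G i m n)"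
  by (induction A rule: finite_induct) (auto intro: bounded2_add bounded2_0)

lemma bounded2_shift:
  assumes "bounded2 H" shows "bounded2 (\<lambda>m n. H (m + a) (n + b))"
proof -
  obtain N where "\<And>m n. m \<ge> N \<or> n \<ge> N \<Longrightarrow> H m n = 0" using assms by (auto simp: bounded2_def)
  then show ?thesis unfolding bounded2_def by (intro exI [of _ "max (N - a) (N - b)"]) auto
qed

lemma bounded2_map:
  assumes "bounded2 H" "f 0 = 0" shows "bounded2 (\<lambda>m n. f (H m n))"
  using assms unfolding bounded2_def by metis

lemma dif_pow_map:
  assumes "\<And>x y. f (x - y) = f x - f y"
  shows "(dif ^^ k) (\<lambda>m n. f (H m n)) m n = f ((dif ^^ k) H m n)"
  by (induction k arbitrary: m n) (simp_all add: dif_def assms)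

lemma dif_pow_add: "(dif ^^ k) (\<lambda>m n. G m n + H m n) m n = (dif ^^ k) G m n + (dif ^^ k) H m n"
  by (induction k arbitrary: m n) (simp_all add: dif_def)

lemma dif_pow_uminus: "(dif ^^ k) (\<lambda>m n. - G m n) m n = - (dif ^^ k) G m n"
  by (induction k arbitrary: m n) (simp_all add: dif_def)

lemma dif_pow_sum: "(dif ^^ k) (\<lambda>m n. \<Sum>i\<in>A. G i m n) m n = (\<Sum>i\<in>A. (dif ^^ k) (G i) m n)"
  by (induction k arbitrary: m n) (simp_all add: dif_def sum_subtractf)

lemma dif_pow_shift: "(dif ^^ k) (\<lambda>m n. G (m + a) (n + b)) m n = (dif ^^ k) G (m + a) (n + b)"
  by (induction k arbitrary: m n) (simp_all add: dif_def algebra_simps)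

lemma dif_pow_Suc: "(dif ^^ Suc k) H m n = (dif ^^ k) H (m + 1) n - (dif ^^ k) H m (n + 1)"
  by (simp add: dif_def)

lemma dif_pow_vanish:
  assumes "\<And>i j. i \<ge> m \<Longrightarrow> j \<ge> n \<Longrightarrow> H i j = 0"
  shows "(dif ^^ k) H m n = 0"
  using assms
proof (induction k arbitrary: m n)
  case (Suc k)
  have "(dif ^^ k) H (m + 1) n = 0" "(dif ^^ k) H m (n + 1) = 0"
    by (rule Suc.IH; use Suc.prems in force)+
  then show ?case by (simp only: dif_pow_Suc diff_self)
qed simp

lemma trunc2_dif_pow:
  assumes "trunc2 H"
  shows "trunc2 ((dif ^^ k) H)"
  unfolding trunc2_def
proof (intro allI)
  fix m n
  obtain K where K: "\<And>i j. i \<ge> K \<or> j \<ge> K \<Longrightarrow> H (m + int i) (n + int j) = 0"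
    using trunc2E [OF assms] by metis
  have "(dif ^^ k) H (m + int i) (n + int j) = 0" if "i \<ge> K \<or> j \<ge> K" for i j
  proof (rule dif_pow_vanish)
    fix i' j' assume "i' \<ge> m + int i" "j' \<ge> n + int j"
    then show "H i' j' = 0"
      using K [of "nat (i' - m)" "nat (j' - n)"] that by force
  qed
  then show "\<exists>K. \<forall>i j. i \<ge> K \<or> j \<ge> K \<longrightarrow> (dif ^^ k) H (m + int i) (n + int j) = 0"
    by blast
qed

context complex_vs
begin

lemma bounded2_scale: "bounded2 H \<Longrightarrow> bounded2 (\<lambda>m n. scale c (H m n))"
  by (rule bounded2_map) auto

lemma dif_pow_scale: "(dif ^^ k) (\<lambda>m n. scale c (G m n)) m n = scale c ((dif ^^ k) G m n)"
  by (rule dif_pow_map) (rule scale_right_diff_distrib)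

lemma dif_pow_exps2:
  assumes "trunc2 H"
  shows "(dif ^^ k) (exps2 scale c d H) m n = exps2 scale c d ((dif ^^ k) H) m n"
proof (induction k arbitrary: m n)
  case (Suc k)
  let ?H = "(dif ^^ k) H"
  have 1: "trunc2 (\<lambda>m n. ?H (m + a) (n + b))" for a b
    unfolding trunc2_def
  proof (intro allI)
    fix m n
    obtain K where "\<And>i j. i \<ge> K \<or> j \<ge> K \<Longrightarrow> ?H (m + a + int i) (n + b + int j) = 0"
      using trunc2E [OF trunc2_dif_pow [OF assms]] by metis
    then show "\<exists>K. \<forall>i j. i \<ge> K \<or> j \<ge> K \<longrightarrow> ?H (m + int i + a) (n + int j + b) = 0"
      by (intro exI [of _ K]) (simp add: algebra_simps)
  qed
  have 2: "trunc2 (\<lambda>m n. scale (-1) (?H (m + 0) (n + 1)))"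
    using 1 [of 0 1] by (simp add: trunc2_def)
  have e: "(dif ^^ Suc k) H = (\<lambda>m n. ?H (m + 1) (n + 0) + scale (-1) (?H (m + 0) (n + 1)))"
    by (intro ext) (simp add: dif_def)
  have "(dif ^^ Suc k) (exps2 scale c d H) m n
      = exps2 scale c d ?H (m + 1) (n + 0) + scale (-1) (exps2 scale c d ?H (m + 0) (n + 1))"
    by (simp only: dif_pow_Suc Suc.IH) simp
  then show ?case
    unfolding e exps2_add [OF 1 2] exps2_scale [OF 1] exps2_shift .
qed simp

lemma zop_eq:
  assumes "\<And>k. k \<ge> K \<Longrightarrow> H (m + int k) (n - int k - int j - 1) = 0"
  shows "zop scale e j H m n =
    (\<Sum>t<K. scale (e ^ t * of_nat ((t + j) choose j)) (H (m + int t) (n - int t - int j - 1)))"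
  unfolding zop_def by (rule Sum_any_lessThan) (simp add: assms)

text \<open>Geometric series: multiplied by x2 - e x1 the summands telescope, and the far end
  vanishes by truncation in the first variable.\<close>

lemma zop_delt_0:
  assumes "utrunc H"
  shows "zop scale e 0 (delt scale e H) m n = H m n"
proof -
  obtain K where K: "\<And>k n. k \<ge> K \<Longrightarrow> H (m + int k) n = 0" using utruncE [OF assms] by metis
  have K1: "H (1 + (m + int k)) n = 0" if "k \<ge> K" for k n
    using K [of "Suc k" n] that by (simp add: algebra_simps)
  define f where "f t = scale (e ^ t) (H (m + int t) (n - int t))" for t
  have "zop scale e 0 (delt scale e H) m n = (\<Sum>t<K. f t - f (Suc t))"
    by (subst zop_eq [where K = K])
      (auto simp: delt_def K K1 f_def scale_right_diff_distrib algebra_simps intro!: sum.cong)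
  also have "\<dots> = f 0 - f K" by (rule sum_lessThan_telescope')
  finally show ?thesis using K [of K] by (simp add: f_def)
qed

text \<open>By Pascal's rule each summand is the one for \<open>j\<close> plus a telescoping
  difference \<open>f t - f (Suc t)\<close>; \<open>f 0\<close> is zero because
  \<open>j choose Suc j\<close> is.\<close>

lemma zop_delt_Suc:
  assumes "utrunc H"
  shows "zop scale e (Suc j) (delt scale e H) m n = zop scale e j H m n"
proof -
  obtain K where K: "\<And>k n. k \<ge> K \<Longrightarrow> H (m + int k) n = 0" using utruncE [OF assms] by metis
  have K1: "H (m + int k + 1) n = 0" if "k \<ge> K" for k n
    using K [of "Suc k" n] that by (simp add: algebra_simps)
  define f where "f t = scale (e ^ t * of_nat ((t + j) choose Suc j)) (H (m + int t) (n - int t - int j - 1))" for t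
  define g where "g t = scale (e ^ t * of_nat ((t + j) choose j)) (H (m + int t) (n - int t - int j - 1))" for t
  have "scale (e ^ t * of_nat ((t + Suc j) choose Suc j)) (delt scale e H (m + int t) (n - int t - int (Suc j) - 1))
      = g t + (f t - f (Suc t))" for t
    by (simp add: delt_def f_def g_def scale_right_diff_distrib scale_left_distrib algebra_simps)
  then have "zop scale e (Suc j) (delt scale e H) m n = (\<Sum>t<K. g t + (f t - f (Suc t)))"
    by (subst zop_eq [where K = K]) (auto simp: delt_def K K1)
  also have "\<dots> = (\<Sum>t<K. g t) + (f 0 - f K)" by (simp add: sum.distrib sum_lessThan_telescope')
  also have "f 0 - f K = 0" using K [of K] by (simp add: f_def)
  also have "(\<Sum>t<K. g t) = zop scale e j H m n"
    by (subst zop_eq [where K = K]) (auto simp: K g_def)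
  finally show ?thesis by simp
qed

lemma utrunc_delt: assumes "utrunc H" shows "utrunc (delt scale e H)"
proof -
  obtain N where "\<And>m n. m \<ge> N \<Longrightarrow> H m n = 0" using assms by (auto simp: utrunc_def)
  then show ?thesis unfolding utrunc_def delt_def by (intro exI [of _ N]) auto
qed

lemma delt_zop:
  assumes "utrunc H"
  shows "delt scale e (zop scale e j H) m n = zop scale e j (delt scale e H) m n"
proof -
  obtain K where K: "\<And>k n. k \<ge> K \<Longrightarrow> H (m + int k) n = 0" using utruncE [OF assms] by metis
  have K1: "H (m + 1 + int k) n = 0" if "k \<ge> K" for k n
    using K [of "Suc k" n] that by (simp add: algebra_simps)
  have K2: "H (m + int k + 1) n = 0" if "k \<ge> K" for k n
    using K [of "Suc k" n] that by (simp add: algebra_simps)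
  show ?thesis
    by (subst zop_eq [where K = K], simp add: delt_def K K2, subst delt_def,
       (subst zop_eq [where K = K], simp add: K K1)+)
      (simp add: delt_def scale_right_diff_distrib scale_sum_right sum_subtractf algebra_simps)
qed

lemma zop_delt_pow:
  assumes "utrunc H"
  shows "zop scale e j ((delt scale e ^^ Suc j) H) m n = H m n"
  using assms
proof (induction j arbitrary: H)
  case 0 then show ?case by (simp add: zop_delt_0)
next
  case (Suc j)
  have "utrunc ((delt scale e ^^ k) H)" for k
    by (induction k) (auto simp: Suc.prems utrunc_delt)
  from zop_delt_Suc [OF this [of "Suc j"], of e j m n] Suc.IH [OF Suc.prems]
  show ?case by simp
qed

lemma dif_zop: 
  assumes "utrunc H"
  shows "dif (zop scale 1 0 H) = (\<lambda>m n. - H m n)"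
    and "dif (zop scale 1 (Suc j) H) = (\<lambda>m n. - zop scale 1 j H m n)"
proof -
  have *: "dif G = (\<lambda>m n. - delt scale 1 G m n)" for G
    by (intro ext) (simp add: dif_def delt_def)
  show "dif (zop scale 1 0 H) = (\<lambda>m n. - H m n)"
    and "dif (zop scale 1 (Suc j) H) = (\<lambda>m n. - zop scale 1 j H m n)"
    by (simp_all add: * delt_zop [OF assms] zop_delt_0 [OF assms] zop_delt_Suc [OF assms])
qed

lemma dif_pow_zop:
  assumes "utrunc H"
  shows "(dif ^^ Suc j) (zop scale 1 j H) m n = scale ((-1) ^ Suc j) (H m n)"
proof (induction j arbitrary: m n)
  case 0 then show ?case by (simp add: dif_zop [OF assms])
next
  case (Suc j)
  have "(dif ^^ Suc (Suc j)) (zop scale 1 (Suc j) H) m n = - (dif ^^ Suc j) (zop scale 1 j H) m n"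
    unfolding funpow_Suc_right [of "Suc j"] o_def dif_zop [OF assms] by (rule dif_pow_uminus)
  then show ?case by (simp only: Suc) simp
qed

lemma dif_pow_kop:
  assumes "utrunc (\<lambda>m n. H n m)"
  shows "(dif ^^ Suc j) (kop scale j H) m n = H m n"
proof (induction j arbitrary: m n)
  have *: "dif (kop scale j H) m n = delt scale 1 (zop scale 1 j (\<lambda>m n. H n m)) n m" for j m n
    by (simp add: dif_def kop_def delt_def)
  {
    case 0
    show ?case by (simp add: * delt_zop [OF assms] zop_delt_0 [OF assms])
  next
    case (Suc j)
    have "dif (kop scale (Suc j) H) = kop scale j H"
      by (intro ext) (simp add: * delt_zop [OF assms] zop_delt_Suc [OF assms], simp add: kop_def)
    then show ?case unfolding funpow_Suc_right [of "Suc j"] o_def by (simp only: Suc)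
  }
qed

lemma subst2_eq:
  assumes "\<And>m n. m \<ge> N \<or> n \<ge> N \<Longrightarrow> G m n = 0" "a < 0" "N' \<ge> N"
  shows "subst2 scale G a b =
    (\<Sum>m\<in>{a + b - N'..N'}. scale ((- of_int m - 1) gchoose nat (- a - 1)) (G m (b - m + a)))"
proof -
  have "G m (b - m + a) = 0" if "m \<notin> {a + b - N'..N'}" for m
    using that assms(3) by (intro assms(1)) auto
  then show ?thesis
    unfolding subst2_def using assms(2)
    by (simp, intro Sum_any.expand_superset) (auto intro: classical)
qed

lemma subst2_cong:
  assumes "\<And>m. G m (b - m + a) = H m (b - m + a)"
  shows "subst2 scale G a b = subst2 scale H a b"
  by (simp add: subst2_def assms)

lemma subst2_nonneg [simp]: "a \<ge> 0 \<Longrightarrow> subst2 scale G a b = 0"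
  by (simp add: subst2_def)

lemma subst2_0 [simp]: "subst2 scale (\<lambda>m n. 0) a b = 0"
  by (simp add: subst2_def)

lemma subst2_add:
  assumes "bounded2 G" "bounded2 H"
  shows "subst2 scale (\<lambda>m n. G m n + H m n) a b = subst2 scale G a b + subst2 scale H a b"
proof (cases "a < 0")
  case True
  obtain N M where N: "\<And>m n. m \<ge> N \<or> n \<ge> N \<Longrightarrow> G m n = 0" and M: "\<And>m n. m \<ge> M \<or> n \<ge> M \<Longrightarrow> H m n = 0"
    using bounded2E [OF assms(1)] bounded2E [OF assms(2)] by metis
  have "subst2 scale (\<lambda>m n. G m n + H m n) a b = (\<Sum>m\<in>{a + b - max N M..max N M}.
      scale ((- of_int m - 1) gchoose nat (- a - 1)) (G m (b - m + a) + H m (b - m + a)))"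
    by (rule subst2_eq [where N = "max N M"]) (use N M True in auto)
  moreover have "subst2 scale G a b = (\<Sum>m\<in>{a + b - max N M..max N M}.
      scale ((- of_int m - 1) gchoose nat (- a - 1)) (G m (b - m + a)))"
    by (rule subst2_eq [where N = N]) (use N True in auto)
  moreover have "subst2 scale H a b = (\<Sum>m\<in>{a + b - max N M..max N M}.
      scale ((- of_int m - 1) gchoose nat (- a - 1)) (H m (b - m + a)))"
    by (rule subst2_eq [where N = M]) (use M True in auto)
  ultimately show ?thesis by (simp add: scale_right_distrib sum.distrib)
qed simp

lemma subst2_scale:
  assumes "bounded2 G"
  shows "subst2 scale (\<lambda>m n. scale c (G m n)) a b = scale c (subst2 scale G a b)"
proof (cases "a < 0")
  case True
  obtain N where N: "\<And>m n. m \<ge> N \<or> n \<ge> N \<Longrightarrow> G m n = 0"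
    using assms by (auto simp: bounded2_def)
  have "subst2 scale (\<lambda>m n. scale c (G m n)) a b = (\<Sum>m\<in>{a + b - N..N}.
      scale ((- of_int m - 1) gchoose nat (- a - 1)) (scale c (G m (b - m + a))))"
    by (rule subst2_eq [where N = N]) (use N True in auto)
  moreover have "subst2 scale G a b = (\<Sum>m\<in>{a + b - N..N}.
      scale ((- of_int m - 1) gchoose nat (- a - 1)) (G m (b - m + a)))"
    by (rule subst2_eq [where N = N]) (use N True in auto)
  ultimately show ?thesis by (simp add: scale_sum_right mult.commute)
qed simp

lemma subst2_sum:
  assumes "finite A" "\<And>i. i \<in> A \<Longrightarrow> bounded2 (G i)"
  shows "subst2 scale (\<lambda>m n. \<Sum>i\<in>A. G i m n) a b = (\<Sum>i\<in>A. subst2 scale (G i) a b)"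
  using assms by (induction A rule: finite_induct) (simp_all add: subst2_add bounded2_sum)

text \<open>Under x1 = x2 + x0, multiplication by x1 becomes multiplication by x0 + x2; on
  coefficients this is Pascal's rule for the binomial series of (x2 + x0)^(-m-1).\<close>

lemma subst2_shift1:
  assumes "bounded2 G"
  shows "subst2 scale (\<lambda>m n. G (m + 1) n) a b = subst2 scale G (a + 1) b + subst2 scale G a (b + 1)"
proof (cases "a < 0")
  case True
  obtain N where N: "\<And>m n. m \<ge> N \<or> n \<ge> N \<Longrightarrow> G m n = 0"
    using assms by (auto simp: bounded2_def)
  let ?e = "nat (- a - 1)"
  let ?A = "{a + b + 1 - (N + 1)..N + 1}"
  have 1: "G (m + 1) n = 0" if "m \<ge> N \<or> n \<ge> N" for m n
    using that N by auto
  have "subst2 scale (\<lambda>m n. G (m + 1) n) a b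
      = (\<Sum>m\<in>{a + b - (N+1)..N+1}. scale ((- of_int m - 1) gchoose ?e) (G (m + 1) (b - m + a)))"
    by (rule subst2_eq [OF 1]) (use True in auto)
  also have "\<dots> = (\<Sum>m\<in>{a + b - N..N+2}. scale ((- of_int m) gchoose ?e) (G m (b - m + 1 + a)))"
  proof (rule sum.reindex_bij_witness [of _ "\<lambda>m. m - 1" "\<lambda>m. m + 1"])
    fix m :: int
    have "(- of_int (m + 1) :: complex) = - of_int m - 1" by simp
    then show "scale (- of_int (m + 1) gchoose ?e) (G (m + 1) (b - (m + 1) + 1 + a))
        = scale (- of_int m - 1 gchoose ?e) (G (m + 1) (b - m + a))" by (simp only:) simp
  qed auto
  also have "\<dots> = (\<Sum>m\<in>?A. scale ((- of_int m) gchoose ?e) (G m (b - m + 1 + a)))"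
    by (rule sum.mono_neutral_right) (auto simp: N)
  also have "\<dots> = subst2 scale G (a + 1) b + subst2 scale G a (b + 1)"
  \<comment> \<open>At \<open>a = -1\<close> the first summand has mode \<open>a + 1 = 0\<close>,
    where \<open>subst2\<close> is zero by definition, and all remaining coefficients are binomials
    of order 0; Pascal's rule starts below that.\<close>
  proof (cases "a = -1")
    case True
    then have "subst2 scale G a (b + 1) = (\<Sum>m\<in>?A. scale 1 (G m (b + 1 - m + a)))"
      by (subst subst2_eq [OF N, where N' = "N + 1"]) (auto simp: algebra_simps)
    then show ?thesis using True by (simp add: algebra_simps)
  next
    case False
    with True have a: "a + 1 < 0" by simp
    define e where "e = nat (- a - 2)"
    have e: "nat (- a - 1) = Suc e" "nat (- a - 2) = e"
      using a by (auto simp: e_def)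
    have pascal: "(- of_int m :: complex) gchoose Suc e
        = ((- of_int m - 1) gchoose e) + ((- of_int m - 1) gchoose Suc e)" for m :: int
      using gbinomial_Suc_Suc [of "- of_int m - 1 :: complex" e] by simp
    have "subst2 scale G (a + 1) b = (\<Sum>m\<in>?A. scale ((- of_int m - 1) gchoose e) (G m (b - m + (a + 1))))"
      by (subst subst2_eq [OF N a, where N' = "N + 1"]) (auto simp: e(2) algebra_simps)
    moreover have "subst2 scale G a (b + 1) = (\<Sum>m\<in>?A. scale ((- of_int m - 1) gchoose Suc e) (G m (b + 1 - m + a)))"
      by (subst subst2_eq [OF N True, where N' = "N + 1"]) (auto simp: e(1) algebra_simps)
    ultimately show ?thesis
      by (simp only: e(1) pascal scale_left_distrib sum.distrib) (simp add: algebra_simps)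
  qed
  finally show ?thesis .
qed simp

lemma subst2_shift2: "subst2 scale (\<lambda>m n. G m (n + c)) a b = subst2 scale G a (b + c)"
  by (simp add: subst2_def algebra_simps)

text \<open>x1 - x2 becomes x0. This is how a pole in x1 - x2 turns into a shift of the mode of the
  iterate.\<close>

lemma subst2_dif:
  assumes "bounded2 G"
  shows "subst2 scale (dif G) a b = subst2 scale G (a + 1) b"
proof -
  have b1: "bounded2 (\<lambda>m n. G (m + 1) n)" using bounded2_shift [OF assms, of 1 0] by simp
  have b2: "bounded2 (\<lambda>m n. G m (n + 1))" using bounded2_shift [OF assms, of 0 1] by simp
  have "subst2 scale (dif G) a b = subst2 scale (\<lambda>m n. G (m + 1) n + scale (-1) (G m (n + 1))) a b"
    by (simp add: dif_def [abs_def])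
  also have "\<dots> = subst2 scale G (a + 1) b"
    unfolding subst2_add [OF b1 bounded2_scale [OF b2]] subst2_scale [OF b2]
      subst2_shift1 [OF assms] subst2_shift2
    by (simp add: scale_minus_left)
  finally show ?thesis .
qed

lemma subst2_dif_pow:
  "bounded2 G \<Longrightarrow> subst2 scale ((dif ^^ k) G) a b = subst2 scale G (a + int k) b"
  by (induction k arbitrary: a) (simp_all add: subst2_dif bounded2_dif_pow algebra_simps)

lemma subst2_shift_pow:
  assumes "bounded2 G"
  shows "subst2 scale (\<lambda>m n. G (m + int i) n) a b
    = (\<Sum>j\<le>i. scale (of_nat (i choose j)) (subst2 scale G (a + int j) (b + int (i - j))))"
proof (induction i arbitrary: a b)
  case (Suc i)
  let ?S = "subst2 scale G"
  have "bounded2 (\<lambda>m n. G (m + int i) n)" using bounded2_shift [OF assms, of "int i" 0] by simp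
  from subst2_shift1 [OF this, of a b]
  have "subst2 scale (\<lambda>m n. G (m + int (Suc i)) n) a b
    = (\<Sum>j\<le>i. scale (of_nat (i choose j)) (?S (a + 1 + int j) (b + int (i - j))))
    + (\<Sum>j\<le>i. scale (of_nat (i choose j)) (?S (a + int j) (b + 1 + int (i - j))))"
    by (simp add: Suc algebra_simps)
  also have "(\<Sum>j\<le>i. scale (of_nat (i choose j)) (?S (a + 1 + int j) (b + int (i - j))))
    = (\<Sum>j\<le>i. scale (of_nat (i choose j)) (?S (a + int (Suc j)) (b + int (Suc i - Suc j))))"
    by (simp add: algebra_simps)
  also have "(\<Sum>j\<le>i. scale (of_nat (i choose j)) (?S (a + int j) (b + 1 + int (i - j))))
    = (\<Sum>j\<le>Suc i. scale (of_nat (i choose j)) (?S (a + int j) (b + int (Suc i - j))))"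
    by (simp add: Suc_diff_le of_nat_diff algebra_simps)
  also have "\<dots> = scale 1 (?S a (b + int (Suc i)))
     + (\<Sum>j\<le>i. scale (of_nat (i choose Suc j)) (?S (a + int (Suc j)) (b + int (Suc i - Suc j))))"
    by (subst sum.atMost_Suc_shift) simp
  finally show ?case
    by (subst sum.atMost_Suc_shift)
      (simp add: sum.distrib scale_left_distrib algebra_simps del: sum.atMost_Suc)
qed simp

text \<open>Dividing by x1^(j+1) becomes dividing by (x2 + x0)^(j+1): multiplication by x2 + x0 is
  \<open>delt scale (-1)\<close>, and on series truncated in x0 powers of it are inverted by
  \<open>zop scale (-1)\<close>.\<close>

lemma subst2_neg_shift:
  assumes "bounded2 G"
  shows "subst2 scale (\<lambda>m n. G (m - int j - 1) n) a b = zop scale (-1) j (subst2 scale G) a b"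
proof -
  have d: "delt scale (-1) (subst2 scale H) = subst2 scale (\<lambda>m n. H (m + 1) n)" if "bounded2 H" for H
    by (intro ext) (simp add: delt_def subst2_shift1 [OF that])
  have p: "(delt scale (-1) ^^ k) (subst2 scale H) = subst2 scale (\<lambda>m n. H (m + int k) n)" if "bounded2 H" for H k
  proof (induction k)
    case (Suc k)
    have "bounded2 (\<lambda>m n. H (m + int k) n)" using bounded2_shift [OF that, of "int k" 0] by simp
    then show ?case by (simp add: Suc d algebra_simps)
  qed simp
  let ?H = "\<lambda>m n. G (m - int j - 1) n"
  have b: "bounded2 ?H" using bounded2_shift [OF assms, of "- int j - 1" 0] by (simp add: algebra_simps)
  have "(delt scale (-1) ^^ Suc j) (subst2 scale ?H) = subst2 scale G"
    by (subst p [OF b]) (simp add: algebra_simps)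
  moreover have "utrunc (subst2 scale ?H)"
    unfolding utrunc_def by (rule exI [of _ 0]) simp
  ultimately show ?thesis using zop_delt_pow [of "subst2 scale ?H" "-1" j a b] by simp
qed

text \<open>Substitution preserves the total degree, so the result vanishes for
  \<open>a + b \<ge> 2 * N\<close>; it also vanishes for \<open>a \<ge> 0\<close>, having no
  negative powers of x0. The two half-planes leave a finite part of each quadrant.\<close>

lemma trunc2_subst2:
  assumes "bounded2 G"
  shows "trunc2 (subst2 scale G)"
  unfolding trunc2_def
proof (intro allI)
  fix a b
  obtain N where N: "\<And>m n. m \<ge> N \<or> n \<ge> N \<Longrightarrow> G m n = 0"
    using assms by (auto simp: bounded2_def)
  have z: "subst2 scale G a b = 0" if "a + b \<ge> 2 * N" for a b
  proof -
    have "G m (b - m + a) = 0" for m using that by (intro N) arith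
    then show ?thesis by (simp add: subst2_def)
  qed
  show "\<exists>K. \<forall>i j. i \<ge> K \<or> j \<ge> K \<longrightarrow> subst2 scale G (a + int i) (b + int j) = 0"
  proof (intro exI allI impI)
    fix i j assume "i \<ge> nat (\<bar>a\<bar> + \<bar>2 * N - a - b\<bar>) \<or> j \<ge> nat (\<bar>a\<bar> + \<bar>2 * N - a - b\<bar>)"
    then consider "a + int i \<ge> 0" | "a + int i + (b + int j) \<ge> 2 * N" by linarith
    then show "subst2 scale G (a + int i) (b + int j) = 0"
      by cases (simp_all add: z)
  qed
qed

text \<open>e^(c x1 + d x2) becomes e^(c x0 + (c + d) x2). The two variables are treated apart; in
  both cases the exponential series is first cut at a length valid for all \<open>m\<close> at once,
  which the bound on the total degree provides.\<close>

lemma subst2_exps2: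
  assumes "bounded2 G"
  shows "subst2 scale (exps2 scale c d G) a b = exps2 scale c (c + d) (subst2 scale G) a b"
proof -
  have right: "subst2 scale (exps2 scale 0 d G) a b = exps2 scale 0 d (subst2 scale G) a b"
    if bG: "bounded2 G" for G d a b
  proof -
    obtain N where N: "\<And>m n. m \<ge> N \<or> n \<ge> N \<Longrightarrow> G m n = 0" using bG by (auto simp: bounded2_def)
    obtain K where K: "\<And>i j. i \<ge> K \<or> j \<ge> K \<Longrightarrow> subst2 scale G (a + int i) (b + int j) = 0"
      using trunc2E [OF trunc2_subst2 [OF bG]] by metis
    define L where "L = max K (nat (2 * N - a - b))"
    have bs: "bounded2 (\<lambda>m n. scale (d ^ k / fact k) (G m (n + int k)))" for k
      using bounded2_scale [OF bounded2_shift [OF bG, of 0 "int k"]] by simp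
    have bs': "bounded2 (\<lambda>m n. G m (n + int k))" for k
      using bounded2_shift [OF bG, of 0 "int k"] by simp
    have "subst2 scale (exps2 scale 0 d G) a b
        = subst2 scale (\<lambda>m n. \<Sum>k<L. scale (d ^ k / fact k) (G m (n + int k))) a b"
    proof (rule subst2_cong)
      fix m
      have "G m (b - m + a + int k) = 0" if "k \<ge> L" for k
      proof -
        have "int k \<ge> 2 * N - a - b" using that by (auto simp: L_def)
        then have "m \<ge> N \<or> b - m + a + int k \<ge> N" by linarith
        then show ?thesis by (rule N)
      qed
      then show "exps2 scale 0 d G m (b - m + a) = (\<Sum>k<L. scale (d ^ k / fact k) (G m (b - m + a + int k)))"
        unfolding exps2_right by (rule exps_eq)
    qed
    also have "\<dots> = (\<Sum>k<L. scale (d ^ k / fact k) (subst2 scale G a (b + int k)))"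
      by (simp add: subst2_sum bs subst2_scale [OF bs'] subst2_shift2)
    also have "\<dots> = exps2 scale 0 d (subst2 scale G) a b"
      unfolding exps2_right by (rule exps_eq [symmetric]) (use K [of 0] in \<open>auto simp: L_def\<close>)
    finally show ?thesis .
  qed
  have left: "subst2 scale (exps2 scale c 0 G) a b = exps2 scale c c (subst2 scale G) a b" for a b
  proof -
    obtain N where N: "\<And>m n. m \<ge> N \<or> n \<ge> N \<Longrightarrow> G m n = 0" using assms by (auto simp: bounded2_def)
    obtain K where K: "\<And>i j. i \<ge> K \<or> j \<ge> K \<Longrightarrow> subst2 scale G (a + int i) (b + int j) = 0"
      using trunc2E [OF trunc2_subst2 [OF assms]] by metis
    define L where "L = max K (nat (2 * N - a - b))"
    have L: "\<And>i j. i \<ge> L \<or> j \<ge> L \<Longrightarrow> subst2 scale G (a + int i) (b + int j) = 0"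
      by (rule K) (auto simp: L_def)
    have bs: "bounded2 (\<lambda>m n. scale (c ^ k / fact k) (G (m + int k) n))" for k
      using bounded2_scale [OF bounded2_shift [OF assms, of "int k" 0]] by simp
    have bs': "bounded2 (\<lambda>m n. G (m + int k) n)" for k
      using bounded2_shift [OF assms, of "int k" 0] by simp
    have "subst2 scale (exps2 scale c 0 G) a b
        = subst2 scale (\<lambda>m n. \<Sum>k<2*L. scale (c ^ k / fact k) (G (m + int k) n)) a b"
    proof (rule subst2_cong)
      fix m
      have "G (m + int k) (b - m + a) = 0" if "k \<ge> 2 * L" for k
      proof -
        have "int k \<ge> 2 * N - a - b" using that by (auto simp: L_def)
        then have "m + int k \<ge> N \<or> b - m + a \<ge> N" by linarith
        then show ?thesis by (rule N)
      qed
      then show "exps2 scale c 0 G m (b - m + a) = (\<Sum>k<2*L. scale (c ^ k / fact k) (G (m + int k) (b - m + a)))"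
        unfolding exps2_left by (rule exps_eq)
    qed
    also have "\<dots> = (\<Sum>k<2*L. scale (c ^ k / fact k)
        (\<Sum>j\<le>k. scale (of_nat (k choose j)) (subst2 scale G (a + int j) (b + int (k - j)))))"
      by (simp add: subst2_sum bs subst2_scale [OF bs'] subst2_shift_pow [OF assms])
    also have "\<dots> = (\<Sum>k<2*L. \<Sum>j\<le>k. scale (c ^ j / fact j * (c ^ (k - j) / fact (k - j)))
        (subst2 scale G (a + int j) (b + int (k - j))))"
      unfolding scale_sum_right scale_scale
    proof (intro sum.cong refl)
      fix k j :: nat assume j: "j \<in> {..k}"
      then have "c ^ k = c ^ j * c ^ (k - j)" by (simp flip: power_add)
      with j have "c ^ k / fact k * of_nat (k choose j) = c ^ j / fact j * (c ^ (k - j) / fact (k - j))"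
        by (simp add: binomial_fact)
      then show "scale (c ^ k / fact k * of_nat (k choose j)) (subst2 scale G (a + int j) (b + int (k - j)))
        = scale (c ^ j / fact j * (c ^ (k - j) / fact (k - j))) (subst2 scale G (a + int j) (b + int (k - j)))"
        by (simp only:)
    qed
    also have "\<dots> = (\<Sum>i<L. \<Sum>j<L. scale (c ^ i / fact i * (c ^ j / fact j)) (subst2 scale G (a + int i) (b + int j)))"
      by (rule sum_square_triangle [symmetric]) (auto simp: L)
    also have "\<dots> = exps2 scale c c (subst2 scale G) a b"
      by (rule exps2_eq [symmetric]) (rule L)
    finally show ?thesis .
  qed
  have "exps2 scale c d G = exps2 scale 0 d (exps2 scale c 0 G)"
    by (intro ext) (simp add: exps2_exps2 [OF bounded2_trunc2 [OF assms]])
  moreover have "subst2 scale (exps2 scale c 0 G) = exps2 scale c c (subst2 scale G)"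
    by (intro ext left)
  ultimately show ?thesis
    by (simp add: right bounded2_exps2 [OF assms] exps2_exps2 [OF trunc2_subst2 [OF assms]] add.commute)
qed

end

lemma linear_subst2:
  assumes "Vector_Spaces.linear s t L" "bounded2 G"
  shows "L (subst2 s G a b) = subst2 t (\<lambda>m n. L (G m n)) a b"
proof (cases "a < 0")
  case True
  interpret S: complex_vs s using assms(1) by (simp add: Vector_Spaces.linear_iff complex_vs_def)
  interpret T: complex_vs t using assms(1) by (simp add: Vector_Spaces.linear_iff complex_vs_def)
  obtain N where N: "\<And>m n. m \<ge> N \<or> n \<ge> N \<Longrightarrow> G m n = 0" using assms(2) by (auto simp: bounded2_def)
  then have N': "\<And>m n. m \<ge> N \<or> n \<ge> N \<Longrightarrow> L (G m n) = 0" by (simp add: linear_zeroD [OF assms(1)])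
  show ?thesis
    by (simp add: S.subst2_eq [where N = N and N' = N and G = G, OF N True]
      T.subst2_eq [where N = N and N' = N and G = "\<lambda>m n. L (G m n)", OF N' True]
      linear_sumD [OF assms(1)] linear_scaleD [OF assms(1)])
next
  case False
  then show ?thesis by (simp add: subst2_def linear_zeroD [OF assms(1)])
qed

section \<open>The universal vacuum module\<close>

sublocale A_module \<subseteq> complex_vs scale
  by unfold_locales

definition field :: "(complex \<Rightarrow> 'w \<Rightarrow> 'w) \<Rightarrow> (int \<Rightarrow> 'w \<Rightarrow> 'w::ab_group_add) \<Rightarrow> bool" where
  "field s \<phi> \<longleftrightarrow> (\<forall>n. Vector_Spaces.linear s s (\<phi> n)) \<and> (\<forall>w. trunc (\<lambda>n. \<phi> n w))"

lemma field_linear: "field s \<phi> \<Longrightarrow> Vector_Spaces.linear s s (\<phi> n)"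
  and field_trunc: "field s \<phi> \<Longrightarrow> trunc (\<lambda>n. \<phi> n w)"
  by (simp_all add: field_def)

lemma common_bound:
  assumes "\<And>j. j < (J::nat) \<Longrightarrow> \<exists>K::nat. \<forall>i\<ge>K. P i j"
  shows "\<exists>K. \<forall>j<J. \<forall>i\<ge>K. P i j"
  using assms
proof (induction J)
  case (Suc J)
  have "\<exists>K. \<forall>j<J. \<forall>i\<ge>K. P i j" by (rule Suc.IH) (rule Suc.prems, simp)
  then obtain K where "\<forall>j<J. \<forall>i\<ge>K. P i j" by blast
  moreover obtain L where "\<forall>i\<ge>L. P i J" using Suc.prems [of J] by auto
  ultimately show ?case by (intro exI [of _ "max K L"]) (auto simp: less_Suc_eq)
qed simp

lemma trunc2_comp:
  assumes "field s \<phi>" "trunc f"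
  shows "trunc2 (\<lambda>m n. \<phi> m (f n))"
  unfolding trunc2_def
proof (intro allI)
  fix m n
  obtain J where J: "\<And>j. j \<ge> J \<Longrightarrow> f (n + int j) = 0" using truncE [OF assms(2)] by metis
  have "\<exists>K. \<forall>i\<ge>K. \<phi> (m + int i) (f (n + int j)) = 0" for j
    using truncE [OF field_trunc [OF assms(1)]] by metis
  then obtain K where K: "\<forall>j<J. \<forall>i\<ge>K. \<phi> (m + int i) (f (n + int j)) = 0"
    using common_bound [of J "\<lambda>i j. \<phi> (m + int i) (f (n + int j)) = 0"] by blast
  have "\<phi> (m + int i) (f (n + int j)) = 0" if "i \<ge> max J K \<or> j \<ge> max J K" for i j
  proof (cases "j < J")
    case True then show ?thesis using that K by auto
  next
    case False
    then show ?thesis using J linear_zeroD [OF field_linear [OF assms(1)]] by simp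
  qed
  then show "\<exists>K. \<forall>i j. i \<ge> K \<or> j \<ge> K \<longrightarrow> \<phi> (m + int i) (f (n + int j)) = 0" by blast
qed

lemma (in complex_vs) same_term_exps2:
  assumes "field scale A"
  shows "Sum_any (same_term scale A m n w) = exps2 scale (-1) 1 (\<lambda>m n. A n (A m w)) m n"
    and "finite {p. same_term scale A m n w p \<noteq> 0}"
proof -
  have t: "trunc2 (\<lambda>m n. A n (A m w))"
    by (rule trunc2_flip [OF trunc2_comp [OF assms field_trunc [OF assms]]])
  show "Sum_any (same_term scale A m n w) = exps2 scale (-1) 1 (\<lambda>m n. A n (A m w)) m n"
    unfolding same_term_def by (rule Sum_any_exps2(1) [OF t])
  show "finite {p. same_term scale A m n w p \<noteq> 0}"
    unfolding same_term_def by (rule Sum_any_exps2(2) [OF t])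
qed

lemma (in complex_vs) mixed_term_exps2:
  assumes "field scale A" "field scale B"
  shows "Sum_any (mixed_term scale A B m n w) = exps2 scale 1 (-1) (\<lambda>m n. B n (A m w)) m n"
    and "finite {p. mixed_term scale A B m n w p \<noteq> 0}"
proof -
  have t: "trunc2 (\<lambda>n m. B n (A m w))"
    by (rule trunc2_comp [OF assms(2) field_trunc [OF assms(1)]])
  show "Sum_any (mixed_term scale A B m n w) = exps2 scale 1 (-1) (\<lambda>m n. B n (A m w)) m n"
    unfolding mixed_term_def Sum_any_exps2(1) [OF t] by (rule exps2_flip [OF t, symmetric])
  show "finite {p. mixed_term scale A B m n w p \<noteq> 0}"
    unfolding mixed_term_def by (rule Sum_any_exps2(2) [OF t])
qed

section \<open>Words acting on a vacuum vector, and the action of the free algebra\<close>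

lemma T_induct [case_names zero add]:
  fixes x :: T
  assumes "P 0" "\<And>x ws c. P x \<Longrightarrow> P (x + Poly_Mapping.single ws c)"
  shows "P x"
proof (induction x rule: update_induct)
  case (update f k v)
  have "Poly_Mapping.update k v f = f + Poly_Mapping.single k v"
    using update.hyps
    by (intro poly_mapping_eqI) (auto simp: lookup_update lookup_add lookup_single when_def in_keys_iff)
  with update.IH assms(2) show ?case by simp
qed (rule assms(1))

context A_module
begin

lemma linear_letter_act: "Vector_Spaces.linear scale scale (letter_act Y Ys p)"
  by (cases p; cases "fst p") (auto simp: linear_Y linear_Ys)

lemma word_act_Nil [simp]: "word_act Y Ys [] w = w"
  by (simp add: word_act_def)

lemma word_act_Cons [simp]: "word_act Y Ys (p # ws) w = letter_act Y Ys p (word_act Y Ys ws w)"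
  by (simp add: word_act_def)

lemma word_act_append [simp]: "word_act Y Ys (us @ ws) w = word_act Y Ys us (word_act Y Ys ws w)"
  by (simp add: word_act_def)

lemma linear_word_act: "Vector_Spaces.linear scale scale (word_act Y Ys ws)"
proof (induction ws)
  case Nil then show ?case by (intro linearI vector_space_axioms) simp_all
next
  case (Cons p ws)
  show ?case
    by (intro linearI vector_space_axioms)
      (simp_all add: linear_addD [OF Cons] linear_scaleD [OF Cons]
        linear_addD [OF linear_letter_act] linear_scaleD [OF linear_letter_act])
qed

text \<open>A letter of nonnegative mode is moved to the right until it meets the vacuum-like vector.\<close>

lemma word_act_nonneg_letter:
  assumes vac: "\<And>a n. n \<ge> 0 \<Longrightarrow> letter_act Y Ys (a, n) v = 0"
    and shorter: "\<And>ws. ws \<noteq> [] \<Longrightarrow> length ws < r \<Longrightarrow> sum_list (map snd ws) \<ge> 0 \<Longrightarrow> word_act Y Ys ws v = 0"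
    and "m \<ge> 0" "length z + length x < r"
    and "sum_list (map snd z) + m + sum_list (map snd x) \<ge> 0"
  shows "word_act Y Ys (z @ (a, m) # x) v = 0"
  using assms(3-)
proof (induction x arbitrary: a m z)
  case Nil
  then show ?case by (simp add: vac linear_zeroD [OF linear_word_act])
next
  case (Cons p x)
  obtain b n where p: "p = (b, n)" by (cases p)
  define Z where "Z = word_act Y Ys z"
  define u where "u = word_act Y Ys x v"
  let ?L = "letter_act Y Ys"
  have linZ: "Vector_Spaces.linear scale scale Z" unfolding Z_def by (rule linear_word_act)
  \<comment> \<open>Every term that an exchange of the two letters produces has this form, with a
    nonnegative mode \<open>m'\<close> on the letter being moved and total mode at least
    \<open>m + n\<close>; the suffix is shorter by one letter, so the induction hypothesis kills
    it.\<close>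
  have sw: "Z (?L (b, n') (?L (a, m') u)) = 0" if "m' \<ge> 0" "m' + n' \<ge> m + n" for m' n'
    using Cons.IH [of m' "z @ [(b, n')]" a] Cons.prems that by (simp add: p Z_def u_def)
  \<comment> \<open>The delta term deletes two letters of total mode -1, which leaves a shorter word
    of positive total mode.\<close>
  have rem: "Z u = 0" if "m' + n' + 1 = 0" "m' + n' \<ge> m + n" for m' n'
  proof -
    have pos: "sum_list (map snd (z @ x)) > 0" using Cons.prems that by (simp add: p)
    then have "z @ x \<noteq> []" by auto
    then show ?thesis using shorter [of "z @ x"] pos Cons.prems by (simp add: Z_def u_def)
  qed
  have Z0: "Z 0 = 0" by (rule linear_zeroD [OF linZ])
  have same: "Z (A m (A n u)) = 0"
    if rel: "same_rel scale A m n u = 0" and fin: "finite {p. same_term scale A m n u p \<noteq> 0}"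
      and A: "\<And>i w. A i w = ?L (b, i) w" "\<And>i w. A i w = ?L (a, i) w" for A
  proof -
    have "Z (same_term scale A m n u q) = 0" for q
    proof (cases q)
      case (Pair k i)
      show ?thesis
      proof (cases "i \<le> k")
        case True
        have "Z (A (n + int k - int i) (A (m + int i) u)) = 0"
          using sw [of "m + int i" "n + int k - int i"] True Cons.prems by (simp flip: A)
        then show ?thesis by (simp add: Pair same_term_def linear_scaleD [OF linZ])
      qed (simp add: Pair same_term_def Z0 binomial_eq_0)
    qed
    then have "Z (Sum_any (same_term scale A m n u)) = 0"
      by (simp add: linear_Sum_any [OF linZ fin])
    moreover have "A m (A n u) = - Sum_any (same_term scale A m n u)"
      using rel by (simp add: same_rel_def eq_neg_iff_add_eq_0)
    ultimately show ?thesis by (simp add: linear_negD [OF linZ])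
  qed
  have "Z (?L (a, m) (?L (b, n) u)) = 0"
  proof (cases a; cases b)
    assume ab: "a = Yl" "b = Yl"
    have "Z (Y m (Y n u)) = 0" by (rule same [OF rel_YY finite_YY]) (simp_all add: ab)
    then show ?thesis by (simp add: ab)
  next
    assume ab: "a = Ysl" "b = Ysl"
    have "Z (Ys m (Ys n u)) = 0" by (rule same [OF rel_YsYs finite_YsYs]) (simp_all add: ab)
    then show ?thesis by (simp add: ab)
  next
    assume ab: "a = Yl" "b = Ysl"
    have "Z (mixed_term scale Y Ys m n u q) = 0" for q
    proof (cases q)
      case (Pair k i)
      show ?thesis
      proof (cases "i \<le> k")
        case True
        have "Z (Ys (n + int i) (Y (m + int k - int i) u)) = 0"
          using sw [of "m + int k - int i" "n + int i"] True Cons.prems ab by simp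
        then show ?thesis by (simp add: Pair mixed_term_def linear_scaleD [OF linZ])
      qed (simp add: Pair mixed_term_def Z0 binomial_eq_0)
    qed
    then have "Z (Sum_any (mixed_term scale Y Ys m n u)) = 0"
      by (simp add: linear_Sum_any [OF linZ finite_YYs])
    moreover have "Y m (Ys n u) = (if m + n + 1 = 0 then u else 0) - Sum_any (mixed_term scale Y Ys m n u)"
      using rel_YYs [of m n u] by (simp add: mixed_rel_def algebra_simps split: if_splits)
    ultimately show ?thesis using rem [of m n] by (simp add: ab linear_diffD [OF linZ] Z0)
  next
    assume ab: "a = Ysl" "b = Yl"
    let ?M = "mixed_term scale Y Ys"
    \<comment> \<open>In this order of letters the relation has to be read backwards, since it
      expresses Y Ys by Ys Y. The module is not assumed restricted, so the bound comes from the
      finiteness of the family of terms in the relation.\<close>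
    obtain K where K: "\<And>k i. ?M n m u (k, i) \<noteq> 0 \<Longrightarrow> k < K"
    proof -
      have "finite (fst ` {p. ?M n m u p \<noteq> 0})" by (rule finite_imageI) (rule finite_YYs)
      then obtain K where K: "\<And>k. k \<in> fst ` {p. ?M n m u p \<noteq> 0} \<Longrightarrow> k < K"
        by (meson finite_nat_set_iff_bounded)
      show thesis by (rule that [of K]) (force intro: K)
    qed
    \<comment> \<open>The index \<open>(i + j, i)\<close> has a nonzero coefficient, so a nonzero
      vector here would give a nonzero term beyond the bound.\<close>
    have zero: "Ys (m + int i) (Y (n + int j) u) = 0" if "i + j \<ge> K" for i j
    proof (rule ccontr)
      assume "Ys (m + int i) (Y (n + int j) u) \<noteq> 0"
      then have "?M n m u (i + j, i) \<noteq> 0" by (simp add: mixed_term_def algebra_simps)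
      with K that show False by fastforce
    qed
    \<comment> \<open>Descending induction on \<open>i + j\<close>: in the relation at modes
      \<open>?n\<close>, \<open>?m\<close>, all terms but the one with index \<open>(0, 0)\<close>
      have a larger \<open>i + j\<close> and are already killed by \<open>Z\<close>.\<close>
    have "\<forall>i j. i + j \<ge> K - d \<longrightarrow> Z (Ys (m + int i) (Y (n + int j) u)) = 0" for d
    proof (induction d)
      case 0 then show ?case by (simp add: zero Z0)
    next
      case (Suc d)
      show ?case
      proof (intro allI impI)
        fix i j assume ij: "i + j \<ge> K - Suc d"
        let ?m = "m + int i" and ?n = "n + int j"
        have "Z (?M ?n ?m u q) = 0" if "q \<noteq> (0, 0)" for q
        proof (cases q)
          case (Pair k l)
          have "l > k \<or> l \<le> k \<and> k \<noteq> 0" using that Pair by auto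
          then consider "l > k" | "l \<le> k" "k \<noteq> 0" by blast
          then show ?thesis
          proof cases
            case 2
            have "(i + l) + (j + (k - l)) \<ge> K - d" using ij 2 by simp
            then have "Z (Ys (m + int (i + l)) (Y (n + int (j + (k - l))) u)) = 0"
              using Suc by blast
            then show ?thesis using 2
              by (simp add: Pair mixed_term_def linear_scaleD [OF linZ] of_nat_diff algebra_simps)
          qed (simp add: Pair mixed_term_def Z0 binomial_eq_0)
        qed
        then have "Sum_any (\<lambda>q. Z (?M ?n ?m u q)) = (\<Sum>q\<in>{(0, 0)}. Z (?M ?n ?m u q))"
          by (intro Sum_any.expand_superset) auto
        then have "Z (Sum_any (?M ?n ?m u)) = Z (Ys ?m (Y ?n u))"
          by (simp add: linear_Sum_any [OF linZ finite_YYs]) (simp add: mixed_term_def)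
        moreover have "Sum_any (?M ?n ?m u) = (if ?n + ?m + 1 = 0 then u else 0) - Y ?n (Ys ?m u)"
          using rel_YYs [of ?n ?m u] by (simp add: mixed_rel_def algebra_simps split: if_splits)
        moreover have "Z (Y ?n (Ys ?m u)) = 0"
          using sw [of ?m ?n] Cons.prems by (simp add: ab)
        moreover have "Z (if ?n + ?m + 1 = 0 then u else 0) = 0"
          using rem [of ?m ?n] by (simp add: Z0 algebra_simps)
        ultimately show "Z (Ys ?m (Y ?n u)) = 0" by (simp add: linear_diffD [OF linZ])
      qed
    qed
    from this [of K] show ?thesis by (simp add: ab) (metis add.right_neutral le0 of_nat_0)
  qed
  then show ?case by (simp add: p Z_def u_def)
qed

text \<open>A word of nonnegative total mode contains a letter of nonnegative mode, which can be
  moved to the vacuum; induction on the length takes care of the shorter words left by delta terms.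
  Thus \<open>T_plus\<close> annihilates every vacuum vector.\<close>

lemma word_act_vacuum:
  assumes vac: "\<And>a n. n \<ge> 0 \<Longrightarrow> letter_act Y Ys (a, n) v = 0"
    and "ws \<noteq> []" "sum_list (map snd ws) \<ge> 0"
  shows "word_act Y Ys ws v = 0"
  using assms(2-)
proof (induction "length ws" arbitrary: ws rule: less_induct)
  case less
  have "\<exists>p\<in>set ws. snd p \<ge> 0"
  proof (rule ccontr)
    assume "\<not> ?thesis"
    then have neg: "\<forall>p\<in>set ws. snd p < 0" by auto
    have "sum_list (map snd us) \<le> 0 \<and> (us \<noteq> [] \<longrightarrow> sum_list (map snd us) < 0)"
      if "\<forall>p\<in>set us. snd p < (0::int)" for us :: wrd
      using that by (induction us) force+
    from this [OF neg] less.prems show False by simp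
  qed
  then obtain z a m x where ws: "ws = z @ (a, m) # x" "m \<ge> 0"
    by (metis in_set_conv_decomp prod.collapse)
  show ?case unfolding ws
  proof (rule word_act_nonneg_letter [where r = "length ws"])
    show "word_act Y Ys us v = 0"
      if "us \<noteq> []" "length us < length ws" "sum_list (map snd us) \<ge> 0" for us
      using less.hyps that by blast
  qed (use vac ws less.prems in auto)
qed

definition act :: "T \<Rightarrow> 'w \<Rightarrow> 'w" where
  "act x w = Sum_any (\<lambda>ws. scale (Poly_Mapping.lookup x ws) (word_act Y Ys ws w))"

lemma act_eq:
  assumes "finite A" "Poly_Mapping.keys x \<subseteq> A"
  shows "act x w = (\<Sum>ws\<in>A. scale (Poly_Mapping.lookup x ws) (word_act Y Ys ws w))"
  unfolding act_def
  by (rule Sum_any.expand_superset) (use assms in \<open>auto simp: in_keys_iff subset_iff\<close>)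

lemma act_zero [simp]: "act 0 w = 0"
  by (simp add: act_def)

lemma act_add: "act (x + y) w = act x w + act y w"
  using Poly_Mapping.keys_add [of x y]
  by (simp add: act_eq [where A = "Poly_Mapping.keys x \<union> Poly_Mapping.keys y"]
      lookup_add scale_left_distrib sum.distrib)

lemma act_single: "act (Poly_Mapping.single ws c) w = scale c (word_act Y Ys ws w)"
  by (subst act_eq [where A = "{ws}"]) (auto simp: lookup_single split: if_splits)

lemma linear_act: "Vector_Spaces.linear scale scale (act x)"
proof (induction x rule: T_induct)
  case zero show ?case by (intro linearI vector_space_axioms) simp_all
next
  case (add x ws c)
  show ?case
    by (intro linearI vector_space_axioms)
      (simp_all add: act_add act_single linear_addD [OF add] linear_scaleD [OF add]
        linear_addD [OF linear_word_act] linear_scaleD [OF linear_word_act] scale_right_distrib mult.commute add.assoc add.left_commute)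
qed

lemma act_T_scale: "act (T_scale c x) w = scale c (act x w)"
proof (induction x rule: T_induct)
  case zero show ?case by (simp add: T_scale_def)
next
  case (add x ws d)
  have "T_scale c (Poly_Mapping.single ws d) = Poly_Mapping.single ws (c * d)"
    by (simp add: T_scale_def mult_single)
  then show ?case by (simp add: T.scale_right_distrib act_add add act_single scale_right_distrib)
qed

lemma act_mult: "act (x * y) w = act x (act y w)"
proof (induction x rule: T_induct)
  case zero show ?case by simp
next
  case (add x ws c)
  have "act (Poly_Mapping.single ws c * y) w = act (Poly_Mapping.single ws c) (act y w)"
  proof (induction y rule: T_induct)
    case zero show ?case by (simp add: act_single linear_zeroD [OF linear_word_act])
  next
    case (add y us d)
    show ?case
      by (simp add: distrib_left act_add add mult_single act_single linear_addD [OF linear_word_act]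
          linear_scaleD [OF linear_word_act] scale_right_distrib plus_list_def mult.commute)
  qed
  then show ?case by (simp add: distrib_right act_add add)
qed

lemma act_diff: "act (x - y) w = act x w - act y w"
  using act_add [of "x - y" y w] by simp

lemma act_T_gen: "act (T_gen a n) w = letter_act Y Ys (a, n) w"
  by (simp add: T_gen_def act_single)

end

section \<open>The quotient as a restricted module generated by its vacuum\<close>

lemma T_gen_single: "T_gen a n * Poly_Mapping.single ws c = Poly_Mapping.single ((a, n) # ws) c"
  by (simp add: T_gen_def mult_single plus_list_def)

lemma single_in_TT_plus:
  assumes "ws \<noteq> []" "sum_list (map snd ws) \<ge> 0"
  shows "Poly_Mapping.single ws c \<in> TT_plus"
proof -
  have "Poly_Mapping.single ws (1::complex) \<in> T_plus"
    unfolding T_plus_def by (rule T.span_base) (use assms in blast)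
  moreover have "Poly_Mapping.single ws c = Poly_Mapping.single 0 c * Poly_Mapping.single ws 1"
    by (simp add: mult_single)
  ultimately have "Poly_Mapping.single ws c \<in> {x * y | x y. y \<in> T_plus}" by blast
  then show ?thesis unfolding TT_plus_def by (rule T.span_base)
qed

text \<open>For large \<open>n\<close> the letter put in front of any of the finitely many words of
  \<open>x\<close> gives a word of nonnegative total mode.\<close>

lemma T_gen_truncated: "\<exists>N. \<forall>n\<ge>N. T_gen a n * x \<in> TT_plus"
proof (induction x rule: T_induct)
  case zero show ?case by (simp add: T.subspace_0 [OF subspace_TT_plus])
next
  case (add x ws c)
  then obtain N where N: "\<forall>n\<ge>N. T_gen a n * x \<in> TT_plus" by blast
  have "T_gen a n * Poly_Mapping.single ws c \<in> TT_plus" if "n \<ge> - sum_list (map snd ws)" for n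
    unfolding T_gen_single using that by (intro single_in_TT_plus) simp_all
  with N show ?case
    by (intro exI [of _ "max N (- sum_list (map snd ws))"])
      (simp add: distrib_left T.subspace_add [OF subspace_TT_plus])
qed

lemma trunc_VT_act: "trunc (\<lambda>n. VT_act (T_gen a n) u)"
proof (induction u rule: VT.abs_induct)
  case (1 x)
  obtain N where "\<forall>n\<ge>N. T_gen a n * x \<in> TT_plus" using T_gen_truncated by blast
  then show ?case unfolding trunc_def
    by (intro exI [of _ N]) (simp add: VT_act.abs_eq zero_VT_def VT.abs_eq_iff VT_eq_def)
qed

lemma field_VT: "field VT_scale VT_Y" "field VT_scale VT_Ys"
proof -
  have "Vector_Spaces.linear VT_scale VT_scale (VT_act x)" for x
    by (intro linearI VT.vector_space_axioms VT_act_add VT_act_scale)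
  then show "field VT_scale VT_Y" "field VT_scale VT_Ys"
    by (simp_all add: field_def VT_Y_def VT_Ys_def trunc_VT_act)
qed

interpretation VT: complex_vs VT_scale ..

interpretation VA: complex_vs VA_scale
proof
  show "VA_scale a (x + y) = VA_scale a x + VA_scale a y" for a x y
    by transfer (simp add: VA_eq_def VT.scale_right_distrib VT.subspace_0 [OF subspace_VT_relsub])
  show "VA_scale (a + b) x = VA_scale a x + VA_scale b x" for a b x
    by transfer (simp add: VA_eq_def VT.scale_left_distrib VT.subspace_0 [OF subspace_VT_relsub])
  show "VA_scale a (VA_scale b x) = VA_scale (a * b) x" for a b x
    by transfer (simp add: VA_eq_def VT.subspace_0 [OF subspace_VT_relsub])
  show "VA_scale 1 x = x" for x
    by transfer (simp add: VA_eq_def VT.subspace_0 [OF subspace_VT_relsub])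
qed

lemma linear_abs_VA: "Vector_Spaces.linear VT_scale VA_scale abs_VA"
  by (intro linearI VT.vector_space_axioms VA.vector_space_axioms)
    (simp_all add: plus_VA.abs_eq VA_scale.abs_eq)

lemma field_VA: "field VA_scale VA_Y" "field VA_scale VA_Ys"
proof -
  have lin: "Vector_Spaces.linear VA_scale VA_scale f"
    if "\<And>u. f (abs_VA u) = abs_VA (g u)" "Vector_Spaces.linear VT_scale VT_scale g" for f g
  proof (intro linearI VA.vector_space_axioms)
    show "f (x + y) = f x + f y" for x y
      by (induction x rule: VA.abs_induct, induction y rule: VA.abs_induct)
        (simp add: plus_VA.abs_eq that(1) linear_addD [OF that(2)])
    show "f (VA_scale c x) = VA_scale c (f x)" for c x
      by (induction x rule: VA.abs_induct) (simp add: VA_scale.abs_eq that(1) linear_scaleD [OF that(2)])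
  qed
  have tr: "trunc (\<lambda>n. f n w)" if "\<And>n u. f n (abs_VA u) = abs_VA (g n u)" "\<And>u. trunc (\<lambda>n. g n u)" for f g w
  proof (induction w rule: VA.abs_induct)
    case (1 u)
    show ?case using that(2) [of u] linear_zeroD [OF linear_abs_VA] unfolding trunc_def
      by (metis that(1))
  qed
  show "field VA_scale VA_Y" "field VA_scale VA_Ys"
    unfolding field_def
    using lin [OF VA_Y.abs_eq field_linear [OF field_VT(1)]] tr [of VA_Y VT_Y, OF VA_Y.abs_eq field_trunc [OF field_VT(1)]]
      lin [OF VA_Ys.abs_eq field_linear [OF field_VT(2)]] tr [of VA_Ys VT_Ys, OF VA_Ys.abs_eq field_trunc [OF field_VT(2)]]
    by blast+
qed

lemma relators_in_VT_relsub: "r \<in> VT_relators \<Longrightarrow> r \<in> VT_relsub"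
proof -
  assume r: "r \<in> VT_relators"
  have "VT_act 1 r = r" by (induction r rule: VT.abs_induct) (simp add: VT_act.abs_eq)
  with r have "r \<in> {VT_act x r | x r. r \<in> VT_relators}" by (metis (mono_tags, lifting) mem_Collect_eq)
  then show ?thesis unfolding VT_relsub_def by (rule VT.span_base)
qed

lemma abs_VA_relator: "r \<in> VT_relators \<Longrightarrow> abs_VA r = 0"
  by (simp add: zero_VA_def VA.abs_eq_iff VA_eq_def relators_in_VT_relsub)

interpretation VA: restricted_A_module VA_scale VA_Y VA_Ys
proof (intro restricted_A_module.intro A_module.intro A_module_axioms.intro
    restricted_A_module_axioms.intro VA.vector_space_axioms)
  have st: "same_term VA_scale A m n (abs_VA u) = (\<lambda>p. abs_VA (same_term VT_scale B m n u p))"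
    if "\<And>n u. A n (abs_VA u) = abs_VA (B n u)" for A B m n u
    by (intro ext) (simp add: same_term_def that linear_scaleD [OF linear_abs_VA] split: prod.splits)
  have mt: "mixed_term VA_scale VA_Y VA_Ys m n (abs_VA u) = (\<lambda>p. abs_VA (mixed_term VT_scale VT_Y VT_Ys m n u p))"
    for m n u
    by (intro ext) (simp add: mixed_term_def VA_Y.abs_eq VA_Ys.abs_eq linear_scaleD [OF linear_abs_VA] split: prod.splits)
  show "same_rel VA_scale VA_Y m n w = 0" for m n w
  proof (induction w rule: VA.abs_induct)
    case (1 u)
    have "same_rel VA_scale VA_Y m n (abs_VA u) = abs_VA (same_rel VT_scale VT_Y m n u)"
      unfolding same_rel_def st [of VA_Y VT_Y, OF VA_Y.abs_eq] linear_addD [OF linear_abs_VA] VA_Y.abs_eq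
        linear_Sum_any [OF linear_abs_VA VT.same_term_exps2(2) [OF field_VT(1)]] ..
    moreover have "same_rel VT_scale VT_Y m n u \<in> VT_relators" unfolding VT_relators_def by blast
    ultimately show ?case by (simp add: abs_VA_relator)
  qed
  show "same_rel VA_scale VA_Ys m n w = 0" for m n w
  proof (induction w rule: VA.abs_induct)
    case (1 u)
    have "same_rel VA_scale VA_Ys m n (abs_VA u) = abs_VA (same_rel VT_scale VT_Ys m n u)"
      unfolding same_rel_def st [of VA_Ys VT_Ys, OF VA_Ys.abs_eq] linear_addD [OF linear_abs_VA] VA_Ys.abs_eq
        linear_Sum_any [OF linear_abs_VA VT.same_term_exps2(2) [OF field_VT(2)]] ..
    moreover have "same_rel VT_scale VT_Ys m n u \<in> VT_relators" unfolding VT_relators_def by blast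
    ultimately show ?case by (simp add: abs_VA_relator)
  qed
  show "mixed_rel VA_scale VA_Y VA_Ys m n w = 0" for m n w
  proof (induction w rule: VA.abs_induct)
    case (1 u)
    have "mixed_rel VA_scale VA_Y VA_Ys m n (abs_VA u) = abs_VA (mixed_rel VT_scale VT_Y VT_Ys m n u)"
      unfolding mixed_rel_def mt linear_addD [OF linear_abs_VA] linear_diffD [OF linear_abs_VA] VA_Y.abs_eq
        VA_Ys.abs_eq linear_Sum_any [OF linear_abs_VA VT.mixed_term_exps2(2) [OF field_VT]]
      by (simp add: linear_zeroD [OF linear_abs_VA])
    moreover have "mixed_rel VT_scale VT_Y VT_Ys m n u \<in> VT_relators" unfolding VT_relators_def by blast
    ultimately show ?case by (simp add: abs_VA_relator)
  qed
  show "\<exists>N. \<forall>n\<ge>N. VA_Y n w = 0 \<and> VA_Ys n w = 0" for w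
    using field_trunc [OF field_VA(1), of w] field_trunc [OF field_VA(2), of w]
    unfolding trunc_def by (metis order.trans linorder_linear)
qed (rule field_linear [OF field_VA(1)] field_linear [OF field_VA(2)]
    VA.same_term_exps2(2) [OF field_VA(1)] VA.same_term_exps2(2) [OF field_VA(2)]
    VA.mixed_term_exps2(2) [OF field_VA])+

lemma VA_word: "word_act VA_Y VA_Ys ws VA_one = abs_VA (abs_VT (Poly_Mapping.single ws 1))"
proof (induction ws)
  case Nil
  have "VA_one = abs_VA (abs_VT 1)" by (simp add: VA_one_def VT_one_def)
  then show ?case by (metis VA.word_act_Nil single_one zero_list_def)
next
  case (Cons p ws)
  obtain a n where p: "p = (a, n)" by (cases p)
  show ?case
    by (cases a) (simp_all add: p Cons VA_Y.abs_eq VA_Ys.abs_eq VT_Y_def VT_Ys_def VT_act.abs_eq T_gen_single)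
qed

lemma VA_generated: "VA.span {word_act VA_Y VA_Ys ws VA_one | ws. True} = UNIV"
proof -
  let ?S = "{word_act VA_Y VA_Ys ws VA_one | ws. True}"
  have "abs_VA (abs_VT x) \<in> VA.span ?S" for x
  proof (induction x rule: T_induct)
    case zero
    have "abs_VA (abs_VT 0) = 0" by (simp only: zero_VA_def zero_VT_def)
    then show ?case by (simp only: VA.span_zero)
  next
    case (add x ws c)
    have 1: "abs_VA (abs_VT (x + Poly_Mapping.single ws c))
        = abs_VA (abs_VT x) + VA_scale c (word_act VA_Y VA_Ys ws VA_one)"
      by (simp add: VA_word VA_scale.abs_eq VT_scale.abs_eq T_scale_def mult_single
          plus_VA.abs_eq plus_VT.abs_eq)
    have "word_act VA_Y VA_Ys ws VA_one \<in> VA.span ?S"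
      by (rule VA.span_base) blast
    then show ?case unfolding 1 by (intro VA.span_add VA.span_scale add)
  qed
  then have "u \<in> VA.span ?S" for u
    by (induction u rule: VA.abs_induct, rename_tac y, induct_tac y rule: VT.abs_induct) simp
  then show ?thesis by (rule UNIV_eq_I [symmetric])
qed

lemma VA_one_vacuum: "n \<ge> 0 \<Longrightarrow> letter_act VA_Y VA_Ys (a, n) VA_one = 0"
proof -
  assume n: "n \<ge> 0"
  have "letter_act VA_Y VA_Ys (a, n) VA_one = abs_VA (abs_VT (Poly_Mapping.single [(a, n)] 1))"
    using VA_word [of "[(a, n)]"] by simp
  moreover have "abs_VT (Poly_Mapping.single [(a, n)] 1) = 0"
    using single_in_TT_plus [of "[(a, n)]"] n by (simp add: zero_VT_def VT.abs_eq_iff VT_eq_def)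
  ultimately show ?thesis by (simp add: linear_zeroD [OF linear_abs_VA])
qed

lemma VA_induct [consumes 0, case_names add scale one Y Ys]:
  assumes "\<And>u v. P u \<Longrightarrow> P v \<Longrightarrow> P (u + v)" "\<And>c u. P u \<Longrightarrow> P (VA_scale c u)" "P VA_one"
    "\<And>n u. P u \<Longrightarrow> P (VA_Y n u)" "\<And>n u. P u \<Longrightarrow> P (VA_Ys n u)"
  shows "P u"
proof -
  have w: "P (word_act VA_Y VA_Ys ws VA_one)" for ws
  proof (induction ws)
    case (Cons p ws)
    then show ?case by (cases p; cases "fst p") (auto intro: assms)
  qed (simp add: assms)
  have "u \<in> VA.span {word_act VA_Y VA_Ys ws VA_one | ws. True}"
    unfolding VA_generated by (rule UNIV_I)
  then show ?thesis
  proof (induction rule: VA.span_induct_alt)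
    case base then show ?case using assms(2) [OF w, of 0] by simp
  next
    case (step c x y) then show ?case using w assms(1,2) by blast
  qed
qed

text \<open>The map sending \<open>x\<close> to \<open>act x v\<close> kills \<open>T_plus\<close>
  and hence the left ideal, so it descends to \<open>VT\<close>; it kills the relators because the
  relations hold in the target, so it descends again. Only a vacuum-like \<open>v\<close> is asked
  for, so that the Fock space can serve as a target as well as any vacuum module.\<close>

lemma (in A_module) VA_hom:
  assumes vac: "\<And>a n. n \<ge> 0 \<Longrightarrow> letter_act Y Ys (a, n) v = 0"
  shows "\<exists>f. A_module_hom VA_scale VA_Y VA_Ys scale Y Ys f \<and> f VA_one = v"
proof -
  have Tp: "act y v = 0" if "y \<in> T_plus" for y
    using that unfolding T_plus_def
  proof (induction rule: T.span_induct_alt)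
    case (step c x y)
    from step(1) obtain ws where ws: "x = Poly_Mapping.single ws 1" "ws \<noteq> []" "sum_list (map snd ws) \<ge> 0"
      by auto
    have "word_act Y Ys ws v = 0" by (rule word_act_vacuum [OF vac ws(2,3)])
    then show ?case using step by (simp add: ws act_add act_T_scale act_single)
  qed simp
  have TT: "act y v = 0" if "y \<in> TT_plus" for y
    using that unfolding TT_plus_def
  proof (induction rule: T.span_induct_alt)
    case (step c x y)
    from step(1) obtain x' y' where "x = x' * y'" "y' \<in> T_plus" by auto
    then show ?case using step by (simp add: act_add act_T_scale act_mult linear_zeroD [OF linear_act] Tp)
  qed simp
  define f0 where "f0 u = act (rep_VT u) v" for u
  have f0: "f0 (abs_VT x) = act x v" for x
  proof -
    have "VT_eq (rep_VT (abs_VT x)) x"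
      using Quotient3_rep_abs [OF Quotient3_VT, of x] by (simp add: VT_eq_refl)
    then show ?thesis using TT act_diff unfolding f0_def VT_eq_def by fastforce
  qed
  have lin0: "Vector_Spaces.linear VT_scale scale f0"
  proof (intro linearI vector_space_axioms VT.vector_space_axioms)
    show "f0 (x + y) = f0 x + f0 y" for x y
      by (induction x rule: VT.abs_induct, induction y rule: VT.abs_induct)
        (simp add: plus_VT.abs_eq f0 act_add)
    show "f0 (VT_scale c x) = scale c (f0 x)" for c x
      by (induction x rule: VT.abs_induct) (simp add: VT_scale.abs_eq f0 act_T_scale)
  qed
  have f0_act: "f0 (VT_act x u) = act x (f0 u)" for x u
    by (induction u rule: VT.abs_induct) (simp add: VT_act.abs_eq f0 act_mult)
  have f0_Y: "f0 (VT_Y n u) = Y n (f0 u)" "f0 (VT_Ys n u) = Ys n (f0 u)" for n u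
    by (simp_all add: VT_Y_def VT_Ys_def f0_act act_T_gen)
  have st: "same_term scale A m n (f0 u) = (\<lambda>p. f0 (same_term VT_scale B m n u p))"
    if "\<And>n u. f0 (B n u) = A n (f0 u)" for A B m n u
    by (intro ext) (simp add: same_term_def that linear_scaleD [OF lin0] split: prod.splits)
  have mt: "mixed_term scale Y Ys m n (f0 u) = (\<lambda>p. f0 (mixed_term VT_scale VT_Y VT_Ys m n u p))"
    for m n u
    by (intro ext) (simp add: mixed_term_def f0_Y linear_scaleD [OF lin0] split: prod.splits)
  have rel: "f0 r = 0" if "r \<in> VT_relators" for r
  proof -
    have 1: "f0 (same_rel VT_scale VT_Y m n u) = same_rel scale Y m n (f0 u)" for m n u
      unfolding same_rel_def linear_addD [OF lin0] f0_Y
        linear_Sum_any [OF lin0 VT.same_term_exps2(2) [OF field_VT(1)]] st [of VT_Y Y, OF f0_Y(1)] ..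
    have 2: "f0 (same_rel VT_scale VT_Ys m n u) = same_rel scale Ys m n (f0 u)" for m n u
      unfolding same_rel_def linear_addD [OF lin0] f0_Y
        linear_Sum_any [OF lin0 VT.same_term_exps2(2) [OF field_VT(2)]] st [of VT_Ys Ys, OF f0_Y(2)] ..
    have 3: "f0 (mixed_rel VT_scale VT_Y VT_Ys m n u) = mixed_rel scale Y Ys m n (f0 u)" for m n u
      unfolding mixed_rel_def linear_addD [OF lin0] linear_diffD [OF lin0] f0_Y
        linear_Sum_any [OF lin0 VT.mixed_term_exps2(2) [OF field_VT]] mt
      by (simp add: linear_zeroD [OF lin0])
    show ?thesis using that unfolding VT_relators_def
      by (auto simp: 1 2 3 rel_YY rel_YsYs rel_YYs)
  qed
  have relsub: "f0 r = 0" if "r \<in> VT_relsub" for r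
    using that unfolding VT_relsub_def
  proof (induction rule: VT.span_induct_alt)
    case (step c x y)
    from step(1) obtain x' r where "x = VT_act x' r" "r \<in> VT_relators" by auto
    then show ?case using step
      by (simp add: linear_addD [OF lin0] linear_scaleD [OF lin0] f0_act linear_zeroD [OF linear_act] rel)
  qed (simp add: linear_zeroD [OF lin0])
  define f where "f u = f0 (rep_VA u)" for u
  have f: "f (abs_VA x) = f0 x" for x
  proof -
    have "VA_eq (rep_VA (abs_VA x)) x"
      using Quotient3_rep_abs [OF Quotient3_VA, of x]
      by (simp add: VA_eq_def VT.subspace_0 [OF subspace_VT_relsub])
    then show ?thesis using relsub linear_diffD [OF lin0] unfolding f_def VA_eq_def by fastforce
  qed
  have "A_module_hom VA_scale VA_Y VA_Ys scale Y Ys f"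
    unfolding A_module_hom_def
  proof (intro conjI allI linearI vector_space_axioms VA.vector_space_axioms)
    show "f (x + y) = f x + f y" for x y
      by (induction x rule: VA.abs_induct, induction y rule: VA.abs_induct)
        (simp add: plus_VA.abs_eq f linear_addD [OF lin0])
    show "f (VA_scale c x) = scale c (f x)" for c x
      by (induction x rule: VA.abs_induct) (simp add: VA_scale.abs_eq f linear_scaleD [OF lin0])
    show "f (VA_Y n w) = Y n (f w)" for n w
      by (induction w rule: VA.abs_induct) (simp add: VA_Y.abs_eq f f0_Y)
    show "f (VA_Ys n w) = Ys n (f w)" for n w
      by (induction w rule: VA.abs_induct) (simp add: VA_Ys.abs_eq f f0_Y)
  qed
  moreover have "f VA_one = v"
  proof -
    have "VA_one = abs_VA (abs_VT (Poly_Mapping.single [] 1))" using VA_word [of "[]"] by simp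
    then have "f VA_one = f (abs_VA (abs_VT (Poly_Mapping.single [] 1)))" by (rule arg_cong)
    also have "\<dots> = act (Poly_Mapping.single [] 1) v" unfolding f by (rule f0)
    finally show ?thesis by (simp only: act_single word_act_Nil scale_one)
  qed
  ultimately show ?thesis by blast
qed

lemma VA_hom_unique:
  assumes "A_module_hom VA_scale VA_Y VA_Ys s Y Ys f" "A_module_hom VA_scale VA_Y VA_Ys s Y Ys g"
    "f VA_one = g VA_one"
  shows "f = g"
proof
  fix u
  have lin: "Vector_Spaces.linear VA_scale s f" "Vector_Spaces.linear VA_scale s g"
    using assms by (auto simp: A_module_hom_def)
  show "f u = g u"
    by (induction u rule: VA_induct)
      (use assms in \<open>auto simp: A_module_hom_def linear_addD [OF lin(1)] linear_addD [OF lin(2)]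
        linear_scaleD [OF lin(1)] linear_scaleD [OF lin(2)]\<close>)
qed

section \<open>Deformed Clifford relations, twists and loop spaces\<close>

fun charge :: "letter \<Rightarrow> int" where
  "charge Yl = 1"
| "charge Ysl = -1"

lemma charge_neq: "a \<noteq> b \<Longrightarrow> charge b = - charge a"
  by (cases a; cases b) auto

lemma charge_square [simp]: "charge a * charge a = 1"
  by (cases a) auto

text \<open>
  The relations \<open>a(z) b(w) + e^(l p (w - z)) b(w) a(z) = [a \<noteq> b] w^(-1) \<delta>(z/w)\<close> with \<open>p\<close> the product of the charges:
  \<open>l = 1\<close> is the algebra of the theorem, \<open>l = 0\<close> the Clifford algebra.
\<close>

locale deformed_ops = complex_vs scale
  for scale :: "complex \<Rightarrow> 'w::ab_group_add \<Rightarrow> 'w" +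
  fixes l :: complex and A :: "letter \<Rightarrow> int \<Rightarrow> 'w \<Rightarrow> 'w"
  assumes field_A: "field scale (A a)"
    and rel_A: "A a m (A b n w) + exps2 scale (- l * of_int (charge a * charge b)) (l * of_int (charge a * charge b))
        (\<lambda>m n. A b n (A a m w)) m n = (if a \<noteq> b \<and> m + n + 1 = 0 then w else 0)"
begin

lemmas linear_A = field_linear [OF field_A]
lemmas trunc_A = field_trunc [OF field_A]
lemmas A_add = linear_addD [OF linear_A]
lemmas A_scale = linear_scaleD [OF linear_A]
lemmas A_0 [simp] = linear_zeroD [OF linear_A]

lemma trunc2_AA: "trunc2 (\<lambda>m n. A a m (A b n w))"
  by (rule trunc2_comp [OF field_A trunc_A])

lemma trunc2_AA': "trunc2 (\<lambda>m n. A b n (A a m w))"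
  by (rule trunc2_flip [OF trunc2_AA])

end

context complex_vs
begin

lemma exps_shift: "exps scale c (\<lambda>m. f (m + a)) m = exps scale c f (m + a)"
  by (simp add: exps_def algebra_simps)

text \<open>The delta function depends on \<open>m + n\<close> only, so e^(c x1 + d x2) acts on it
  as e^((c + d) x) does on a series in one variable.\<close>

lemma exps2_delta:
  assumes "c + d = 0"
  shows "exps2 scale c d (\<lambda>m n. if m + n + 1 = 0 then w else 0) m n = (if m + n + 1 = 0 then w else 0)"
proof -
  define g where "g t = (if t + 1 = 0 then w else 0)" for t :: int
  have tr: "trunc g" unfolding trunc_def g_def by (rule exI [of _ 0]) auto
  have "exps2 scale c d (\<lambda>m n. g (m + n)) m n = exps scale c (\<lambda>m. exps scale d g (m + n)) m"
    using exps_shift [of d g] by (simp add: exps2_def add.commute)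
  also have "\<dots> = g (m + n)"
    by (simp add: exps_shift exps_exps [OF tr] assms)
  finally show ?thesis by (simp add: g_def)
qed

lemma field_zero: "field scale \<phi> \<Longrightarrow> \<phi> n 0 = 0"
  by (rule linear_zeroD [OF field_linear])

lemma linear_exps_family:
  assumes "field scale \<phi>"
  shows "Vector_Spaces.linear scale scale (\<lambda>x. exps scale c (\<lambda>m. \<phi> m x) n)"
  by (intro linearI vector_space_axioms)
    (simp_all add: linear_addD [OF field_linear [OF assms]] linear_scaleD [OF field_linear [OF assms]]
      exps_add exps_scale field_trunc [OF assms])

lemma field_exps:
  assumes "field scale \<phi>"
  shows "field scale (\<lambda>n x. exps scale c (\<lambda>m. \<phi> m x) n)"
  unfolding field_def
  using linear_exps_family [OF assms] trunc_exps [OF field_trunc [OF assms]] by auto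

end

context deformed_ops
begin

text \<open>The relation multiplied by e^(c z + d w). The delta function absorbs the exponential
  where it occurs, that is for \<open>a \<noteq> b\<close>; all changes of \<open>l\<close> come
  from comparing such factors on the two orders.\<close>

lemma twisted_rel:
  assumes "a \<noteq> b \<Longrightarrow> c + d = 0"
  defines "p \<equiv> l * of_int (charge a * charge b)"
  shows "exps2 scale c d (\<lambda>m n. A a m (A b n w)) m n
      + exps2 scale (c - p) (d + p) (\<lambda>m n. A b n (A a m w)) m n
    = (if a \<noteq> b \<and> m + n + 1 = 0 then w else 0)"
proof -
  let ?P = "\<lambda>m n. A a m (A b n w)" and ?B = "\<lambda>m n. A b n (A a m w)"
  have "exps2 scale c d ?P m n + exps2 scale (c - p) (d + p) ?B m n
      = exps2 scale c d ?P m n + exps2 scale c d (exps2 scale (- p) p ?B) m n"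
    by (simp add: exps2_exps2 [OF trunc2_AA'])
  also have "\<dots> = exps2 scale c d (\<lambda>m n. ?P m n + exps2 scale (- p) p ?B m n) m n"
    by (rule exps2_add [symmetric]) (intro trunc2_AA trunc2_exps2 trunc2_AA')+
  also have "(\<lambda>m n. ?P m n + exps2 scale (- p) p ?B m n)
      = (\<lambda>m n. if a \<noteq> b \<and> m + n + 1 = 0 then w else 0)"
    using rel_A [of a _ b] by (simp add: p_def)
  also have "exps2 scale c d (\<lambda>m n. if a \<noteq> b \<and> m + n + 1 = 0 then w else 0) m n
      = (if a \<noteq> b \<and> m + n + 1 = 0 then w else 0)"
    using exps2_delta [of c d w m n] assms(1) exps2_vanish [of m n "\<lambda>_ _. 0"] by (cases "a = b") auto
  finally show ?thesis .
qed

text \<open>Multiplying a(x) by e^(s p x) leaves the exchange factors alone, since both orders get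
  the same exponential, and the delta function too, since it pairs opposite charges.\<close>

lemma spectral_flow:
  "deformed_ops scale l (\<lambda>a m w. exps scale (s * of_int (charge a)) (\<lambda>m. A a m w) m)"
proof (unfold_locales)
  show "field scale (\<lambda>m w. exps scale (s * of_int (charge a)) (\<lambda>m. A a m w) m)" for a
    by (rule field_exps [OF field_A])
  fix a b m n w
  let ?c = "s * of_int (charge a)" and ?d = "s * of_int (charge b)"
  let ?p = "l * of_int (charge a * charge b)"
  have 1: "exps scale ?c (\<lambda>m. A a m (exps scale ?d (\<lambda>n. A b n w) n)) m
      = exps2 scale ?c ?d (\<lambda>m n. A a m (A b n w)) m n" for m n
    by (simp add: exps2_def linear_exps [OF linear_A trunc_A])
  have 2: "exps scale ?d (\<lambda>n. A b n (exps scale ?c (\<lambda>m. A a m w) m)) n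
      = exps2 scale ?c ?d (\<lambda>m n. A b n (A a m w)) m n" for m n
    by (simp add: linear_exps [OF linear_A trunc_A] exps2_swap [OF trunc2_AA'])
  have "a \<noteq> b \<Longrightarrow> ?c + ?d = 0" using charge_neq [of a b] by simp
  from twisted_rel [where w = w and m = m and n = n, OF this]
  show "exps scale ?c (\<lambda>m. A a m (exps scale ?d (\<lambda>n. A b n w) n)) m
      + exps2 scale (- l * of_int (charge a * charge b)) ?p
        (\<lambda>m n. exps scale ?d (\<lambda>n. A b n (exps scale ?c (\<lambda>m. A a m w) m)) n) m n
      = (if a \<noteq> b \<and> m + n + 1 = 0 then w else 0)"
    by (simp add: 1 2 exps2_exps2 [OF trunc2_AA'] add.commute)
qed

end

section \<open>Gradings and the twist by the charge\<close>

locale graded = complex_vs scale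
  for scale :: "complex \<Rightarrow> 'w::ab_group_add \<Rightarrow> 'w" +
  fixes pr :: "int \<Rightarrow> 'w \<Rightarrow> 'w"
  assumes linear_pr: "Vector_Spaces.linear scale scale (pr n)"
    and pr_pr: "pr m (pr n x) = (if m = n then pr n x else 0)"
    and finite_pr: "finite {n. pr n x \<noteq> 0}"
    and Sum_any_pr: "Sum_any (\<lambda>n. pr n x) = x"
begin

lemmas pr_0 [simp] = linear_zeroD [OF linear_pr]

lemma homogeneous_induct:
  assumes "\<And>n x. pr n x = x \<Longrightarrow> P x" "\<And>x y. P x \<Longrightarrow> P y \<Longrightarrow> P (x + y)"
  shows "P x"
proof -
  have "P (\<Sum>n\<in>S. pr n x)" if "finite S" for S
    using that
  proof (induction S rule: finite_induct)
    case empty then show ?case using assms(1) [of 0 0] by simp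
  next
    case (insert n S)
    then show ?case using assms(1) [of n "pr n x"] by (simp add: assms(2) pr_pr)
  qed
  from this [OF finite_pr [of x]] show ?thesis
    using Sum_any_pr [of x] by (simp add: Sum_any.expand_set)
qed

lemma pr_homogeneous: "pr n x = x \<Longrightarrow> pr m x = (if m = n then x else 0)"
  using pr_pr [of m n x] by simp

lemma Sum_any_homogeneous:
  assumes "pr n x = x" "\<And>m. f m 0 = (0::'v::comm_monoid_add)"
  shows "Sum_any (\<lambda>m. f m (pr m x)) = f n x"
proof -
  have "Sum_any (\<lambda>m. f m (pr m x)) = (\<Sum>m\<in>{n}. f m (pr m x))"
    by (rule Sum_any.expand_superset) (auto simp: pr_homogeneous [OF assms(1)] assms(2) split: if_splits)
  then show ?thesis by (simp add: assms(1))
qed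

lemma Sum_any_pr_add:
  assumes "\<And>m x y. f m (x + y) = f m x + f m y"
  shows "Sum_any (\<lambda>m. f m (pr m (x + y)) :: 'v::ab_group_add)
    = Sum_any (\<lambda>m. f m (pr m x)) + Sum_any (\<lambda>m. f m (pr m y))"
proof -
  have f0: "f m 0 = 0" for m using assms [of m 0 0] by simp
  have "finite {m. f m (pr m x) \<noteq> 0}" for x
    by (rule finite_subset [OF _ finite_pr [of x]]) (auto simp: f0)
  then show ?thesis by (simp add: linear_addD [OF linear_pr] assms Sum_any.distrib)
qed

end

locale graded_deformed_ops = deformed_ops scale l A + graded scale pr
  for scale :: "complex \<Rightarrow> 'w::ab_group_add \<Rightarrow> 'w" and l A pr +
  assumes pr_A: "pr (n + charge a) (A a m x) = A a m (pr n x)"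
begin

text \<open>The operators \<open>a(x) e^(s (p N + 1/2) x)\<close>, where \<open>p\<close> is the charge of \<open>a\<close> and \<open>N\<close> the grading operator.\<close>

definition twist :: "complex \<Rightarrow> letter \<Rightarrow> int \<Rightarrow> 'w \<Rightarrow> 'w" where
  "twist s a m x = Sum_any (\<lambda>n. exps scale (s * (of_int (charge a * n) + 1/2)) (\<lambda>m. A a m (pr n x)) m)"

lemma twist_homogeneous:
  assumes "pr n x = x"
  shows "twist s a m x = exps scale (s * (of_int (charge a * n) + 1/2)) (\<lambda>m. A a m x) m"
  unfolding twist_def
  by (rule Sum_any_homogeneous [where f = "\<lambda>n x. exps scale (s * (of_int (charge a * n) + 1/2)) (\<lambda>m. A a m x) m", OF assms]) simp

lemma twist_add: "twist s a m (x + y) = twist s a m x + twist s a m y"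
  unfolding twist_def
  by (rule Sum_any_pr_add [where f = "\<lambda>n x. exps scale (s * (of_int (charge a * n) + 1/2)) (\<lambda>m. A a m x) m"])
    (rule linear_addD [OF linear_exps_family [OF field_A]])

lemma pr_A_homogeneous: "pr n x = x \<Longrightarrow> pr (n + charge a) (A a m x) = A a m x"
  by (simp add: pr_A)

lemma pr_twist: assumes "pr n x = x" shows "pr (n + charge a) (twist s a m x) = twist s a m x"
  unfolding twist_homogeneous [OF assms]
  by (simp add: linear_exps [OF linear_pr trunc_A] pr_A assms)

lemma field_twist: "field scale (twist s a)"
  unfolding field_def
proof (intro conjI allI)
  fix m
  show "Vector_Spaces.linear scale scale (twist s a m)"
  proof (intro linearI vector_space_axioms twist_add)
    show "twist s a m (scale c x) = scale c (twist s a m x)" for c x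
    proof (induction x rule: homogeneous_induct)
      case (1 n x)
      then have "pr n (scale c x) = scale c x" by (simp add: linear_scaleD [OF linear_pr])
      then show ?case
        by (simp add: twist_homogeneous [of n] 1 linear_scaleD [OF linear_exps_family [OF field_A]])
    qed (simp add: scale_right_distrib twist_add)
  qed
next
  fix x
  show "trunc (\<lambda>n. twist s a n x)"
  proof (induction x rule: homogeneous_induct)
    case (1 n x)
    then show ?case by (simp add: twist_homogeneous trunc_exps trunc_A)
  next
    case (2 x y)
    then obtain N M where "\<forall>n\<ge>N. twist s a n x = 0" "\<forall>n\<ge>M. twist s a n y = 0"
      by (auto simp: trunc_def)
    then show ?case unfolding trunc_def by (intro exI [of _ "max N M"]) (simp add: twist_add)
  qed
qed

text \<open>In either order the operator acting second sees the degree raised by the charge of the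
  first. This changes the exponents of the two orders relative to each other by \<open>s\<close>
  times the product of the charges, which lowers \<open>l\<close> by \<open>s\<close>.\<close>

lemma deformed_twist: "deformed_ops scale (l - s) (twist s)"
proof (unfold_locales)
  show "field scale (twist s a)" for a by (rule field_twist)
  fix a b m k x
  let ?p = "charge a * charge b"
  let ?q = "(l - s) * of_int ?p"
  have tr: "trunc2 (\<lambda>m k. twist s b k (twist s a m x))" for x
    by (rule trunc2_flip [OF trunc2_comp [OF field_twist field_trunc [OF field_twist]]])
  show "twist s a m (twist s b k x) + exps2 scale (- (l - s) * of_int ?p) ?q
      (\<lambda>m k. twist s b k (twist s a m x)) m k = (if a \<noteq> b \<and> m + k + 1 = 0 then x else 0)"
  proof (induction x rule: homogeneous_induct)
    case (1 n x)
    define c where "c = s * (of_int (charge a * (n + charge b)) + 1/2)"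
    define d where "d = s * (of_int (charge b * n) + 1/2)"
    define c' where "c' = s * (of_int (charge a * n) + 1/2)"
    define d' where "d' = s * (of_int (charge b * (n + charge a)) + 1/2)"
    have 1: "twist s a m (twist s b k x) = exps2 scale c d (\<lambda>m k. A a m (A b k x)) m k" for m k
      using twist_homogeneous [OF pr_twist [OF \<open>pr n x = x\<close>], of s a m s b k]
      unfolding twist_homogeneous [OF \<open>pr n x = x\<close>]
      by (simp add: exps2_def linear_exps [OF linear_A trunc_A] c_def d_def)
    have 2: "twist s b k (twist s a m x) = exps2 scale c' d' (\<lambda>m k. A b k (A a m x)) m k" for m k
      using twist_homogeneous [OF pr_twist [OF \<open>pr n x = x\<close>], of s b k s a m]
      unfolding twist_homogeneous [OF \<open>pr n x = x\<close>]
      by (simp add: linear_exps [OF linear_A trunc_A] exps2_swap [OF trunc2_AA'] c'_def d'_def)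
    \<comment> \<open>The origin of 1/2: for different letters the degree cancels, and the exponents
      add up to \<open>s\<close> times one plus the product of the charges, which is -1.\<close>
    have ne: "a \<noteq> b \<Longrightarrow> c + d = 0"
      using charge_neq [of a b] arg_cong [OF charge_square [of a], of "of_int :: int \<Rightarrow> complex"]
      by (simp add: c_def d_def algebra_simps)
    have e1: "- (l - s) * of_int ?p + c' = c - l * of_int ?p"
      by (simp add: c_def c'_def algebra_simps)
    have e2: "?q + d' = d + l * of_int ?p"
      by (simp add: d_def d'_def algebra_simps)
    show ?case
      unfolding 1 2 exps2_exps2 [OF trunc2_AA'] e1 e2
      by (rule twisted_rel [OF ne])
  next
    case (2 x y)
    from arg_cong2 [OF 2, of "(+)"] show ?case
      by (simp add: twist_add exps2_add [OF tr tr] ac_simps split: if_splits)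
  qed
qed

end

text \<open>The defining relations cover three of the four pairs of letters. The fourth, Ys before
  Y, is the mixed relation multiplied by the inverse exponential, under which the delta function is
  invariant.\<close>

lemma restricted_A_module_deformed:
  assumes "restricted_A_module s Y Ys"
  shows "deformed_ops s 1 (\<lambda>a. case a of Yl \<Rightarrow> Y | Ysl \<Rightarrow> Ys)"
proof -
  interpret restricted_A_module s Y Ys by fact
  have fY: "field s Y" "field s Ys"
    unfolding field_def trunc_def using linear_Y linear_Ys restricted by blast+
  have YsY: "Ys m (Y n w) + exps2 s 1 (-1) (\<lambda>m n. Y n (Ys m w)) m n = (if m + n + 1 = 0 then w else 0)"
    for m n w
  proof -
    let ?H = "\<lambda>m n. Ys m (Y n w)" and ?B = "\<lambda>m n. Y n (Ys m w)"
    have tH: "trunc2 ?H" by (rule trunc2_comp [OF fY(2) field_trunc [OF fY(1)]])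
    have tB: "trunc2 ?B" by (rule trunc2_flip [OF trunc2_comp [OF fY(1) field_trunc [OF fY(2)]]])
    have "?B m n + exps2 s (-1) 1 ?H m n = (if m + n + 1 = 0 then w else 0)" for m n
      using rel_YYs [of n m w] exps2_flip [OF tH, of 1 "-1" n m]
      by (simp add: mixed_rel_def mixed_term_exps2 [OF fY] add.commute split: if_splits)
    then have "exps2 s 1 (-1) (\<lambda>m n. ?B m n + exps2 s (-1) 1 ?H m n) m n = (if m + n + 1 = 0 then w else 0)"
      using exps2_delta [of 1 "-1" w m n] by simp
    then show ?thesis
      by (simp add: exps2_add [OF tB trunc2_exps2 [OF tH]] exps2_exps2 [OF tH] add.commute)
  qed
  show ?thesis
  proof (unfold_locales)
    show "field s (case a of Yl \<Rightarrow> Y | Ysl \<Rightarrow> Ys)" for a by (cases a) (simp_all add: fY)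
    fix a b m n w
    show "(case a of Yl \<Rightarrow> Y | Ysl \<Rightarrow> Ys) m ((case b of Yl \<Rightarrow> Y | Ysl \<Rightarrow> Ys) n w)
      + exps2 s (- 1 * of_int (charge a * charge b)) (1 * of_int (charge a * charge b))
        (\<lambda>m n. (case b of Yl \<Rightarrow> Y | Ysl \<Rightarrow> Ys) n ((case a of Yl \<Rightarrow> Y | Ysl \<Rightarrow> Ys) m w)) m n
      = (if a \<noteq> b \<and> m + n + 1 = 0 then w else 0)"
      using rel_YY [of m n w] rel_YsYs [of m n w] rel_YYs [of m n w] YsY [of m n w]
      by (cases a; cases b)
        (simp_all add: same_rel_def mixed_rel_def same_term_exps2 fY mixed_term_exps2 [OF fY] algebra_simps split: if_splits)
  qed
qed

lemma (in deformed_ops) A_module_if_1: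
  assumes "l = 1"
  shows "restricted_A_module scale (A Yl) (A Ysl)"
proof (intro restricted_A_module.intro A_module.intro A_module_axioms.intro
    restricted_A_module_axioms.intro vector_space_axioms)
  show "same_rel scale (A Yl) m n w = 0" for m n w
    using rel_A [of Yl m Yl n w] by (simp add: same_rel_def same_term_exps2 field_A assms)
  show "same_rel scale (A Ysl) m n w = 0" for m n w
    using rel_A [of Ysl m Ysl n w] by (simp add: same_rel_def same_term_exps2 field_A assms)
  show "mixed_rel scale (A Yl) (A Ysl) m n w = 0" for m n w
    using rel_A [of Yl m Ysl n w] by (simp add: mixed_rel_def mixed_term_exps2 field_A assms)
  show "\<exists>N. \<forall>n\<ge>N. A Yl n w = 0 \<and> A Ysl n w = 0" for w
    using trunc_A [of Yl w] trunc_A [of Ysl w]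
    unfolding trunc_def by (metis order.trans linorder_linear)
qed (rule linear_A same_term_exps2(2) [OF field_A] mixed_term_exps2(2) [OF field_A field_A])+

section \<open>Loop spaces W[t, 1/t] as finitely supported functions\<close>

definition pscale :: "(complex \<Rightarrow> 'w \<Rightarrow> 'w) \<Rightarrow> complex \<Rightarrow> ('k \<Rightarrow>\<^sub>0 'w::zero) \<Rightarrow> 'k \<Rightarrow>\<^sub>0 'w" where
  "pscale s c f = Abs_poly_mapping (\<lambda>k. s c (Poly_Mapping.lookup f k))"

lemma lookup_Abs:
  assumes "finite A" "\<And>k. g k \<noteq> 0 \<Longrightarrow> k \<in> A"
  shows "Poly_Mapping.lookup (Abs_poly_mapping g) = g"
  by (rule lookup_Abs_poly_mapping) (rule finite_subset [OF _ assms(1)], use assms(2) in auto)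

context complex_vs
begin

lemma lookup_pscale [simp]: "Poly_Mapping.lookup (pscale scale c f) k = scale c (Poly_Mapping.lookup f k)"
  unfolding pscale_def
  by (subst lookup_Abs [where A = "Poly_Mapping.keys f"]) (auto simp: in_keys_iff)

lemma complex_vs_pscale: "complex_vs (pscale scale)"
  by unfold_locales (intro poly_mapping_eqI, simp add: lookup_add scale_right_distrib scale_left_distrib)+

lemma linear_lookup: "Vector_Spaces.linear (pscale scale) scale (\<lambda>f. Poly_Mapping.lookup f k)"
  using complex_vs_pscale by (intro linearI vector_space_axioms) (auto simp: lookup_add complex_vs_def)

lemma linear_single: "Vector_Spaces.linear scale (pscale scale) (Poly_Mapping.single k)"
  using complex_vs_pscale
  by (intro linearI vector_space_axioms)
    (auto simp: complex_vs_def single_add intro!: poly_mapping_eqI simp: lookup_single when_def)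

end

context deformed_ops
begin

text \<open>The operator a_m t^p with p the charge of a: the exponent of t counts charges, whether
  or not W itself can do so.\<close>

definition loop :: "letter \<Rightarrow> int \<Rightarrow> (int \<Rightarrow>\<^sub>0 'w) \<Rightarrow> (int \<Rightarrow>\<^sub>0 'w)" where
  "loop a m f = Abs_poly_mapping (\<lambda>j. A a m (Poly_Mapping.lookup f (j - charge a)))"

lemma lookup_loop [simp]:
  "Poly_Mapping.lookup (loop a m f) j = A a m (Poly_Mapping.lookup f (j - charge a))"
  unfolding loop_def
proof (subst lookup_Abs [where A = "(\<lambda>j. j + charge a) ` Poly_Mapping.keys f"])
  show "k \<in> (\<lambda>j. j + charge a) ` Poly_Mapping.keys f"
    if "A a m (Poly_Mapping.lookup f (k - charge a)) \<noteq> 0" for k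
    by (rule image_eqI [of _ _ "k - charge a"]) (use that in \<open>auto simp: in_keys_iff\<close>)
qed auto

lemma field_loop: "field (pscale scale) (loop a)"
  unfolding field_def
proof (intro conjI allI linearI)
  show "vector_space (pscale scale)" using complex_vs_pscale by (simp add: complex_vs_def)
  then show "vector_space (pscale scale)" .
  show "loop a m (x + y) = loop a m x + loop a m y" for m x y
    by (rule poly_mapping_eqI) (simp add: lookup_add A_add)
  show "loop a m (pscale scale c x) = pscale scale c (loop a m x)" for m c x
    by (rule poly_mapping_eqI) (simp add: A_scale)
  fix f :: "int \<Rightarrow>\<^sub>0 'w"
  have "\<exists>N. \<forall>n\<ge>N. \<forall>x\<in>X. A a n x = 0" if "finite X" for X
    using that
  proof (induction X rule: finite_induct)
    case (insert x X)
    then obtain N where "\<forall>n\<ge>N. \<forall>x\<in>X. A a n x = 0" by blast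
    moreover obtain M where "\<forall>n\<ge>M. A a n x = 0" using trunc_A unfolding trunc_def by blast
    ultimately show ?case by (intro exI [of _ "max N M"]) auto
  qed simp
  from this [of "Poly_Mapping.lookup f ` Poly_Mapping.keys f"]
  obtain N where "\<forall>n\<ge>N. \<forall>x\<in>Poly_Mapping.lookup f ` Poly_Mapping.keys f. A a n x = 0" by auto
  then have "loop a n f = 0" if "n \<ge> N" for n
    using that by (intro poly_mapping_eqI) (metis A_0 image_eqI in_keys_iff lookup_loop lookup_zero)
  then show "trunc (\<lambda>n. loop a n f)" unfolding trunc_def by blast
qed

lemma deformed_loop: "deformed_ops (pscale scale) l loop"
proof (intro deformed_ops.intro complex_vs_pscale deformed_ops_axioms.intro field_loop)
  fix a b m n f
  have tr: "trunc2 (\<lambda>m n. loop b n (loop a m f))"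
    by (rule trunc2_flip [OF trunc2_comp [OF field_loop field_trunc [OF field_loop]]])
  show "loop a m (loop b n f) + exps2 (pscale scale) (- l * of_int (charge a * charge b))
      (l * of_int (charge a * charge b)) (\<lambda>m n. loop b n (loop a m f)) m n
      = (if a \<noteq> b \<and> m + n + 1 = 0 then f else 0)"
  proof (rule poly_mapping_eqI)
    fix j
    show "Poly_Mapping.lookup (loop a m (loop b n f) + exps2 (pscale scale) (- l * of_int (charge a * charge b))
      (l * of_int (charge a * charge b)) (\<lambda>m n. loop b n (loop a m f)) m n) j
      = Poly_Mapping.lookup (if a \<noteq> b \<and> m + n + 1 = 0 then f else 0) j"
      unfolding lookup_add linear_exps2 [OF linear_lookup tr]
      using rel_A [of a m b n "Poly_Mapping.lookup f (j - charge a - charge b)"]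
      by (cases "a = b") (auto simp: algebra_simps charge_neq)
  qed
qed

definition loop_pr :: "int \<Rightarrow> (int \<Rightarrow>\<^sub>0 'w) \<Rightarrow> (int \<Rightarrow>\<^sub>0 'w)" where
  "loop_pr n f = Poly_Mapping.single n (Poly_Mapping.lookup f n)"

lemma lookup_loop_pr: "Poly_Mapping.lookup (loop_pr n f) j = (if j = n then Poly_Mapping.lookup f n else 0)"
  by (simp add: loop_pr_def lookup_single)

lemma graded_loop: "graded (pscale scale) loop_pr"
proof (intro graded.intro complex_vs_pscale graded_axioms.intro)
  have v: "vector_space (pscale scale)" using complex_vs_pscale by (simp add: complex_vs_def)
  show "Vector_Spaces.linear (pscale scale) (pscale scale) (loop_pr n)" for n
    by (intro linearI v; rule poly_mapping_eqI) (simp_all add: lookup_loop_pr lookup_add)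
  show "loop_pr m (loop_pr n x) = (if m = n then loop_pr n x else 0)" for m n x
    by (rule poly_mapping_eqI) (simp add: lookup_loop_pr)
  have sub: "{n. loop_pr n f \<noteq> 0} \<subseteq> Poly_Mapping.keys f" for f
    by (auto simp: loop_pr_def in_keys_iff)
  then show "finite {n. loop_pr n f \<noteq> 0}" for f
    by (rule finite_subset) simp
  fix f
  show "Sum_any (\<lambda>n. loop_pr n f) = f"
  proof (rule poly_mapping_eqI)
    fix j
    have "Poly_Mapping.lookup (Sum_any (\<lambda>n. loop_pr n f)) j
        = (\<Sum>n\<in>Poly_Mapping.keys f. Poly_Mapping.lookup (loop_pr n f) j)"
      by (subst Sum_any.expand_superset [OF _ sub]) (simp_all add: lookup_sum)
    also have "\<dots> = Poly_Mapping.lookup f j"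
      by (simp add: lookup_loop_pr in_keys_iff)
    finally show "Poly_Mapping.lookup (Sum_any (\<lambda>n. loop_pr n f)) j = Poly_Mapping.lookup f j" .
  qed
qed

end

locale loop_deformed_ops = deformed_ops

sublocale loop_deformed_ops \<subseteq> L: graded_deformed_ops "pscale scale" l loop loop_pr
proof (intro graded_deformed_ops.intro deformed_loop graded_loop graded_deformed_ops_axioms.intro)
  show "loop_pr (n + charge a) (loop a m x) = loop a m (loop_pr n x)" for n a m x
    by (rule poly_mapping_eqI) (auto simp: lookup_loop_pr)
qed

context loop_deformed_ops
begin

lemma lookup_twist_loop:
  "Poly_Mapping.lookup (L.twist s a m f) j
    = exps scale (s * (of_int (charge a * (j - charge a)) + 1/2)) (\<lambda>m. A a m (Poly_Mapping.lookup f (j - charge a))) m"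
proof (induction f rule: L.homogeneous_induct)
  case (1 n f)
  have f: "f = Poly_Mapping.single n (Poly_Mapping.lookup f n)" using 1 by (simp add: loop_pr_def)
  have "Poly_Mapping.lookup (L.twist s a m f) j
    = exps scale (s * (of_int (charge a * n) + 1/2)) (\<lambda>m. A a m (Poly_Mapping.lookup f (j - charge a))) m"
    by (simp add: L.twist_homogeneous [OF 1] linear_exps [OF linear_lookup L.trunc_A])
  moreover have "Poly_Mapping.lookup f (j - charge a) = 0" if "j - charge a \<noteq> n"
    by (subst f) (use that in \<open>simp add: lookup_single\<close>)
  ultimately show ?case by (cases "j - charge a = n") auto
next
  case (2 x y)
  then show ?case
    by (simp add: L.twist_add lookup_add linear_addD [OF linear_exps_family [OF field_A]])
qed

end

section \<open>The Fock space\<close>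

text \<open>
  The generator \<open>g\<close> of the exterior algebra is the creation operator of mode \<open>- (g div 2) - 1\<close>; its
  parity tells the letter.
\<close>

type_synonym fock = "nat fset \<Rightarrow>\<^sub>0 complex"

definition gen_letter :: "nat \<Rightarrow> letter" where
  "gen_letter g = (if even g then Yl else Ysl)"

definition gen :: "letter \<Rightarrow> nat \<Rightarrow> nat" where
  "gen a n = 2 * n + (if a = Yl then 0 else 1)"

fun dual :: "letter \<Rightarrow> letter" where
  "dual Yl = Ysl"
| "dual Ysl = Yl"

lemma gen_letter_gen [simp]: "gen_letter (gen a n) = a"
  by (cases a) (auto simp: gen_letter_def gen_def)

lemma gen_eq_iff [simp]: "gen a m = gen b n \<longleftrightarrow> a = b \<and> m = n"
  by (cases a; cases b) (auto simp: gen_def, presburger+)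

lemma gen_surj: "gen (gen_letter g) (g div 2) = g"
  by (auto simp: gen_letter_def gen_def)

lemma charge_dual [simp]: "charge (dual a) = - charge a"
  by (cases a) auto

lemma dual_eq_iff: "dual a = b \<longleftrightarrow> a \<noteq> b"
  by (cases a; cases b) auto

text \<open>The sign of moving the generator \<open>g\<close> past the smaller elements of
  \<open>S\<close> in an increasing product.\<close>

definition sg :: "nat fset \<Rightarrow> nat \<Rightarrow> complex" where
  "sg S g = (-1) ^ card {h \<in> fset S. h < g}"

lemma sg_insert:
  assumes "g |\<notin>| S"
  shows "sg (finsert g S) h = (if g < h then - sg S h else sg S h)"
proof (cases "g < h")
  case True
  then have "{k \<in> fset (finsert g S). k < h} = insert g {k \<in> fset S. k < h}" by auto
  moreover have "g \<notin> {k \<in> fset S. k < h}" using assms by simp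
  ultimately show ?thesis using True by (simp add: sg_def)
next
  case False
  then have "{k \<in> fset (finsert g S). k < h} = {k \<in> fset S. k < h}" by auto
  then show ?thesis using False by (simp add: sg_def)
qed

lemma sg_remove:
  assumes "g |\<in>| S"
  shows "sg (S |-| {|g|}) h = (if g < h then - sg S h else sg S h)"
proof -
  have "S = finsert g (S |-| {|g|})" using assms by auto
  then have "sg S h = (if g < h then - sg (S |-| {|g|}) h else sg (S |-| {|g|}) h)"
    using sg_insert [of g "S |-| {|g|}" h] by auto
  then show ?thesis by auto
qed

lemma sg_sg [simp]: "sg S g * sg S g = 1"
  by (simp add: sg_def flip: power_add)

lemma sg_sg' [simp]: "sg S g * (sg S g * x) = x"
  using sg_sg [of S g] by (metis mult.assoc mult_1)

text \<open>Exterior multiplication by \<open>g\<close> from the left, written by its effect on the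
  coefficient at the basis element \<open>T\<close>; \<open>ann\<close> is the dual
  contraction.\<close>

definition cre :: "nat \<Rightarrow> fock \<Rightarrow> fock" where
  "cre g x = Abs_poly_mapping (\<lambda>T. if g |\<in>| T then sg T g * Poly_Mapping.lookup x (T |-| {|g|}) else 0)"

definition ann :: "nat \<Rightarrow> fock \<Rightarrow> fock" where
  "ann g x = Abs_poly_mapping (\<lambda>T. if g |\<notin>| T then sg T g * Poly_Mapping.lookup x (finsert g T) else 0)"

lemma lookup_cre:
  "Poly_Mapping.lookup (cre g x) T = (if g |\<in>| T then sg T g * Poly_Mapping.lookup x (T |-| {|g|}) else 0)"
  unfolding cre_def
proof (subst lookup_Abs [where A = "finsert g ` Poly_Mapping.keys x"])
  fix T assume "(if g |\<in>| T then sg T g * Poly_Mapping.lookup x (T |-| {|g|}) else 0) \<noteq> 0"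
  then show "T \<in> finsert g ` Poly_Mapping.keys x"
    by (intro image_eqI [of _ _ "T |-| {|g|}"]) (auto simp: in_keys_iff split: if_splits)
qed auto

lemma lookup_ann:
  "Poly_Mapping.lookup (ann g x) T = (if g |\<notin>| T then sg T g * Poly_Mapping.lookup x (finsert g T) else 0)"
  unfolding ann_def
proof (subst lookup_Abs [where A = "(\<lambda>T. T |-| {|g|}) ` Poly_Mapping.keys x"])
  fix T assume "(if g |\<notin>| T then sg T g * Poly_Mapping.lookup x (finsert g T) else 0) \<noteq> 0"
  then show "T \<in> (\<lambda>T. T |-| {|g|}) ` Poly_Mapping.keys x"
    by (intro image_eqI [of _ _ "finsert g T"]) (auto simp: in_keys_iff split: if_splits)
qed auto

lemma cre_cre: "cre g (cre h x) + cre h (cre g x) = 0"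
proof (rule poly_mapping_eqI)
  fix T
  have "T |-| {|g|} |-| {|h|} = T |-| {|h|} |-| {|g|}" by auto
  then show "Poly_Mapping.lookup (cre g (cre h x) + cre h (cre g x)) T = Poly_Mapping.lookup 0 T"
    by (auto simp: lookup_add lookup_cre sg_remove algebra_simps)
qed

lemma ann_ann: "ann g (ann h x) + ann h (ann g x) = 0"
proof (rule poly_mapping_eqI)
  fix T
  have "finsert g (finsert h T) = finsert h (finsert g T)" by auto
  then show "Poly_Mapping.lookup (ann g (ann h x) + ann h (ann g x)) T = Poly_Mapping.lookup 0 T"
    by (auto simp: lookup_add lookup_ann sg_insert algebra_simps)
qed

lemma ann_cre: "ann g (cre h x) + cre h (ann g x) = (if g = h then x else 0)"
proof (rule poly_mapping_eqI)
  fix T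
  show "Poly_Mapping.lookup (ann g (cre h x) + cre h (ann g x)) T = Poly_Mapping.lookup (if g = h then x else 0) T"
  proof (cases "g = h")
    case True
    have "finsert h (T |-| {|h|}) = T" if "h |\<in>| T" using that by auto
    moreover have "finsert h T |-| {|h|} = T" if "h |\<notin>| T" using that by auto
    ultimately show ?thesis using True
      by (auto simp: lookup_add lookup_ann lookup_cre sg_insert sg_remove)
  next
    case False
    then have "finsert g (T |-| {|h|}) = finsert g T |-| {|h|}" by auto
    with False show ?thesis
      by (auto simp: lookup_add lookup_ann lookup_cre sg_insert sg_remove algebra_simps)
  qed
qed

interpretation complex_mult: complex_vs "(*) :: complex \<Rightarrow> complex \<Rightarrow> complex"
  by unfold_locales (simp_all add: algebra_simps)

declare complex_mult.scale_scale [simp del]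

abbreviation fscale :: "complex \<Rightarrow> fock \<Rightarrow> fock" where
  "fscale \<equiv> pscale (*)"

text \<open>A nonnegative mode \<open>m\<close> of a letter pairs with the mode
  \<open>- m - 1\<close> of the other letter, whose generator it contracts; hence
  \<open>dual\<close>.\<close>

definition psi :: "letter \<Rightarrow> int \<Rightarrow> fock \<Rightarrow> fock" where
  "psi a m = (if m < 0 then cre (gen a (nat (- m - 1))) else ann (gen (dual a) (nat m)))"

interpretation F: complex_vs fscale
  by (rule complex_mult.complex_vs_pscale)

lemma linear_cre: "Vector_Spaces.linear fscale fscale (cre g)"
proof (intro linearI F.vector_space_axioms)
  show "cre g (x + y) = cre g x + cre g y" for x y
    by (rule poly_mapping_eqI) (simp add: lookup_cre lookup_add distrib_left)
  show "cre g (fscale c x) = fscale c (cre g x)" for c x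
    by (rule poly_mapping_eqI) (simp add: lookup_cre)
qed

lemma linear_ann: "Vector_Spaces.linear fscale fscale (ann g)"
proof (intro linearI F.vector_space_axioms)
  show "ann g (x + y) = ann g x + ann g y" for x y
    by (rule poly_mapping_eqI) (simp add: lookup_ann lookup_add distrib_left)
  show "ann g (fscale c x) = fscale c (ann g x)" for c x
    by (rule poly_mapping_eqI) (simp add: lookup_ann)
qed

lemma field_psi: "field fscale (psi a)"
  unfolding field_def
proof (intro conjI allI)
  show "Vector_Spaces.linear fscale fscale (psi a m)" for m
    by (simp add: psi_def linear_cre linear_ann)
  fix x :: fock
  have "finite (\<Union>T\<in>Poly_Mapping.keys x. fset T)" by simp
  then obtain N where N: "\<And>T g. T \<in> Poly_Mapping.keys x \<Longrightarrow> g |\<in>| T \<Longrightarrow> g < N"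
    unfolding finite_nat_set_iff_bounded by blast
  have "psi a m x = 0" if "m \<ge> int N" for m
  proof (rule poly_mapping_eqI)
    fix T
    have "gen (dual a) (nat m) \<ge> N" using that by (auto simp: gen_def)
    then have "finsert (gen (dual a) (nat m)) T \<notin> Poly_Mapping.keys x"
      using N by fastforce
    then show "Poly_Mapping.lookup (psi a m x) T = Poly_Mapping.lookup 0 T"
      using that by (simp add: psi_def lookup_ann in_keys_iff)
  qed
  then show "trunc (\<lambda>n. psi a n x)" unfolding trunc_def by blast
qed

definition fcharge :: "nat fset \<Rightarrow> int" where
  "fcharge S = (\<Sum>g\<in>fset S. charge (gen_letter g))"

lemma fcharge_insert: "g |\<notin>| S \<Longrightarrow> fcharge (finsert g S) = fcharge S + charge (gen_letter g)"
  by (simp add: fcharge_def)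

lemma fcharge_remove: "g |\<in>| S \<Longrightarrow> fcharge (S |-| {|g|}) = fcharge S - charge (gen_letter g)"
  by (simp add: fcharge_def sum_diff1)

definition fpr :: "int \<Rightarrow> fock \<Rightarrow> fock" where
  "fpr n x = Abs_poly_mapping (\<lambda>T. if fcharge T = n then Poly_Mapping.lookup x T else 0)"

lemma lookup_fpr: "Poly_Mapping.lookup (fpr n x) T = (if fcharge T = n then Poly_Mapping.lookup x T else 0)"
  unfolding fpr_def by (subst lookup_Abs [where A = "Poly_Mapping.keys x"]) (auto simp: in_keys_iff split: if_splits)

interpretation F: graded fscale fpr
proof (intro graded.intro F.complex_vs_axioms graded_axioms.intro)
  show "Vector_Spaces.linear fscale fscale (fpr n)" for n
    by (intro linearI F.vector_space_axioms; rule poly_mapping_eqI) (simp_all add: lookup_fpr lookup_add)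
  show "fpr m (fpr n x) = (if m = n then fpr n x else 0)" for m n x
    by (rule poly_mapping_eqI) (simp add: lookup_fpr)
  have sub: "{n. fpr n x \<noteq> 0} \<subseteq> fcharge ` Poly_Mapping.keys x" for x
  proof
    fix n assume "n \<in> {n. fpr n x \<noteq> 0}"
    then obtain T where "Poly_Mapping.lookup (fpr n x) T \<noteq> 0"
      using poly_mapping_eqI [of "fpr n x" 0] by auto
    then show "n \<in> fcharge ` Poly_Mapping.keys x" by (auto simp: lookup_fpr in_keys_iff split: if_splits)
  qed
  then show "finite {n. fpr n x \<noteq> 0}" for x by (rule finite_subset) simp
  fix x
  show "Sum_any (\<lambda>n. fpr n x) = x"
  proof (rule poly_mapping_eqI)
    fix T
    have "Poly_Mapping.lookup (Sum_any (\<lambda>n. fpr n x)) T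
        = (\<Sum>n\<in>fcharge ` Poly_Mapping.keys x. Poly_Mapping.lookup (fpr n x) T)"
      by (subst Sum_any.expand_superset [OF _ sub]) (simp_all add: lookup_sum)
    also have "\<dots> = Poly_Mapping.lookup x T"
      by (auto simp: lookup_fpr in_keys_iff sum.delta image_iff)
    finally show "Poly_Mapping.lookup (Sum_any (\<lambda>n. fpr n x)) T = Poly_Mapping.lookup x T" .
  qed
qed

interpretation F: graded_deformed_ops fscale 0 psi fpr
proof
  show "field fscale (psi a)" for a by (rule field_psi)
  fix a b m n x
  have "psi a m (psi b n x) + psi b n (psi a m x) = (if a \<noteq> b \<and> m + n + 1 = 0 then x else 0)"
  proof (cases "m < 0"; cases "n < 0")
    assume "m < 0" "n < 0" then show ?thesis by (simp add: psi_def cre_cre)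
  next
    assume mn: "\<not> m < 0" "\<not> n < 0"
    then have "m + n + 1 \<noteq> 0" by linarith
    with mn show ?thesis by (simp add: psi_def ann_ann)
  next
    assume mn: "m < 0" "\<not> n < 0"
    then have "nat n = nat (- m - 1) \<longleftrightarrow> m + n + 1 = 0" by linarith
    with mn ann_cre [of "gen (dual b) (nat n)" "gen a (nat (- m - 1))" x] show ?thesis
      by (simp add: psi_def dual_eq_iff add.commute [of "cre _ _"])
  next
    assume mn: "\<not> m < 0" "n < 0"
    then have "nat m = nat (- n - 1) \<longleftrightarrow> m + n + 1 = 0" by linarith
    with mn ann_cre [of "gen (dual a) (nat m)" "gen b (nat (- n - 1))" x] show ?thesis
      by (simp add: psi_def dual_eq_iff)
  qed
  then show "psi a m (psi b n x) + exps2 fscale (- 0 * of_int (charge a * charge b)) (0 * of_int (charge a * charge b))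
        (\<lambda>m n. psi b n (psi a m x)) m n = (if a \<noteq> b \<and> m + n + 1 = 0 then x else 0)"
    by simp
next
  show "fpr (n + charge a) (psi a m x) = psi a m (fpr n x)" for n a m x
  proof (rule poly_mapping_eqI)
    fix T
    show "Poly_Mapping.lookup (fpr (n + charge a) (psi a m x)) T = Poly_Mapping.lookup (psi a m (fpr n x)) T"
    proof (cases "m < 0")
      case True
      then show ?thesis
        by (simp add: psi_def lookup_fpr lookup_cre fcharge_remove eq_diff_eq add.commute)
    next
      case False
      then show ?thesis
        by (simp add: psi_def lookup_fpr lookup_ann fcharge_insert diff_eq_eq)
    qed
  qed
qed

definition fvac :: fock where "fvac = Poly_Mapping.single {||} 1"

definition word_vec :: "nat list \<Rightarrow> fock" where "word_vec ws = foldr cre ws fvac"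

definition word_charge :: "nat list \<Rightarrow> int" where
  "word_charge ws = (\<Sum>g\<leftarrow>ws. charge (gen_letter g))"

lemma word_vec_simps [simp]: "word_vec [] = fvac" "word_vec (g # ws) = cre g (word_vec ws)"
  by (simp_all add: word_vec_def)

lemma word_charge_simps [simp]: "word_charge [] = 0"
  "word_charge (g # ws) = charge (gen_letter g) + word_charge ws"
  by (simp_all add: word_charge_def)

lemma cre_psi: "cre g = psi (gen_letter g) (- int (g div 2) - 1)"
  by (simp add: psi_def gen_surj)

lemma psi_fvac: "m \<ge> 0 \<Longrightarrow> psi a m fvac = 0"
  by (rule poly_mapping_eqI) (auto simp: psi_def lookup_ann fvac_def lookup_single when_def)

lemma fpr_fvac: "fpr 0 fvac = fvac"
  by (rule poly_mapping_eqI) (auto simp: lookup_fpr fvac_def lookup_single fcharge_def when_def)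

lemma fvac_neq_0: "fvac \<noteq> 0"
proof
  assume "fvac = 0"
  from arg_cong [OF this, of "\<lambda>x. Poly_Mapping.lookup x {||}"] show False by (simp add: fvac_def)
qed

lemma fpr_word_vec: "fpr (word_charge ws) (word_vec ws) = word_vec ws"
proof (induction ws)
  case (Cons g ws)
  then show ?case
    using F.pr_A [of "word_charge ws" "gen_letter g" "- int (g div 2) - 1" "word_vec ws"]
    by (simp add: cre_psi add.commute)
qed (simp add: fpr_fvac)

lemma cre_single:
  "cre g (Poly_Mapping.single S c) = (if g |\<in>| S then 0 else Poly_Mapping.single (finsert g S) (sg S g * c))"
proof (rule poly_mapping_eqI)
  fix T
  show "Poly_Mapping.lookup (cre g (Poly_Mapping.single S c)) T
    = Poly_Mapping.lookup (if g |\<in>| S then 0 else Poly_Mapping.single (finsert g S) (sg S g * c)) T"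
  proof (cases "g |\<in>| S")
    case True
    then have "S \<noteq> T |-| {|g|}" by auto
    with True show ?thesis by (simp add: lookup_cre lookup_single)
  next
    case gS: False
    show ?thesis
    proof (cases "finsert g S = T")
      case True
      then have "S = T |-| {|g|}" "g |\<in>| T" "sg T g = sg S g"
        using gS by (auto simp: sg_insert)
      then show ?thesis using gS True by (simp add: lookup_cre lookup_single)
    next
      case False
      then have "S \<noteq> T |-| {|g|}" if "g |\<in>| T" using that by auto
      then show ?thesis using gS False by (simp add: lookup_cre lookup_single)
    qed
  qed
qed

abbreviation flist :: "nat fset \<Rightarrow> nat list" where
  "flist S \<equiv> sorted_list_of_set (fset S)"

lemma word_vec_sorted:
  assumes "sorted_wrt (<) ws"
  shows "word_vec ws = Poly_Mapping.single (fset_of_list ws) 1"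
  using assms
proof (induction ws)
  case (Cons g ws)
  have "{h \<in> fset (fset_of_list ws). h < g} = {}"
    using Cons.prems by (auto simp: fset_of_list.rep_eq)
  then have "sg (fset_of_list ws) g = 1" by (simp only: sg_def) simp
  moreover have "g |\<notin>| fset_of_list ws" using Cons.prems by (auto simp: fset_of_list_elem)
  ultimately show ?case using Cons by (simp add: cre_single)
qed (simp add: fvac_def)

lemma fset_of_flist: "fset_of_list (flist S) = S"
  by (simp add: fset_inject [symmetric] fset_of_list.rep_eq)

lemma word_vec_flist: "word_vec (flist S) = Poly_Mapping.single S 1"
  by (subst word_vec_sorted) (auto simp: fset_of_flist)

lemma word_charge_flist: "word_charge (flist S) = fcharge S"
  by (simp add: word_charge_def fcharge_def sum_list_distinct_conv_sum_set)

lemma single_fscale: "Poly_Mapping.single S c = fscale c (Poly_Mapping.single S 1)"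
  by (rule poly_mapping_eqI) (simp add: lookup_single when_def)

lemma fock_induct [consumes 1, case_names zero add scale word]:
  assumes "fpr n x = x"
    and "P 0" "\<And>x y. P x \<Longrightarrow> P y \<Longrightarrow> P (x + y)" "\<And>c x. P x \<Longrightarrow> P (fscale c x)"
    and "\<And>ws. word_charge ws = n \<Longrightarrow> P (word_vec ws)"
  shows "P x"
proof -
  have ch: "fcharge S = n" if "Poly_Mapping.lookup x S \<noteq> 0" for S
    using arg_cong [OF assms(1), of "\<lambda>x. Poly_Mapping.lookup x S"] that by (auto simp: lookup_fpr split: if_splits)
  have "P (\<Sum>S\<in>A. Poly_Mapping.single S (Poly_Mapping.lookup x S))" if "finite A" for A
    using that
  proof (induction A rule: finite_induct)
    case (insert S A)
    have "P (Poly_Mapping.single S (Poly_Mapping.lookup x S))"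
    proof (cases "Poly_Mapping.lookup x S = 0")
      case False
      then have "P (word_vec (flist S))" using ch assms(5) by (simp add: word_charge_flist)
      then show ?thesis using assms(4) by (subst single_fscale) (simp add: word_vec_flist)
    qed (simp add: assms(2))
    with insert show ?case by (simp add: assms(3))
  qed (simp add: assms(2))
  moreover have "(\<Sum>S\<in>Poly_Mapping.keys x. Poly_Mapping.single S (Poly_Mapping.lookup x S)) = x"
    by (rule poly_mapping_eqI) (auto simp: lookup_sum lookup_single when_def in_keys_iff)
  ultimately show ?thesis by (metis finite_keys)
qed

lemma fock_induct' [case_names add scale word]:
  assumes "\<And>x y. P x \<Longrightarrow> P y \<Longrightarrow> P (x + y)" "\<And>c x. P x \<Longrightarrow> P (fscale c x)"
    and "\<And>ws. P (word_vec ws)"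
  shows "P x"
proof (induction x rule: F.homogeneous_induct)
  case (1 n x)
  have "P 0" using assms(2) [OF assms(3), of 0] by simp
  with 1 show ?case by (induction rule: fock_induct) (use assms in auto)
qed (rule assms(1))

text \<open>Universal property of the exterior algebra: antisymmetric functions of words extend to it.\<close>

locale antisymmetric = complex_vs scale
  for scale :: "complex \<Rightarrow> 'w::ab_group_add \<Rightarrow> 'w" +
  fixes f :: "nat list \<Rightarrow> 'i \<Rightarrow> 'w"
  assumes swap: "f (g # h # ws) i = - f (h # g # ws) i"
    and cong: "word_charge ws = word_charge us \<Longrightarrow> (\<And>i. f ws i = scale c (f us i)) \<Longrightarrow>
      f (g # ws) i = scale c (f (g # us) i)"
begin

lemma double_0: "x + x = 0 \<Longrightarrow> x = 0" for x :: 'w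
proof -
  assume "x + x = 0"
  then have "scale 2 x = 0" using scale_left_distrib [of 1 1 x] by simp
  then show "x = 0" by simp
qed

lemma word_charge_insort: "word_charge (insort g xs) = charge (gen_letter g) + word_charge xs"
  by (induction xs) auto

lemma cong_0: assumes "\<And>i. f ws i = 0" shows "f (g # ws) i = 0"
proof -
  have "f (g # ws) i = scale 0 (f (g # ws) i)" by (rule cong) (simp_all add: assms)
  then show ?thesis by simp
qed

text \<open>Insertion sort with signs: each transposition costs -1, and a generator meeting its
  equal gives a vector equal to its negative, hence 0.\<close>

lemma f_insort:
  assumes "sorted_wrt (<) xs"
  shows "f (g # xs) i = (if g \<in> set xs then 0 else scale (sg (fset_of_list xs) g) (f (insort g xs) i))"
  using assms
proof (induction xs arbitrary: i)
  case Nil then show ?case by (simp add: sg_def)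
next
  case (Cons x xs)
  have "sorted_wrt (<) xs" using Cons.prems by simp
  note IH = Cons.IH [OF this]
  have nx: "x |\<notin>| fset_of_list xs" using Cons.prems by (auto simp: fset_of_list_elem)
  consider "g < x" | "g = x" | "x < g" by linarith
  then show ?case
  proof cases
    case 1
    have "{h \<in> fset (fset_of_list (x # xs)). h < g} = {}"
      using Cons.prems 1 by (auto simp: fset_of_list.rep_eq)
    then have "sg (fset_of_list (x # xs)) g = 1" by (simp only: sg_def) simp
    then show ?thesis using 1 Cons.prems by auto
  next
    case 2
    have "f (x # x # xs) i + f (x # x # xs) i = 0" using swap [of x x xs i] by (metis add.right_inverse)
    then have "f (x # x # xs) i = 0" by (rule double_0)
    then show ?thesis using 2 by simp
  next
    case 3
    have sgx: "sg (fset_of_list (x # xs)) g = - sg (fset_of_list xs) g"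
      using 3 nx by (simp add: sg_insert)
    show ?thesis
    proof (cases "g \<in> set xs")
      case True
      then have "f (g # xs) i = 0" for i unfolding IH by (rule if_P)
      then have "f (x # g # xs) i = 0" by (rule cong_0)
      with swap [of g x xs i] True show ?thesis by simp
    next
      case False
      then have "f (g # xs) i = scale (sg (fset_of_list xs) g) (f (insort g xs) i)" for i
        unfolding IH by (rule if_not_P)
      then have "f (x # g # xs) i = scale (sg (fset_of_list xs) g) (f (x # insort g xs) i)"
        by (rule cong [rotated]) (simp add: word_charge_insort)
      then show ?thesis using 3 False sgx by (simp add: swap [of g x xs i])
    qed
  qed
qed

definition extend :: "fock \<Rightarrow> 'i \<Rightarrow> 'w" where
  "extend x i = Sum_any (\<lambda>S. scale (Poly_Mapping.lookup x S) (f (flist S) i))"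

lemma extend_eq:
  assumes "finite A" "Poly_Mapping.keys x \<subseteq> A"
  shows "extend x i = (\<Sum>S\<in>A. scale (Poly_Mapping.lookup x S) (f (flist S) i))"
  unfolding extend_def
  by (rule Sum_any.expand_superset) (use assms in \<open>auto simp: in_keys_iff subset_iff\<close>)

lemma extend_single: "extend (Poly_Mapping.single S c) i = scale c (f (flist S) i)"
  by (subst extend_eq [where A = "{S}"]) (auto simp: lookup_single split: if_splits)

lemma linear_extend: "Vector_Spaces.linear fscale scale (\<lambda>x. extend x i)"
proof (intro linearI vector_space_axioms F.vector_space_axioms)
  show "extend (x + y) i = extend x i + extend y i" for x y
    using Poly_Mapping.keys_add [of x y]
    by (simp add: extend_eq [where A = "Poly_Mapping.keys x \<union> Poly_Mapping.keys y"]
        lookup_add scale_left_distrib sum.distrib)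
  show "extend (fscale c x) i = scale c (extend x i)" for c x
    by (subst (1 2) extend_eq [where A = "Poly_Mapping.keys x"])
      (auto simp: in_keys_iff scale_sum_right)
qed

text \<open>A word reduces to a multiple of an increasing word, in the exterior algebra and under
  \<open>f\<close> with the same scalar \<open>c\<close>. The charge is carried along since
  \<open>cong\<close> compares only words of equal charge; it is dropped for \<open>c = 0\<close>,
  where the representing set has no meaning.\<close>

lemma extend_word_vec: "extend (word_vec ws) i = f ws i"
proof -
  have "\<exists>c S. word_vec ws = Poly_Mapping.single S c \<and> (\<forall>i. f ws i = scale c (f (flist S) i))
      \<and> (c \<noteq> 0 \<longrightarrow> word_charge ws = fcharge S)"
  proof (induction ws)
    case Nil
    have "flist {||} = []" by simp
    then show ?case by (intro exI [of _ 1] exI [of _ "{||}"]) (simp add: fvac_def fcharge_def)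
  next
    case (Cons g ws)
    then obtain c S where IH: "word_vec ws = Poly_Mapping.single S c" "\<And>i. f ws i = scale c (f (flist S) i)"
      "c \<noteq> 0 \<Longrightarrow> word_charge ws = fcharge S" by blast
    show ?case
    proof (cases "c = 0")
      case True
      then have "f ws i = 0" for i using IH(2) by simp
      then have "f (g # ws) i = 0" for i by (rule cong_0)
      with True IH show ?thesis by (intro exI [of _ 0] exI [of _ S]) (simp add: linear_zeroD [OF linear_cre])
    next
      case False
      then have wc: "word_charge ws = word_charge (flist S)" by (simp add: IH word_charge_flist)
      have f: "f (g # ws) i = scale c (f (g # flist S) i)" for i by (rule cong [OF wc IH(2)])
      have st: "sorted_wrt (<) (flist S)" by simp
      show ?thesis
      proof (cases "g |\<in>| S")
        case True
        then have "f (g # flist S) i = 0" for i using f_insort [OF st, of g i] by simp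
        with True f IH show ?thesis by (intro exI [of _ 0] exI [of _ S]) (simp add: cre_single)
      next
        case gS: False
        have "flist (finsert g S) = insort g (flist S)"
          using gS by (simp add: sorted_list_of_set_insert_remove)
        moreover have "f (g # flist S) i = scale (sg S g) (f (insort g (flist S)) i)" for i
          using f_insort [OF st, of g i] gS by (simp only: fset_of_flist) simp
        ultimately have "f (g # ws) i = scale (sg S g * c) (f (flist (finsert g S)) i)" for i
          unfolding f by (simp only: scale_scale mult.commute)
        moreover have "word_charge (g # ws) = fcharge (finsert g S)"
          using gS wc by (simp add: fcharge_insert word_charge_flist)
        ultimately show ?thesis using IH gS
          by (intro exI [of _ "sg S g * c"] exI [of _ "finsert g S"]) (simp add: cre_single fcharge_insert False add.commute)
      qed
    qed
  qed
  then show ?thesis by (metis extend_single)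
qed

end

interpretation FA: deformed_ops fscale 1 "F.twist (-1)"
  using F.deformed_twist [of "-1"] by simp

interpretation FA: restricted_A_module fscale "F.twist (-1) Yl" "F.twist (-1) Ysl"
  by (rule FA.A_module_if_1) simp

lemma twist_fvac: "m \<ge> 0 \<Longrightarrow> F.twist s a m fvac = 0"
  by (simp add: F.twist_homogeneous [OF fpr_fvac] F.exps_vanish psi_fvac)

section \<open>Fields on Clifford modules\<close>

definition eps :: "int \<Rightarrow> complex" where
  "eps n = (if even n then 1 else -1)"

lemma eps_eps [simp]: "eps n * eps n = 1" and eps_0 [simp]: "eps 0 = 1"
  by (simp_all add: eps_def)

lemma eps_charge [simp]: "eps (n + charge a) = - eps n" "eps (charge a + n) = - eps n"
  by (cases a; simp add: eps_def)+

lemma eps_add: "eps (m + n) = eps m * eps n"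
  by (simp add: eps_def)

lemma eventually_Sum_any:
  fixes f :: "nat \<Rightarrow> 'a::comm_monoid_add"
  assumes "\<And>i. i \<ge> K \<Longrightarrow> f i = 0"
  shows "\<forall>\<^sub>F M in sequentially. Sum_any f = (\<Sum>i<M. f i)"
  using eventually_ge_at_top [of K]
  by (rule eventually_mono) (rule Sum_any_lessThan, use assms in auto)

lemma finite_truncated:
  fixes f :: "nat \<Rightarrow> 'a::zero"
  assumes "\<And>i. i \<ge> K \<Longrightarrow> f i = 0"
  shows "finite {i. f i \<noteq> 0}"
  by (rule finite_subset [of _ "{..<K}"]) (use assms not_le in auto)

context complex_vs
begin

text \<open>The mode \<open>l\<close> of the normally ordered product of g(x) and \<phi>(x): the
  part of g(x) with nonnegative powers of x acts on the left, the other part on the right, with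
  \<open>\<eta>\<close> as the sign of the exchange.\<close>

definition nord :: "(int \<Rightarrow> 'w \<Rightarrow> 'w) \<Rightarrow> complex \<Rightarrow> (int \<Rightarrow> 'w \<Rightarrow> 'w) \<Rightarrow> int \<Rightarrow> 'w \<Rightarrow> 'w" where
  "nord g \<eta> \<phi> l w = Sum_any (\<lambda>i::nat. g (- int i - 1) (\<phi> (l + int i) w))
     + scale \<eta> (Sum_any (\<lambda>j::nat. \<phi> (l - int j - 1) (g (int j) w)))"

text \<open>One cutoff \<open>M\<close> serves all shifts \<open>l + i\<close>. Nested products then
  become finite double sums with equal ranges, which can be compared termwise for all large
  \<open>M\<close>.\<close>

lemma nord_uniform:
  assumes "field scale g" "field scale \<phi>"
  shows "\<forall>\<^sub>F M in sequentially. \<forall>i::nat. nord g \<eta> \<phi> (l + int i) w =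
    (\<Sum>k<M. g (- int k - 1) (\<phi> (l + int i + int k) w))
    + scale \<eta> (\<Sum>j<M. \<phi> (l + int i - int j - 1) (g (int j) w))"
proof -
  obtain K where K: "\<And>k. k \<ge> K \<Longrightarrow> \<phi> (l + int k) w = 0"
    using truncE [OF field_trunc [OF assms(2)]] by metis
  obtain J where J: "\<And>j. j \<ge> J \<Longrightarrow> g (0 + int j) w = 0"
    using truncE [OF field_trunc [OF assms(1)]] by metis
  show ?thesis using eventually_ge_at_top [of "max K J"]
  proof (rule eventually_mono, intro allI)
    fix M i assume M: "M \<ge> max K J"
    have "Sum_any (\<lambda>k. g (- int k - 1) (\<phi> (l + int i + int k) w))
        = (\<Sum>k<M. g (- int k - 1) (\<phi> (l + int i + int k) w))"
      using K [of "i + _"] M by (intro Sum_any_lessThan) (simp add: add.assoc field_zero [OF assms(1)])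
    moreover have "Sum_any (\<lambda>j. \<phi> (l + int i - int j - 1) (g (int j) w))
        = (\<Sum>j<M. \<phi> (l + int i - int j - 1) (g (int j) w))"
      using J M by (intro Sum_any_lessThan) (simp add: field_zero [OF assms(2)])
    ultimately show "nord g \<eta> \<phi> (l + int i) w =
        (\<Sum>k<M. g (- int k - 1) (\<phi> (l + int i + int k) w))
        + scale \<eta> (\<Sum>j<M. \<phi> (l + int i - int j - 1) (g (int j) w))"
      by (simp add: nord_def)
  qed
qed

lemma nord_eventually:
  assumes "field scale g" "field scale \<phi>"
  shows "\<forall>\<^sub>F M in sequentially. nord g \<eta> \<phi> l w =
    (\<Sum>k<M. g (- int k - 1) (\<phi> (l + int k) w)) + scale \<eta> (\<Sum>j<M. \<phi> (l - int j - 1) (g (int j) w))"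
  using nord_uniform [OF assms, of \<eta> l w] by (rule eventually_mono) (drule spec [of _ 0], simp)

lemma nord_zero: "field scale g \<Longrightarrow> field scale \<phi> \<Longrightarrow> nord g \<eta> \<phi> l 0 = 0"
  by (simp add: nord_def field_zero)

lemma nord_uniform':
  assumes "field scale g" "field scale h" "field scale \<phi>"
  shows "\<forall>\<^sub>F M in sequentially. \<forall>j::nat. nord g \<eta> \<phi> (l - int j - 1) (h (int j) w) =
    (\<Sum>k<M. g (- int k - 1) (\<phi> (l - int j - 1 + int k) (h (int j) w)))
    + scale \<eta> (\<Sum>k<M. \<phi> (l - int j - 1 - int k - 1) (g (int k) (h (int j) w)))"
proof -
  obtain J where J: "\<And>j. j \<ge> J \<Longrightarrow> h (0 + int j) w = 0"
    using truncE [OF field_trunc [OF assms(2)]] by metis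
  have "\<forall>\<^sub>F M in sequentially. \<forall>j\<in>{..<J}. nord g \<eta> \<phi> (l - int j - 1) (h (int j) w) =
    (\<Sum>k<M. g (- int k - 1) (\<phi> (l - int j - 1 + int k) (h (int j) w)))
    + scale \<eta> (\<Sum>k<M. \<phi> (l - int j - 1 - int k - 1) (g (int k) (h (int j) w)))"
    by (intro eventually_ball_finite ballI nord_eventually assms) simp
  then show ?thesis
  proof (rule eventually_mono, intro allI)
    fix M j
    assume *: "\<forall>j\<in>{..<J}. nord g \<eta> \<phi> (l - int j - 1) (h (int j) w) =
      (\<Sum>k<M. g (- int k - 1) (\<phi> (l - int j - 1 + int k) (h (int j) w)))
      + scale \<eta> (\<Sum>k<M. \<phi> (l - int j - 1 - int k - 1) (g (int k) (h (int j) w)))"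
    show "nord g \<eta> \<phi> (l - int j - 1) (h (int j) w) =
      (\<Sum>k<M. g (- int k - 1) (\<phi> (l - int j - 1 + int k) (h (int j) w)))
      + scale \<eta> (\<Sum>k<M. \<phi> (l - int j - 1 - int k - 1) (g (int k) (h (int j) w)))"
    proof (cases "j < J")
      case True then show ?thesis using * by blast
    next
      case False
      then have "h (int j) w = 0" using J [of j] by simp
      then show ?thesis by (simp add: nord_zero assms field_zero [OF assms(1)] field_zero [OF assms(3)])
    qed
  qed
qed

lemma field_nord:
  assumes g: "field scale g" and p: "field scale \<phi>"
  shows "field scale (nord g \<eta> \<phi>)"
  unfolding field_def
proof (intro conjI allI linearI vector_space_axioms)
  note lin = linear_addD [OF field_linear [OF g]] linear_addD [OF field_linear [OF p]]
    linear_scaleD [OF field_linear [OF g]] linear_scaleD [OF field_linear [OF p]]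
  fix l
  show "nord g \<eta> \<phi> l (x + y) = nord g \<eta> \<phi> l x + nord g \<eta> \<phi> l y" for x y
  proof -
    have "\<forall>\<^sub>F M in sequentially. nord g \<eta> \<phi> l (x + y) = nord g \<eta> \<phi> l x + nord g \<eta> \<phi> l y"
      using nord_eventually [OF g p, of \<eta> l x] nord_eventually [OF g p, of \<eta> l y]
        nord_eventually [OF g p, of \<eta> l "x + y"]
      by eventually_elim (simp add: lin sum.distrib scale_right_distrib)
    then show ?thesis by simp
  qed
  show "nord g \<eta> \<phi> l (scale c x) = scale c (nord g \<eta> \<phi> l x)" for c x
  proof -
    have "\<forall>\<^sub>F M in sequentially. nord g \<eta> \<phi> l (scale c x) = scale c (nord g \<eta> \<phi> l x)"
      using nord_eventually [OF g p, of \<eta> l x] nord_eventually [OF g p, of \<eta> l "scale c x"]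
      by eventually_elim
        (simp add: lin scale_right_distrib scale_sum_right scale_left_commute mult.commute)
    then show ?thesis by simp
  qed
next
  fix w
  obtain N where N: "\<And>n. n \<ge> N \<Longrightarrow> \<phi> n w = 0" using field_trunc [OF p] by (auto simp: trunc_def)
  obtain J where J: "\<And>j. j \<ge> J \<Longrightarrow> g (0 + int j) w = 0" using truncE [OF field_trunc [OF g]] by metis
  have "\<exists>K. \<forall>j<J. \<forall>i\<ge>K. \<phi> (0 + int i) (g (int j) w) = 0"
    by (rule common_bound) (metis truncE [OF field_trunc [OF p]])
  then obtain K where K: "\<And>j i. j < J \<Longrightarrow> i \<ge> K \<Longrightarrow> \<phi> (int i) (g (int j) w) = 0" by auto
  have "nord g \<eta> \<phi> n w = 0" if "n \<ge> max N (int K + int J + 1)" for n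
  proof -
    have "\<phi> (n - int j - 1) (g (int j) w) = 0" for j
    proof (cases "j < J")
      case True
      then have "n - int j - 1 \<ge> int K" using that by linarith
      then show ?thesis using K [OF True, of "nat (n - int j - 1)"] by (simp add: le_nat_iff)
    next
      case False
      then show ?thesis using J [of j] by (simp add: field_zero [OF p])
    qed
    then show ?thesis using that N by (simp add: nord_def field_zero [OF g])
  qed
  then show "trunc (\<lambda>n. nord g \<eta> \<phi> n w)" unfolding trunc_def by blast
qed

lemma nord_add:
  assumes g: "field scale g" and p: "field scale \<phi>" and q: "field scale \<psi>"
  shows "nord g \<eta> (\<lambda>l w. \<phi> l w + \<psi> l w) l w = nord g \<eta> \<phi> l w + nord g \<eta> \<psi> l w"
proof -
  note lin = linear_addD [OF field_linear [OF g]]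
  obtain K where K: "\<And>k. k \<ge> K \<Longrightarrow> \<phi> (l + int k) w = 0" using truncE [OF field_trunc [OF p]] by metis
  obtain L where L: "\<And>k. k \<ge> L \<Longrightarrow> \<psi> (l + int k) w = 0" using truncE [OF field_trunc [OF q]] by metis
  obtain J where J: "\<And>j. j \<ge> J \<Longrightarrow> g (0 + int j) w = 0" using truncE [OF field_trunc [OF g]] by metis
  have "Sum_any (\<lambda>i. g (- int i - 1) (\<phi> (l + int i) w + \<psi> (l + int i) w))
      = Sum_any (\<lambda>i. g (- int i - 1) (\<phi> (l + int i) w)) + Sum_any (\<lambda>i. g (- int i - 1) (\<psi> (l + int i) w))"
    unfolding lin
    by (rule Sum_any.distrib; rule finite_truncated [of "max K L"]) (simp_all add: K L field_zero [OF g])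
  moreover have "Sum_any (\<lambda>j. \<phi> (l - int j - 1) (g (int j) w) + \<psi> (l - int j - 1) (g (int j) w))
      = Sum_any (\<lambda>j. \<phi> (l - int j - 1) (g (int j) w)) + Sum_any (\<lambda>j. \<psi> (l - int j - 1) (g (int j) w))"
    using J by (intro Sum_any.distrib; intro finite_truncated [of J]) (simp_all add: field_zero [OF p] field_zero [OF q])
  ultimately show ?thesis by (simp add: nord_def scale_right_distrib)
qed

lemma nord_scale:
  assumes g: "field scale g" and p: "field scale \<phi>"
  shows "nord g \<eta> (\<lambda>l w. scale c (\<phi> l w)) l w = scale c (nord g \<eta> \<phi> l w)"
proof -
  obtain K where K: "\<And>k. k \<ge> K \<Longrightarrow> \<phi> (l + int k) w = 0" using truncE [OF field_trunc [OF p]] by metis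
  obtain J where J: "\<And>j. j \<ge> J \<Longrightarrow> g (0 + int j) w = 0" using truncE [OF field_trunc [OF g]] by metis
  have "Sum_any (\<lambda>i. g (- int i - 1) (scale c (\<phi> (l + int i) w)))
      = (\<Sum>i<K. g (- int i - 1) (scale c (\<phi> (l + int i) w)))"
    by (rule Sum_any_lessThan) (simp add: K field_zero [OF g])
  moreover have "Sum_any (\<lambda>i. g (- int i - 1) (\<phi> (l + int i) w)) = (\<Sum>i<K. g (- int i - 1) (\<phi> (l + int i) w))"
    by (rule Sum_any_lessThan) (simp add: K field_zero [OF g])
  moreover have "Sum_any (\<lambda>j. scale c (\<phi> (l - int j - 1) (g (int j) w)))
      = (\<Sum>j<J. scale c (\<phi> (l - int j - 1) (g (int j) w)))"
    using J by (intro Sum_any_lessThan) (simp add: field_zero [OF p])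
  moreover have "Sum_any (\<lambda>j. \<phi> (l - int j - 1) (g (int j) w)) = (\<Sum>j<J. \<phi> (l - int j - 1) (g (int j) w))"
    using J by (intro Sum_any_lessThan) (simp add: field_zero [OF p])
  ultimately show ?thesis
    by (simp add: nord_def scale_right_distrib scale_sum_right linear_scaleD [OF field_linear [OF g]] mult.commute)
qed

lemma linear_scale: "Vector_Spaces.linear scale scale (scale c)"
  by (intro linearI vector_space_axioms) (simp_all add: scale_right_distrib mult.commute)

text \<open>Both creation parts on the left give \<open>T\<close>, both annihilation parts on the
  right \<open>U\<close>, and \<open>X\<close> has one on each side, once for either order of
  \<open>g\<close> and \<open>h\<close>.\<close>

lemma nord_nord:
  fixes l :: int and w :: 'w
  assumes g: "field scale g" and h: "field scale h" and p: "field scale \<phi>"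
  defines "T \<equiv> \<lambda>g h M. \<Sum>i<M. \<Sum>k<M. g (- int i - 1) (h (- int k - 1) (\<phi> (l + int i + int k) w))"
    and "X \<equiv> \<lambda>g h M. \<Sum>i<M. \<Sum>j<M. g (- int i - 1) (\<phi> (l + int i - int j - 1) (h (int j) w))"
    and "U \<equiv> \<lambda>g h M. \<Sum>j<M. \<Sum>k<M. \<phi> (l - int j - 1 - int k - 1) (h (int k) (g (int j) w))"
  shows "\<forall>\<^sub>F M in sequentially. nord g \<eta>' (nord h \<eta> \<phi>) l w
    = T g h M + scale \<eta> (X g h M) + scale \<eta>' (X h g M) + scale (\<eta>' * \<eta>) (U g h M)"
  using nord_eventually [OF g field_nord [OF h p], of \<eta>' \<eta> l w]
    nord_uniform [OF h p, of \<eta> l w] nord_uniform' [OF h g p, of \<eta> l w]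
proof eventually_elim
  case (elim M)
  have "(\<Sum>i<M. g (- int i - 1) (nord h \<eta> \<phi> (l + int i) w)) = T g h M + scale \<eta> (X g h M)"
    unfolding T_def X_def elim(2) [rule_format] linear_addD [OF field_linear [OF g]]
      linear_scaleD [OF field_linear [OF g]] linear_sumD [OF field_linear [OF g]]
    by (simp add: sum.distrib scale_sum_right)
  moreover have "(\<Sum>j<M. nord h \<eta> \<phi> (l - int j - 1) (g (int j) w)) = X h g M + scale \<eta> (U g h M)"
  proof -
    have "(\<Sum>j<M. \<Sum>k<M. h (- int k - 1) (\<phi> (l - int j - 1 + int k) (g (int j) w))) = X h g M"
      unfolding X_def by (subst sum.swap) (simp add: algebra_simps)
    then show ?thesis unfolding U_def elim(3) [rule_format]
      by (simp add: sum.distrib scale_sum_right)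
  qed
  ultimately show ?case using elim(1) by (simp add: scale_right_distrib add.assoc)
qed

text \<open>\<open>T\<close> and \<open>U\<close> change sign by \<open>cc\<close> and
  \<open>aa\<close>. The mixed sums carry \<open>\<eta>\<close> and \<open>- \<eta>\<close> and are
  interchanged, so no relation between a creation part of one field and an annihilation part of the
  other enters.\<close>

lemma nord_swap:
  assumes g: "field scale g" and h: "field scale h" and p: "field scale \<phi>"
    and cc: "\<And>i k x. g (- int i - 1) (h (- int k - 1) x) = - h (- int k - 1) (g (- int i - 1) x)"
    and aa: "\<And>i k x. g (int i) (h (int k) x) = - h (int k) (g (int i) x)"
  shows "nord g (- \<eta>) (nord h \<eta> \<phi>) l w = - nord h (- \<eta>) (nord g \<eta> \<phi>) l w"
proof -
  have "\<forall>\<^sub>F M in sequentially. nord g (- \<eta>) (nord h \<eta> \<phi>) l w = - nord h (- \<eta>) (nord g \<eta> \<phi>) l w"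
    using nord_nord [OF g h p, of "- \<eta>" \<eta> l w] nord_nord [OF h g p, of "- \<eta>" \<eta> l w]
  proof eventually_elim
    case (elim M)
    have "(\<Sum>i<M. \<Sum>k<M. h (- int i - 1) (g (- int k - 1) (\<phi> (l + int i + int k) w)))
      = - (\<Sum>i<M. \<Sum>k<M. g (- int i - 1) (h (- int k - 1) (\<phi> (l + int i + int k) w)))"
      unfolding cc sum_negf by (subst sum.swap) (simp add: algebra_simps)
    moreover have "(\<Sum>j<M. \<Sum>k<M. \<phi> (l - int j - 1 - int k - 1) (g (int k) (h (int j) w)))
      = - (\<Sum>j<M. \<Sum>k<M. \<phi> (l - int j - 1 - int k - 1) (h (int k) (g (int j) w)))"
      unfolding aa linear_negD [OF field_linear [OF p]] sum_negf by (subst sum.swap) (simp add: algebra_simps)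
    ultimately show ?case unfolding elim by (simp add: algebra_simps)
  qed
  then show ?thesis by simp
qed

end

section \<open>The state-field map of a Clifford module and its commutators\<close>

locale clifford = deformed_ops scale 0 A
  for scale :: "complex \<Rightarrow> 'w::ab_group_add \<Rightarrow> 'w" and A
begin

lemma anticomm: "A a m (A b n w) = - A b n (A a m w) + (if a \<noteq> b \<and> m + n + 1 = 0 then w else 0)"
  using rel_A [of a m b n w] by (simp add: algebra_simps split: if_splits)

text \<open>The modes of the \<open>n\<close>-th divided derivative of the field \<open>a(x)\<close>.\<close>

definition gmode :: "letter \<Rightarrow> nat \<Rightarrow> int \<Rightarrow> 'w \<Rightarrow> 'w" where
  "gmode a n m w = scale ((-1) ^ n * (of_int m gchoose n)) (A a (m - int n) w)"

lemma field_gmode: "field scale (gmode a n)"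
  unfolding field_def
proof (intro conjI allI linearI vector_space_axioms)
  show "gmode a n m (x + y) = gmode a n m x + gmode a n m y" for m x y
    by (simp add: gmode_def A_add scale_right_distrib)
  show "gmode a n m (scale c x) = scale c (gmode a n m x)" for m c x
    by (simp add: gmode_def A_scale mult.commute)
  fix w
  obtain N where "\<And>m. m \<ge> N \<Longrightarrow> A a m w = 0" using trunc_A [of a w] unfolding trunc_def by blast
  then show "trunc (\<lambda>m. gmode a n m w)"
    unfolding trunc_def by (intro exI [of _ "N + int n"]) (simp add: gmode_def)
qed

lemma gmode_nonneg: "m \<ge> 0 \<Longrightarrow> m < int n \<Longrightarrow> gmode a n m w = 0"
proof -
  assume m: "m \<ge> 0" "m < int n"
  then have "(of_int m :: complex) = of_nat (nat m)" by simp
  moreover have "(of_nat (nat m) :: complex) gchoose n = 0"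
    using m by (subst binomial_gbinomial [symmetric]) (simp add: binomial_eq_0)
  ultimately show ?thesis by (simp add: gmode_def)
qed

lemma neg_gchoose: "(of_int (- int i - 1) :: complex) gchoose n = (-1) ^ n * of_nat ((n + i) choose n)"
  using gbinomial_negated_upper [of "of_int (- int i - 1) :: complex" n]
  by (simp add: binomial_gbinomial add.commute)

lemma gmode_neg: "gmode a n (- int i - 1) w = scale (of_nat ((n + i) choose n)) (A a (- int (n + i) - 1) w)"
  unfolding gmode_def neg_gchoose
  by (simp add: mult.assoc [symmetric] algebra_simps flip: power_add mult_2)

lemma gmode_cc: "gmode a n (- int i - 1) (gmode b k (- int j - 1) x) = - gmode b k (- int j - 1) (gmode a n (- int i - 1) x)"
  unfolding gmode_neg A_scale by (subst anticomm) (simp add: mult.commute)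

lemma gmode_aa: "gmode a n (int i) (gmode b k (int j) x) = - gmode b k (int j) (gmode a n (int i) x)"
proof (cases "i < n \<or> j < k")
  case True
  then show ?thesis
    using gmode_nonneg [of "int i" n a] gmode_nonneg [of "int j" k b] by (auto simp: field_zero [OF field_gmode])
next
  case False
  then show ?thesis
    unfolding gmode_def A_scale by (subst anticomm) (simp add: mult.commute)
qed

text \<open>A word of creation operators becomes the nested normally ordered product of divided
  derivatives; the empty word gives the identity field. The sign uses that the charge of a word has
  the parity of its length.\<close>

primrec vow :: "nat list \<Rightarrow> int \<Rightarrow> 'w \<Rightarrow> 'w" where
  "vow [] = (\<lambda>l w. if l = -1 then w else 0)"
| "vow (g # ws) = nord (gmode (gen_letter g) (g div 2)) (eps (word_charge ws)) (vow ws)"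

lemma field_vow: "field scale (vow ws)"
proof (induction ws)
  case Nil
  have "trunc (\<lambda>n. if n = -1 then w else (0::'w))" for w
    unfolding trunc_def by (rule exI [of _ 0]) auto
  then show ?case unfolding field_def by (auto intro!: linearI vector_space_axioms)
next
  case (Cons g ws)
  then show ?case by (simp add: field_nord field_gmode)
qed

sublocale V: antisymmetric scale "\<lambda>ws i. vow ws (fst i) (snd i)"
proof
  fix g h ws and i :: "int \<times> 'w"
  show "vow (g # h # ws) (fst i) (snd i) = - vow (h # g # ws) (fst i) (snd i)"
    unfolding vow.simps word_charge_simps eps_charge
    by (rule nord_swap [OF field_gmode field_gmode field_vow gmode_cc gmode_aa])
next
  fix ws us c g and i :: "int \<times> 'w"
  assume wc: "word_charge ws = word_charge us"
    and eq: "\<And>i. vow ws (fst i) (snd i) = scale c (vow us (fst i) (snd i))"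
  have "vow ws = (\<lambda>l w. scale c (vow us l w))"
    using eq by (intro ext) (metis fst_conv snd_conv)
  then show "vow (g # ws) (fst i) (snd i) = scale c (vow (g # us) (fst i) (snd i))"
    by (simp add: wc nord_scale [OF field_gmode field_vow])
qed

definition vo :: "fock \<Rightarrow> int \<Rightarrow> 'w \<Rightarrow> 'w" where
  "vo u l w = V.extend u (l, w)"

lemma vo_word [simp]: "vo (word_vec ws) l w = vow ws l w"
  by (simp add: vo_def V.extend_word_vec)

lemma linear_vo_left: "Vector_Spaces.linear fscale scale (\<lambda>u. vo u l w)"
  unfolding vo_def by (rule V.linear_extend)

lemmas vo_add = linear_addD [OF linear_vo_left]
lemmas vo_scale = linear_scaleD [OF linear_vo_left]
lemmas vo_0 [simp] = linear_zeroD [OF linear_vo_left]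
lemmas vo_diff = linear_diffD [OF linear_vo_left]
lemmas vo_neg = linear_negD [OF linear_vo_left]

lemma field_add:
  assumes "field scale \<phi>" "field scale \<psi>"
  shows "field scale (\<lambda>l w. \<phi> l w + \<psi> l w)"
  unfolding field_def
proof (intro conjI allI linearI vector_space_axioms)
  fix w
  obtain N M where "\<And>n. n \<ge> N \<Longrightarrow> \<phi> n w = 0" "\<And>n. n \<ge> M \<Longrightarrow> \<psi> n w = 0"
    using field_trunc [OF assms(1), of w] field_trunc [OF assms(2), of w] unfolding trunc_def by metis
  then show "trunc (\<lambda>n. \<phi> n w + \<psi> n w)" unfolding trunc_def by (intro exI [of _ "max N M"]) simp
qed (simp_all add: linear_addD [OF field_linear [OF assms(1)]] linear_addD [OF field_linear [OF assms(2)]]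
      linear_scaleD [OF field_linear [OF assms(1)]] linear_scaleD [OF field_linear [OF assms(2)]]
      scale_right_distrib algebra_simps)

lemma field_scale:
  assumes "field scale \<phi>"
  shows "field scale (\<lambda>l w. scale c (\<phi> l w))"
  unfolding field_def
proof (intro conjI allI linearI vector_space_axioms)
  fix w
  show "trunc (\<lambda>n. scale c (\<phi> n w))" using field_trunc [OF assms, of w] unfolding trunc_def by (metis scale_zero_right)
qed (simp_all add: linear_addD [OF field_linear [OF assms(1)]] linear_scaleD [OF field_linear [OF assms(1)]]
      scale_right_distrib mult.commute)

lemma field_vo: "field scale (vo u)"
proof (induction u rule: fock_induct')
  case (add x y)
  then show ?case using field_add [OF add] by (simp add: vo_add [abs_def])
next
  case (scale c x)
  then show ?case using field_scale [OF scale] by (simp add: vo_scale [abs_def])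
next
  case (word ws)
  have "vo (word_vec ws) = vow ws" by (intro ext) simp
  then show ?case by (simp add: field_vow)
qed

lemmas linear_vo = field_linear [OF field_vo]
lemmas trunc_vo = field_trunc [OF field_vo]
lemmas vo_0_right [simp] = linear_zeroD [OF linear_vo]

lemma vo_fvac: "vo fvac l w = (if l = -1 then w else 0)"
  using vo_word [of "[]" l w] by simp

text \<open>Membership of \<open>u\<close> in one degree fixes the sign \<open>eps n\<close> for all
  words in \<open>u\<close>, so the recursion for words extends to their combinations.\<close>

lemma vo_cre:
  assumes "fpr n u = u"
  shows "vo (psi b (- int k - 1) u) l w = nord (gmode b k) (eps n) (vo u) l w"
  using assms
proof (induction u arbitrary: l w rule: fock_induct)
  case zero
  have "vo 0 = (\<lambda>l w. scale 0 (vo 0 l w))" by (intro ext) simp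
  then have "nord (gmode b k) (eps n) (vo 0) l w = 0"
    using nord_scale [OF field_gmode field_vo, of b k "eps n" 0 0 l w] by (metis scale_zero_left)
  moreover have "vo (psi b (- int k - 1) 0) l w = 0" by (simp add: F.A_0)
  ultimately show ?case by (rule trans [OF _ sym, rotated])
next
  case (add x y)
  then show ?case by (simp add: F.A_add vo_add [abs_def] nord_add [OF field_gmode field_vo field_vo])
next
  case (scale c x)
  then show ?case by (simp add: F.A_scale vo_scale [abs_def] nord_scale [OF field_gmode field_vo])
next
  case (word ws)
  have "psi b (- int k - 1) = cre (gen b k)"
    by (simp add: psi_def)
  moreover have "gen b k div 2 = k" by (auto simp: gen_def)
  moreover have "vo (word_vec ws) = vow ws" by (intro ext) simp
  ultimately show ?case using word vo_word [of "gen b k # ws" l w] by simp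
qed

text \<open>\<open>\<kappa> n\<close> is the scalar by which a_m and the mode \<open>n\<close> of
  the k-th divided derivative fail to anticommute. Only \<open>n = k - m - 1\<close> contributes,
  and it lies in exactly one half of the normally ordered product; upper negation gives the same
  value in both cases.\<close>

lemma contraction:
  fixes \<phi> :: "int \<Rightarrow> 'w" and m l :: int and k :: nat
  defines "\<kappa> \<equiv> \<lambda>n. if m + n - int k + 1 = 0 then (-1) ^ k * (of_int n gchoose k) else 0 :: complex"
  assumes M: "M > nat \<bar>m\<bar> + k"
  shows "(\<Sum>i<M. scale (\<kappa> (- int i - 1)) (\<phi> (l + int i))) + (\<Sum>j<M. scale (\<kappa> (int j)) (\<phi> (l - int j - 1)))
    = scale (of_int m gchoose k) (\<phi> (m + l - int k))"
proof -
  define n where "n = int k - m - 1"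
  have c: "(-1) ^ k * (of_int n gchoose k) = (of_int m gchoose k :: complex)"
    using gbinomial_negated_upper [of "of_int m :: complex" k] by (simp add: n_def algebra_simps)
  have k0: "\<kappa> i = (if i = n then of_int m gchoose k else 0)" for i
    using c by (auto simp: \<kappa>_def n_def)
  show ?thesis
  proof (cases "n \<ge> 0")
    case True
    have "(\<Sum>j<M. scale (\<kappa> (int j)) (\<phi> (l - int j - 1)))
        = (\<Sum>j<M. if j = nat n then scale (of_int m gchoose k) (\<phi> (l - n - 1)) else 0)"
      by (rule sum.cong) (use True in \<open>auto simp: k0\<close>)
    also have "\<dots> = scale (of_int m gchoose k) (\<phi> (l - n - 1))"
      by (subst sum.delta) (use M in \<open>auto simp: n_def\<close>)
    also have "l - n - 1 = m + l - int k" by (simp add: n_def)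
    finally show ?thesis using True by (simp add: k0)
  next
    case False
    have "(\<Sum>i<M. scale (\<kappa> (- int i - 1)) (\<phi> (l + int i)))
        = (\<Sum>i<M. if i = nat (- n - 1) then scale (of_int m gchoose k) (\<phi> (l + (- n - 1))) else 0)"
      by (rule sum.cong) (use False in \<open>auto simp: k0\<close>)
    also have "\<dots> = scale (of_int m gchoose k) (\<phi> (l + (- n - 1)))"
      by (subst sum.delta) (use M in \<open>auto simp: n_def\<close>)
    also have "l + (- n - 1) = m + l - int k" by (simp add: n_def)
    finally show ?thesis using False by (simp add: k0)
  qed
qed

lemma anticomm_gmode:
  "A a m (gmode b k n x) = - gmode b k n (A a m x)
    + scale (if a \<noteq> b then (if m + n - int k + 1 = 0 then (-1) ^ k * (of_int n gchoose k) else 0) else 0) x"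
  unfolding gmode_def A_scale by (subst anticomm) (simp add: scale_right_distrib scale_minus_right algebra_simps)

text \<open>The commutator formula [a_m, Y(u)_l] = \<Sum> (m choose j) Y(a_j u)_(m + l - j), with
  signs, for a generating field a. Moving a_m through a normally ordered product contracts it with
  the outer field or commutes it with the inner one, matching the two terms of a_j on a product in
  the Fock space.\<close>

lemma comm_word:
  "A a m (vo (word_vec ws) l w) - scale (eps (word_charge ws)) (vo (word_vec ws) l (A a m w))
    = Sum_any (\<lambda>j::nat. scale (of_int m gchoose j) (vo (psi a (int j) (word_vec ws)) (m + l - int j) w))"
proof (induction ws arbitrary: l w)
  case Nil
  then show ?case by (simp add: psi_fvac vo_fvac)
next
  case (Cons g ws)
  define b where "b = gen_letter g"
  define k where "k = g div 2"
  define u where "u = word_vec ws"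
  define \<eta> where "\<eta> = eps (word_charge ws)"
  define \<zeta> where "\<zeta> j = vo (psi a (int j) u)" for j :: nat
  define h where "h = gmode b k"
  let ?\<phi> = "vo u"
  let ?c = "\<lambda>j::nat. (of_int m gchoose j :: complex)"
  have fh: "field scale h" by (simp add: h_def field_gmode)
  note h_add = linear_addD [OF field_linear [OF fh]] and h_neg = linear_negD [OF field_linear [OF fh]]
    and h_scale = linear_scaleD [OF field_linear [OF fh]] and h_sum = linear_sumD [OF field_linear [OF fh]]
  note p_add = linear_addD [OF linear_vo] and p_neg = linear_negD [OF linear_vo]
    and p_scale = linear_scaleD [OF linear_vo]
  have hu: "fpr (word_charge ws) u = u" by (simp add: u_def fpr_word_vec)
  have cre: "cre g u = psi b (- int k - 1) u" by (simp add: cre_psi b_def k_def)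
  have nd: "vo (cre g u) l w = nord h \<eta> ?\<phi> l w" for l w
    unfolding cre h_def \<eta>_def by (rule vo_cre [OF hu])
  \<comment> \<open>The anticommutation relation in the Fock space: a_j passes the creation operator
    of \<open>g\<close> with a sign, and contracts it exactly for the other letter at
    \<open>j = k\<close>.\<close>
  have nd': "vo (psi a (int j) (cre g u)) l w
      = - nord h (- \<eta>) (\<zeta> j) l w + (if a \<noteq> b \<and> j = k then ?\<phi> l w else 0)" for j l w
  proof -
    have "fpr (word_charge ws + charge a) (psi a (int j) u) = psi a (int j) u"
      by (rule F.pr_A_homogeneous [OF hu])
    from vo_cre [OF this, of b k l w]
    have "vo (psi b (- int k - 1) (psi a (int j) u)) l w = nord h (- \<eta>) (\<zeta> j) l w"
      by (simp add: \<zeta>_def [abs_def] h_def \<eta>_def)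
    moreover have "psi a (int j) (cre g u) = - psi b (- int k - 1) (psi a (int j) u) + (if a \<noteq> b \<and> j = k then u else 0)"
      using F.rel_A [of a "int j" b "- int k - 1" u] by (simp add: cre algebra_simps split: if_splits)
    ultimately show ?thesis by (auto simp: vo_diff vo_neg)
  qed
  obtain J where J: "\<And>j. j \<ge> J \<Longrightarrow> psi a (0 + int j) u = 0"
    using truncE [OF field_trunc [OF field_psi]] by metis
  obtain J' where J': "\<And>j. j \<ge> J' \<Longrightarrow> psi a (0 + int j) (cre g u) = 0"
    using truncE [OF field_trunc [OF field_psi]] by metis
  have \<zeta>0: "\<zeta> j l w = 0" if "j \<ge> J" for j l w using J [OF that] by (simp add: \<zeta>_def)
  have \<zeta>f: "field scale (\<zeta> j)" for j unfolding \<zeta>_def by (rule field_vo)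
  have IH: "A a m (?\<phi> l w) = scale \<eta> (?\<phi> l (A a m w)) + (\<Sum>j<M. scale (?c j) (\<zeta> j (m + l - int j) w))"
    if "M \<ge> J" for M l w
  proof -
    have "Sum_any (\<lambda>j. scale (?c j) (\<zeta> j (m + l - int j) w)) = (\<Sum>j<M. scale (?c j) (\<zeta> j (m + l - int j) w))"
      by (rule Sum_any_lessThan) (use that \<zeta>0 in simp)
    with Cons.IH [of l w] show ?thesis by (simp add: u_def \<eta>_def \<zeta>_def algebra_simps)
  qed
  have ev: "\<forall>\<^sub>F M in sequentially. \<forall>j. nord h (- \<eta>) (\<zeta> j) (m + l - int j) w =
      (\<Sum>i<M. h (- int i - 1) (\<zeta> j (m + l - int j + int i) w))
      + scale (- \<eta>) (\<Sum>i<M. \<zeta> j (m + l - int j - int i - 1) (h (int i) w))"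
  proof -
    have "\<forall>\<^sub>F M in sequentially. \<forall>j\<in>{..<J}. nord h (- \<eta>) (\<zeta> j) (m + l - int j) w =
      (\<Sum>i<M. h (- int i - 1) (\<zeta> j (m + l - int j + int i) w))
      + scale (- \<eta>) (\<Sum>i<M. \<zeta> j (m + l - int j - int i - 1) (h (int i) w))"
      by (intro eventually_ball_finite ballI nord_eventually fh \<zeta>f) simp
    then show ?thesis
    proof (rule eventually_mono, intro allI)
      fix M j
      assume *: "\<forall>j\<in>{..<J}. nord h (- \<eta>) (\<zeta> j) (m + l - int j) w =
        (\<Sum>i<M. h (- int i - 1) (\<zeta> j (m + l - int j + int i) w))
        + scale (- \<eta>) (\<Sum>i<M. \<zeta> j (m + l - int j - int i - 1) (h (int i) w))"
      show "nord h (- \<eta>) (\<zeta> j) (m + l - int j) w =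
        (\<Sum>i<M. h (- int i - 1) (\<zeta> j (m + l - int j + int i) w))
        + scale (- \<eta>) (\<Sum>i<M. \<zeta> j (m + l - int j - int i - 1) (h (int i) w))"
      proof (cases "j < J")
        case True then show ?thesis using * by blast
      next
        case False
        then show ?thesis by (simp add: \<zeta>0 nord_def field_zero [OF fh])
      qed
    qed
  qed
  have "\<forall>\<^sub>F M in sequentially.
    A a m (vo (cre g u) l w) - scale (- \<eta>) (vo (cre g u) l (A a m w))
    = Sum_any (\<lambda>j. scale (?c j) (vo (psi a (int j) (cre g u)) (m + l - int j) w))"
    using nord_eventually [OF fh field_vo, of \<eta> u l w] nord_eventually [OF fh field_vo, of \<eta> u l "A a m w"]
      ev eventually_ge_at_top [of J] eventually_ge_at_top [of J']
      eventually_ge_at_top [of "Suc (nat \<bar>m\<bar> + k)"]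
  proof eventually_elim
    case (elim M)
    define \<kappa> where "\<kappa> n = (if m + n - int k + 1 = 0 then (-1) ^ k * (of_int n gchoose k) else 0 :: complex)" for n
    define \<delta> where "\<delta> = (if a \<noteq> b then 1 else 0 :: complex)"
    have Ah: "A a m (h n x) = - h n (A a m x) + scale \<delta> (scale (\<kappa> n) x)" for n x
      unfolding h_def anticomm_gmode by (simp add: \<kappa>_def \<delta>_def)
    define S1 where "S1 = (\<Sum>i<M. h (- int i - 1) (?\<phi> (l + int i) (A a m w)))"
    define S2 where "S2 = (\<Sum>i<M. \<Sum>j<M. scale (?c j) (h (- int i - 1) (\<zeta> j (m + (l + int i) - int j) w)))"
    define S3 where "S3 = (\<Sum>j<M. ?\<phi> (l - int j - 1) (h (int j) (A a m w)))"
    define S4 where "S4 = (\<Sum>j<M. \<Sum>i<M. scale (?c i) (\<zeta> i (m + (l - int j - 1) - int i) (h (int j) w)))"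
    define K1 where "K1 = (\<Sum>i<M. scale (\<kappa> (- int i - 1)) (?\<phi> (l + int i) w))"
    define K2 where "K2 = (\<Sum>j<M. scale (\<kappa> (int j)) (?\<phi> (l - int j - 1) w))"
    \<comment> \<open>The contractions of both halves together give the single extra term with
      \<open>j = k\<close> on the right side.\<close>
    have K: "K1 + K2 = scale (?c k) (?\<phi> (m + l - int k) w)"
      unfolding K1_def K2_def \<kappa>_def using elim(6) by (intro contraction) simp
    have 1: "A a m (\<Sum>i<M. h (- int i - 1) (?\<phi> (l + int i) w)) = - scale \<eta> S1 - S2 + scale \<delta> K1"
      unfolding S1_def S2_def K1_def linear_sumD [OF linear_A] Ah IH [OF elim(4)] h_add h_scale h_sum
      by (simp add: sum.distrib sum_negf scale_sum_right sum_subtractf)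
    have 2: "A a m (\<Sum>j<M. ?\<phi> (l - int j - 1) (h (int j) w)) = scale \<eta> (scale \<delta> K2 - S3) + S4"
      unfolding S3_def S4_def K2_def linear_sumD [OF linear_A] IH [OF elim(4)] Ah p_add p_neg p_scale
      by (simp add: sum.distrib sum_negf scale_sum_right sum_subtractf scale_right_distrib
        scale_right_diff_distrib mult.commute mult.left_commute)
    have \<eta>\<eta>: "\<eta> * \<eta> = 1" by (simp add: \<eta>_def)
    have L: "A a m (vo (cre g u) l w) - scale (- \<eta>) (vo (cre g u) l (A a m w))
      = - S2 + scale \<delta> (K1 + K2) + scale \<eta> S4"
      unfolding nd elim(1,2) A_add A_scale 1 2
      unfolding S1_def [symmetric] S3_def [symmetric]
      by (simp add: scale_right_distrib scale_right_diff_distrib \<eta>\<eta> scale_minus_left algebra_simps)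
    have "Sum_any (\<lambda>j. scale (?c j) (vo (psi a (int j) (cre g u)) (m + l - int j) w))
        = (\<Sum>j<M. scale (?c j) (vo (psi a (int j) (cre g u)) (m + l - int j) w))"
      by (rule Sum_any_lessThan) (use J' elim(5) in simp)
    also have "\<dots> = (\<Sum>j<M. \<Sum>i<M. - scale (?c j) (h (- int i - 1) (\<zeta> j (m + l - int j + int i) w)))
        + (\<Sum>j<M. \<Sum>i<M. scale \<eta> (scale (?c j) (\<zeta> j (m + l - int j - int i - 1) (h (int i) w))))
        + (\<Sum>j<M. if j = k then scale (?c k) (scale \<delta> (?\<phi> (m + l - int k) w)) else 0)"
      unfolding nd' elim(3) [rule_format] sum.distrib [symmetric]
      by (rule sum.cong) (auto simp: \<delta>_def scale_right_distrib scale_right_diff_distrib scale_sum_right sum_negf sum_subtractf algebra_simps)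
    also have "\<dots> = - S2 + scale \<eta> S4 + scale \<delta> (K1 + K2)"
    proof -
      have "(\<Sum>j<M. \<Sum>i<M. - scale (?c j) (h (- int i - 1) (\<zeta> j (m + l - int j + int i) w))) = - S2"
        unfolding S2_def sum_negf by (subst sum.swap) (simp add: algebra_simps)
      moreover have "(\<Sum>j<M. \<Sum>i<M. scale \<eta> (scale (?c j) (\<zeta> j (m + l - int j - int i - 1) (h (int i) w)))) = scale \<eta> S4"
        unfolding S4_def scale_sum_right by (subst sum.swap) (simp add: algebra_simps)
      moreover have "(\<Sum>j<M. if j = k then scale (?c k) (scale \<delta> (?\<phi> (m + l - int k) w)) else 0) = scale \<delta> (K1 + K2)"
        using elim(6) by (simp add: K mult.commute)
      ultimately show ?thesis by simp
    qed
    finally show ?case unfolding L by (simp add: algebra_simps)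
  qed
  then show ?case by (simp add: u_def \<eta>_def)
qed

lemma comm:
  assumes "fpr n u = u"
  shows "A a m (vo u l w) - scale (eps n) (vo u l (A a m w))
    = Sum_any (\<lambda>j::nat. scale (of_int m gchoose j) (vo (psi a (int j) u) (m + l - int j) w))"
proof -
  have fin: "finite {j. scale (of_int m gchoose j) (vo (psi a (int j) u) (m + l - int j) w) \<noteq> 0}" for u
  proof -
    obtain J where "\<And>j. j \<ge> J \<Longrightarrow> psi a (0 + int j) u = 0"
      using truncE [OF field_trunc [OF field_psi]] by metis
    then show ?thesis by (intro finite_truncated [of J]) simp
  qed
  show ?thesis using assms
  proof (induction u rule: fock_induct)
    case zero show ?case by (simp add: F.A_0)
  next
    case (add x y)
    from arg_cong2 [OF add, of "(+)"] Sum_any.distrib [OF fin fin, of x y] show ?case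
      by (simp add: F.A_add vo_add A_add scale_right_distrib algebra_simps)
  next
    case (scale c x)
    from arg_cong [OF scale, of "scale c"] linear_Sum_any [OF linear_scale fin, of c x] show ?case
      by (simp add: F.A_scale vo_scale A_scale scale_right_diff_distrib mult.commute)
  next
    case (word ws) with comm_word [of a m ws l w] show ?case by simp
  qed
qed

end

interpretation F: clifford fscale psi ..

section \<open>Rationality of products and iterates\<close>

lemma Sum_any_shift:
  fixes f :: "nat \<Rightarrow> 'a::comm_monoid_add"
  assumes "\<And>j. j \<ge> K \<Longrightarrow> f j = 0" "\<And>j. j < n \<Longrightarrow> f j = 0"
  shows "Sum_any f = Sum_any (\<lambda>j. f (n + j))"
  using assms
proof (induction n arbitrary: f)
  case (Suc n)
  have "Sum_any f = Sum_any (\<lambda>j. f (Suc j))"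
    using Sum_any_Suc [of K f] Suc.prems by simp
  also have "\<dots> = Sum_any (\<lambda>j. f (Suc (n + j)))"
    by (rule Suc.IH) (use Suc.prems in auto)
  finally show ?case by simp
qed simp

lemma trunc2I:
  assumes "utrunc H" "\<And>m. trunc (H m)"
  shows "trunc2 H"
  unfolding trunc2_def
proof (intro allI)
  fix m n
  obtain K where K: "\<And>k n. k \<ge> K \<Longrightarrow> H (m + int k) n = 0" using utruncE [OF assms(1)] by metis
  have "\<exists>L. \<forall>i<K. \<forall>j\<ge>L. H (m + int i) (n + int j) = 0"
    by (rule common_bound) (metis truncE [OF assms(2)])
  then obtain L where L: "\<forall>i<K. \<forall>j\<ge>L. H (m + int i) (n + int j) = 0" by blast
  have "H (m + int i) (n + int j) = 0" if "i \<ge> max K L \<or> j \<ge> max K L" for i j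
    using K L that by (cases "i < K") auto
  then show "\<exists>K. \<forall>i j. i \<ge> K \<or> j \<ge> K \<longrightarrow> H (m + int i) (n + int j) = 0" by blast
qed

lemma utrunc_comp: "field s \<phi> \<Longrightarrow> trunc f \<Longrightarrow> utrunc (\<lambda>n m. \<phi> m (f n))"
  unfolding trunc_def utrunc_def using linear_zeroD [OF field_linear] by metis

context complex_vs
begin

text \<open>Multiplication by the creation part of g at x1. It brings in no poles, so it commutes
  with powers of x1 - x2 and passes into the numerator.\<close>

definition star :: "(int \<Rightarrow> 'w \<Rightarrow> 'w) \<Rightarrow> (int \<Rightarrow> int \<Rightarrow> 'w) \<Rightarrow> int \<Rightarrow> int \<Rightarrow> 'w" where
  "star g H m n = Sum_any (\<lambda>i::nat. g (- int i - 1) (H (m + int i) n))"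

lemma star_eq:
  assumes "field scale g" "\<And>k. k \<ge> K \<Longrightarrow> H (m + int k) n = 0"
  shows "star g H m n = (\<Sum>i<K. g (- int i - 1) (H (m + int i) n))"
  unfolding star_def by (rule Sum_any_lessThan) (simp add: assms field_zero)

lemma dif_pow_star:
  assumes g: "field scale g" and H: "trunc2 H"
  shows "(dif ^^ k) (star g H) m n = star g ((dif ^^ k) H) m n"
proof (induction k arbitrary: m n)
  case (Suc k)
  let ?H = "(dif ^^ k) H"
  have tr: "trunc2 ?H" by (rule trunc2_dif_pow [OF H])
  obtain K where K: "\<And>i. i \<ge> K \<Longrightarrow> ?H (m + 1 + int i) n = 0"
    using truncE [OF trunc2_col [OF tr]] by metis
  obtain L where L: "\<And>i. i \<ge> L \<Longrightarrow> ?H (m + int i) (n + 1) = 0"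
    using truncE [OF trunc2_col [OF tr]] by metis
  let ?M = "max K L"
  have "star g ?H (m + 1) n - star g ?H m (n + 1) = star g ((dif ^^ Suc k) H) m n"
    by (subst (1 2 3) star_eq [OF g, where K = ?M])
      (use K L in \<open>auto simp: dif_def linear_diffD [OF field_linear [OF g]] sum_subtractf algebra_simps\<close>)
  then show ?case by (simp only: dif_pow_Suc [of k "star g H"] Suc)
qed simp

lemma bounded2_star:
  assumes g: "field scale g" and H: "bounded2 H"
  shows "bounded2 (star g H)"
proof -
  obtain N where N: "\<And>m n. m \<ge> N \<or> n \<ge> N \<Longrightarrow> H m n = 0" using bounded2E [OF H] by metis
  show ?thesis unfolding bounded2_def
    by (rule exI [of _ N]) (auto simp: star_def N field_zero [OF g])
qed

text \<open>The creation part of g at x2 + x0 is \<Sum> ((i + j) choose i) g_(- i - j - 1) x0^i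
  x2^j; the same double sum appears in the iterate.\<close>

lemma subst2_star:
  assumes g: "field scale g" and H: "bounded2 H"
  shows "subst2 scale (star g H) a b
    = Sum_any (\<lambda>i. Sum_any (\<lambda>j. scale (of_nat ((i + j) choose i))
        (g (- int i - int j - 1) (subst2 scale H (a + int i) (b + int j)))))"
proof -
  obtain N where N: "\<And>m n. m \<ge> N \<or> n \<ge> N \<Longrightarrow> H m n = 0" using bounded2E [OF H] by metis
  obtain K where K: "\<And>i j. i \<ge> K \<or> j \<ge> K \<Longrightarrow> subst2 scale H (a + int i) (b + int j) = 0"
    using trunc2E [OF trunc2_subst2 [OF H]] by metis
  define L where "L = max K (nat (2 * N - a - b + 1))"
  note lin = linear_sumD [OF field_linear [OF g]] linear_scaleD [OF field_linear [OF g]]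
  have bs: "bounded2 (\<lambda>m n. g (- int l - 1) (H (m + int l) n))" for l
    using bounded2_map [OF bounded2_shift [OF H, of "int l" 0], of "g (- int l - 1)"] by (simp add: field_zero [OF g])
  have bs': "bounded2 (\<lambda>m n. H (m + int l) n)" for l
    using bounded2_shift [OF H, of "int l" 0] by simp
  have "subst2 scale (star g H) a b = subst2 scale (\<lambda>m n. \<Sum>l<2*L. g (- int l - 1) (H (m + int l) n)) a b"
  proof (rule subst2_cong)
    fix m
    have "H (m + int k) (b - m + a) = 0" if "k \<ge> 2 * L" for k
    proof -
      have "int k \<ge> 2 * N - a - b" using that unfolding L_def by linarith
      then have "m + int k \<ge> N \<or> b - m + a \<ge> N" by linarith
      then show ?thesis by (rule N)
    qed
    then show "star g H m (b - m + a) = (\<Sum>l<2*L. g (- int l - 1) (H (m + int l) (b - m + a)))"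
      by (rule star_eq [OF g])
  qed
  also have "\<dots> = (\<Sum>l<2*L. \<Sum>j\<le>l. scale (of_nat (l choose j))
      (g (- int l - 1) (subst2 scale H (a + int j) (b + int (l - j)))))"
    by (simp add: subst2_sum bs linear_subst2 [OF field_linear [OF g] bs', symmetric] subst2_shift_pow [OF H] lin)
  also have "\<dots> = (\<Sum>l<2*L. \<Sum>j\<le>l. scale (of_nat ((j + (l - j)) choose j))
      (g (- int j - int (l - j) - 1) (subst2 scale H (a + int j) (b + int (l - j)))))"
    by (intro sum.cong) (auto simp: of_nat_diff)
  also have "\<dots> = (\<Sum>i<L. \<Sum>j<L. scale (of_nat ((i + j) choose i))
        (g (- int i - int j - 1) (subst2 scale H (a + int i) (b + int j))))"
    by (rule sum_square_triangle [symmetric]) (use K in \<open>auto simp: L_def field_zero [OF g]\<close>)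
  also have "\<dots> = Sum_any (\<lambda>i. Sum_any (\<lambda>j. scale (of_nat ((i + j) choose i))
        (g (- int i - int j - 1) (subst2 scale H (a + int i) (b + int j)))))"
  proof -
    have "Sum_any (\<lambda>j. scale (of_nat ((i + j) choose i))
        (g (- int i - int j - 1) (subst2 scale H (a + int i) (b + int j))))
      = (\<Sum>j<L. scale (of_nat ((i + j) choose i))
        (g (- int i - int j - 1) (subst2 scale H (a + int i) (b + int j))))" for i
      by (rule Sum_any_lessThan) (simp add: K L_def field_zero [OF g])
    moreover have "Sum_any (\<lambda>i. \<Sum>j<L. scale (of_nat ((i + j) choose i))
        (g (- int i - int j - 1) (subst2 scale H (a + int i) (b + int j))))
      = (\<Sum>i<L. \<Sum>j<L. scale (of_nat ((i + j) choose i))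
        (g (- int i - int j - 1) (subst2 scale H (a + int i) (b + int j))))"
      by (rule Sum_any_lessThan) (simp add: K L_def field_zero [OF g])
    ultimately show ?thesis by simp
  qed
  finally show ?thesis .
qed

text \<open>Indexed by the mode \<open>j\<close> of the annihilation operator from which the pole
  arises in \<open>P2_psi\<close>; the terms with \<open>j < i\<close> are zero.\<close>

lemma kop_alt:
  assumes "utrunc (\<lambda>n m. H m n)"
  shows "kop scale i H m n = Sum_any (\<lambda>j. scale (of_nat (j choose i)) (H (m - int j - 1) (n + int j - int i)))"
proof -
  obtain K where K: "\<And>k m. k \<ge> K \<Longrightarrow> H m (n + int k) = 0" using utruncE [OF assms] by metis
  have "H (m - int j - 1) (n + int j - int i) = 0" if "j \<ge> K + i" for j
    using K [of "j - i" "m - int j - 1"] that by (simp add: of_nat_diff add_diff_eq)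
  then have "Sum_any (\<lambda>j. scale (of_nat (j choose i)) (H (m - int j - 1) (n + int j - int i)))
      = Sum_any (\<lambda>j. scale (of_nat ((i + j) choose i)) (H (m - int (i + j) - 1) (n + int (i + j) - int i)))"
    by (intro Sum_any_shift [of "K + i"]) simp_all
  also have "\<dots> = kop scale i H m n"
    by (simp add: kop_def zop_def algebra_simps)
  finally show ?thesis by simp
qed

end

context clifford
begin

lemma trinomial: "(of_int m gchoose (n + j)) * (of_nat (n + j) gchoose n) = ((of_int m gchoose n) * (of_int (m - int n) gchoose j) :: complex)"
  using gbinomial_trinomial_revision [of n "n + j" "of_int m :: complex"] by simp

text \<open>Divided derivatives of the commutator formula. By trinomial revision the index moves
  from \<open>j\<close> to \<open>n + j\<close>, and the terms with index below \<open>n\<close> are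
  zero because the corresponding modes of \<open>gmode\<close> vanish.\<close>

lemma comm_gmode:
  assumes "fpr q v = v"
  shows "gmode a n m (vo v l w) - scale (eps q) (vo v l (gmode a n m w))
    = Sum_any (\<lambda>j::nat. scale (of_int m gchoose j) (vo (F.gmode a n (int j) v) (m + l - int j) w))"
proof -
  let ?c = "(-1) ^ n * (of_int m gchoose n) :: complex"
  obtain J where J: "\<And>j. j \<ge> J \<Longrightarrow> psi a (0 + int j) v = 0"
    using truncE [OF field_trunc [OF field_psi]] by metis
  obtain J' where J': "\<And>j. j \<ge> J' \<Longrightarrow> F.gmode a n (0 + int j) v = 0"
    using truncE [OF field_trunc [OF F.field_gmode]] by metis
  have fin: "finite {j. scale (of_int (m - int n) gchoose j) (vo (psi a (int j) v) (m - int n + l - int j) w) \<noteq> 0}"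
    using J by (intro finite_truncated [of J]) simp
  have "gmode a n m (vo v l w) - scale (eps q) (vo v l (gmode a n m w))
      = scale ?c (A a (m - int n) (vo v l w) - scale (eps q) (vo v l (A a (m - int n) w)))"
    by (simp add: gmode_def linear_scaleD [OF linear_vo] scale_right_diff_distrib mult.commute)
  also have "\<dots> = Sum_any (\<lambda>j. scale ?c (scale (of_int (m - int n) gchoose j) (vo (psi a (int j) v) (m - int n + l - int j) w)))"
    unfolding comm [OF assms] by (rule linear_Sum_any [OF linear_scale fin])
  also have "\<dots> = Sum_any (\<lambda>j. scale (of_int m gchoose (n + j)) (vo (F.gmode a n (int (n + j)) v) (m + l - int (n + j)) w))"
  proof (rule Sum_any.cong)
    fix j
    have "(of_int m gchoose (n + j)) * ((-1) ^ n * (of_int (int (n + j)) gchoose n))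
        = ?c * (of_int (m - int n) gchoose j)"
      using trinomial [of m n j] by (simp add: mult.left_commute mult.commute)
    then show "scale ?c (scale (of_int (m - int n) gchoose j) (vo (psi a (int j) v) (m - int n + l - int j) w))
      = scale (of_int m gchoose (n + j)) (vo (F.gmode a n (int (n + j)) v) (m + l - int (n + j)) w)"
      unfolding F.gmode_def vo_scale scale_scale by (simp only:) (simp add: algebra_simps)
  qed
  also have "\<dots> = Sum_any (\<lambda>j. scale (of_int m gchoose j) (vo (F.gmode a n (int j) v) (m + l - int j) w))"
    using J' by (intro Sum_any_shift [symmetric, of J']) (simp_all add: F.gmode_nonneg)
  finally show ?thesis .
qed

text \<open>Summed against x0^i this is the normally ordered product of the field of
  \<open>u\<close> at x2 with the n-th divided derivative of a taken at x2 + x0; the sign (-1)^i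
  comes from expanding (x2 + x0)^(-j-1).\<close>

lemma vo_gmode:
  assumes "fpr q u = u"
  shows "vo (F.gmode a n (- int i - 1) u) l w
    = Sum_any (\<lambda>j. scale (of_nat ((i + j) choose i)) (gmode a n (- int i - int j - 1) (vo u (l + int j) w)))
    + scale (eps q * (-1) ^ i) (Sum_any (\<lambda>j. scale (of_nat ((i + j) choose i))
        (vo u (l - int i - int j - 1) (gmode a n (int j) w))))"
proof -
  let ?b = "of_nat ((n + i) choose n) :: complex"
  obtain K where K: "\<And>k. k \<ge> K \<Longrightarrow> vo u (l + int k) w = 0"
    using truncE [OF trunc_vo] by metis
  obtain J where J: "\<And>j. j \<ge> J \<Longrightarrow> gmode a (n + i) (0 + int j) w = 0"
    using truncE [OF field_trunc [OF field_gmode]] by metis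
  have "vo (F.gmode a n (- int i - 1) u) l w = scale ?b (nord (gmode a (n + i)) (eps q) (vo u) l w)"
    by (simp only: F.gmode_neg vo_scale vo_cre [OF assms])
  also have "\<dots> = scale ?b (Sum_any (\<lambda>j. gmode a (n + i) (- int j - 1) (vo u (l + int j) w)))
      + scale (eps q) (scale ?b (Sum_any (\<lambda>j. vo u (l - int j - 1) (gmode a (n + i) (int j) w))))"
    by (simp add: nord_def scale_right_distrib mult.commute)
  also have "scale ?b (Sum_any (\<lambda>j. gmode a (n + i) (- int j - 1) (vo u (l + int j) w)))
      = Sum_any (\<lambda>j. scale ?b (gmode a (n + i) (- int j - 1) (vo u (l + int j) w)))"
    by (rule linear_Sum_any [OF linear_scale finite_truncated [of K]])
      (simp add: K field_zero [OF field_gmode])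
  also have "\<dots> = Sum_any (\<lambda>j. scale (of_nat ((i + j) choose i)) (gmode a n (- int i - int j - 1) (vo u (l + int j) w)))"
  proof (rule Sum_any.cong)
    fix j
    have "((n + i + j) choose (n + i)) * ((n + i) choose n) = ((n + i + j) choose n) * ((i + j) choose i)"
      using choose_mult [of n "n + i" "n + i + j"] by (simp add: add.assoc)
    then have "of_nat ((n + i) choose n) * of_nat ((n + i + j) choose (n + i))
        = (of_nat ((i + j) choose i) * of_nat ((n + (i + j)) choose n) :: complex)"
      by (simp only: of_nat_mult [symmetric] add.assoc mult.commute)
    then show "scale ?b (gmode a (n + i) (- int j - 1) (vo u (l + int j) w))
        = scale (of_nat ((i + j) choose i)) (gmode a n (- int i - int j - 1) (vo u (l + int j) w))"
      using gmode_neg [of a n "i + j" "vo u (l + int j) w"]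
      by (simp add: gmode_neg diff_diff_eq add.assoc)
  qed
  also have "scale ?b (Sum_any (\<lambda>j. vo u (l - int j - 1) (gmode a (n + i) (int j) w)))
      = Sum_any (\<lambda>j. scale ?b (vo u (l - int j - 1) (gmode a (n + i) (int j) w)))"
    by (rule linear_Sum_any [OF linear_scale finite_truncated [of J]])
      (use J in simp)
  also have "\<dots> = Sum_any (\<lambda>j. scale ?b (vo u (l - int (i + j) - 1) (gmode a (n + i) (int (i + j)) w)))"
    using J by (intro Sum_any_shift [of J]) (simp_all add: gmode_nonneg)
  also have "\<dots> = Sum_any (\<lambda>j. scale ((-1) ^ i) (scale (of_nat ((i + j) choose i))
        (vo u (l - int i - int j - 1) (gmode a n (int j) w))))"
  proof (rule Sum_any.cong)
    fix j
    have "(of_int (int (i + j)) gchoose (i + n)) * of_nat ((i + n) choose i)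
        = (of_nat ((i + j) choose i) * (of_int (int j) gchoose n) :: complex)"
      using trinomial [of "int (i + j)" i n] by (simp add: binomial_gbinomial)
    moreover have "(n + i) choose n = (i + n) choose i"
      using binomial_symmetric [of n "n + i"] by (simp add: add.commute)
    ultimately have "?b * ((-1) ^ (n + i) * (of_int (int (i + j)) gchoose (n + i)))
        = (-1) ^ i * (of_nat ((i + j) choose i) * ((-1) ^ n * (of_int (int j) gchoose n)))"
      by (simp add: power_add add.commute mult.left_commute mult.commute)
    then show "scale ?b (vo u (l - int (i + j) - 1) (gmode a (n + i) (int (i + j)) w))
      = scale ((-1) ^ i) (scale (of_nat ((i + j) choose i)) (vo u (l - int i - int j - 1) (gmode a n (int j) w)))"
      unfolding gmode_def linear_scaleD [OF linear_vo] scale_scale by (simp only: mult.assoc) (simp add: algebra_simps)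
  qed
  also have "\<dots> = scale ((-1) ^ i) (Sum_any (\<lambda>j. scale (of_nat ((i + j) choose i))
        (vo u (l - int i - int j - 1) (gmode a n (int j) w))))"
  proof -
    obtain J' where J': "\<And>j. j \<ge> J' \<Longrightarrow> gmode a n (0 + int j) w = 0"
      using truncE [OF field_trunc [OF field_gmode]] by metis
    show ?thesis
      by (rule linear_Sum_any [OF linear_scale finite_truncated [of J'], symmetric]) (use J' in simp)
  qed
  finally show ?thesis by simp
qed

end

section \<open>Charges of fields\<close>

locale graded_clifford = clifford scale A + graded_deformed_ops scale 0 A pr
  for scale :: "complex \<Rightarrow> 'w::ab_group_add \<Rightarrow> 'w" and A pr
begin

lemma pr_gmode: "pr (n + charge a) (gmode a k m x) = gmode a k m (pr n x)"
  by (simp add: gmode_def linear_scaleD [OF linear_pr] pr_A)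

lemma pr_vow: "pr (n + word_charge ws) (vow ws l x) = vow ws l (pr n x)"
proof (induction ws arbitrary: n l x)
  case (Cons g ws)
  let ?g = "gmode (gen_letter g) (g div 2)" and ?c = "charge (gen_letter g)"
  obtain K where K: "\<And>k. k \<ge> K \<Longrightarrow> vow ws (l + int k) x = 0"
    using truncE [OF field_trunc [OF field_vow]] by metis
  obtain J where J: "\<And>j. j \<ge> J \<Longrightarrow> ?g (0 + int j) x = 0"
    using truncE [OF field_trunc [OF field_gmode]] by metis
  have 1: "pr (n + word_charge (g # ws)) (Sum_any (\<lambda>i. ?g (- int i - 1) (vow ws (l + int i) x)))
      = Sum_any (\<lambda>i. ?g (- int i - 1) (vow ws (l + int i) (pr n x)))"
  proof -
    have "pr (n + word_charge (g # ws)) (?g (- int i - 1) (vow ws (l + int i) x))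
        = ?g (- int i - 1) (vow ws (l + int i) (pr n x))" for i
      using pr_gmode [of "n + word_charge ws" "gen_letter g"] Cons.IH by (simp add: algebra_simps)
    then show ?thesis
      by (subst linear_Sum_any [OF linear_pr finite_truncated [of K]])
        (simp_all add: K field_zero [OF field_gmode])
  qed
  have 2: "pr (n + word_charge (g # ws)) (Sum_any (\<lambda>j. vow ws (l - int j - 1) (?g (int j) x)))
      = Sum_any (\<lambda>j. vow ws (l - int j - 1) (?g (int j) (pr n x)))"
  proof -
    have "pr (n + word_charge (g # ws)) (vow ws (l - int j - 1) (?g (int j) x))
        = vow ws (l - int j - 1) (?g (int j) (pr n x))" for j
      using pr_gmode [of n "gen_letter g"] Cons.IH [of "n + ?c"] by (simp add: add.assoc)
    then show ?thesis
      by (subst linear_Sum_any [OF linear_pr finite_truncated [of J]])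
        (use J in \<open>simp_all add: field_zero [OF field_vow]\<close>)
  qed
  show ?case
    unfolding vow.simps nord_def linear_addD [OF linear_pr] linear_scaleD [OF linear_pr] 1 2 ..
qed auto

lemma pr_vo:
  assumes "fpr p u = u"
  shows "pr (n + p) (vo u l x) = vo u l (pr n x)"
  using assms
proof (induction u rule: fock_induct)
  case (word ws)
  then show ?case using pr_vow [of n ws l x] by simp
qed (simp_all add: vo_add vo_scale linear_addD [OF linear_pr] linear_scaleD [OF linear_pr])

end

interpretation F: graded_clifford fscale psi fpr ..

lemma fpr_F_vo:
  assumes "fpr p u = u" "fpr q v = v"
  shows "fpr (p + q) (F.vo u l v) = F.vo u l v"
  using F.pr_vo [OF assms(1), of q l v] assms(2) by (simp add: add.commute)

section \<open>Products, opposite products and iterates of two fields\<close>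

context clifford
begin

definition P2 :: "fock \<Rightarrow> fock \<Rightarrow> 'w \<Rightarrow> int \<Rightarrow> int \<Rightarrow> 'w" where
  "P2 u v w m n = vo u m (vo v n w)"

definition B2 :: "fock \<Rightarrow> fock \<Rightarrow> 'w \<Rightarrow> int \<Rightarrow> int \<Rightarrow> 'w" where
  "B2 u v w m n = vo v n (vo u m w)"

definition I2 :: "fock \<Rightarrow> fock \<Rightarrow> 'w \<Rightarrow> int \<Rightarrow> int \<Rightarrow> 'w" where
  "I2 u v w a b = vo (F.vo u a v) b w"

lemma trunc2_P2: "trunc2 (P2 u v w)"
  unfolding P2_def by (rule trunc2_comp [OF field_vo trunc_vo])

lemma utrunc_P2: "utrunc (\<lambda>n m. P2 u v w m n)"
  unfolding P2_def by (rule utrunc_comp [OF field_vo trunc_vo])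

lemma trunc2_B2: "trunc2 (B2 u v w)"
  unfolding B2_def by (rule trunc2_flip [OF trunc2_comp [OF field_vo trunc_vo]])

lemma utrunc_B2: "utrunc (B2 u v w)"
  using utrunc_comp [OF field_vo trunc_vo, of v u w] by (simp add: B2_def [abs_def])

lemma utrunc_I2: "utrunc (I2 u v w)"
proof -
  obtain N where "\<And>n. n \<ge> N \<Longrightarrow> F.vo u n v = 0" using F.trunc_vo [of u v] by (auto simp: trunc_def)
  then show ?thesis unfolding utrunc_def I2_def by (intro exI [of _ N]) simp
qed

lemma trunc2_I2: "trunc2 (I2 u v w)"
proof (rule trunc2I [OF utrunc_I2])
  fix m
  have "I2 u v w m = (\<lambda>b. vo (F.vo u m v) b w)" by (intro ext) (simp add: I2_def)
  then show "trunc (I2 u v w m)" by (simp add: trunc_vo)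
qed

text \<open>
  Locality and associativity of \<open>u\<close> and \<open>v\<close> on \<open>w\<close>: both products and the iterate are expansions of
  \<open>(x1 - x2)^(-k) G(x1, x2)\<close>.
\<close>

definition rat :: "nat \<Rightarrow> complex \<Rightarrow> fock \<Rightarrow> fock \<Rightarrow> 'w \<Rightarrow> (int \<Rightarrow> int \<Rightarrow> 'w) \<Rightarrow> bool" where
  "rat k e u v w G \<longleftrightarrow> bounded2 G \<and> (\<forall>m n. (dif ^^ k) (P2 u v w) m n = G m n) \<and>
     (\<forall>m n. (dif ^^ k) (B2 u v w) m n = scale e (G m n)) \<and>
     (\<forall>a b. I2 u v w (a + int k) b = subst2 scale G a b)"

lemma ratD:
  assumes "rat k e u v w G"
  shows "bounded2 G" "(dif ^^ k) (P2 u v w) = G" "(dif ^^ k) (B2 u v w) = (\<lambda>m n. scale e (G m n))"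
    "\<And>a b. I2 u v w (a + int k) b = subst2 scale G a b"
  using assms by (auto intro!: ext simp: rat_def)

lemma rat_mono:
  assumes "rat k e u v w G"
  shows "rat (j + k) e u v w ((dif ^^ j) G)"
proof -
  have b: "bounded2 G" and P: "(dif ^^ k) (P2 u v w) = G"
    and B: "(dif ^^ k) (B2 u v w) = (\<lambda>m n. scale e (G m n))"
    and I: "\<And>a b. I2 u v w (a + int k) b = subst2 scale G a b"
    by (fact ratD [OF assms])+
  have "I2 u v w (a + int (j + k)) b = subst2 scale ((dif ^^ j) G) a b" for a b
    using I [of "a + int j" b] by (simp add: subst2_dif_pow [OF b] add.assoc)
  then show ?thesis
    unfolding rat_def by (simp add: funpow_add P B bounded2_dif_pow [OF b] dif_pow_scale)
qed

text \<open>The annihilation part of the new field at x1 is moved through Y(v, x2) to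
  \<open>w\<close>. On \<open>w\<close> only modes below \<open>J\<close> survive, which gives the
  sum over \<open>j\<close>; the commutators with \<open>v\<close> give poles (x1 - x2)^(-i-1),
  whose order is bounded by \<open>I\<close>.\<close>

lemma P2_psi:
  assumes u: "fpr p u = u" and v: "fpr q v = v" and u': "u' = psi a (- int n - 1) u"
    and J: "\<And>j. j \<ge> J \<Longrightarrow> gmode a n (int j) w = 0"
    and I: "\<And>i. i \<ge> I \<Longrightarrow> F.gmode a n (int i) v = 0"
  shows "P2 u' v w m l = star (gmode a n) (P2 u v w) m l
    + scale (eps p * eps q) (\<Sum>j<J. P2 u v (gmode a n (int j) w) (m - int j - 1) l)
    + scale (eps p) (\<Sum>i<I. kop scale i (P2 u (F.gmode a n (int i) v) w) m l)"
proof -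
  let ?g = "gmode a n" and ?gF = "\<lambda>i. F.gmode a n (int i) v"
  have N: "vo u' m x = nord ?g (eps p) (vo u) m x" for m x
    unfolding u' by (rule vo_cre [OF u])
  have "\<forall>\<^sub>F M in sequentially. Sum_any (\<lambda>j. vo u (m - int j - 1) (?g (int j) (vo v l w)))
      = (\<Sum>j<M. vo u (m - int j - 1) (?g (int j) (vo v l w)))"
  proof -
    obtain K where "\<And>j. j \<ge> K \<Longrightarrow> ?g (0 + int j) (vo v l w) = 0"
      using truncE [OF field_trunc [OF field_gmode]] by metis
    then show ?thesis by (intro eventually_Sum_any [of K]) simp
  qed
  moreover have "\<forall>\<^sub>F M in sequentially. \<forall>i\<in>{..<I}. kop scale i (P2 u (?gF i) w) m l
      = (\<Sum>j<M. scale (of_nat (j choose i)) (P2 u (?gF i) w (m - int j - 1) (l + int j - int i)))"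
  proof (intro eventually_ball_finite ballI)
    fix i
    obtain K where K: "\<And>k. k \<ge> K \<Longrightarrow> vo (?gF i) (l + int k) w = 0" using truncE [OF trunc_vo] by metis
    have "vo (?gF i) (l + int j - int i) w = 0" if "j \<ge> K + i" for j
      using K [of "j - i"] that by (simp add: of_nat_diff add_diff_eq)
    then show "\<forall>\<^sub>F M in sequentially. kop scale i (P2 u (?gF i) w) m l
      = (\<Sum>j<M. scale (of_nat (j choose i)) (P2 u (?gF i) w (m - int j - 1) (l + int j - int i)))"
      unfolding kop_alt [OF utrunc_P2] by (intro eventually_Sum_any [of "K + i"]) (simp add: P2_def)
  qed simp
  ultimately have "\<forall>\<^sub>F M in sequentially. Sum_any (\<lambda>j. vo u (m - int j - 1) (?g (int j) (vo v l w)))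
      = scale (eps q) (\<Sum>j<J. P2 u v (?g (int j) w) (m - int j - 1) l)
        + (\<Sum>i<I. kop scale i (P2 u (?gF i) w) m l)"
    using eventually_ge_at_top [of J]
  proof eventually_elim
    case (elim M)
    have c: "?g (int j) (vo v l w) = scale (eps q) (vo v l (?g (int j) w))
        + (\<Sum>i<I. scale (of_nat (j choose i)) (vo (?gF i) (l + int j - int i) w))" for j
    proof -
      have "Sum_any (\<lambda>i. scale (of_int (int j) gchoose i) (vo (?gF i) (int j + l - int i) w))
        = (\<Sum>i<I. scale (of_int (int j) gchoose i) (vo (?gF i) (int j + l - int i) w))"
        by (rule Sum_any_lessThan) (simp add: I)
      with comm_gmode [OF v, of a n "int j" l w] show ?thesis
        by (simp add: binomial_gbinomial algebra_simps)
    qed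
    have "(\<Sum>j<M. P2 u v (?g (int j) w) (m - int j - 1) l) = (\<Sum>j<J. P2 u v (?g (int j) w) (m - int j - 1) l)"
      by (rule sum.mono_neutral_right) (use elim(3) J in \<open>auto simp: P2_def not_less\<close>)
    moreover have "(\<Sum>j<M. \<Sum>i<I. scale (of_nat (j choose i)) (vo u (m - int j - 1) (vo (?gF i) (l + int j - int i) w)))
        = (\<Sum>i<I. kop scale i (P2 u (?gF i) w) m l)"
      by (subst sum.swap) (use elim(2) in \<open>auto simp: P2_def intro!: sum.cong\<close>)
    ultimately show ?case
      unfolding elim(1) unfolding c linear_addD [OF linear_vo] linear_scaleD [OF linear_vo] linear_sumD [OF linear_vo]
        sum.distrib scale_sum_right [symmetric]
      by (simp add: P2_def)
  qed
  then have *: "Sum_any (\<lambda>j. vo u (m - int j - 1) (?g (int j) (vo v l w)))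
      = scale (eps q) (\<Sum>j<J. P2 u v (?g (int j) w) (m - int j - 1) l)
        + (\<Sum>i<I. kop scale i (P2 u (?gF i) w) m l)" by simp
  have "P2 u' v w m l = star ?g (P2 u v w) m l
      + scale (eps p) (Sum_any (\<lambda>j. vo u (m - int j - 1) (?g (int j) (vo v l w))))"
    by (simp add: P2_def N nord_def star_def)
  then show ?thesis unfolding * by (simp add: scale_right_distrib)
qed

text \<open>In the opposite order it is the creation part that has to be moved, leftwards through
  Y(v, x2). The commutators give the same poles as for the product, up to sign and expanded in
  nonnegative powers of x1.\<close>

lemma B2_psi:
  assumes u: "fpr p u = u" and v: "fpr q v = v" and u': "u' = psi a (- int n - 1) u"
    and J: "\<And>j. j \<ge> J \<Longrightarrow> gmode a n (int j) w = 0"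
    and I: "\<And>i. i \<ge> I \<Longrightarrow> F.gmode a n (int i) v = 0"
  shows "B2 u' v w m l = scale (eps q) (star (gmode a n) (B2 u v w) m l)
    + scale (eps p) (\<Sum>j<J. B2 u v (gmode a n (int j) w) (m - int j - 1) l)
    - scale (eps q) (\<Sum>i<I. scale ((-1) ^ i) (zop scale 1 i (B2 u (F.gmode a n (int i) v) w) m l))"
proof -
  let ?g = "gmode a n" and ?gF = "\<lambda>i. F.gmode a n (int i) v"
  obtain K where K: "\<And>k. k \<ge> K \<Longrightarrow> vo u (m + int k) w = 0" using truncE [OF trunc_vo] by metis
  have c: "vo v l (?g (- int t - 1) x) = scale (eps q) (?g (- int t - 1) (vo v l x))
      - scale (eps q) (\<Sum>i<I. scale ((-1) ^ i * of_nat ((t + i) choose i)) (vo (?gF i) (l - int t - int i - 1) x))" for t x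
  proof -
    have "Sum_any (\<lambda>i. scale (of_int (- int t - 1) gchoose i) (vo (?gF i) (- int t - 1 + l - int i) x))
      = (\<Sum>i<I. scale (of_int (- int t - 1) gchoose i) (vo (?gF i) (- int t - 1 + l - int i) x))"
      by (rule Sum_any_lessThan) (simp add: I)
    with comm_gmode [OF v, of a n "- int t - 1" l x]
    have "scale (eps q) (?g (- int t - 1) (vo v l x)) - vo v l (?g (- int t - 1) x)
      = scale (eps q) (\<Sum>i<I. scale (of_int (- int t - 1) gchoose i) (vo (?gF i) (- int t - 1 + l - int i) x))"
      by (metis (no_types, lifting) eps_eps scale_one scale_right_diff_distrib scale_scale)
    then show ?thesis unfolding neg_gchoose by (simp add: algebra_simps)
  qed
  have z: "zop scale 1 i (B2 u (?gF i) w) m l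
      = (\<Sum>t<K. scale (of_nat ((t + i) choose i)) (B2 u (?gF i) w (m + int t) (l - int t - int i - 1)))" for i
    by (subst zop_eq [where K = K]) (simp_all add: B2_def K)
  have s: "star ?g (B2 u v w) m l = (\<Sum>t<K. ?g (- int t - 1) (B2 u v w (m + int t) l))"
    by (rule star_eq [OF field_gmode]) (simp add: B2_def K)
  have "vo u' m w = Sum_any (\<lambda>t. ?g (- int t - 1) (vo u (m + int t) w))
      + scale (eps p) (Sum_any (\<lambda>j. vo u (m - int j - 1) (?g (int j) w)))"
    unfolding u' vo_cre [OF u] nord_def ..
  also have "Sum_any (\<lambda>t. ?g (- int t - 1) (vo u (m + int t) w)) = (\<Sum>t<K. ?g (- int t - 1) (vo u (m + int t) w))"
    by (rule Sum_any_lessThan) (simp add: K field_zero [OF field_gmode])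
  also have "Sum_any (\<lambda>j. vo u (m - int j - 1) (?g (int j) w)) = (\<Sum>j<J. vo u (m - int j - 1) (?g (int j) w))"
    by (rule Sum_any_lessThan) (simp add: J)
  finally have "B2 u' v w m l = (\<Sum>t<K. vo v l (?g (- int t - 1) (vo u (m + int t) w)))
      + scale (eps p) (\<Sum>j<J. B2 u v (?g (int j) w) (m - int j - 1) l)"
    by (simp add: B2_def linear_addD [OF linear_vo] linear_scaleD [OF linear_vo] linear_sumD [OF linear_vo])
  also have "(\<Sum>t<K. vo v l (?g (- int t - 1) (vo u (m + int t) w)))
      = scale (eps q) (star ?g (B2 u v w) m l)
        - scale (eps q) (\<Sum>i<I. scale ((-1) ^ i) (zop scale 1 i (B2 u (?gF i) w) m l))"
  proof -
    have "(\<Sum>t<K. \<Sum>i<I. scale ((-1) ^ i * of_nat ((t + i) choose i))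
        (vo (?gF i) (l - int t - int i - 1) (vo u (m + int t) w)))
      = (\<Sum>i<I. scale ((-1) ^ i) (zop scale 1 i (B2 u (?gF i) w) m l))"
      unfolding z by (subst sum.swap) (simp add: scale_sum_right B2_def)
    then show ?thesis
      unfolding c sum_subtractf scale_sum_right [symmetric] s by (simp add: B2_def)
  qed
  finally show ?thesis by simp
qed

text \<open>At x1 = x2 + x0 the same three parts return: the poles are the negative powers of x0 in
  the action on \<open>v\<close>, and the modes acting on \<open>w\<close> come with negative powers
  of x2 + x0.\<close>

lemma I2_psi:
  assumes u: "fpr p u = u" and v: "fpr q v = v" and u': "u' = psi a (- int n - 1) u"
    and J: "\<And>j. j \<ge> J \<Longrightarrow> gmode a n (int j) w = 0"
    and I: "\<And>i. i \<ge> I \<Longrightarrow> F.gmode a n (int i) v = 0"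
  shows "I2 u' v w c d = Sum_any (\<lambda>i. Sum_any (\<lambda>j. scale (of_nat ((i + j) choose i))
        (gmode a n (- int i - int j - 1) (I2 u v w (c + int i) (d + int j)))))
    + scale (eps p * eps q) (\<Sum>j<J. zop scale (-1) j (I2 u v (gmode a n (int j) w)) c d)
    + scale (eps p) (\<Sum>i<I. I2 u (F.gmode a n (int i) v) w (c - int i - 1) d)"
proof -
  let ?g = "gmode a n" and ?gF = "\<lambda>i. F.gmode a n (int i) v"
  define z where "z i = F.vo u (c + int i) v" for i :: nat
  have hz: "fpr (p + q) (z i) = z i" for i unfolding z_def by (rule fpr_F_vo [OF u v])
  obtain K where K: "\<And>i. i \<ge> K \<Longrightarrow> z i = 0" using truncE [OF F.trunc_vo] unfolding z_def by metis
  have "F.vo u' c v = Sum_any (\<lambda>i. F.gmode a n (- int i - 1) (z i))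
      + fscale (eps p) (Sum_any (\<lambda>j. F.vo u (c - int j - 1) (?gF j)))"
    unfolding u' F.vo_cre [OF u] F.nord_def z_def ..
  also have "Sum_any (\<lambda>i. F.gmode a n (- int i - 1) (z i)) = (\<Sum>i<K. F.gmode a n (- int i - 1) (z i))"
    by (rule Sum_any_lessThan) (simp add: K F.field_zero [OF F.field_gmode])
  also have "Sum_any (\<lambda>j. F.vo u (c - int j - 1) (?gF j)) = (\<Sum>j<I. F.vo u (c - int j - 1) (?gF j))"
    by (rule Sum_any_lessThan) (simp add: I)
  finally have "I2 u' v w c d = (\<Sum>i<K. vo (F.gmode a n (- int i - 1) (z i)) d w)
      + scale (eps p) (\<Sum>i<I. I2 u (?gF i) w (c - int i - 1) d)"
    by (simp add: I2_def vo_add vo_scale linear_sumD [OF linear_vo_left])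
  also have "(\<Sum>i<K. vo (F.gmode a n (- int i - 1) (z i)) d w)
      = Sum_any (\<lambda>i. Sum_any (\<lambda>j. scale (of_nat ((i + j) choose i))
          (?g (- int i - int j - 1) (I2 u v w (c + int i) (d + int j)))))
        + scale (eps p * eps q) (\<Sum>j<J. zop scale (-1) j (I2 u v (?g (int j) w)) c d)"
  proof -
    have "vo (F.gmode a n (- int i - 1) (z i)) d w
        = Sum_any (\<lambda>j. scale (of_nat ((i + j) choose i)) (?g (- int i - int j - 1) (I2 u v w (c + int i) (d + int j))))
        + (\<Sum>j<J. scale (eps (p + q) * ((-1) ^ i * of_nat ((i + j) choose j))) (I2 u v (?g (int j) w) (c + int i) (d - int i - int j - 1)))" for i
    proof -
      have "Sum_any (\<lambda>j. scale (of_nat ((i + j) choose i)) (vo (z i) (d - int i - int j - 1) (?g (int j) w)))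
        = (\<Sum>j<J. scale (of_nat ((i + j) choose i)) (vo (z i) (d - int i - int j - 1) (?g (int j) w)))"
        by (rule Sum_any_lessThan) (simp add: J)
      moreover have "(i + j) choose i = (i + j) choose j" for j
        using binomial_symmetric [of i "i + j"] by simp
      ultimately show ?thesis
        unfolding vo_gmode [OF hz] by (simp add: I2_def z_def scale_sum_right mult.assoc)
    qed
    moreover have "Sum_any (\<lambda>i. Sum_any (\<lambda>j. scale (of_nat ((i + j) choose i))
          (?g (- int i - int j - 1) (I2 u v w (c + int i) (d + int j)))))
      = (\<Sum>i<K. Sum_any (\<lambda>j. scale (of_nat ((i + j) choose i))
          (?g (- int i - int j - 1) (I2 u v w (c + int i) (d + int j)))))"
      by (rule Sum_any_lessThan) (use K in \<open>simp add: I2_def z_def field_zero [OF field_gmode]\<close>)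
    moreover have "(\<Sum>j<J. zop scale (-1) j (I2 u v (?g (int j) w)) c d)
        = (\<Sum>i<K. \<Sum>j<J. scale ((-1) ^ i * of_nat ((i + j) choose j)) (I2 u v (?g (int j) w) (c + int i) (d - int i - int j - 1)))"
    proof -
      have "zop scale (-1) j (I2 u v (?g (int j) w)) c d
          = (\<Sum>i<K. scale ((-1) ^ i * of_nat ((i + j) choose j)) (I2 u v (?g (int j) w) (c + int i) (d - int i - int j - 1)))" for j
        by (rule zop_eq) (use K in \<open>simp add: I2_def z_def\<close>)
      then show ?thesis by (simp add: sum.swap [of _ "{..<K}"])
    qed
    ultimately show ?thesis
      by (simp add: sum.distrib scale_sum_right eps_add)
  qed
  finally show ?thesis .
qed

lemma dif_pow_kop':
  assumes "i < I"
  shows "(dif ^^ (I + k)) (kop scale i (P2 u v w)) m l = (dif ^^ (I - Suc i)) ((dif ^^ k) (P2 u v w)) m l"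
proof -
  have "I + k = ((I - Suc i) + k) + Suc i" using assms by simp
  moreover have "(dif ^^ Suc i) (kop scale i (P2 u v w)) = P2 u v w"
    by (intro ext dif_pow_kop utrunc_P2)
  ultimately show ?thesis by (simp only: funpow_add o_apply)
qed

lemma dif_pow_zop':
  assumes "i < I"
  shows "(dif ^^ (I + k)) (zop scale 1 i (B2 u v w)) m l
    = scale ((-1) ^ Suc i) ((dif ^^ (I - Suc i)) ((dif ^^ k) (B2 u v w)) m l)"
proof -
  have "I + k = ((I - Suc i) + k) + Suc i" using assms by simp
  moreover have "(dif ^^ Suc i) (zop scale 1 i (B2 u v w)) = (\<lambda>m n. scale ((-1) ^ Suc i) (B2 u v w m n))"
    by (intro ext dif_pow_zop utrunc_B2)
  ultimately have "(dif ^^ (I + k)) (zop scale 1 i (B2 u v w)) m l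
      = (dif ^^ ((I - Suc i) + k)) (\<lambda>m n. scale ((-1) ^ Suc i) (B2 u v w m n)) m l"
    by (simp only: funpow_add o_apply)
  then show ?thesis by (simp only: dif_pow_scale) (simp only: funpow_add o_apply)
qed

text \<open>Any exponent can be raised by \<open>rat_mono\<close>. The form "for all large
  \<open>k\<close>" lets several families share one exponent.\<close>

lemma rat_common:
  assumes "\<And>i. i < (I::nat) \<Longrightarrow> \<exists>k G. rat k (e i) u (v i) (w i) G"
  shows "\<exists>K. \<forall>k\<ge>K. \<exists>G. \<forall>i<I. rat k (e i) u (v i) (w i) (G i)"
  using assms
proof (induction I)
  case (Suc I)
  have "\<exists>K. \<forall>k\<ge>K. \<exists>G. \<forall>i<I. rat k (e i) u (v i) (w i) (G i)"
    by (rule Suc.IH) (rule Suc.prems, simp)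
  then obtain K where K: "\<And>k. k \<ge> K \<Longrightarrow> \<exists>G. \<forall>i<I. rat k (e i) u (v i) (w i) (G i)" by blast
  obtain k0 G0 where 0: "rat k0 (e I) u (v I) (w I) G0" using Suc.prems by blast
  show ?case
  proof (rule exI [of _ "max K k0"], intro allI impI)
    fix k assume k: "k \<ge> max K k0"
    then obtain G where G: "\<forall>i<I. rat k (e i) u (v i) (w i) (G i)" using K by fastforce
    have "rat ((k - k0) + k0) (e I) u (v I) (w I) ((dif ^^ (k - k0)) G0)" by (rule rat_mono [OF 0])
    then have "rat k (e I) u (v I) (w I) ((dif ^^ (k - k0)) G0)" using k by simp
    with G have "\<forall>i<Suc I. rat k (e i) u (v i) (w i) ((G (I := (dif ^^ (k - k0)) G0)) i)"
      by (auto simp: less_Suc_eq)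
    then show "\<exists>G. \<forall>i<Suc I. rat k (e i) u (v i) (w i) (G i)" by blast
  qed
qed simp

lemma eps_mult_charge: "eps ((p + charge a) * q) = eps (p * q) * eps q" "eps (p * (q + charge a)) = eps (p * q) * eps p"
  by (cases a; auto simp: eps_def)+

text \<open>The product, the opposite product and the iterate each reduce to a creation part, terms
  with a_j on \<open>w\<close> and terms with a_i on \<open>v\<close>, all covered by the induction
  hypothesis for other \<open>v\<close> and \<open>w\<close>. It remains to clear the new
  poles.\<close>

lemma rat_psi:
  assumes u: "fpr p u = u" and v: "fpr q v = v"
    and IH: "\<And>q v w. fpr q v = v \<Longrightarrow> \<exists>k G. rat k (eps (p * q)) u v w G"
  shows "\<exists>k G. rat k (eps ((p + charge a) * q)) (psi a (- int n - 1) u) v w G"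
proof -
  let ?g = "gmode a n" and ?gF = "\<lambda>i. F.gmode a n (int i) v"
  define u' where "u' = psi a (- int n - 1) u"
  obtain J where J: "\<And>j. j \<ge> J \<Longrightarrow> ?g (int j) w = 0"
  proof -
    obtain J where "\<And>j. j \<ge> J \<Longrightarrow> ?g (0 + int j) w = 0"
      using truncE [OF field_trunc [OF field_gmode]] by metis
    then show thesis by (intro that [of J]) simp
  qed
  obtain I where I: "\<And>i. i \<ge> I \<Longrightarrow> ?gF i = 0"
  proof -
    obtain I where "\<And>i. i \<ge> I \<Longrightarrow> F.gmode a n (0 + int i) v = 0"
      using truncE [OF field_trunc [OF F.field_gmode]] by metis
    then show thesis by (intro that [of I]) simp
  qed
  have hg: "fpr (q + charge a) (?gF i) = ?gF i" for i
    using F.pr_gmode [of q a n "int i" v] by (simp add: v)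
  obtain K1 where K1: "\<forall>k\<ge>K1. \<exists>G. \<forall>i<I. rat k (eps (p * (q + charge a))) u (?gF i) w (G i)"
    using rat_common [of I "\<lambda>i. eps (p * (q + charge a))" u ?gF "\<lambda>i. w"] IH [OF hg] by blast
  obtain K2 where K2: "\<forall>k\<ge>K2. \<exists>G. \<forall>j<J. rat k (eps (p * q)) u v (?g (int j) w) (G j)"
    using rat_common [of J "\<lambda>i. eps (p * q)" u "\<lambda>i. v" "\<lambda>j. ?g (int j) w"] IH [OF v] by blast
  obtain K3 where K3: "\<forall>k\<ge>K3. \<exists>G. \<forall>i<(1::nat). rat k (eps (p * q)) u v w (G i)"
    using rat_common [of 1 "\<lambda>i. eps (p * q)" u "\<lambda>i. v" "\<lambda>i. w"] IH [OF v] by blast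
  define k where "k = max K1 (max K2 K3)"
  obtain G1 where G1: "\<And>i. i < I \<Longrightarrow> rat k (eps (p * (q + charge a))) u (?gF i) w (G1 i)"
    using K1 unfolding k_def by (metis max.cobounded1)
  obtain G2 where G2: "\<And>j. j < J \<Longrightarrow> rat k (eps (p * q)) u v (?g (int j) w) (G2 j)"
    using K2 unfolding k_def by (metis max.cobounded1 max.coboundedI2)
  obtain G3 where G3: "rat k (eps (p * q)) u v w G3"
    using K3 unfolding k_def by (metis max.cobounded2 max.coboundedI2 less_one)
  define H where "H = (dif ^^ I) G3"
  \<comment> \<open>\<open>k\<close> clears the old poles and \<open>I\<close> the new ones. A pole
    (x1 - x2)^(-i-1) under (x1 - x2)^I leaves the power \<open>I - Suc i\<close>; the other parts
    keep all of it.\<close>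
  define G where "G m l = star ?g H m l
    + scale (eps p * eps q) (\<Sum>j<J. (dif ^^ I) (G2 j) (m - int j - 1) l)
    + scale (eps p) (\<Sum>i<I. (dif ^^ (I - Suc i)) (G1 i) m l)" for m l
  have bG3: "bounded2 G3" and PG3: "(dif ^^ k) (P2 u v w) = G3"
    and BG3: "(dif ^^ k) (B2 u v w) = (\<lambda>m n. scale (eps (p * q)) (G3 m n))"
    and IG3: "\<And>c d. I2 u v w (c + int k) d = subst2 scale G3 c d"
    by (fact ratD [OF G3])+
  have bG2: "bounded2 (G2 j)" and PG2: "(dif ^^ k) (P2 u v (?g (int j) w)) = G2 j"
    and BG2: "(dif ^^ k) (B2 u v (?g (int j) w)) = (\<lambda>m n. scale (eps (p * q)) (G2 j m n))"
    and IG2: "\<And>c d. I2 u v (?g (int j) w) (c + int k) d = subst2 scale (G2 j) c d" if "j < J" for j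
    by (fact ratD [OF G2 [OF that]])+
  have bG1: "bounded2 (G1 i)" and PG1: "(dif ^^ k) (P2 u (?gF i) w) = G1 i"
    and BG1: "(dif ^^ k) (B2 u (?gF i) w) = (\<lambda>m n. scale (eps (p * (q + charge a))) (G1 i m n))"
    and IG1: "\<And>c d. I2 u (?gF i) w (c + int k) d = subst2 scale (G1 i) c d" if "i < I" for i
    by (fact ratD [OF G1 [OF that]])+
  have bH: "bounded2 H" unfolding H_def by (rule bounded2_dif_pow [OF bG3])
  have bs2: "bounded2 (\<lambda>m l. (dif ^^ I) (G2 j) (m - int j - 1) l)" if "j < J" for j
    using bounded2_shift [OF bounded2_dif_pow [OF bG2 [OF that]], of I "- int j - 1" 0] by (simp add: algebra_simps)
  have bs1: "bounded2 (\<lambda>m l. (dif ^^ (I - Suc i)) (G1 i) m l)" if "i < I" for i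
    using bounded2_dif_pow [OF bG1 [OF that]] by simp
  have b1: "bounded2 (star ?g H)" by (rule bounded2_star [OF field_gmode bH])
  have b2: "bounded2 (\<lambda>m l. \<Sum>j<J. (dif ^^ I) (G2 j) (m - int j - 1) l)"
    by (rule bounded2_sum) (use bs2 in auto)
  have b3: "bounded2 (\<lambda>m l. \<Sum>i<I. (dif ^^ (I - Suc i)) (G1 i) m l)"
    by (rule bounded2_sum) (use bs1 in auto)
  note b2' = bounded2_scale [OF b2, of "eps p * eps q"] and b3' = bounded2_scale [OF b3, of "eps p"]
  have bG: "bounded2 G"
    unfolding G_def by (intro bounded2_add b1 b2' b3')
  have P: "(dif ^^ (I + k)) (P2 u' v w) m l = G m l" for m l
  proof -
    have e: "P2 u' v w = (\<lambda>m l. star ?g (P2 u v w) m l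
      + scale (eps p * eps q) (\<Sum>j<J. P2 u v (?g (int j) w) (m - int j - 1) l)
      + scale (eps p) (\<Sum>i<I. kop scale i (P2 u (?gF i) w) m l))"
      by (intro ext P2_psi [OF u v u'_def J I])
    have 1: "(dif ^^ (I + k)) (star ?g (P2 u v w)) m l = star ?g H m l"
      unfolding dif_pow_star [OF field_gmode trunc2_P2] by (simp add: funpow_add PG3 H_def)
    have 2: "(dif ^^ (I + k)) (\<lambda>m l. P2 u v (?g (int j) w) (m - int j - 1) l) m l
        = (dif ^^ I) (G2 j) (m - int j - 1) l" if "j < J" for j
      using dif_pow_shift [of "I + k" "P2 u v (?g (int j) w)" "- int j - 1" 0 m l]
      by (simp add: funpow_add PG2 [OF that] diff_diff_eq add_diff_eq)
    have 3: "(dif ^^ (I + k)) (kop scale i (P2 u (?gF i) w)) m l = (dif ^^ (I - Suc i)) (G1 i) m l" if "i < I" for i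
      unfolding dif_pow_kop' [OF that] PG1 [OF that] ..
    show ?thesis
      unfolding e dif_pow_add dif_pow_scale dif_pow_sum G_def 1
      by (simp add: 2 3)
  qed
  have B: "(dif ^^ (I + k)) (B2 u' v w) m l = scale (eps ((p + charge a) * q)) (G m l)" for m l
  proof -
    have e: "B2 u' v w = (\<lambda>m l. scale (eps q) (star ?g (B2 u v w) m l)
      + (scale (eps p) (\<Sum>j<J. B2 u v (?g (int j) w) (m - int j - 1) l)
      + scale (- eps q) (\<Sum>i<I. scale ((-1) ^ i) (zop scale 1 i (B2 u (?gF i) w) m l))))"
      using B2_psi [OF u v u'_def J I] by (intro ext) (simp add: scale_minus_left)
    have 1: "(dif ^^ (I + k)) (star ?g (B2 u v w)) m l = scale (eps (p * q)) (star ?g H m l)"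
    proof -
      have "(dif ^^ (I + k)) (B2 u v w) = (\<lambda>m n. scale (eps (p * q)) (H m n))"
        by (intro ext) (simp add: funpow_add BG3 dif_pow_scale H_def)
      moreover obtain L where L: "\<And>i. i \<ge> L \<Longrightarrow> H (m + int i) l = 0"
        using truncE [OF trunc2_col [OF bounded2_trunc2 [OF bH]]] by metis
      ultimately show ?thesis
        unfolding dif_pow_star [OF field_gmode trunc2_B2]
        by (simp add: star_eq [OF field_gmode, where K = L] linear_scaleD [OF field_linear [OF field_gmode]] scale_sum_right)
    qed
    have 2: "(dif ^^ (I + k)) (\<lambda>m l. B2 u v (?g (int j) w) (m - int j - 1) l) m l
        = scale (eps (p * q)) ((dif ^^ I) (G2 j) (m - int j - 1) l)" if "j < J" for j
      using dif_pow_shift [of "I + k" "B2 u v (?g (int j) w)" "- int j - 1" 0 m l]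
      by (simp add: funpow_add BG2 [OF that] dif_pow_scale diff_diff_eq add_diff_eq)
    have 3: "(dif ^^ (I + k)) (zop scale 1 i (B2 u (?gF i) w)) m l
        = scale ((-1) ^ Suc i * eps (p * (q + charge a))) ((dif ^^ (I - Suc i)) (G1 i) m l)" if "i < I" for i
      unfolding dif_pow_zop' [OF that] BG1 [OF that] dif_pow_scale scale_scale ..
    \<comment> \<open>The sign (-1)^i of \<open>B2_psi\<close> meets (-1)^(i+1) from the other
      expansion of the pole; what is left does not depend on \<open>i\<close>.\<close>
    have sg: "(-1) ^ i * (-1) ^ i = (1::complex)" for i by (simp flip: power_add)
    have s2: "(\<Sum>j<J. (dif ^^ (I + k)) (\<lambda>m l. B2 u v (?g (int j) w) (m - int j - 1) l) m l)
        = scale (eps (p * q)) (\<Sum>j<J. (dif ^^ I) (G2 j) (m - int j - 1) l)"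
      by (simp add: 2 scale_sum_right)
    have s3: "(\<Sum>i<I. scale ((-1) ^ i) ((dif ^^ (I + k)) (zop scale 1 i (B2 u (?gF i) w)) m l))
        = scale (- (eps (p * q) * eps p)) (\<Sum>i<I. (dif ^^ (I - Suc i)) (G1 i) m l)"
      unfolding scale_sum_right
    proof (rule sum.cong)
      fix i assume "i \<in> {..<I}"
      then have i: "i < I" by simp
      have "(-1) ^ i * ((-1) ^ Suc i * eps (p * (q + charge a))) = - (eps (p * q) * eps p)"
        using sg [of i] by (simp add: eps_mult_charge mult.assoc [symmetric])
      then show "scale ((-1) ^ i) ((dif ^^ (I + k)) (zop scale 1 i (B2 u (?gF i) w)) m l)
          = scale (- (eps (p * q) * eps p)) ((dif ^^ (I - Suc i)) (G1 i) m l)"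
        unfolding 3 [OF i] scale_scale by (simp only:)
    qed simp
    \<comment> \<open>All three kinds of terms acquire the same braiding sign, that of the charge
      \<open>p + charge a\<close> against \<open>q\<close>.\<close>
    have c1: "eps p * eps (p * q) = eps ((p + charge a) * q) * (eps p * eps q)"
      using eps_eps [of q] by (simp add: eps_mult_charge mult.left_commute mult.commute)
    have c2: "- eps q * - (eps (p * q) * eps p) = eps ((p + charge a) * q) * eps p"
      by (simp add: eps_mult_charge)
    have c3: "eps q * eps (p * q) = eps ((p + charge a) * q)" by (simp add: eps_mult_charge)
    show ?thesis
      unfolding e dif_pow_add dif_pow_scale dif_pow_sum G_def 1 s2 s3 scale_scale scale_right_distrib c1 c2 c3
      by (simp add: add.assoc)
  qed
  have Ith: "I2 u' v w (c + int (I + k)) d = subst2 scale G c d" for c d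
  proof -
    have 1: "subst2 scale (star ?g H) c d = Sum_any (\<lambda>i. Sum_any (\<lambda>j. scale (of_nat ((i + j) choose i))
        (?g (- int i - int j - 1) (I2 u v w (c + int (I + k) + int i) (d + int j)))))"
    proof -
      have "I2 u v w (c + int (I + k) + int i) d' = subst2 scale H (c + int i) d'" for i d'
        using IG3 [of "c + int I + int i" d'] by (simp add: H_def subst2_dif_pow [OF bG3] algebra_simps)
      then show ?thesis unfolding subst2_star [OF field_gmode bH] by simp
    qed
    have 2: "subst2 scale (\<lambda>m l. (dif ^^ I) (G2 j) (m - int j - 1) l) c d
        = zop scale (-1) j (I2 u v (?g (int j) w)) (c + int (I + k)) d" if "j < J" for j
    proof -
      have "I2 u v (?g (int j) w) (c + int (I + k) + int i) d' = subst2 scale ((dif ^^ I) (G2 j)) (c + int i) d'" for i d'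
        using IG2 [OF that, of "c + int I + int i" d'] by (simp add: subst2_dif_pow [OF bG2 [OF that]] algebra_simps)
      then show ?thesis
        unfolding subst2_neg_shift [OF bounded2_dif_pow [OF bG2 [OF that]]] zop_def by simp
    qed
    have 3: "subst2 scale ((dif ^^ (I - Suc i)) (G1 i)) c d = I2 u (?gF i) w (c + int (I + k) - int i - 1) d" if "i < I" for i
      using IG1 [OF that, of "c + int (I - Suc i)" d] that
      by (simp add: subst2_dif_pow [OF bG1 [OF that]] of_nat_diff algebra_simps)
    have "subst2 scale G c d = subst2 scale (star ?g H) c d
      + scale (eps p * eps q) (\<Sum>j<J. subst2 scale (\<lambda>m l. (dif ^^ I) (G2 j) (m - int j - 1) l) c d)
      + scale (eps p) (\<Sum>i<I. subst2 scale ((dif ^^ (I - Suc i)) (G1 i)) c d)"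
    proof -
      have s2: "subst2 scale (\<lambda>m l. \<Sum>j<J. (dif ^^ I) (G2 j) (m - int j - 1) l) c d
          = (\<Sum>j<J. subst2 scale (\<lambda>m l. (dif ^^ I) (G2 j) (m - int j - 1) l) c d)"
        by (rule subst2_sum) (use bs2 in auto)
      have s3: "subst2 scale (\<lambda>m l. \<Sum>i<I. (dif ^^ (I - Suc i)) (G1 i) m l) c d
          = (\<Sum>i<I. subst2 scale ((dif ^^ (I - Suc i)) (G1 i)) c d)"
        by (rule subst2_sum) (use bs1 in auto)
      show ?thesis
        unfolding G_def subst2_add [OF bounded2_add [OF b1 b2'] b3'] subst2_add [OF b1 b2']
          subst2_scale [OF b2] subst2_scale [OF b3] s2 s3 ..
    qed
    also have "\<dots> = I2 u' v w (c + int (I + k)) d"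
    proof -
      have e: "I2 u' v w c d = Sum_any (\<lambda>i. Sum_any (\<lambda>j. scale (of_nat ((i + j) choose i))
            (?g (- int i - int j - 1) (I2 u v w (c + int i) (d + int j)))))
        + scale (eps p * eps q) (\<Sum>j<J. zop scale (-1) j (I2 u v (?g (int j) w)) c d)
        + scale (eps p) (\<Sum>i<I. I2 u (?gF i) w (c - int i - 1) d)" for c d
        by (rule I2_psi [OF u v u'_def J I])
      show ?thesis unfolding 1 e [of "c + int (I + k)"] by (simp add: 2 3)
    qed
    finally show ?thesis by simp
  qed
  show ?thesis
    unfolding u'_def [symmetric] using bG P B Ith unfolding rat_def by blast
qed

lemma rat_add:
  assumes "rat k e u v w G" "rat k' e u' v w G'"
  shows "\<exists>k G. rat k e (u + u') v w G"
proof -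
  have 1: "rat (k' + k) e u v w ((dif ^^ k') G)" by (rule rat_mono [OF assms(1)])
  have "rat (k + k') e u' v w ((dif ^^ k) G')" by (rule rat_mono [OF assms(2)])
  then have 2: "rat (k' + k) e u' v w ((dif ^^ k) G')" by (simp add: add.commute)
  have P: "P2 (u + u') v w = (\<lambda>m n. P2 u v w m n + P2 u' v w m n)"
    by (intro ext) (simp add: P2_def vo_add)
  have B: "B2 (u + u') v w = (\<lambda>m n. B2 u v w m n + B2 u' v w m n)"
    by (intro ext) (simp add: B2_def vo_add linear_addD [OF linear_vo])
  have I: "I2 (u + u') v w = (\<lambda>m n. I2 u v w m n + I2 u' v w m n)"
    by (intro ext) (simp add: I2_def vo_add F.vo_add)
  have "rat (k' + k) e (u + u') v w (\<lambda>m n. (dif ^^ k') G m n + (dif ^^ k) G' m n)"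
    using 1 2 unfolding rat_def P B I
    by (simp only: dif_pow_add subst2_add bounded2_add scale_right_distrib simp_thms)
  then show ?thesis by blast
qed

lemma rat_scale:
  assumes "rat k e u v w G"
  shows "rat k e (fscale c u) v w (\<lambda>m n. scale c (G m n))"
proof -
  have P: "P2 (fscale c u) v w = (\<lambda>m n. scale c (P2 u v w m n))"
    by (intro ext) (simp add: P2_def vo_scale)
  have B: "B2 (fscale c u) v w = (\<lambda>m n. scale c (B2 u v w m n))"
    by (intro ext) (simp add: B2_def vo_scale linear_scaleD [OF linear_vo])
  have I: "I2 (fscale c u) v w = (\<lambda>m n. scale c (I2 u v w m n))"
    by (intro ext) (simp add: I2_def vo_scale F.vo_scale)
  show ?thesis
    using assms unfolding rat_def P B I
    by (auto simp only: dif_pow_scale subst2_scale bounded2_scale scale_left_commute simp_thms)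
qed

lemma rat_fvac: "\<exists>k G. rat k 1 fvac v w G"
proof -
  define G where "G m n = (if m = -1 then vo v n w else 0)" for m n :: int
  obtain N where N: "\<And>n. n \<ge> N \<Longrightarrow> vo v n w = 0" using trunc_vo [of v w] unfolding trunc_def by blast
  have b: "bounded2 G" unfolding bounded2_def G_def
    by (rule exI [of _ "max 0 N"]) (auto simp: N)
  have s: "subst2 scale G c d = I2 fvac v w c d" for c d
  proof (cases "c < 0")
    case True
    have "subst2 scale G c d = (\<Sum>m\<in>{-1}. scale ((- of_int m - 1) gchoose nat (- c - 1)) (G m (d - m + c)))"
      unfolding subst2_def if_P [OF True] by (rule Sum_any.expand_superset) (auto simp: G_def)
    also have "\<dots> = (if c = -1 then vo v d w else 0)"
      using True by (auto simp: G_def gbinomial_0_left)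
    finally show ?thesis by (simp add: I2_def F.vo_fvac)
  qed (simp add: I2_def F.vo_fvac)
  have P: "P2 fvac v w = G" and B: "B2 fvac v w = G"
    by (intro ext; simp add: P2_def B2_def vo_fvac G_def)+
  have "rat 0 1 fvac v w G"
    unfolding rat_def P B by (simp add: b s)
  then show ?thesis by blast
qed

text \<open>Induction on the words of \<open>u\<close>, with \<open>v\<close> and \<open>w\<close>
  free, because the step passes to a_i v and a_j w.\<close>

theorem rationality:
  assumes "fpr p u = u" "fpr q v = v"
  shows "\<exists>k G. rat k (eps (p * q)) u v w G"
  using assms(1)
proof (induction u rule: fock_induct)
  case zero
  have "rat 0 e 0 v w (\<lambda>m n. 0)" for e
  proof -
    have "P2 0 v w = (\<lambda>m n. 0)" "B2 0 v w = (\<lambda>m n. 0)" "I2 0 v w = (\<lambda>m n. 0)"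
      by (intro ext; simp add: P2_def B2_def I2_def)+
    then show ?thesis by (simp add: rat_def bounded2_0)
  qed
  then show ?case by blast
next
  case (add x y) then show ?case using rat_add by blast
next
  case (scale c x) then show ?case using rat_scale by blast
next
  case (word ws)
  have "\<exists>k G. rat k (eps (word_charge ws * q)) (word_vec ws) v w G" if "fpr q v = v" for q v w
    using that
  proof (induction ws arbitrary: q v w)
    case Nil then show ?case using rat_fvac by simp
  next
    case (Cons g ws)
    have "\<exists>k G. rat k (eps ((word_charge ws + charge (gen_letter g)) * q))
        (psi (gen_letter g) (- int (g div 2) - 1) (word_vec ws)) v w G"
      by (rule rat_psi [OF fpr_word_vec Cons.prems Cons.IH])
    then show ?case by (simp add: cre_psi add.commute)
  qed
  with word assms(2) show ?case by blast
qed

end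

section \<open>Charge shifts\<close>

locale clifford_hom = M: clifford s A + N: clifford t B
  for s :: "complex \<Rightarrow> 'v::ab_group_add \<Rightarrow> 'v" and A
    and t :: "complex \<Rightarrow> 'w::ab_group_add \<Rightarrow> 'w" and B +
  fixes f :: "'v \<Rightarrow> 'w"
  assumes linear_f: "Vector_Spaces.linear s t f"
    and f_A: "f (A a m x) = B a m (f x)"
begin

lemma f_gmode: "f (M.gmode a n m x) = N.gmode a n m (f x)"
  by (simp add: M.gmode_def N.gmode_def linear_scaleD [OF linear_f] f_A)

lemma f_vow: "f (M.vow ws l x) = N.vow ws l (f x)"
proof (induction ws arbitrary: l x)
  case (Cons g ws)
  let ?g = "M.gmode (gen_letter g) (g div 2)"
  obtain K where K: "\<And>k. k \<ge> K \<Longrightarrow> M.vow ws (l + int k) x = 0"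
    using truncE [OF field_trunc [OF M.field_vow]] by metis
  obtain J where J: "\<And>j. j \<ge> J \<Longrightarrow> ?g (0 + int j) x = 0"
    using truncE [OF field_trunc [OF M.field_gmode]] by metis
  have "finite {i. ?g (- int i - 1) (M.vow ws (l + int i) x) \<noteq> 0}"
    by (rule finite_truncated [of K]) (simp add: K M.field_zero [OF M.field_gmode])
  moreover have "finite {j. M.vow ws (l - int j - 1) (?g (int j) x) \<noteq> 0}"
    by (rule finite_truncated [of J]) (use J in \<open>simp add: M.field_zero [OF M.field_vow]\<close>)
  ultimately show ?case
    by (simp add: M.nord_def N.nord_def linear_addD [OF linear_f] linear_scaleD [OF linear_f]
        linear_Sum_any [OF linear_f] f_gmode Cons)
qed (simp add: linear_zeroD [OF linear_f])

lemma f_vo: "f (M.vo u l x) = N.vo u l (f x)"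
  by (induction u rule: fock_induct')
    (simp_all add: M.vo_add N.vo_add M.vo_scale N.vo_scale f_vow linear_addD [OF linear_f] linear_scaleD [OF linear_f])

end

context clifford
begin

lemma vo_generator: "vo (psi a (-1) fvac) l w = A a l w"
proof -
  have g0: "gmode a 0 m x = A a m x" for m x by (simp add: gmode_def)
  have "vo (psi a (-1) fvac) l w = nord (gmode a 0) 1 (vo fvac) l w"
    using vo_cre [OF fpr_fvac, of a 0 l w] by simp
  also have "\<dots> = Sum_any (\<lambda>i. A a (- int i - 1) (vo fvac (l + int i) w))
      + Sum_any (\<lambda>j. vo fvac (l - int j - 1) (A a (int j) w))"
    by (simp add: nord_def g0)
  also have "\<dots> = A a l w"
  proof (cases "l \<ge> 0")
    case True
    have "Sum_any (\<lambda>j. vo fvac (l - int j - 1) (A a (int j) w)) = (\<Sum>j\<in>{nat l}. vo fvac (l - int j - 1) (A a (int j) w))"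
      by (rule Sum_any.expand_superset) (use True in \<open>auto simp: vo_fvac\<close>)
    then show ?thesis using True by (simp add: vo_fvac)
  next
    case False
    have "Sum_any (\<lambda>i. A a (- int i - 1) (vo fvac (l + int i) w)) = (\<Sum>i\<in>{nat (- l - 1)}. A a (- int i - 1) (vo fvac (l + int i) w))"
      by (rule Sum_any.expand_superset) (use False in \<open>auto simp: vo_fvac split: if_splits\<close>)
    then show ?thesis using False by (simp add: vo_fvac)
  qed
  finally show ?thesis .
qed

definition flow :: "complex \<Rightarrow> letter \<Rightarrow> int \<Rightarrow> 'w \<Rightarrow> 'w" where
  "flow s a m w = exps scale (s * of_int (charge a)) (\<lambda>m. A a m w) m"

lemma clifford_flow: "clifford scale (flow s)"
  using spectral_flow [of s] unfolding clifford_def flow_def [abs_def] by simp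

text \<open>The creation operators anticommute, so the images of words extend to the exterior
  algebra. Annihilation modes are then moved to the vacuum, which is where \<open>vac\<close>
  enters.\<close>

lemma fock_hom:
  assumes vac: "\<And>a m. m \<ge> 0 \<Longrightarrow> A a m v = 0"
  shows "\<exists>h. Vector_Spaces.linear fscale scale h \<and> h fvac = v \<and> (\<forall>a m x. h (psi a m x) = A a m (h x))"
proof -
  let ?c = "\<lambda>g. A (gen_letter g) (- int (g div 2) - 1)"
  define f where "f ws (i::unit) = foldr ?c ws v" for ws i
  interpret X: antisymmetric scale f
  proof
    show "f (g # h # ws) i = - f (h # g # ws) i" for g h ws i
      unfolding f_def foldr.simps o_apply by (subst anticomm) simp
    show "f (g # ws) i = scale c (f (g # us) i)"
      if "\<And>i. f ws i = scale c (f us i)" for ws us c g i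
      using that [of i] by (simp add: f_def A_scale)
  qed
  define h where "h x = X.extend x ()" for x
  have lin: "Vector_Spaces.linear fscale scale h" unfolding h_def by (rule X.linear_extend)
  have hw: "h (word_vec ws) = foldr ?c ws v" for ws by (simp add: h_def X.extend_word_vec f_def)
  note hl = linear_addD [OF lin] linear_scaleD [OF lin] linear_negD [OF lin] linear_zeroD [OF lin]
  have hc: "h (cre g x) = ?c g (h x)" for g x
  proof (induction x rule: fock_induct')
    case (word ws)
    show ?case using hw [of "g # ws"] hw [of ws] by simp
  qed (simp_all add: hl linear_addD [OF linear_cre] linear_scaleD [OF linear_cre] A_add A_scale)
  have hp: "h (psi a m x) = A a m (h x)" for a m x
  proof (induction x rule: fock_induct')
    case (word ws)
    show ?case
    proof (cases "m < 0")
      case True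
      then have "psi a m = cre (gen a (nat (- m - 1)))" by (simp add: psi_def)
      moreover have "gen a (nat (- m - 1)) div 2 = nat (- m - 1)" by (simp add: gen_def)
      ultimately show ?thesis using True by (simp add: hc)
    next
      case False
      show ?thesis
      proof (induction ws)
        case Nil
        then show ?case using False hw [of "[]"] by (simp add: psi_fvac hl vac)
      next
        case (Cons g ws)
        have "h (psi a m (word_vec (g # ws)))
            = h (- cre g (psi a m (word_vec ws)) + (if a \<noteq> gen_letter g \<and> m + (- int (g div 2) - 1) + 1 = 0 then word_vec ws else 0))"
          using F.anticomm [of a m "gen_letter g" "- int (g div 2) - 1"] by (simp add: cre_psi)
        also have "\<dots> = - ?c g (A a m (h (word_vec ws)))
            + (if a \<noteq> gen_letter g \<and> m + (- int (g div 2) - 1) + 1 = 0 then h (word_vec ws) else 0)"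
          by (simp only: hl hc Cons.IH if_distrib [of h])
        also have "\<dots> = A a m (?c g (h (word_vec ws)))" by (rule anticomm [symmetric])
        finally show ?case by (simp add: hc)
      qed
    qed
  qed (simp_all add: hl F.A_add F.A_scale A_add A_scale)
  from lin hp hw [of "[]"] show ?thesis by auto
qed

end

text \<open>The automorphism of the Fock space that turns \<open>a(x)\<close> of charge \<open>p\<close> into \<open>e^(p s x) a(x)\<close>.\<close>

definition theta :: "complex \<Rightarrow> fock \<Rightarrow> fock" where
  "theta s = (SOME h. Vector_Spaces.linear fscale fscale h \<and> h fvac = fvac \<and>
     (\<forall>a m x. h (psi a m x) = F.flow s a m (h x)))"

lemma theta:
  "Vector_Spaces.linear fscale fscale (theta s)" "theta s fvac = fvac"
  "theta s (psi a m x) = F.flow s a m (theta s x)"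
proof -
  interpret N: clifford fscale "F.flow s" by (rule F.clifford_flow)
  have "\<exists>h. Vector_Spaces.linear fscale fscale h \<and> h fvac = fvac \<and>
     (\<forall>a m x. h (psi a m x) = F.flow s a m (h x))"
    by (rule N.fock_hom) (simp add: F.flow_def F.exps_vanish psi_fvac)
  from someI_ex [OF this] show "Vector_Spaces.linear fscale fscale (theta s)" "theta s fvac = fvac"
    "theta s (psi a m x) = F.flow s a m (theta s x)"
    unfolding theta_def by blast+
qed

lemma theta_word_induct [consumes 1, case_names zero add scale vac psi]:
  assumes "fpr n u = u"
    and "\<And>n. P n 0" "\<And>n x y. P n x \<Longrightarrow> P n y \<Longrightarrow> P n (x + y)" "\<And>n c x. P n x \<Longrightarrow> P n (fscale c x)"
    and "P 0 fvac"
    and "\<And>n a m x. fpr n x = x \<Longrightarrow> P n x \<Longrightarrow> P (n + charge a) (psi a m x)"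
  shows "P n u"
  using assms(1)
proof (induction u rule: fock_induct)
  case (word ws)
  have "P (word_charge ws) (word_vec ws)"
  proof (induction ws)
    case (Cons g ws)
    from assms(6) [OF fpr_word_vec Cons, of "gen_letter g" "- int (g div 2) - 1"]
    show ?case by (simp add: cre_psi add.commute)
  qed (simp add: assms(5))
  with word show ?case by simp
qed (use assms in auto)

lemma fpr_theta: "fpr n u = u \<Longrightarrow> fpr n (theta s u) = theta s u"
proof (induction rule: theta_word_induct)
  case (psi n a m x)
  have "fpr (n + charge a) (F.flow s a m (theta s x)) = F.flow s a m (theta s x)"
    unfolding F.flow_def
    by (simp add: linear_exps [OF F.linear_pr F.trunc_A] F.pr_A psi.IH)
  then show ?case by (simp add: theta)
qed (simp_all add: theta linear_zeroD [OF theta(1)] linear_addD [OF theta(1)] linear_scaleD [OF theta(1)]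
    linear_addD [OF F.linear_pr] linear_scaleD [OF F.linear_pr] fpr_fvac)

lemma theta_theta: "theta (- s) (theta s u) = u"
proof (induction u rule: F.homogeneous_induct)
  case (1 n u)
  then show ?case
  proof (induction rule: theta_word_induct)
    case (psi n a m x)
    have "theta (- s) (F.flow s a m (theta s x))
      = exps fscale (s * of_int (charge a)) (exps fscale (- s * of_int (charge a)) (\<lambda>m. psi a m x)) m"
      unfolding F.flow_def linear_exps [OF theta(1) F.trunc_A] theta(3) psi.IH by simp
    then show ?case by (simp add: theta(3) F.exps_exps F.trunc_A)
  qed (simp_all add: theta linear_zeroD [OF theta(1)] linear_addD [OF theta(1)] linear_scaleD [OF theta(1)])
qed (simp add: linear_addD [OF theta(1)])

context clifford
begin

text \<open>Both state-field maps recover the field of a_m x from the product of the fields of a and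
  x by rationality, and the exponential factor of the product becomes that of the iterate under x1 =
  x2 + x0.\<close>

theorem vo_flow:
  assumes "fpr p u = u"
  shows "clifford.vo scale (flow s) u l w = exps scale (s * of_int p) (\<lambda>l. vo (theta s u) l w) l"
proof -
  interpret S: clifford scale "flow s" by (rule clifford_flow)
  show ?thesis using assms
  proof (induction arbitrary: l w rule: theta_word_induct)
    case (zero n) show ?case by (simp add: linear_zeroD [OF theta(1)])
  next
    case (add n x y)
    then show ?case by (simp add: S.vo_add vo_add linear_addD [OF theta(1)] exps_add trunc_vo)
  next
    case (scale n c x)
    then show ?case by (simp add: S.vo_scale vo_scale linear_scaleD [OF theta(1)] exps_scale trunc_vo)
  next
    case vac show ?case by (simp add: theta S.vo_fvac vo_fvac)
  next
    case (psi n a m x)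
    let ?g = "psi a (-1) fvac" and ?c = "s * of_int (charge a)" and ?d = "s * of_int n"
    have hg: "fpr (charge a) ?g = ?g" using F.pr_A_homogeneous [OF fpr_fvac, of a "-1"] by simp
    have Fg: "F.vo ?g m y = psi a m y" for m y by (rule F.vo_generator)
    obtain k1 G1 where 1: "S.rat k1 (eps (charge a * n)) ?g x w G1"
      using S.rationality [OF hg \<open>fpr n x = x\<close>] by blast
    obtain k2 G2 where 2: "rat k2 (eps (charge a * n)) ?g (theta s x) w G2"
      using rationality [OF hg fpr_theta [OF \<open>fpr n x = x\<close>]] by blast
    define k where "k = k1 + k2"
    obtain G where G: "S.rat k (eps (charge a * n)) ?g x w G"
      using S.rat_mono [OF 1, of k2] by (auto simp: k_def add.commute)
    obtain H where H: "rat k (eps (charge a * n)) ?g (theta s x) w H"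
      using rat_mono [OF 2, of k1] by (auto simp: k_def)
    have "S.P2 ?g x w = exps2 scale ?c ?d (P2 ?g (theta s x) w)"
    proof (intro ext)
      fix i j
      have "S.P2 ?g x w i j = flow s a i (S.vo x j w)"
        by (simp add: S.P2_def S.vo_generator)
      also have "\<dots> = exps2 scale ?c ?d (P2 ?g (theta s x) w) i j"
        by (simp add: psi.IH flow_def exps2_def P2_def [abs_def] vo_generator linear_exps [OF linear_A trunc_vo])
      finally show "S.P2 ?g x w i j = exps2 scale ?c ?d (P2 ?g (theta s x) w) i j" .
    qed
    \<comment> \<open>The numerators are determined by the products once the exponents
      \<open>k\<close> agree, so they differ by the same exponential.\<close>
    then have GH: "G = exps2 scale ?c ?d H"
      using S.ratD(2) [OF G] ratD(2) [OF H]
      by (metis (no_types, lifting) ext dif_pow_exps2 [OF trunc2_P2])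
    have bH: "bounded2 H" by (rule ratD(1) [OF H])
    have sH: "subst2 scale H = (\<lambda>i j. vo (psi a (i + int k) (theta s x)) j w)"
      using ratD(4) [OF H] by (intro ext) (simp add: I2_def Fg)
    have tr: "trunc2 (\<lambda>i j. vo (psi a (i + int k) (theta s x)) j w)"
      using trunc2_subst2 [OF bH] by (simp add: sH)
    have "S.vo (psi a m x) l w = subst2 scale G (m - int k) l"
      using S.ratD(4) [OF G, of "m - int k" l] by (simp add: S.I2_def Fg)
    also have "\<dots> = exps2 scale ?c (?c + ?d) (\<lambda>i j. vo (psi a (i + int k) (theta s x)) j w) (m - int k) l"
      unfolding GH subst2_exps2 [OF bH] sH ..
    also have "\<dots> = exps scale (?c + ?d) (\<lambda>j. exps scale ?c (\<lambda>i. vo (psi a (i + int k) (theta s x)) j w) (m - int k)) l"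
      by (rule exps2_swap [OF tr, symmetric])
    also have "\<dots> = exps scale (?c + ?d) (\<lambda>j. vo (F.flow s a m (theta s x)) j w) l"
    proof -
      have "exps scale ?c (\<lambda>i. vo (psi a (i + int k) (theta s x)) j w) (m - int k) = vo (F.flow s a m (theta s x)) j w" for j
        unfolding F.flow_def linear_exps [OF linear_vo_left F.trunc_A]
        using exps_shift [of ?c "\<lambda>i. vo (psi a i (theta s x)) j w" "int k" "m - int k"] by simp
      then show ?thesis by simp
    qed
    finally show ?case by (simp add: theta(3) algebra_simps)
  qed
qed

end

lemma (in graded_deformed_ops) pr_twist_shift: "pr (n + charge a) (twist s a m x) = twist s a m (pr n x)"
proof (induction x rule: homogeneous_induct)
  case (1 k x)
  show ?case
  proof (cases "n = k")
    case True then show ?thesis using 1 by (simp add: pr_twist)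
  next
    case False
    then have "pr n x = 0" using pr_homogeneous [OF 1] by simp
    moreover have "pr (n + charge a) (twist s a m x) = 0"
      using pr_homogeneous [OF pr_twist [OF 1]] False by simp
    ultimately show ?thesis using linear_zeroD [OF field_linear [OF field_twist]] by simp
  qed
next
  case (2 x y)
  then show ?case by (simp add: twist_add linear_addD [OF linear_pr])
qed

section \<open>Restricted modules through their loop spaces\<close>

locale module_ops = loop_deformed_ops scale 1 A
  for scale :: "complex \<Rightarrow> 'w::ab_group_add \<Rightarrow> 'w" and A
begin

lemma graded_clifford_twist: "graded_clifford (pscale scale) (L.twist 1) loop_pr"
proof -
  have d: "deformed_ops (pscale scale) 0 (L.twist 1)" using L.deformed_twist [of 1] by simp
  interpret X: deformed_ops "pscale scale" 0 "L.twist 1" by (rule d)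
  show ?thesis
    by (intro graded_clifford.intro clifford.intro graded_deformed_ops.intro graded_deformed_ops_axioms.intro
        d graded_loop L.pr_twist_shift)
qed

end

sublocale module_ops \<subseteq> M: graded_clifford "pscale scale" "L.twist 1" loop_pr
  by (rule graded_clifford_twist)

context module_ops
begin

text \<open>Multiplication by \<open>t^(-q)\<close>, which turns the flow by \<open>-q\<close> into the given action.\<close>

definition shift :: "int \<Rightarrow> (int \<Rightarrow>\<^sub>0 'w) \<Rightarrow> (int \<Rightarrow>\<^sub>0 'w)" where
  "shift q f = Abs_poly_mapping (\<lambda>j. Poly_Mapping.lookup f (j + q))"

lemma lookup_shift [simp]: "Poly_Mapping.lookup (shift q f) j = Poly_Mapping.lookup f (j + q)"
  unfolding shift_def
proof (subst lookup_Abs [where A = "(\<lambda>j. j - q) ` Poly_Mapping.keys f"])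
  show "k \<in> (\<lambda>j. j - q) ` Poly_Mapping.keys f" if "Poly_Mapping.lookup f (k + q) \<noteq> 0" for k
    by (rule image_eqI [of _ _ "k + q"]) (use that in \<open>auto simp: in_keys_iff\<close>)
qed auto

lemma vs_pscale: "vector_space (pscale scale)"
  using complex_vs_pscale by (simp add: complex_vs_def)

text \<open>A field of charge q takes t^0 to t^q, so before the next field acts the result is moved
  back by \<open>shift q\<close>. The twist on degree \<open>j + q\<close> exceeds that on degree
  \<open>j\<close> by q times the charge of the letter, which is a flow and is handled by
  \<open>vo_flow\<close>.\<close>

lemma vo_shift:
  assumes "fpr p u = u"
  shows "M.vo u l (shift q f)
    = shift q (exps (pscale scale) (- of_int (p * q)) (\<lambda>l. M.vo (theta (- of_int q) u) l f) l)"
proof -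
  have "Vector_Spaces.linear (pscale scale) (pscale scale) (shift q)"
    by (intro linearI vs_pscale; rule poly_mapping_eqI) (simp_all add: lookup_add)
  moreover have "shift q (M.flow (- of_int q) a m x) = L.twist 1 a m (shift q x)" for a m x
  proof (rule poly_mapping_eqI)
    fix j
    let ?f = "\<lambda>m. A a m (Poly_Mapping.lookup x (j + q - charge a))"
    have "Poly_Mapping.lookup (shift q (M.flow (- of_int q) a m x)) j
      = exps scale (- of_int q * of_int (charge a)) (exps scale (of_int (charge a * (j + q - charge a)) + 1/2) ?f) m"
      by (simp add: M.flow_def linear_exps [OF linear_lookup M.trunc_A] lookup_twist_loop)
    also have "\<dots> = exps scale (of_int (charge a * (j - charge a)) + 1/2) ?f m"
      by (simp add: exps_exps trunc_A algebra_simps)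
    finally show "Poly_Mapping.lookup (shift q (M.flow (- of_int q) a m x)) j = Poly_Mapping.lookup (L.twist 1 a m (shift q x)) j"
      by (simp add: lookup_twist_loop algebra_simps)
  qed
  ultimately interpret H: clifford_hom "pscale scale" "M.flow (- of_int q)" "pscale scale" "L.twist 1" "shift q"
    by (intro clifford_hom.intro M.clifford_flow M.clifford_axioms clifford_hom_axioms.intro)
  show ?thesis
    using H.f_vo [of u l f] M.vo_flow [OF assms, of "- of_int q" l f] by (simp add: mult.commute)
qed

end

interpretation FM: module_ops fscale "F.twist (-1)"
  by (intro module_ops.intro loop_deformed_ops.intro FA.deformed_ops_axioms)

text \<open>The Fock space inside its own loop space, with the charge, lowered by \<open>q\<close>,
  recorded by t. There the twists by -1 on the Fock space and by 1 on loops cancel up to a flow by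
  \<open>- q\<close>.\<close>

definition unroll :: "int \<Rightarrow> fock \<Rightarrow> (int \<Rightarrow>\<^sub>0 fock)" where
  "unroll q y = Abs_poly_mapping (\<lambda>j. fpr (j + q) y)"

lemma lookup_unroll: "Poly_Mapping.lookup (unroll q y) j = fpr (j + q) y"
  unfolding unroll_def
proof (subst lookup_Abs [where A = "(\<lambda>n. n - q) ` {n. fpr n y \<noteq> 0}"])
  show "k \<in> (\<lambda>n. n - q) ` {n. fpr n y \<noteq> 0}" if "fpr (k + q) y \<noteq> 0" for k
    by (rule image_eqI [of _ _ "k + q"]) (use that in auto)
qed (auto simp: F.finite_pr)

lemma unroll_homogeneous: "fpr q y = y \<Longrightarrow> unroll q y = Poly_Mapping.single 0 y"
  by (rule poly_mapping_eqI) (auto simp: lookup_unroll lookup_single when_def F.pr_homogeneous [of q])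

text \<open>Expresses the fields on the loop space of the Fock module by those of the Fock space
  itself, so that iterates in \<open>V\<close> can be compared with iterates in the Fock
  space.\<close>

lemma vo_unroll:
  assumes "fpr p u = u"
  shows "FM.M.vo u l (unroll q y)
    = unroll q (exps fscale (- of_int (p * q)) (\<lambda>l. F.vo (theta (- of_int q) u) l y) l)"
proof -
  have "Vector_Spaces.linear fscale (pscale fscale) (unroll q)"
    by (intro linearI F.vector_space_axioms FM.vs_pscale; rule poly_mapping_eqI)
      (simp_all add: lookup_add lookup_unroll linear_addD [OF F.linear_pr] linear_scaleD [OF F.linear_pr])
  moreover have "unroll q (F.flow (- of_int q) a m x) = FM.L.twist 1 a m (unroll q x)" for a m x
  proof (rule poly_mapping_eqI)
    fix j
    define n where "n = j - charge a + q"
    have "fpr n (fpr n x) = fpr n x" by (simp add: F.pr_pr)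
    note h = F.twist_homogeneous [OF this]
    have "Poly_Mapping.lookup (FM.L.twist 1 a m (unroll q x)) j
      = exps fscale (of_int (charge a * (j - charge a)) + 1/2) (exps fscale (- (of_int (charge a * n) + 1/2)) (\<lambda>m. psi a m (fpr n x))) m"
      by (simp only: FM.lookup_twist_loop lookup_unroll n_def [symmetric] h) simp
    also have "\<dots> = exps fscale (- of_int q * of_int (charge a)) (\<lambda>m. psi a m (fpr n x)) m"
      by (simp add: F.exps_exps F.trunc_A n_def algebra_simps)
    also have "\<dots> = fpr (n + charge a) (F.flow (- of_int q) a m x)"
      by (simp add: F.flow_def linear_exps [OF F.linear_pr F.trunc_A] F.pr_A)
    finally show "Poly_Mapping.lookup (unroll q (F.flow (- of_int q) a m x)) j
        = Poly_Mapping.lookup (FM.L.twist 1 a m (unroll q x)) j"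
      by (simp add: lookup_unroll n_def)
  qed
  ultimately interpret H: clifford_hom fscale "F.flow (- of_int q)" "pscale fscale" "FM.L.twist 1" "unroll q"
    by (intro clifford_hom.intro F.clifford_flow FM.M.clifford_axioms clifford_hom_axioms.intro)
  show ?thesis
    using H.f_vo [of u l y] F.vo_flow [OF assms, of "- of_int q" l y] by (simp add: mult.commute)
qed

section \<open>The fields on a restricted module\<close>

definition ops :: "(int \<Rightarrow> 'w \<Rightarrow> 'w) \<Rightarrow> (int \<Rightarrow> 'w \<Rightarrow> 'w) \<Rightarrow> letter \<Rightarrow> int \<Rightarrow> 'w \<Rightarrow> 'w" where
  "ops Y Ys = (\<lambda>a. case a of Yl \<Rightarrow> Y | Ysl \<Rightarrow> Ys)"

lemma ops_simps [simp]: "ops Y Ys Yl = Y" "ops Y Ys Ysl = Ys"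
  by (simp_all add: ops_def)

lemma letter_act_ops: "letter_act Y Ys (a, n) = ops Y Ys a n"
  by (cases a) simp_all

lemma module_ops_restricted:
  assumes "restricted_A_module s Y Ys"
  shows "module_ops s (ops Y Ys)"
  unfolding ops_def
  by (intro module_ops.intro loop_deformed_ops.intro restricted_A_module_deformed assms)

interpretation VM: module_ops VA_scale "ops VA_Y VA_Ys"
  by (rule module_ops_restricted) (rule VA.restricted_A_module_axioms)

section \<open>The canonical map from V to the Fock space\<close>

definition kappa :: "VA \<Rightarrow> fock" where
  "kappa = (SOME f. A_module_hom VA_scale VA_Y VA_Ys fscale (F.twist (-1) Yl) (F.twist (-1) Ysl) f \<and> f VA_one = fvac)"

lemma kappa_hom: "A_module_hom VA_scale VA_Y VA_Ys fscale (F.twist (-1) Yl) (F.twist (-1) Ysl) kappa"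
  and kappa_one [simp]: "kappa VA_one = fvac"
proof -
  have "\<exists>f. A_module_hom VA_scale VA_Y VA_Ys fscale (F.twist (-1) Yl) (F.twist (-1) Ysl) f \<and> f VA_one = fvac"
    by (rule FA.VA_hom) (rename_tac a n, case_tac a, simp_all add: twist_fvac)
  from someI_ex [OF this]
  show "A_module_hom VA_scale VA_Y VA_Ys fscale (F.twist (-1) Yl) (F.twist (-1) Ysl) kappa" "kappa VA_one = fvac"
    unfolding kappa_def by blast+
qed

lemma linear_kappa: "Vector_Spaces.linear VA_scale fscale kappa"
  using kappa_hom by (simp add: A_module_hom_def)

lemma kappa_ops: "kappa (ops VA_Y VA_Ys a n u) = F.twist (-1) a n (kappa u)"
  using kappa_hom by (cases a) (simp_all add: A_module_hom_def)

lemmas kappa_add = linear_addD [OF linear_kappa]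
lemmas kappa_scale = linear_scaleD [OF linear_kappa]

lemma VA_one_neq_0: "VA_one \<noteq> 0"
  using fvac_neq_0 kappa_one linear_zeroD [OF linear_kappa] by metis

text \<open>Charge is read off in the Fock space, on which alone the fields below depend; vectors
  killed by \<open>kappa\<close> have every charge.\<close>

definition hom :: "int \<Rightarrow> VA \<Rightarrow> bool" where
  "hom n u \<longleftrightarrow> fpr n (kappa u) = kappa u"

lemma hom_one: "hom 0 VA_one"
  by (simp add: hom_def fpr_fvac)

lemma hom_ops: "hom n u \<Longrightarrow> hom (n + charge a) (ops VA_Y VA_Ys a m u)"
  by (simp add: hom_def kappa_ops F.pr_twist)

lemma hom_scale: "hom n u \<Longrightarrow> hom n (VA_scale c u)"
  by (simp add: hom_def kappa_scale linear_scaleD [OF F.linear_pr])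

lemma VA_word_induct [case_names add scale one ops]:
  assumes "\<And>u v. P u \<Longrightarrow> P v \<Longrightarrow> P (u + v)" "\<And>c u. P u \<Longrightarrow> P (VA_scale c u)" "P VA_one"
    "\<And>a n m u. hom m u \<Longrightarrow> P u \<Longrightarrow> P (ops VA_Y VA_Ys a n u)"
  shows "P u"
proof -
  have w: "P (word_act VA_Y VA_Ys ws VA_one) \<and> (\<exists>m. hom m (word_act VA_Y VA_Ys ws VA_one))" for ws
  proof (induction ws)
    case Nil then show ?case using assms(3) hom_one by auto
  next
    case (Cons p ws)
    then show ?case by (cases p) (auto simp: letter_act_ops intro: assms(4) hom_ops)
  qed
  have "u \<in> VA.span {word_act VA_Y VA_Ys ws VA_one | ws. True}"
    unfolding VA_generated by (rule UNIV_I)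
  then show ?thesis
  proof (induction rule: VA.span_induct_alt)
    case base
    have "P (VA_scale 0 VA_one)" by (rule assms(2) [OF assms(3)])
    then show ?case by simp
  next
    case (step c x y)
    from step(1) obtain ws where "x = word_act VA_Y VA_Ys ws VA_one" by auto
    with w [of ws] have "P x" by simp
    then show ?case by (intro assms(1,2) step.IH)
  qed
qed

lemma VA_hom_induct [case_names add hom]:
  assumes "\<And>u v. P u \<Longrightarrow> P v \<Longrightarrow> P (u + v)" "\<And>n u. hom n u \<Longrightarrow> P u"
  shows "P u"
proof -
  have "\<exists>us. u = sum_list us \<and> (\<forall>v\<in>set us. \<exists>n. hom n v)"
  proof (induction u rule: VA_word_induct)
    case (add u v)
    obtain us where us: "u = sum_list us" "\<forall>v\<in>set us. \<exists>n. hom n v" using add(1) by blast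
    obtain vs where vs: "v = sum_list vs" "\<forall>v\<in>set vs. \<exists>n. hom n v" using add(2) by blast
    show ?case by (rule exI [of _ "us @ vs"]) (use us vs in auto)
  next
    case (scale c u)
    then obtain us where us: "u = sum_list us" "\<forall>v\<in>set us. \<exists>n. hom n v" by blast
    have "VA_scale c (sum_list us) = sum_list (map (VA_scale c) us)"
      by (induction us) (simp_all add: VA.scale_right_distrib)
    then show ?case using us by (intro exI [of _ "map (VA_scale c) us"]) (auto intro: hom_scale)
  next
    case one then show ?case by (intro exI [of _ "[VA_one]"]) (auto intro: hom_one)
  next
    case (ops a n m u)
    then show ?case by (intro exI [of _ "[ops VA_Y VA_Ys a n u]"]) (auto intro: hom_ops)
  qed
  then obtain us where us: "u = sum_list us" "\<forall>v\<in>set us. \<exists>n. hom n v" by blast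
  have "P 0" using assms(2) [of 0 0] by (simp add: hom_def linear_zeroD [OF linear_kappa])
  with us(2) have "P (sum_list us)" by (induction us) (auto intro: assms)
  then show ?thesis by (simp add: us)
qed

text \<open>A creation operator is recovered from twisted operators by the opposite exponential, a
  finite combination of modes on \<open>V\<close>. The states of the braiding are chosen as
  preimages.\<close>

lemma kappa_surj: "\<exists>u. kappa u = x"
proof (induction x rule: fock_induct')
  case (add x y) then show ?case by (metis kappa_add)
next
  case (scale c x) then show ?case by (metis kappa_scale)
next
  case (word ws)
  show ?case
  proof (induction ws)
    case Nil
    have "kappa VA_one = word_vec []" by (simp add: word_vec_simps)
    then show ?case by blast
  next
    case (Cons g ws)
    then obtain u where u: "kappa u = word_vec ws" by blast
    let ?a = "gen_letter g" and ?m = "- int (g div 2) - 1"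
    let ?c = "of_int (charge ?a * word_charge ws) + 1/2 :: complex"
    have h: "kappa (ops VA_Y VA_Ys ?a m u) = exps fscale (- ?c) (\<lambda>m. psi ?a m (word_vec ws)) m" for m
      using F.twist_homogeneous [OF fpr_word_vec [of ws], of "-1" ?a m] by (simp add: kappa_ops u)
    have "kappa (exps VA_scale ?c (\<lambda>m. ops VA_Y VA_Ys ?a m u) ?m)
        = exps fscale ?c (exps fscale (- ?c) (\<lambda>m. psi ?a m (word_vec ws))) ?m"
      by (simp add: linear_exps [OF linear_kappa VM.trunc_A] h)
    also have "\<dots> = word_vec (g # ws)" by (simp add: F.exps_exps F.trunc_A cre_psi)
    finally show ?case by blast
  qed
qed

lemma kappa_generator: "kappa (ops VA_Y VA_Ys a (-1) VA_one) = psi a (-1) fvac"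
proof -
  have "kappa (ops VA_Y VA_Ys a (-1) VA_one) = exps fscale (-1/2) (\<lambda>m. psi a m fvac) (-1)"
    by (simp add: kappa_ops F.twist_homogeneous [OF fpr_fvac])
  also have "\<dots> = (\<Sum>k<1. fscale ((-1/2) ^ k / fact k) (psi a (-1 + int k) fvac))"
    by (rule F.exps_eq) (simp add: psi_fvac)
  finally show ?thesis by simp
qed

context module_ops
begin

abbreviation inj0 :: "'w \<Rightarrow> (int \<Rightarrow>\<^sub>0 'w)" where
  "inj0 \<equiv> Poly_Mapping.single 0"

lemma trunc_lookup: "trunc (\<lambda>n. Poly_Mapping.lookup (M.vo u n f) p)"
  using M.trunc_vo [of u f] unfolding trunc_def by (metis lookup_zero)

text \<open>
  The twist makes the loop space a Clifford module; on a vector of charge \<open>p\<close> the state-field map of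
  the Fock space is corrected by the factor \<open>e^(- p^2 x / 2)\<close>, which untwists it.
\<close>

definition YW :: "VA \<Rightarrow> int \<Rightarrow> 'w \<Rightarrow> 'w" where
  "YW u n w = Sum_any (\<lambda>p. exps scale (- (of_int p)\<^sup>2 / 2)
     (\<lambda>n. Poly_Mapping.lookup (M.vo (fpr p (kappa u)) n (inj0 w)) p) n)"

lemma YW_hom:
  assumes "hom p u"
  shows "YW u n w = exps scale (- (of_int p)\<^sup>2 / 2) (\<lambda>n. Poly_Mapping.lookup (M.vo (kappa u) n (inj0 w)) p) n"
  unfolding YW_def
  by (rule F.Sum_any_homogeneous [where f = "\<lambda>p x. exps scale (- (of_int p)\<^sup>2 / 2)
     (\<lambda>n. Poly_Mapping.lookup (M.vo x n (inj0 w)) p) n"]) (use assms in \<open>simp_all add: hom_def\<close>)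

lemma YW_add: "YW (u + v) n w = YW u n w + YW v n w"
  unfolding YW_def kappa_add
  by (rule F.Sum_any_pr_add [where f = "\<lambda>p x. exps scale (- (of_int p)\<^sup>2 / 2)
     (\<lambda>n. Poly_Mapping.lookup (M.vo x n (inj0 w)) p) n"])
    (simp add: M.vo_add lookup_add exps_add trunc_lookup)

lemma YW_scale: "YW (VA_scale c u) n w = scale c (YW u n w)"
proof (induction u rule: VA_hom_induct)
  case (add u v)
  then show ?case by (simp add: VA.scale_right_distrib YW_add scale_right_distrib)
next
  case (hom p u)
  show ?case
    by (simp add: YW_hom [OF hom] YW_hom [OF hom_scale [OF hom]] kappa_scale M.vo_scale exps_scale trunc_lookup)
qed

lemma linear_YW_left: "Vector_Spaces.linear VA_scale scale (\<lambda>u. YW u n w)"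
  by (intro linearI VA.vector_space_axioms vector_space_axioms YW_add YW_scale)

lemma field_YW: "field scale (YW u)"
proof (induction u rule: VA_hom_induct)
  case (add u v)
  have "field scale (\<lambda>n w. YW u n w + YW v n w)"
    unfolding field_def
  proof (intro conjI allI linearI vector_space_axioms)
    note l = linear_addD [OF field_linear [OF add(1)]] linear_addD [OF field_linear [OF add(2)]]
      linear_scaleD [OF field_linear [OF add(1)]] linear_scaleD [OF field_linear [OF add(2)]]
    show "YW u n (x + y) + YW v n (x + y) = YW u n x + YW v n x + (YW u n y + YW v n y)" for n x y
      by (simp add: l algebra_simps)
    show "YW u n (scale c x) + YW v n (scale c x) = scale c (YW u n x + YW v n x)" for n c x
      by (simp add: l scale_right_distrib)
    fix w
    obtain N K where "\<And>n. n \<ge> N \<Longrightarrow> YW u n w = 0" "\<And>n. n \<ge> K \<Longrightarrow> YW v n w = 0"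
      using field_trunc [OF add(1), of w] field_trunc [OF add(2), of w] unfolding trunc_def by metis
    then show "trunc (\<lambda>n. YW u n w + YW v n w)" unfolding trunc_def by (intro exI [of _ "max N K"]) simp
  qed
  then show ?case by (simp add: YW_add [abs_def])
next
  case (hom p u)
  have "field scale (\<lambda>n w. Poly_Mapping.lookup (M.vo (kappa u) n (inj0 w)) p)"
    unfolding field_def
  proof (intro conjI allI linearI vector_space_axioms trunc_lookup)
    show "Poly_Mapping.lookup (M.vo (kappa u) n (inj0 (x + y))) p
      = Poly_Mapping.lookup (M.vo (kappa u) n (inj0 x)) p + Poly_Mapping.lookup (M.vo (kappa u) n (inj0 y)) p" for n x y
      by (simp add: single_add linear_addD [OF M.linear_vo] lookup_add)
    show "Poly_Mapping.lookup (M.vo (kappa u) n (inj0 (scale c x))) p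
      = scale c (Poly_Mapping.lookup (M.vo (kappa u) n (inj0 x)) p)" for n c x
      by (simp add: linear_scaleD [OF linear_single] linear_scaleD [OF M.linear_vo])
  qed
  from field_exps [OF this] show ?case by (simp add: YW_hom [OF hom] field_def)
qed

lemmas linear_YW = field_linear [OF field_YW]
lemmas trunc_YW = field_trunc [OF field_YW]

lemma YW_one: "YW VA_one n w = (if n = -1 then w else 0)"
  by (simp add: YW_hom [OF hom_one] M.vo_fvac)

text \<open>On t^0 the twist multiplies a(x) by e^(x/2), which the correction with p^2 = 1
  removes.\<close>

lemma YW_generator: "YW (ops VA_Y VA_Ys a (-1) VA_one) n w = A a n w"
proof -
  have h: "hom (charge a) (ops VA_Y VA_Ys a (-1) VA_one)" using hom_ops [OF hom_one] by simp
  have "(of_int (charge a))\<^sup>2 = (1 :: complex)" by (cases a) simp_all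
  then show ?thesis
    by (simp add: YW_hom [OF h] kappa_generator M.vo_generator lookup_twist_loop exps_exps trunc_A)
qed

lemma vo_inj0:
  assumes "fpr q y = y"
  shows "inj0 (Poly_Mapping.lookup (M.vo y n (inj0 w)) q) = shift q (M.vo y n (inj0 w))"
proof -
  have "loop_pr 0 (inj0 w) = inj0 w" by (simp add: loop_pr_def)
  then have "loop_pr q (M.vo y n (inj0 w)) = M.vo y n (inj0 w)" using M.pr_vo [OF assms, of 0 n "inj0 w"] by simp
  then have l: "Poly_Mapping.lookup (M.vo y n (inj0 w)) j = 0" if "j \<noteq> q" for j
    using lookup_loop_pr [of q "M.vo y n (inj0 w)" j] that by simp
  show ?thesis
    by (rule poly_mapping_eqI) (auto simp: lookup_single when_def l)
qed

text \<open>The exponents collect the correction for \<open>u\<close>, the cost - p q of returning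
  from degree \<open>q\<close> to degree 0, and the correction for \<open>v\<close>.\<close>

lemma YW_YW:
  assumes u: "hom p u" and v: "hom q v"
  defines "\<alpha> \<equiv> - (of_int p)\<^sup>2 / 2 - of_int (p * q) :: complex" and "\<beta> \<equiv> - (of_int q)\<^sup>2 / 2 :: complex"
  shows "YW u m (YW v n w) = exps2 scale \<alpha> \<beta>
    (\<lambda>m n. Poly_Mapping.lookup (M.P2 (theta (- of_int q) (kappa u)) (kappa v) (inj0 w) m n) (p + q)) m n"
proof -
  let ?\<theta> = "theta (- of_int q) (kappa u)"
  define z where "z n = Poly_Mapping.lookup (M.vo (kappa v) n (inj0 w)) q" for n
  define R where "R m n = Poly_Mapping.lookup (M.P2 ?\<theta> (kappa v) (inj0 w) m n) (p + q)" for m n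
  have tz: "trunc z" unfolding z_def by (rule trunc_lookup)
  have tR: "trunc2 R" using M.trunc2_P2 unfolding R_def trunc2_def by (metis lookup_zero)
  have fu: "fpr p (kappa u) = kappa u" and fv: "fpr q (kappa v) = kappa v" using u v by (simp_all add: hom_def)
  have z: "YW u m (z n) = exps scale \<alpha> (\<lambda>m. R m n) m" for m n
  proof -
    have "Poly_Mapping.lookup (M.vo (kappa u) m (inj0 (z n))) p = exps scale (- of_int (p * q)) (\<lambda>m. R m n) m" for m
      unfolding z_def vo_inj0 [OF fv] vo_shift [OF fu]
      by (simp add: R_def M.P2_def linear_exps [OF linear_lookup M.trunc_vo])
    then show ?thesis
      by (simp add: YW_hom [OF u] exps_exps [OF trunc2_col [OF tR]] \<alpha>_def)
  qed
  have "YW v n w = exps scale \<beta> z n" 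
    unfolding YW_hom [OF v] z_def [abs_def] \<beta>_def ..
  then have "YW u m (YW v n w) = exps scale \<beta> (\<lambda>n. exps scale \<alpha> (\<lambda>m. R m n) m) n"
    by (simp add: linear_exps [OF linear_YW tz] z)
  also have "\<dots> = exps2 scale \<alpha> \<beta> R m n" by (rule exps2_swap [OF tR])
  finally show ?thesis by (simp add: R_def [abs_def])
qed

end

text \<open>Applied to \<open>kappa\<close>, this lets fields on \<open>V\<close> be computed after
  passing to the Fock space.\<close>

lemma YW_natural:
  assumes "module_ops s A" "module_ops t B" and lin: "Vector_Spaces.linear s t h"
    and hA: "\<And>a m x. h (A a m x) = B a m (h x)"
  shows "h (module_ops.YW s A u n w) = module_ops.YW t B u n (h w)"
proof -
  interpret S: module_ops s A by fact
  interpret T: module_ops t B by fact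
  define hh where "hh f = Abs_poly_mapping (\<lambda>j. h (Poly_Mapping.lookup f j))" for f :: "int \<Rightarrow>\<^sub>0 'a"
  have lookup_hh: "Poly_Mapping.lookup (hh f) j = h (Poly_Mapping.lookup f j)" for f j
    unfolding hh_def
    by (subst lookup_Abs [where A = "Poly_Mapping.keys f"]) (auto simp: in_keys_iff linear_zeroD [OF lin] intro: classical)
  have "Vector_Spaces.linear (pscale s) (pscale t) hh"
    by (intro linearI S.vs_pscale T.vs_pscale; rule poly_mapping_eqI)
      (simp_all add: lookup_hh lookup_add linear_addD [OF lin] linear_scaleD [OF lin])
  moreover have "hh (S.L.twist 1 a m x) = T.L.twist 1 a m (hh x)" for a m x
    by (rule poly_mapping_eqI)
      (simp add: lookup_hh S.lookup_twist_loop T.lookup_twist_loop linear_exps [OF lin S.trunc_A] hA)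
  ultimately interpret H: clifford_hom "pscale s" "S.L.twist 1" "pscale t" "T.L.twist 1" hh
    by (intro clifford_hom.intro S.M.clifford_axioms T.M.clifford_axioms clifford_hom_axioms.intro)
  have hs: "hh (S.inj0 x) = T.inj0 (h x)" for x
    by (rule poly_mapping_eqI) (simp add: lookup_hh lookup_single when_def linear_zeroD [OF lin])
  show ?thesis
  proof (induction u rule: VA_hom_induct)
    case (add u v)
    then show ?case by (simp add: S.YW_add T.YW_add linear_addD [OF lin])
  next
    case (hom p u)
    have "h (Poly_Mapping.lookup (S.M.vo (kappa u) n (S.inj0 w)) p)
        = Poly_Mapping.lookup (T.M.vo (kappa u) n (T.inj0 (h w))) p" for n
      using arg_cong [OF H.f_vo [of "kappa u" n "S.inj0 w"], of "\<lambda>f. Poly_Mapping.lookup f p"]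
      by (simp add: lookup_hh hs)
    then show ?case
      by (simp add: S.YW_hom [OF hom] T.YW_hom [OF hom] linear_exps [OF lin S.trunc_lookup])
  qed
qed

text \<open>By naturality the computation takes place in the Fock module, where a vector of charge
  \<open>q\<close>, put in degree 0, is its own unrolling.\<close>

lemma kappa_YV:
  assumes u: "hom p u" and v: "hom q v"
  shows "kappa (VM.YW u n v) = exps fscale (- (of_int p)\<^sup>2 / 2 - of_int (p * q))
      (\<lambda>n. F.vo (theta (- of_int q) (kappa u)) n (kappa v)) n"
    and "hom (p + q) (VM.YW u n v)"
proof -
  let ?\<theta> = "theta (- of_int q) (kappa u)"
  have fu: "fpr p (kappa u) = kappa u" and fv: "fpr q (kappa v) = kappa v" using u v by (simp_all add: hom_def)
  have c: "fpr (p + q) (F.vo ?\<theta> n (kappa v)) = F.vo ?\<theta> n (kappa v)" for n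
    by (rule fpr_F_vo [OF fpr_theta [OF fu] fv])
  have "kappa (VM.YW u n v) = FM.YW u n (kappa v)"
    by (rule YW_natural [OF VM.module_ops_axioms FM.module_ops_axioms linear_kappa]) (rule kappa_ops)
  also have "\<dots> = exps fscale (- (of_int p)\<^sup>2 / 2) (\<lambda>n. fpr (p + q) (exps fscale (- of_int (p * q)) (\<lambda>n. F.vo ?\<theta> n (kappa v)) n)) n"
    unfolding FM.YW_hom [OF u] unroll_homogeneous [OF fv, symmetric] vo_unroll [OF fu] lookup_unroll ..
  also have "\<dots> = exps fscale (- (of_int p)\<^sup>2 / 2) (exps fscale (- of_int (p * q)) (\<lambda>n. F.vo ?\<theta> n (kappa v))) n"
    by (simp add: linear_exps [OF F.linear_pr F.trunc_vo] c)
  also have "\<dots> = exps fscale (- (of_int p)\<^sup>2 / 2 - of_int (p * q)) (\<lambda>n. F.vo ?\<theta> n (kappa v)) n"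
    by (simp add: F.exps_exps F.trunc_vo)
  finally show k: "kappa (VM.YW u n v) = exps fscale (- (of_int p)\<^sup>2 / 2 - of_int (p * q))
      (\<lambda>n. F.vo ?\<theta> n (kappa v)) n" .
  show "hom (p + q) (VM.YW u n v)"
    unfolding hom_def k by (simp add: linear_exps [OF F.linear_pr F.trunc_vo] c)
qed

context module_ops
begin

lemma YW_YV:
  assumes u: "hom p u" and v: "hom q v"
  defines "\<alpha> \<equiv> - (of_int p)\<^sup>2 / 2 - of_int (p * q) :: complex" and "\<beta> \<equiv> - (of_int q)\<^sup>2 / 2 :: complex"
  shows "YW (VM.YW u a v) b w = exps2 scale \<alpha> (\<alpha> + \<beta>)
    (\<lambda>a b. Poly_Mapping.lookup (M.I2 (theta (- of_int q) (kappa u)) (kappa v) (inj0 w) a b) (p + q)) a b"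
proof -
  let ?\<theta> = "theta (- of_int q) (kappa u)"
  define R where "R a b = Poly_Mapping.lookup (M.I2 ?\<theta> (kappa v) (inj0 w) a b) (p + q)" for a b
  have tR: "trunc2 R" using M.trunc2_I2 unfolding R_def trunc2_def by (metis lookup_zero)
  \<comment> \<open>By this identity the correction for charge \<open>p + q\<close> is the exponent
    that x2 receives when e^(\<alpha> x1 + \<beta> x2) is evaluated at x1 = x2 + x0.\<close>
  have e: "- (of_int (p + q))\<^sup>2 / 2 = \<alpha> + \<beta>"
    by (simp add: \<alpha>_def \<beta>_def power2_eq_square field_simps)
  have r: "Poly_Mapping.lookup (M.vo (kappa (VM.YW u a v)) b (inj0 w)) (p + q) = exps scale \<alpha> (\<lambda>a. R a b) a" for b
  proof -
    have t: "trunc (\<lambda>a. M.vo (F.vo ?\<theta> a (kappa v)) b (inj0 w))"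
      using F.trunc_vo [of ?\<theta> "kappa v"] unfolding trunc_def by (metis M.vo_0)
    show ?thesis
      unfolding kappa_YV(1) [OF u v] linear_exps [OF M.linear_vo_left F.trunc_vo] linear_exps [OF linear_lookup t]
      by (simp add: R_def M.I2_def \<alpha>_def)
  qed
  have "YW (VM.YW u a v) b w = exps scale (\<alpha> + \<beta>) (\<lambda>b. exps scale \<alpha> (\<lambda>a. R a b) a) b"
    unfolding YW_hom [OF kappa_YV(2) [OF u v]] e r ..
  also have "\<dots> = exps2 scale \<alpha> (\<alpha> + \<beta>) R a b" by (rule exps2_swap [OF tR])
  finally show ?thesis by (simp add: R_def [abs_def])
qed

text \<open>The braiding of \<open>u\<close> and \<open>v\<close> shifts both vectors by the charge of the other one and multiplies by \<open>e^(p q x)\<close>.\<close>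

theorem YW_rational:
  assumes u: "hom p u" and v: "hom q v"
    and u': "kappa u' = theta (- of_int q) (kappa u)" and v': "kappa v' = theta (of_int p) (kappa v)"
  shows "\<exists>k G. bounded2 G \<and>
    (\<forall>m n. (dif ^^ k) (\<lambda>m n. YW u m (YW v n w)) m n = G m n) \<and>
    (\<forall>m n. (dif ^^ k) (exps2 scale (- of_int (p * q)) (of_int (p * q)) (\<lambda>m n. YW v' n (YW u' m w))) m n
      = scale (eps (p * q)) (G m n)) \<and>
    (\<forall>a b. YW (VM.YW u (a + int k) v) b w = subst2 scale G a b)"
proof -
  let ?\<theta> = "theta (- of_int q) (kappa u)" and ?L = "\<lambda>f. Poly_Mapping.lookup f (p + q)"
  define \<alpha> where "\<alpha> = (- (of_int p)\<^sup>2 / 2 - of_int (p * q) :: complex)"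
  define \<beta> where "\<beta> = (- (of_int q)\<^sup>2 / 2 :: complex)"
  have fu: "fpr p (kappa u) = kappa u" and fv: "fpr q (kappa v) = kappa v" using u v by (simp_all add: hom_def)
  obtain k G where G: "M.rat k (eps (p * q)) ?\<theta> (kappa v) (inj0 w) G"
    using M.rationality [OF fpr_theta [OF fu] fv] by blast
  define GL where "GL m n = ?L (G m n)" for m n
  define H where "H = exps2 scale \<alpha> \<beta> GL"
  note ll = linear_diffD [OF linear_lookup, of _ _ "p + q"]
  have bGL: "bounded2 GL" unfolding GL_def by (rule bounded2_map [OF M.ratD(1) [OF G]]) simp
  have tP: "trunc2 (\<lambda>m n. ?L (M.P2 ?\<theta> (kappa v) (inj0 w) m n))"
    using M.trunc2_P2 unfolding trunc2_def by (metis lookup_zero)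
  have tB: "trunc2 (\<lambda>m n. ?L (M.B2 ?\<theta> (kappa v) (inj0 w) m n))"
    using M.trunc2_B2 unfolding trunc2_def by (metis lookup_zero)
  have P: "(dif ^^ k) (\<lambda>m n. YW u m (YW v n w)) m n = H m n" for m n
  proof -
    have "(\<lambda>m n. YW u m (YW v n w)) = exps2 scale \<alpha> \<beta> (\<lambda>m n. ?L (M.P2 ?\<theta> (kappa v) (inj0 w) m n))"
      by (intro ext) (simp only: YW_YW [OF u v] \<alpha>_def \<beta>_def)
    moreover have "(dif ^^ k) (\<lambda>m n. ?L (M.P2 ?\<theta> (kappa v) (inj0 w) m n)) = GL"
      by (intro ext) (subst dif_pow_map [where f = ?L, OF ll], simp add: M.ratD(2) [OF G] GL_def)
    ultimately show ?thesis by (simp add: dif_pow_exps2 [OF tP] H_def)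
  qed
  have B: "(dif ^^ k) (exps2 scale (- of_int (p * q)) (of_int (p * q)) (\<lambda>m n. YW v' n (YW u' m w))) m n
      = scale (eps (p * q)) (H m n)" for m n
  proof -
    have hu': "hom p u'" unfolding hom_def u' by (rule fpr_theta [OF fu])
    have hv': "hom q v'" unfolding hom_def v' by (rule fpr_theta [OF fv])
    let ?R = "\<lambda>m n. ?L (M.B2 ?\<theta> (kappa v) (inj0 w) m n)"
    define \<alpha>' where "\<alpha>' = (- (of_int q)\<^sup>2 / 2 - of_int (q * p) :: complex)"
    define \<beta>' where "\<beta>' = (- (of_int p)\<^sup>2 / 2 :: complex)"
    have "YW v' n (YW u' m w) = exps2 scale \<beta>' \<alpha>' ?R m n" for m n
    proof -
      \<comment> \<open>\<open>v'\<close> carries the flow by \<open>p\<close>, which undoes the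
        shift by \<open>- p\<close> due to the charge of \<open>u'\<close>, and \<open>u'\<close>
        carries the shift that \<open>u\<close> has in the product; so the opposite order is formed
        with the same two states.\<close>
      have "M.P2 (theta (- of_int p) (kappa v')) (kappa u') (inj0 w) n m = M.B2 ?\<theta> (kappa v) (inj0 w) m n" for m n
        by (simp add: M.P2_def M.B2_def u' v' theta_theta)
      then have "YW v' n (YW u' m w) = exps2 scale \<alpha>' \<beta>' (\<lambda>n m. ?R m n) n m"
        using YW_YW [OF hv' hu', of n m w] by (simp add: \<alpha>'_def \<beta>'_def add.commute)
      then show ?thesis by (simp add: exps2_flip [OF tB])
    qed
    then have "exps2 scale (- of_int (p * q)) (of_int (p * q)) (\<lambda>m n. YW v' n (YW u' m w))
        = exps2 scale (- of_int (p * q)) (of_int (p * q)) (exps2 scale \<beta>' \<alpha>' ?R)" by simp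
    also have "\<dots> = exps2 scale \<alpha> \<beta> ?R"
    proof -
      \<comment> \<open>The factor e^(p q (x2 - x1)) moves the cross term - p q from x2 to x1, where
        the product has it.\<close>
      have "- of_int (p * q) + \<beta>' = \<alpha>" "of_int (p * q) + \<alpha>' = \<beta>"
        by (simp_all add: \<alpha>_def \<beta>_def \<alpha>'_def \<beta>'_def)
      then show ?thesis by (intro ext) (simp only: exps2_exps2 [OF tB])
    qed
    finally have "(dif ^^ k) (exps2 scale (- of_int (p * q)) (of_int (p * q)) (\<lambda>m n. YW v' n (YW u' m w)))
        = exps2 scale \<alpha> \<beta> ((dif ^^ k) ?R)"
      by (intro ext) (simp only: dif_pow_exps2 [OF tB])
    moreover have "(dif ^^ k) ?R = (\<lambda>m n. scale (eps (p * q)) (GL m n))"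
      by (intro ext) (subst dif_pow_map [where f = ?L, OF ll], simp add: M.ratD(3) [OF G] GL_def)
    ultimately show ?thesis by (simp add: exps2_scale [OF bounded2_trunc2 [OF bGL]] H_def)
  qed
  have I: "YW (VM.YW u (a + int k) v) b w = subst2 scale H a b" for a b
  proof -
    have "?L (M.I2 ?\<theta> (kappa v) (inj0 w) (a + int k) b) = subst2 scale GL a b" for a b
      using linear_subst2 [OF linear_lookup [of "p + q"] M.ratD(1) [OF G], of a b]
      by (simp add: M.ratD(4) [OF G] GL_def [abs_def])
    then have "exps2 scale \<alpha> (\<alpha> + \<beta>) (\<lambda>a b. ?L (M.I2 ?\<theta> (kappa v) (inj0 w) (a + int k) b)) a b
        = subst2 scale H a b"
      by (simp add: H_def subst2_exps2 [OF bGL])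
    moreover have "exps2 scale \<alpha> (\<alpha> + \<beta>) (\<lambda>a b. ?L (M.I2 ?\<theta> (kappa v) (inj0 w) (a + int k) b)) a b
        = YW (VM.YW u (a + int k) v) b w"
      using exps2_shift [of \<alpha> "\<alpha> + \<beta>" "\<lambda>a b. ?L (M.I2 ?\<theta> (kappa v) (inj0 w) a b)" "int k" 0 a b]
      by (simp add: YW_YV [OF u v] \<alpha>_def \<beta>_def)
    ultimately show ?thesis by simp
  qed
  have "bounded2 H" unfolding H_def by (rule bounded2_exps2 [OF bGL])
  with P B I show ?thesis by blast
qed

end

section \<open>Borcherds sums\<close>

text \<open>
  \<open>bor s H r p q\<close> is the mode \<open>(p, q)\<close> of \<open>(x1 - x2)^r H(x1, x2)\<close>, expanded in nonnegative powers of
  \<open>x2\<close>, and \<open>itr s I r p q\<close> the mode \<open>(r, q)\<close> of \<open>(x2 + x0)^p I(x0, x2)\<close>, expanded in nonnegative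
  powers of \<open>x0\<close>: these are the three sums of Borcherds' identity.
\<close>

definition bor :: "(complex \<Rightarrow> 'w \<Rightarrow> 'w) \<Rightarrow> (int \<Rightarrow> int \<Rightarrow> 'w::comm_monoid_add) \<Rightarrow> int \<Rightarrow> int \<Rightarrow> int \<Rightarrow> 'w" where
  "bor s H r p q = Sum_any (\<lambda>i. s ((-1) ^ i * (of_int r gchoose i)) (H (p + r - int i) (q + int i)))"

definition itr :: "(complex \<Rightarrow> 'w \<Rightarrow> 'w) \<Rightarrow> (int \<Rightarrow> int \<Rightarrow> 'w::comm_monoid_add) \<Rightarrow> int \<Rightarrow> int \<Rightarrow> int \<Rightarrow> 'w" where
  "itr s I r p q = Sum_any (\<lambda>i. s (of_int p gchoose i) (I (r + int i) (p + q - int i)))"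

abbreviation (input) flip2 :: "(int \<Rightarrow> int \<Rightarrow> 'w) \<Rightarrow> int \<Rightarrow> int \<Rightarrow> 'w" where
  "flip2 H \<equiv> \<lambda>m n. H n m"

lemma utrunc_flip2_dif:
  assumes "utrunc (flip2 H)" shows "utrunc (flip2 (dif H))"
proof -
  obtain N where "\<And>m n. m \<ge> N \<Longrightarrow> H n m = 0" using assms by (auto simp: utrunc_def)
  then show ?thesis unfolding utrunc_def by (intro exI [of _ N]) (simp add: dif_def)
qed

lemma utrunc_flip2_dif_pow: "utrunc (flip2 H) \<Longrightarrow> utrunc (flip2 ((dif ^^ k) H))"
  by (induction k) (simp_all add: utrunc_flip2_dif)

lemma flip2_dif_pow: "flip2 ((dif ^^ k) H) = (\<lambda>m n. if even k then (dif ^^ k) (flip2 H) m n else - (dif ^^ k) (flip2 H) m n)"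
proof (induction k)
  case (Suc k)
  have "(dif ^^ k) H n m = (if even k then (dif ^^ k) (flip2 H) m n else - (dif ^^ k) (flip2 H) m n)" for m n
    using fun_cong [OF fun_cong [OF Suc, of m], of n] .
  then have "(dif ^^ k) (flip2 H) m n = (if even k then (dif ^^ k) H n m else - (dif ^^ k) H n m)" for m n by simp
  then show ?case by (intro ext) (simp add: dif_pow_Suc del: funpow.simps)
qed simp

lemma Sum_any_reindex_le:
  fixes f :: "nat \<Rightarrow> 'a::comm_monoid_add"
  assumes "finite S" "\<And>i. c - int i \<notin> S \<Longrightarrow> f i = 0"
  shows "Sum_any f = (\<Sum>m\<in>S. if m \<le> c then f (nat (c - m)) else 0)"
proof -
  have "Sum_any f = sum f ((\<lambda>m. nat (c - m)) ` {m \<in> S. m \<le> c})"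
  proof (rule Sum_any.expand_superset)
    show "{i. f i \<noteq> 0} \<subseteq> (\<lambda>m. nat (c - m)) ` {m \<in> S. m \<le> c}"
    proof
      fix i assume "i \<in> {i. f i \<noteq> 0}"
      then have "c - int i \<in> {m \<in> S. m \<le> c}" using assms(2) by auto
      then show "i \<in> (\<lambda>m. nat (c - m)) ` {m \<in> S. m \<le> c}" by (rule rev_image_eqI) simp
    qed
  qed (use assms(1) in simp)
  also have "\<dots> = (\<Sum>m\<in>{m \<in> S. m \<le> c}. f (nat (c - m)))"
    by (subst sum.reindex) (auto simp: inj_on_def)
  finally show ?thesis using assms(1) by (simp add: sum.inter_filter)
qed

lemma Sum_any_reindex_ge:
  fixes f :: "nat \<Rightarrow> 'a::comm_monoid_add"
  assumes "finite S" "\<And>i. c + int i \<notin> S \<Longrightarrow> f i = 0"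
  shows "Sum_any f = (\<Sum>m\<in>S. if m \<ge> c then f (nat (m - c)) else 0)"
proof -
  have "Sum_any f = (\<Sum>m\<in>uminus ` S. if m \<le> - c then f (nat (- c - m)) else 0)"
  proof (rule Sum_any_reindex_le)
    fix i assume "- c - int i \<notin> uminus ` S"
    then have "c + int i \<notin> S" by (metis image_eqI minus_diff_eq minus_minus diff_minus_eq_add add.commute)
    then show "f i = 0" by (rule assms(2))
  qed (use assms(1) in simp)
  also have "\<dots> = (\<Sum>m\<in>S. if m \<ge> c then f (nat (m - c)) else 0)"
    by (subst sum.reindex) (auto simp: inj_on_def intro!: sum.cong arg_cong [of _ _ f])
  finally show ?thesis .
qed

context complex_vs
begin

lemma bor_eq:
  assumes "\<And>i. i \<ge> K \<Longrightarrow> H (p + r - int i) (q + int i) = 0"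
  shows "bor scale H r p q = (\<Sum>i<K. scale ((-1) ^ i * (of_int r gchoose i)) (H (p + r - int i) (q + int i)))"
  unfolding bor_def by (rule Sum_any_lessThan) (simp add: assms)

lemma itr_eq:
  assumes "\<And>i. i \<ge> K \<Longrightarrow> I (r + int i) (p + q - int i) = 0"
  shows "itr scale I r p q = (\<Sum>i<K. scale (of_int p gchoose i) (I (r + int i) (p + q - int i)))"
  unfolding itr_def by (rule Sum_any_lessThan) (simp add: assms)

lemma bor_vanish: "(\<And>m n. n \<ge> q \<Longrightarrow> H m n = 0) \<Longrightarrow> bor scale H r p q = 0"
  by (simp add: bor_def)

lemma bor_add:
  assumes "utrunc (flip2 G)" "utrunc (flip2 H)"
  shows "bor scale (\<lambda>m n. G m n + H m n) r p q = bor scale G r p q + bor scale H r p q"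
proof -
  obtain K where K: "\<And>i n. i \<ge> K \<Longrightarrow> G n (q + int i) = 0" using utruncE [OF assms(1)] by metis
  obtain L where L: "\<And>i n. i \<ge> L \<Longrightarrow> H n (q + int i) = 0" using utruncE [OF assms(2)] by metis
  show ?thesis
    using K L by (subst (1 2 3) bor_eq [where K = "max K L"]) (simp_all add: scale_right_distrib sum.distrib)
qed

lemma bor_scale:
  assumes "utrunc (flip2 H)"
  shows "bor scale (\<lambda>m n. scale c (H m n)) r p q = scale c (bor scale H r p q)"
proof -
  obtain K where K: "\<And>i n. i \<ge> K \<Longrightarrow> H n (q + int i) = 0" using utruncE [OF assms] by metis
  show ?thesis
    using K by (subst (1 2) bor_eq [where K = K]) (simp_all add: scale_sum_right mult.commute)
qed

lemma itr_add:
  assumes "utrunc G" "utrunc H"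
  shows "itr scale (\<lambda>m n. G m n + H m n) r p q = itr scale G r p q + itr scale H r p q"
proof -
  obtain K where K: "\<And>i n. i \<ge> K \<Longrightarrow> G (r + int i) n = 0" using utruncE [OF assms(1)] by metis
  obtain L where L: "\<And>i n. i \<ge> L \<Longrightarrow> H (r + int i) n = 0" using utruncE [OF assms(2)] by metis
  show ?thesis
    using K L by (subst (1 2 3) itr_eq [where K = "max K L"]) (simp_all add: scale_right_distrib sum.distrib)
qed

lemma bor_dif:
  assumes "utrunc (flip2 H)"
  shows "bor scale (dif H) r p q = bor scale H (r + 1) p q"
proof -
  obtain K where K: "\<And>i n. i \<ge> K \<Longrightarrow> H n (q + int i) = 0" using utruncE [OF assms] by metis
  let ?c = "\<lambda>i. (-1) ^ i * (of_int r gchoose i) :: complex"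
  let ?c' = "\<lambda>i. (-1) ^ i * (of_int (r + 1) gchoose i) :: complex"
  have K1: "H n (q + int i + 1) = 0" if "i \<ge> K" for n i using K [of "Suc i" n] that by (simp add: algebra_simps)
  have "bor scale (dif H) r p q = (\<Sum>i<Suc K. scale (?c i) (dif H (p + r - int i) (q + int i)))"
    by (rule bor_eq) (simp add: dif_def K K1)
  also have "\<dots> = (\<Sum>i<Suc K. scale (?c i) (H (p + r - int i + 1) (q + int i)))
      - (\<Sum>i<Suc K. scale (?c i) (H (p + r - int i) (q + int i + 1)))"
    by (simp only: dif_def scale_right_diff_distrib sum_subtractf)
  also have "\<dots> = H (p + r + 1) q + ((\<Sum>i<K. scale (?c (Suc i)) (H (p + r - int i) (q + int i + 1)))
      - (\<Sum>i<K. scale (?c i) (H (p + r - int i) (q + int i + 1))))"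
    using K1 [of K] by (subst (1) sum.lessThan_Suc_shift) (simp add: algebra_simps)
  also have "\<dots> = H (p + r + 1) q + (\<Sum>i<K. scale (?c' (Suc i)) (H (p + r - int i) (q + int i + 1)))"
    unfolding sum_subtractf [symmetric] scale_left_diff_distrib [symmetric]
  proof -
    have "?c (Suc i) - ?c i = ?c' (Suc i)" for i
      using gbinomial_Suc_Suc [of "of_int r :: complex" i] by (simp add: algebra_simps)
    then show "H (p + r + 1) q + (\<Sum>i<K. scale (?c (Suc i) - ?c i) (H (p + r - int i) (q + int i + 1)))
      = H (p + r + 1) q + (\<Sum>i<K. scale (?c' (Suc i)) (H (p + r - int i) (q + int i + 1)))"
      by (simp only:)
  qed
  also have "\<dots> = (\<Sum>i<Suc K. scale (?c' i) (H (p + (r + 1) - int i) (q + int i)))"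
    by (subst sum.lessThan_Suc_shift) (simp add: algebra_simps)
  also have "\<dots> = bor scale H (r + 1) p q"
    by (rule bor_eq [symmetric]) (simp add: K)
  finally show ?thesis .
qed

text \<open>x1 = (x1 - x2) + x2. \<open>itr\<close> obeys the same recursion, from x2 + x0, so
  multiplication by powers of x0 + x2 is a shift of \<open>p\<close> on either side.\<close>

lemma bor_step:
  assumes "utrunc (flip2 H)"
  shows "bor scale H r (p + 1) q = bor scale H (r + 1) p q + bor scale H r p (q + 1)"
proof -
  obtain N where N: "\<And>m n. m \<ge> N \<Longrightarrow> H n m = 0" using assms by (auto simp: utrunc_def)
  have t: "utrunc (flip2 (\<lambda>m n. H m (n + 1)))"
    unfolding utrunc_def by (rule exI [of _ N]) (simp add: N)
  have "bor scale H r (p + 1) q = bor scale (\<lambda>m n. H (m + 1) n) r p q"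
    unfolding bor_def by (simp add: algebra_simps)
  also have "\<dots> = bor scale (\<lambda>m n. dif H m n + H m (n + 1)) r p q"
    by (simp add: dif_def)
  also have "\<dots> = bor scale H (r + 1) p q + bor scale (\<lambda>m n. H m (n + 1)) r p q"
    using bor_add [OF utrunc_flip2_dif [OF assms] t] by (simp add: bor_dif [OF assms])
  also have "bor scale (\<lambda>m n. H m (n + 1)) r p q = bor scale H r p (q + 1)"
    unfolding bor_def by (simp add: algebra_simps)
  finally show ?thesis .
qed

lemma itr_step:
  assumes "utrunc I"
  shows "itr scale I r (p + 1) q = itr scale I (r + 1) p q + itr scale I r p (q + 1)"
proof -
  obtain K where K: "\<And>i n. i \<ge> K \<Longrightarrow> I (r + int i) n = 0" using utruncE [OF assms] by metis
  have K1: "I (r + 1 + int i) n = 0" if "i \<ge> K" for n i using K [of "Suc i" n] that by (simp add: algebra_simps)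
  have "itr scale I r (p + 1) q = I r (p + 1 + q)
      + (\<Sum>i<K. scale (of_int (p + 1) gchoose Suc i) (I (r + 1 + int i) (p + q - int i)))"
    by (subst itr_eq [where K = "Suc K"], simp add: K, subst sum.lessThan_Suc_shift) (simp add: algebra_simps)
  moreover have "itr scale I (r + 1) p q = (\<Sum>i<K. scale (of_int p gchoose i) (I (r + 1 + int i) (p + q - int i)))"
    by (rule itr_eq) (rule K1)
  moreover have "itr scale I r p (q + 1) = I r (p + 1 + q)
      + (\<Sum>i<K. scale (of_int p gchoose Suc i) (I (r + 1 + int i) (p + q - int i)))"
    by (subst itr_eq [where K = "Suc K"], simp add: K, subst sum.lessThan_Suc_shift) (simp add: algebra_simps)
  moreover have "(\<Sum>i<K. scale (of_int (p + 1) gchoose Suc i) (I (r + 1 + int i) (p + q - int i)))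
    = (\<Sum>i<K. scale (of_int p gchoose i) (I (r + 1 + int i) (p + q - int i)))
    + (\<Sum>i<K. scale (of_int p gchoose Suc i) (I (r + 1 + int i) (p + q - int i)))"
    unfolding sum.distrib [symmetric] scale_left_distrib [symmetric]
    using gbinomial_Suc_Suc [of "of_int p :: complex"] by simp
  ultimately show ?thesis by (simp add: algebra_simps)
qed

lemma bor_dif_pow:
  assumes "utrunc (flip2 H)"
  shows "bor scale ((dif ^^ k) H) r p q = bor scale H (r + int k) p q"
proof (induction k arbitrary: r)
  case (Suc k)
  then show ?case
    using bor_dif [OF utrunc_flip2_dif_pow [OF assms], of k r p q] by (simp add: algebra_simps)
qed simp

lemma bor_0: "bor scale H 0 p q = H p q"
  unfolding bor_def
proof (subst Sum_any_lessThan [where K = 1])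
  show "scale ((-1) ^ i * (of_int 0 gchoose i)) (H (p + 0 - int i) (q + int i)) = 0" if "i \<ge> 1" for i
    using that by (cases i) simp_all
qed simp

end

text \<open>The Vandermonde convolution evaluates the left side to (p - m - 1) choose s. It comes
  from the first expansion for \<open>m \<le> p + r\<close>, from the second for
  \<open>m \<ge> p\<close>, and vanishes in the gap between, where \<open>p - m - 1\<close> is a
  natural number below \<open>s\<close>.\<close>

lemma borcherds_coeff:
  fixes s :: nat and p m :: int
  defines "r \<equiv> - int s - 1"
  shows "(\<Sum>i\<le>s. (of_int p gchoose i) * ((- of_int m - 1) gchoose (s - i)))
    = (if m \<le> p + r then (-1) ^ nat (p + r - m) * (of_int r gchoose nat (p + r - m)) else 0)
    + (-1) ^ s * (if m \<ge> p then (-1) ^ nat (m - p) * (of_int r gchoose nat (m - p)) else (0::complex))"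
proof -
  have neg: "(-1) ^ i * ((of_int r :: complex) gchoose i) = of_nat ((s + i) choose s)" for i
  proof -
    have "(of_int r :: complex) gchoose i = (-1) ^ i * (of_nat (s + i) gchoose i)"
      by (subst gbinomial_negated_upper) (simp add: r_def algebra_simps)
    moreover have "(of_nat (s + i) gchoose i :: complex) = of_nat ((s + i) choose s)"
      unfolding binomial_gbinomial [symmetric] using binomial_symmetric [of s "s + i"] by simp
    ultimately show ?thesis
      by (simp only: mult.assoc [symmetric]) (simp flip: power_mult_distrib)
  qed
  have "(\<Sum>i\<le>s. (of_int p gchoose i) * ((- of_int m - 1) gchoose (s - i))) = (of_int (p - m - 1) gchoose s :: complex)"
    using gbinomial_Vandermonde [of "of_int p :: complex" "- of_int m - 1" s] by (simp add: algebra_simps atMost_atLeast0)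
  also have "\<dots> = (if m \<le> p + r then of_nat ((s + nat (p + r - m)) choose s) else 0)
    + (-1) ^ s * (if m \<ge> p then of_nat ((s + nat (m - p)) choose s) else 0)"
  proof -
    consider "m \<ge> p" | "m < p" "m > p + r" | "m \<le> p + r" by linarith
    then show ?thesis
    proof cases
      case 1
      define i where "i = nat (m - p)"
      have "(of_int (p - m - 1) gchoose s :: complex) = (-1) ^ s * (of_nat (s + i) gchoose s)"
        using 1 by (subst gbinomial_negated_upper) (simp add: i_def algebra_simps)
      then show ?thesis using 1 by (simp add: r_def i_def binomial_gbinomial)
    next
      case 2
      define j where "j = nat (p - m - 1)"
      have "(of_int (p - m - 1) :: complex) = of_nat j" using 2 by (simp add: j_def)
      moreover have "j < s" using 2 by (simp add: j_def r_def)
      ultimately show ?thesis using 2 by (simp flip: binomial_gbinomial)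
    next
      case 3
      define i where "i = nat (p + r - m)"
      have "(of_int (p - m - 1) :: complex) = of_nat (s + i)" using 3 by (simp add: i_def r_def)
      moreover have "\<not> m \<ge> p" using 3 by (simp add: r_def)
      ultimately show ?thesis using 3 by (simp only: binomial_gbinomial [symmetric] i_def) simp
    qed
  qed
  finally show ?thesis by (simp only: neg)
qed

context complex_vs
begin

text \<open>
  Residue theorem in \<open>x1\<close>: the two expansions of \<open>(x1 - x2)^r x1^p x2^q G(x1, x2)\<close> differ by the residue at
  \<open>x1 = x2\<close>.
\<close>

lemma borcherds_subst2:
  assumes "bounded2 G"
  shows "bor scale G r p q - scale ((-1) powi r) (bor scale (flip2 G) r q p) = itr scale (subst2 scale G) r p q"
proof (cases "r \<ge> 0")
  \<comment> \<open>A nonnegative power has only one expansion, and there is no residue since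
    \<open>subst2\<close> is zero at nonnegative modes.\<close>
  case True
  define k where "k = nat r"
  have r: "r = int k" using True by (simp add: k_def)
  have f: "utrunc (flip2 G)" "utrunc G" using assms unfolding bounded2_def utrunc_def by blast+
  have "bor scale G r p q = (dif ^^ k) G p q" "bor scale (flip2 G) r q p = (dif ^^ k) (flip2 G) q p"
    using bor_dif_pow [of G k 0 p q] bor_dif_pow [of "flip2 G" k 0 q p] f by (simp_all add: r bor_0)
  moreover have "(dif ^^ k) G p q = (if even k then (dif ^^ k) (flip2 G) q p else - (dif ^^ k) (flip2 G) q p)"
    using fun_cong [OF fun_cong [OF flip2_dif_pow [of k G], of q], of p] .
  moreover have "itr scale (subst2 scale G) r p q = 0" using True by (simp add: itr_def)
  ultimately show ?thesis by (simp add: r)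
next
  case False
  \<comment> \<open>\<open>s + 1\<close> is the order of the pole, so the residue involves divided
    derivatives up to order \<open>s\<close>.\<close>
  define s where "s = nat (- r - 1)"
  have r: "r = - int s - 1" using False by (simp add: s_def)
  obtain N where N: "\<And>m n. m \<ge> N \<or> n \<ge> N \<Longrightarrow> G m n = 0" using bounded2E [OF assms] by metis
  define S where "S = {p + q + r - N..N}"
  have S: "finite S" by (simp add: S_def)
  have out: "G m (p + q + r - m) = 0" if "m \<notin> S" for m
    using that by (intro N) (auto simp: S_def)
  have 1: "bor scale G r p q = (\<Sum>m\<in>S. scale (if m \<le> p + r then (-1) ^ nat (p + r - m) * (of_int r gchoose nat (p + r - m)) else 0)
      (G m (p + q + r - m)))"
    unfolding bor_def
  proof (subst Sum_any_reindex_le [OF S, where c = "p + r"])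
    fix i assume "p + r - int i \<notin> S"
    from out [OF this] show "scale ((-1) ^ i * (of_int r gchoose i)) (G (p + r - int i) (q + int i)) = 0"
      by (simp add: algebra_simps)
  qed (intro sum.cong, auto simp: algebra_simps)
  have 2: "bor scale (flip2 G) r q p = (\<Sum>m\<in>S. scale (if m \<ge> p then (-1) ^ nat (m - p) * (of_int r gchoose nat (m - p)) else 0)
      (G m (p + q + r - m)))"
    unfolding bor_def
  proof (subst Sum_any_reindex_ge [OF S, where c = p])
    fix i assume "p + int i \<notin> S"
    from out [OF this] show "scale ((-1) ^ i * (of_int r gchoose i)) (G (p + int i) (q + r - int i)) = 0"
      by (simp add: algebra_simps)
  qed (intro sum.cong, auto simp: algebra_simps)
  have "itr scale (subst2 scale G) r p q = (\<Sum>i<Suc s. scale (of_int p gchoose i) (subst2 scale G (r + int i) (p + q - int i)))"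
    by (rule itr_eq) (simp add: r)
  also have "\<dots> = (\<Sum>i<Suc s. \<Sum>m\<in>S. scale ((of_int p gchoose i) * ((- of_int m - 1) gchoose (s - i))) (G m (p + q + r - m)))"
  proof (rule sum.cong [OF refl])
    fix i assume "i \<in> {..<Suc s}"
    then have i: "r + int i < 0" and e: "nat (- (r + int i) - 1) = s - i" by (auto simp: r)
    have "subst2 scale G (r + int i) (p + q - int i) = (\<Sum>m\<in>{r + int i + (p + q - int i) - N..N}.
        scale ((- of_int m - 1) gchoose nat (- (r + int i) - 1)) (G m (p + q - int i - m + (r + int i))))"
      by (rule subst2_eq [OF _ i order_refl]) (rule N)
    then show "scale (of_int p gchoose i) (subst2 scale G (r + int i) (p + q - int i))
      = (\<Sum>m\<in>S. scale ((of_int p gchoose i) * ((- of_int m - 1) gchoose (s - i))) (G m (p + q + r - m)))"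
      unfolding e S_def by (simp add: scale_sum_right algebra_simps)
  qed
  also have "\<dots> = (\<Sum>m\<in>S. scale (\<Sum>i\<le>s. (of_int p gchoose i) * ((- of_int m - 1) gchoose (s - i))) (G m (p + q + r - m)))"
    by (subst sum.swap) (simp add: scale_sum_left lessThan_Suc_atMost)
  also have "\<dots> = bor scale G r p q + scale ((-1) ^ s) (bor scale (flip2 G) r q p)"
    unfolding 1 2 borcherds_coeff [where s = s, folded r]
    by (simp only: scale_left_distrib sum.distrib scale_sum_right scale_scale)
  also have "(-1) ^ s = - ((-1 :: complex) powi r)"
    unfolding r by (simp add: power_int_diff power_int_minus) (metis left_minus_one_mult_self minus_one_mult_self inverse_unique mult.commute)
  finally show ?thesis by (simp add: scale_minus_left)
qed

end

section \<open>The delta functions of the Jacobi identity as Borcherds sums\<close>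

lemma Sum_any_reindex_inj:
  fixes f :: "'a \<Rightarrow> 'c::comm_monoid_add"
  assumes "inj h" "{x. f x \<noteq> 0} \<subseteq> range h"
  shows "Sum_any f = Sum_any (\<lambda>y. f (h y))"
    and "finite {y. f (h y) \<noteq> 0} \<Longrightarrow> finite {x. f x \<noteq> 0}"
proof -
  have e: "{x. f x \<noteq> 0} = h ` {y. f (h y) \<noteq> 0}" using assms(2) by auto
  have i: "inj_on h {y. f (h y) \<noteq> 0}" by (rule inj_on_subset [OF assms(1)]) simp
  show "Sum_any f = Sum_any (\<lambda>y. f (h y))"
    unfolding Sum_any.expand_set e sum.reindex [OF i] by simp
  show "finite {x. f x \<noteq> 0}" if "finite {y. f (h y) \<noteq> 0}"
    unfolding e using that by simp
qed

lemma minus_one_powi: "((-1) powi n :: complex) * (-1) powi n = 1"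
  by (simp add: power_int_mult_distrib [symmetric])

context complex_vs
begin

lemma bor_flip2_dif_pow:
  assumes "utrunc H"
  shows "bor scale (flip2 ((dif ^^ t) H)) r q p = scale ((-1) ^ t) (bor scale (flip2 H) (r + int t) q p)"
proof -
  have u: "utrunc (flip2 ((dif ^^ t) (flip2 H)))" by (rule utrunc_flip2_dif_pow) (rule assms)
  have "flip2 ((dif ^^ t) H) = (\<lambda>m n. scale ((-1) ^ t) ((dif ^^ t) (flip2 H) m n))"
    unfolding flip2_dif_pow by (intro ext) simp
  then show ?thesis
    using bor_dif_pow [of "flip2 H" t r q p] assms by (simp add: bor_scale [OF u])
qed

lemma dif_pow_eq: "(dif ^^ t) H m n = (\<Sum>i\<le>t. scale ((-1) ^ i * of_nat (t choose i)) (H (m + int (t - i)) (n + int i)))"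
proof (induction t arbitrary: m n)
  case (Suc t)
  let ?c = "\<lambda>i. (-1) ^ i * of_nat (t choose i) :: complex"
  have "(dif ^^ Suc t) H m n = (\<Sum>i\<le>t. scale (?c i) (H (m + int (Suc t - i)) (n + int i)))
      - (\<Sum>i\<le>t. scale (?c i) (H (m + int (t - i)) (n + int (Suc i))))"
    unfolding dif_pow_Suc Suc by (intro arg_cong2 [of _ _ _ _ minus] sum.cong) (auto simp: Suc_diff_le algebra_simps)
  also have "(\<Sum>i\<le>t. scale (?c i) (H (m + int (Suc t - i)) (n + int i)))
      = (\<Sum>i\<le>Suc t. scale (?c i) (H (m + int (Suc t - i)) (n + int i)))" by simp
  also have "\<dots> = H (m + int (Suc t)) n + (\<Sum>i\<le>t. scale (?c (Suc i)) (H (m + int (t - i)) (n + int (Suc i))))"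
    by (subst sum.atMost_Suc_shift) simp
  finally have "(dif ^^ Suc t) H m n = H (m + int (Suc t)) n
      + (\<Sum>i\<le>t. scale (?c (Suc i) - ?c i) (H (m + int (t - i)) (n + int (Suc i))))"
    by (simp add: sum_subtractf scale_left_diff_distrib del: funpow.simps)
  also have "\<dots> = H (m + int (Suc t)) n
      + (\<Sum>i\<le>t. scale ((-1) ^ Suc i * of_nat (Suc t choose Suc i)) (H (m + int (t - i)) (n + int (Suc i))))"
  proof -
    have "?c (Suc i) - ?c i = (-1) ^ Suc i * of_nat (Suc t choose Suc i)" for i by (simp add: algebra_simps)
    then show ?thesis by (simp only:)
  qed
  also have "\<dots> = (\<Sum>i\<le>Suc t. scale ((-1) ^ i * of_nat (Suc t choose i)) (H (m + int (Suc t - i)) (n + int i)))"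
    by (subst sum.atMost_Suc_shift) simp
  finally show ?case .
qed simp

text \<open>e^(e (x2 - x1)) as a power series in x1 - x2: the form in which it can be absorbed into
  the power (x1 - x2)^r.\<close>

lemma exps2_dif_pow:
  assumes "\<And>i j. i \<ge> K \<or> j \<ge> K \<Longrightarrow> H (m + int i) (n + int j) = 0"
  shows "exps2 scale (- e) e H m n = (\<Sum>t<2*K. scale ((- e) ^ t / fact t) ((dif ^^ t) H m n))"
proof -
  have "exps2 scale (- e) e H m n = (\<Sum>i<K. \<Sum>j<K. scale ((- e) ^ i / fact i * (e ^ j / fact j)) (H (m + int i) (n + int j)))"
    by (rule exps2_eq) (rule assms)
  also have "\<dots> = (\<Sum>j<K. \<Sum>i<K. scale ((- e) ^ i / fact i * (e ^ j / fact j)) (H (m + int i) (n + int j)))"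
    by (rule sum.swap)
  also have "\<dots> = (\<Sum>t<2*K. \<Sum>j\<le>t. scale ((- e) ^ (t - j) / fact (t - j) * (e ^ j / fact j)) (H (m + int (t - j)) (n + int j)))"
  proof (rule sum_square_triangle)
    fix j i :: nat assume "j \<ge> K \<or> i \<ge> K"
    then have "H (m + int i) (n + int j) = 0" by (intro assms) blast
    then show "scale ((- e) ^ i / fact i * (e ^ j / fact j)) (H (m + int i) (n + int j)) = 0" by (simp only: scale_zero_right)
  qed
  also have "\<dots> = (\<Sum>t<2*K. scale ((- e) ^ t / fact t) ((dif ^^ t) H m n))"
    unfolding dif_pow_eq scale_sum_right scale_scale
  proof (intro sum.cong refl)
    fix t j :: nat assume j: "j \<in> {..t}"
    then have "e ^ t = e ^ (t - j) * e ^ j" "(-1 :: complex) ^ t = (-1) ^ (t - j) * (-1) ^ j"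
      by (simp_all flip: power_add)
    then have "(- e) ^ t / fact t * ((-1) ^ j * of_nat (t choose j))
        = ((-1) ^ (t - j) * ((-1) ^ j * (-1) ^ j)) * e ^ (t - j) * e ^ j * of_nat (t choose j) / fact t"
      unfolding power_minus [of e t] by simp
    also have "\<dots> = (- e) ^ (t - j) / fact (t - j) * (e ^ j / fact j)"
      unfolding power_minus [of e "t - j"] using j by (simp add: binomial_fact flip: power_mult_distrib)
    finally show "scale ((- e) ^ (t - j) / fact (t - j) * (e ^ j / fact j)) (H (m + int (t - j)) (n + int j))
      = scale ((- e) ^ t / fact t * ((-1) ^ j * of_nat (t choose j))) (H (m + int (t - j)) (n + int j))"
      by (simp only:)
  qed
  finally show ?thesis .
qed

text \<open>The sum over \<open>(t, i)\<close> arises from expanding f(-x0), with f(x) = e^(e x),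
  against the delta function; the sum over \<open>t\<close> restores the exponential in x1 and
  x2.\<close>

lemma bor_exps2:
  fixes e :: complex and r p q :: int
  assumes "trunc2 H" "utrunc H"
  defines "f \<equiv> \<lambda>(t, i). scale (e ^ t / fact t * ((-1) ^ i * (of_int (r + int t) gchoose i))) (H (p + int i) (q + r + int t - int i))"
  shows "finite {x. f x \<noteq> 0}" and "Sum_any f = bor scale (flip2 (exps2 scale (- e) e H)) r q p"
proof -
  obtain I where I: "\<And>i n. i \<ge> I \<Longrightarrow> H (p + int i) n = 0" using utruncE [OF assms(2)] by metis
  \<comment> \<open>The second mode \<open>q + r - i + j\<close> falls with \<open>i\<close>, so the
    quadrant starts \<open>I\<close> lower; beyond \<open>I\<close> the first mode alone gives
    zero.\<close>
  obtain K where K: "\<And>i j. i \<ge> K \<or> j \<ge> K \<Longrightarrow> H (p + int i) (q + r - int I + int j) = 0"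
    using trunc2E [OF assms(1)] by metis
  define M where "M = max I K"
  have 0: "H (p + int i) (q + r - int i + int j) = 0" if "i \<ge> M \<or> j \<ge> M" for i j
  proof (cases "i \<ge> I")
    case False
    then have "q + r - int i + int j = q + r - int I + int (I - i + j)" by simp
    moreover have "I - i + j \<ge> K" using that False by (auto simp: M_def)
    ultimately show ?thesis using K [of i "I - i + j"] by metis
  qed (rule I)
  have IM: "H (p + int i) n = 0" if "i \<ge> M" for i n using that by (intro I) (simp add: M_def)
  have s: "{x. f x \<noteq> 0} \<subseteq> {..<2*M} \<times> {..<M}"
  proof clarify
    fix t i assume nz: "f (t, i) \<noteq> 0"
    have "H (p + int i) (q + r + int t - int i) \<noteq> 0" using nz by (auto simp: f_def)
    then have "\<not> (i \<ge> M \<or> t \<ge> M)" using 0 [of i t] by (auto simp: algebra_simps)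
    then show "t \<in> {..<2*M} \<and> i \<in> {..<M}" by simp
  qed
  show "finite {x. f x \<noteq> 0}" by (rule finite_subset [OF s]) simp
  have E: "exps2 scale (- e) e H (p + int i) (q + r - int i) = (\<Sum>t<2*M. scale ((- e) ^ t / fact t) ((dif ^^ t) H (p + int i) (q + r - int i)))" for i
  proof (rule exps2_dif_pow)
    fix i' j assume *: "i' \<ge> M \<or> j \<ge> M"
    show "H (p + int i + int i') (q + r - int i + int j) = 0"
      using 0 [of "i + i'" "i' + j"] * by (auto simp: algebra_simps)
  qed
  have D: "(dif ^^ t) H (p + int i) n = 0" if "i \<ge> M" for t i n
  proof (rule dif_pow_vanish)
    fix i' j assume "i' \<ge> p + int i"
    then show "H i' j = 0" using IM [of "nat (i' - p)" j] that by simp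
  qed
  have b: "bor scale (flip2 ((dif ^^ t) H)) r q p
      = (\<Sum>i<M. scale ((-1) ^ i * (of_int r gchoose i)) ((dif ^^ t) H (p + int i) (q + r - int i)))" for t
    by (rule bor_eq) (rule D)
  have "bor scale (flip2 (exps2 scale (- e) e H)) r q p
      = (\<Sum>i<M. scale ((-1) ^ i * (of_int r gchoose i)) (exps2 scale (- e) e H (p + int i) (q + r - int i)))"
    by (rule bor_eq) (simp add: E D)
  also have "\<dots> = (\<Sum>t<2*M. scale ((- e) ^ t / fact t) (bor scale (flip2 ((dif ^^ t) H)) r q p))"
    unfolding E b scale_sum_right by (subst sum.swap) (simp add: mult.commute)
  also have "\<dots> = (\<Sum>t<2*M. \<Sum>i<M. f (t, i))"
  proof (rule sum.cong [OF refl])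
    fix t
    have "bor scale (flip2 H) (r + int t) q p
        = (\<Sum>i<M. scale ((-1) ^ i * (of_int (r + int t) gchoose i)) (H (p + int i) (q + (r + int t) - int i)))"
      by (rule bor_eq) (rule IM)
    moreover have "(- e) ^ t / fact t * (-1) ^ t = e ^ t / fact t"
      by (simp flip: power_mult_distrib)
    ultimately show "scale ((- e) ^ t / fact t) (bor scale (flip2 ((dif ^^ t) H)) r q p) = (\<Sum>i<M. f (t, i))"
      unfolding bor_flip2_dif_pow [OF assms(2)] scale_scale by (simp add: f_def scale_sum_right add.assoc)
  qed
  also have "\<dots> = sum f ({..<2*M} \<times> {..<M})" by (simp add: sum.cartesian_product)
  also have "\<dots> = Sum_any f" by (rule Sum_any.expand_superset [symmetric]) (use s in simp_all)
  finally show "Sum_any f = bor scale (flip2 (exps2 scale (- e) e H)) r q p" ..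
qed

text \<open>The delta function leaves one summation index, and the Jacobi identity at x0^a x1^b x2^c
  becomes the Borcherds identity for the modes \<open>- a - 1\<close>, \<open>- b - 1\<close>,
  \<open>- c - 1\<close>.\<close>

lemma fprod3_prod_series:
  "fprod3 scale delta_L1 (prod_series Y u v w) a b c = bor scale (\<lambda>m n. Y u m (Y v n w)) (- a - 1) (- b - 1) (- c - 1)"
proof -
  let ?f = "\<lambda>(p, q, r). scale (delta_L1 p q r) (prod_series Y u v w (a - p) (b - q) (c - r))"
  let ?h = "\<lambda>i. (a, - a - 1 - int i, int i)"
  have "{x. ?f x \<noteq> 0} \<subseteq> range ?h"
  proof clarify
    fix p q r assume "scale (delta_L1 p q r) (prod_series Y u v w (a - p) (b - q) (c - r)) \<noteq> 0"
    then have "p = a" "r \<ge> 0" "q = - a - 1 - r"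
      by (auto simp: delta_L1_def delta3_def binexp_def prod_series_def split: if_splits)
    then show "(p, q, r) \<in> range ?h" by (intro range_eqI [of _ _ "nat r"]) simp
  qed
  from Sum_any_reindex_inj(1) [OF _ this]
  have "fprod3 scale delta_L1 (prod_series Y u v w) a b c = Sum_any (\<lambda>i. ?f (?h i))"
    by (simp add: fprod3_def inj_def)
  also have "\<dots> = bor scale (\<lambda>m n. Y u m (Y v n w)) (- a - 1) (- b - 1) (- c - 1)"
    unfolding bor_def
    by (intro arg_cong [of _ _ Sum_any] ext)
      (simp add: delta_L1_def delta3_def binexp_def prod_series_def algebra_simps)
  finally show ?thesis .
qed

lemma fprod3_iter_series:
  "fprod3 scale delta_R (iter_series Y u v w) a b c = itr scale (\<lambda>a b. Y (Y u a v) b w) (- a - 1) (- b - 1) (- c - 1)"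
proof -
  let ?f = "\<lambda>(p, q, r). scale (delta_R p q r) (iter_series Y u v w (a - p) (b - q) (c - r))"
  let ?h = "\<lambda>i. (int i, b, - b - 1 - int i)"
  have "{x. ?f x \<noteq> 0} \<subseteq> range ?h"
  proof clarify
    fix p q r assume "scale (delta_R p q r) (iter_series Y u v w (a - p) (b - q) (c - r)) \<noteq> 0"
    then have "q = b" "p \<ge> 0" "r = - b - 1 - p"
      by (auto simp: delta_R_def delta3_def binexp_def iter_series_def split: if_splits)
    then show "(p, q, r) \<in> range ?h" by (intro range_eqI [of _ _ "nat p"]) simp
  qed
  from Sum_any_reindex_inj(1) [OF _ this]
  have "fprod3 scale delta_R (iter_series Y u v w) a b c = Sum_any (\<lambda>i. ?f (?h i))"
    by (simp add: fprod3_def inj_def)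
  also have "\<dots> = itr scale (\<lambda>a b. Y (Y u a v) b w) (- a - 1) (- b - 1) (- c - 1)"
    unfolding itr_def
  proof (intro arg_cong [of _ _ Sum_any] ext)
    fix i
    have "(of_int (- b - 1) gchoose i :: complex) = (-1) ^ i * ((of_int (b + int i)) gchoose i)"
      by (subst gbinomial_negated_upper) (simp add: algebra_simps)
    then show "?f (?h i) = scale (of_int (- b - 1) gchoose i) (Y (Y u (- a - 1 + int i) v) (- b - 1 + (- c - 1) - int i) w)"
      by (simp add: delta_R_def delta3_def binexp_def iter_series_def algebra_simps)
  qed
  finally show ?thesis .
qed

definition opp_term where
  "opp_term Y ts w a b c = (\<lambda>(p, q, r). scale (delta_L2 p q r) (opp_series scale Y ts w (a - p) (b - q) (c - r)))"

lemma opp_term_append: "opp_term Y (ts @ ts') w a b c x = opp_term Y ts w a b c x + opp_term Y ts' w a b c x"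
  by (cases x) (simp add: opp_term_def opp_series_def scale_right_distrib)

lemma fprod3_opp_term: "fprod3 scale delta_L2 (opp_series scale Y ts w) a b c = Sum_any (opp_term Y ts w a b c)"
  by (simp add: fprod3_def opp_term_def)

text \<open>On the support of the delta function -x0 equals x2 - x1, so the factor f(-x0) becomes
  e^(e (x2 - x1)) on the opposite product. Finiteness is recorded because such terms are added
  later.\<close>

lemma fprod3_opp_series_exp:
  fixes e \<epsilon> :: complex
  assumes "trunc2 (\<lambda>m n. Y v' n (Y u' m w))" "utrunc (\<lambda>m n. Y v' n (Y u' m w))"
  defines "ts \<equiv> [(v', u', fps_to_fls (Abs_fps (\<lambda>t. \<epsilon> * e ^ t / fact t)))]"
  shows "finite {x. opp_term Y ts w a b c x \<noteq> 0}"
    and "Sum_any (opp_term Y ts w a b c) = scale ((-1) powi (- a - 1) * \<epsilon>)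
      (bor scale (flip2 (exps2 scale (- e) e (\<lambda>m n. Y v' n (Y u' m w)))) (- a - 1) (- c - 1) (- b - 1))"
proof -
  let ?H = "\<lambda>m n. Y v' n (Y u' m w)"
  let ?R = "- a - 1" and ?P = "- b - 1" and ?Q = "- c - 1"
  let ?h = "\<lambda>(t, i). (a - int t, int i, ?R + int t - int i)"
  let ?g = "\<lambda>(t, i). scale (e ^ t / fact t * ((-1) ^ i * (of_int (?R + int t) gchoose i))) (?H (?P + int i) (?Q + ?R + int t - int i))"
  let ?f = "opp_term Y ts w a b c"
  have inj: "inj ?h" by (auto simp: inj_def)
  have r: "{x. ?f x \<noteq> 0} \<subseteq> range ?h"
  proof clarify
    fix p q r assume nz: "?f (p, q, r) \<noteq> 0"
    then have "a - p \<ge> 0" "q \<ge> 0" "r = - p - 1 - q"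
      by (auto simp: opp_term_def ts_def opp_series_def delta_L2_def delta3_def binexp_def split: if_splits)
    then show "(p, q, r) \<in> range ?h" by (intro range_eqI [of _ _ "(nat (a - p), nat q)"]) simp
  qed
  have e: "?f (?h x) = scale ((-1) powi ?R * \<epsilon>) (?g x)" for x
  proof (cases x)
    case (Pair t i)
    have "(-1) powi (a - int t) * (-1) powi int t = ((-1) powi a :: complex)" by (simp add: power_int_add [symmetric] del: power_int_of_nat)
    moreover have "(-1) powi a = - ((-1) powi ?R :: complex)"
      by (simp add: power_int_diff power_int_minus inverse_unique [OF minus_one_powi])
    ultimately have s: "- ((-1) powi (a - int t)) * (-1) ^ t = ((-1) powi ?R :: complex)" by simp
    have "?f (?h x) = scale (- ((-1) powi (a - int t)) * (-1) ^ t * \<epsilon> * (e ^ t / fact t * ((-1) ^ i * (of_int (?R + int t) gchoose i))))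
      (?H (?P + int i) (?Q + ?R + int t - int i))"
      unfolding Pair
      by (simp add: opp_term_def ts_def opp_series_def delta_L2_def delta3_def binexp_def scale_minus_left algebra_simps)
    then show ?thesis unfolding s by (simp add: Pair)
  qed
  have fin: "finite {x. ?g x \<noteq> 0}" and S: "Sum_any ?g = bor scale (flip2 (exps2 scale (- e) e ?H)) ?R ?Q ?P"
    using bor_exps2 [OF assms(1,2), where e = e and r = ?R and p = ?P and q = ?Q] by simp_all
  have "finite {x. ?f (?h x) \<noteq> 0}" by (rule finite_subset [OF _ fin]) (auto simp: e)
  then show "finite {x. ?f x \<noteq> 0}" by (rule Sum_any_reindex_inj(2) [OF inj r])
  have "Sum_any ?f = Sum_any (\<lambda>x. scale ((-1) powi ?R * \<epsilon>) (?g x))"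
    unfolding Sum_any_reindex_inj(1) [OF inj r] e ..
  also have "\<dots> = scale ((-1) powi ?R * \<epsilon>) (Sum_any ?g)"
    by (rule linear_Sum_any [OF linear_scale fin, symmetric])
  finally show "Sum_any ?f = scale ((-1) powi ?R * \<epsilon>) (bor scale (flip2 (exps2 scale (- e) e ?H)) ?R ?Q ?P)"
    by (simp only: S)
qed

text \<open>With x0 in the place of x1 - x2, the product at x1 = x0 + x2 is the first Borcherds sum
  at \<open>p = 0\<close>; upper negation matches the binomials.\<close>

lemma shifted_prod_bor: "shifted_prod scale YW u v w a b = bor scale (\<lambda>m n. YW u m (YW v n w)) (- a - 1) 0 (- b - 1)"
proof -
  let ?f = "\<lambda>(m, n). scale (binexp 1 (- m - 1) a (b + n + 1)) (YW u m (YW v n w))"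
  let ?h = "\<lambda>i. (- a - 1 - int i, - b - 1 + int i)"
  have "{x. ?f x \<noteq> 0} \<subseteq> range ?h"
  proof clarify
    fix m n assume "scale (binexp 1 (- m - 1) a (b + n + 1)) (YW u m (YW v n w)) \<noteq> 0"
    then have "b + n + 1 \<ge> 0" "a + (b + n + 1) = - m - 1" by (auto simp: binexp_def split: if_splits)
    then show "(m, n) \<in> range ?h" by (intro range_eqI [of _ _ "nat (b + n + 1)"]) simp
  qed
  from Sum_any_reindex_inj(1) [OF _ this]
  have "shifted_prod scale YW u v w a b = Sum_any (\<lambda>i. ?f (?h i))"
    by (simp add: shifted_prod_def inj_def)
  also have "\<dots> = bor scale (\<lambda>m n. YW u m (YW v n w)) (- a - 1) 0 (- b - 1)"
    unfolding bor_def
  proof (intro arg_cong [of _ _ Sum_any] ext)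
    fix i
    have "(of_int (- a - 1) gchoose i :: complex) = (-1) ^ i * ((of_int (a + int i)) gchoose i)"
      by (subst gbinomial_negated_upper) (simp add: algebra_simps)
    then have "(-1) ^ i * (of_int (- a - 1) gchoose i :: complex) = (of_int (a + int i)) gchoose i"
      by (simp flip: mult.assoc power_mult_distrib)
    then show "?f (?h i) = scale ((-1) ^ i * (of_int (- a - 1) gchoose i)) (YW u (0 + (- a - 1) - int i) (YW v (- b - 1 + int i) w))"
      by (simp add: binexp_def algebra_simps)
  qed
  finally show ?thesis .
qed

lemma mult_pow_Suc: "mult_pow scale (Suc l) F a b = mult_pow scale l F (a - 1) b + mult_pow scale l F a (b - 1)"
proof -
  let ?F = "\<lambda>j. F (a - int (l - j)) (b - 1 - int j)"
  have 1: "mult_pow scale (Suc l) F a b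
      = F (a - int (Suc l)) b + (\<Sum>j\<le>l. scale (of_nat (Suc l choose Suc j)) (?F j))"
    unfolding mult_pow_def by (subst sum.atMost_Suc_shift) (simp add: algebra_simps)
  have "mult_pow scale l F (a - 1) b = (\<Sum>j\<le>Suc l. scale (of_nat (l choose j)) (F (a - int (Suc l - j)) (b - int j)))"
    by (simp add: mult_pow_def Suc_diff_le algebra_simps)
  also have "\<dots> = F (a - int (Suc l)) b + (\<Sum>j\<le>l. scale (of_nat (l choose Suc j)) (?F j))"
    by (subst sum.atMost_Suc_shift) (simp add: algebra_simps)
  finally have 2: "mult_pow scale l F (a - 1) b = \<dots>" .
  have 3: "mult_pow scale l F a (b - 1) = (\<Sum>j\<le>l. scale (of_nat (l choose j)) (?F j))"
    by (simp add: mult_pow_def algebra_simps)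
  show ?thesis unfolding 1 2 3 by (simp add: sum.distrib [symmetric] scale_left_distrib [symmetric] add.commute)
qed

text \<open>The recursion common to \<open>bor\<close> and \<open>itr\<close> identifies
  multiplication by x0 + x2 with raising \<open>p\<close>; both sides of weak associativity are
  instances.\<close>

lemma mult_pow_step:
  assumes "\<And>a b. F a b = J (- a - 1) 0 (- b - 1)"
    and "\<And>r p q. J r (p + 1) q = J (r + 1) p q + J r p (q + 1)"
  shows "mult_pow scale l F a b = J (- a - 1) (int l) (- b - 1)"
proof (induction l arbitrary: a b)
  case 0 show ?case by (simp add: mult_pow_def assms(1))
next
  case (Suc l)
  have "J (- a - 1) (int (Suc l)) (- b - 1) = J (- a - 1 + 1) (int l) (- b - 1) + J (- a - 1) (int l) (- b - 1 + 1)"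
    using assms(2) [of "- a - 1" "int l" "- b - 1"] by (simp add: add.commute)
  then show ?case by (simp add: mult_pow_Suc Suc algebra_simps)
qed

lemma itr_0: "itr scale I r 0 q = I r q"
  unfolding itr_def
proof (subst Sum_any_lessThan [where K = 1])
  show "scale (of_int 0 gchoose i) (I (r + int i) (0 + q - int i)) = 0" if "i \<ge> 1" for i
    using that by (cases i) simp_all
qed simp

lemma bor_itr_mono:
  assumes "utrunc (flip2 P)" "utrunc I" "l \<le> l'" "\<And>r q. bor scale P r (int l) q = itr scale I r (int l) q"
  shows "bor scale P r (int l') q = itr scale I r (int l') q"
  using assms(3)
proof (induction l' arbitrary: r q rule: dec_induct)
  case base show ?case by (rule assms(4))
next
  case (step n)
  then show ?case
    using bor_step [OF assms(1), of r "int n" q] itr_step [OF assms(2), of r "int n" q] by (simp add: add.commute)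
qed

text \<open>The sum \<open>itr\<close> is triangular: the term \<open>i = 0\<close> has first mode
  \<open>r\<close>, the others have larger ones. Descending induction starts where both series
  vanish.\<close>

lemma itr_unique:
  assumes "utrunc I" "utrunc I'" "\<And>r q. itr scale I r (int l) q = itr scale I' r (int l) q"
  shows "I r q = I' r q"
proof -
  obtain N where N: "\<And>m n. m \<ge> N \<Longrightarrow> I m n = 0" using assms(1) by (auto simp: utrunc_def)
  obtain N' where N': "\<And>m n. m \<ge> N' \<Longrightarrow> I' m n = 0" using assms(2) by (auto simp: utrunc_def)
  have step: "r \<ge> max N N' - int k \<Longrightarrow> I r q = I' r q" for k r q
  proof (induction k arbitrary: r q)
    case 0 then show ?case by (simp add: N N')
  next
    case (Suc k)
    define q' where "q' = q - int l"
    obtain K where K: "\<And>i n. i \<ge> K \<Longrightarrow> I (r + int i) n = 0" using utruncE [OF assms(1)] by metis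
    obtain K' where K': "\<And>i n. i \<ge> K' \<Longrightarrow> I' (r + int i) n = 0" using utruncE [OF assms(2)] by metis
    have *: "I (r + int (Suc i)) n = I' (r + int (Suc i)) n" for i n
      by (rule Suc.IH) (use Suc.prems in simp)
    have "itr scale I r (int l) q' = I r q + Sum_any (\<lambda>i. scale (of_int (int l) gchoose Suc i) (I (r + int (Suc i)) (int l + q' - int (Suc i))))"
      unfolding itr_def by (subst Sum_any_Suc [where K = K]) (simp_all add: K q'_def)
    moreover have "itr scale I' r (int l) q' = I' r q + Sum_any (\<lambda>i. scale (of_int (int l) gchoose Suc i) (I' (r + int (Suc i)) (int l + q' - int (Suc i))))"
      unfolding itr_def by (subst Sum_any_Suc [where K = K']) (simp_all add: K' q'_def)
    ultimately show ?case using assms(3) [of r q'] by (simp only: *) simp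
  qed
  show ?thesis by (rule step [where k = "nat (max N N' - r)"]) linarith
qed

end

section \<open>The weak quantum vertex algebra and its modules\<close>

context module_ops
begin

abbreviation prods :: "VA \<Rightarrow> VA \<Rightarrow> 'w \<Rightarrow> int \<Rightarrow> int \<Rightarrow> 'w" where
  "prods u v w \<equiv> \<lambda>m n. YW u m (YW v n w)"

abbreviation iters :: "VA \<Rightarrow> VA \<Rightarrow> 'w \<Rightarrow> int \<Rightarrow> int \<Rightarrow> 'w" where
  "iters u v w \<equiv> \<lambda>a b. YW (VM.YW u a v) b w"

lemma YW_0 [simp]: "YW 0 n w = 0" "YW u n 0 = 0"
  by (rule linear_zeroD [OF linear_YW_left]) (rule linear_zeroD [OF linear_YW])

lemma utrunc_prods: "utrunc (flip2 (prods u v w))"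
proof -
  obtain N where "\<And>n. n \<ge> N \<Longrightarrow> YW v n w = 0" using trunc_YW [of v w] unfolding trunc_def by blast
  then show ?thesis unfolding utrunc_def by (intro exI [of _ N]) simp
qed

lemma utrunc_iters: "utrunc (iters u v w)"
proof -
  obtain N where "\<And>n. n \<ge> N \<Longrightarrow> VM.YW u n v = 0" using VM.trunc_YW [of u v] unfolding trunc_def by blast
  then show ?thesis unfolding utrunc_def by (intro exI [of _ N]) simp
qed

lemma trunc2_prods: "trunc2 (prods u v w)"
  by (rule trunc2_comp [OF field_YW trunc_YW])

text \<open>The common numerator satisfies the identity by \<open>borcherds_subst2\<close>;
  replacing \<open>r\<close> by \<open>r - k\<close> undoes the multiplication by (x1 - x2)^k in all
  three sums.\<close>

theorem borcherds:
  assumes u: "hom d u" and v: "hom e v"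
    and u': "kappa u' = theta (- of_int e) (kappa u)" and v': "kappa v' = theta (of_int d) (kappa v)"
  shows "bor scale (prods u v w) r p q
    - scale ((-1) powi r * eps (d * e)) (bor scale (flip2 (exps2 scale (- of_int (d * e)) (of_int (d * e)) (flip2 (prods v' u' w)))) r q p)
    = itr scale (iters u v w) r p q"
proof -
  let ?B = "exps2 scale (- of_int (d * e)) (of_int (d * e)) (flip2 (prods v' u' w))"
  obtain k G where G: "bounded2 G" and P: "\<And>m n. (dif ^^ k) (prods u v w) m n = G m n"
    and B: "\<And>m n. (dif ^^ k) ?B m n = scale (eps (d * e)) (G m n)"
    and I: "\<And>a b. YW (VM.YW u (a + int k) v) b w = subst2 scale G a b"
    using YW_rational [OF assms, of w] by blast
  have fG: "utrunc (flip2 (flip2 G))" "utrunc (flip2 G)" using G unfolding bounded2_def utrunc_def by blast+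
  obtain N where N: "\<And>n. n \<ge> N \<Longrightarrow> YW u' n w = 0" using trunc_YW [of u' w] unfolding trunc_def by blast
  have uB: "utrunc ?B"
    unfolding utrunc_def by (rule exI [of _ N]) (auto intro!: exps2_vanish simp: N)
  have G': "(dif ^^ k) (prods u v w) = G" "(dif ^^ k) ?B = (\<lambda>m n. scale (eps (d * e)) (G m n))"
    by (intro ext P B)+
  have 1: "bor scale G (r - int k) p q = bor scale (prods u v w) r p q"
    using bor_dif_pow [OF utrunc_prods, of k u v w "r - int k" p q] by (simp add: G')
  have "scale (eps (d * e)) (bor scale (flip2 G) (r - int k) q p) = scale ((-1) ^ k) (bor scale (flip2 ?B) r q p)"
    using bor_flip2_dif_pow [OF uB, of k "r - int k" q p] unfolding G' bor_scale [OF fG(1)] by simp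
  then have "scale (eps (d * e)) (scale (eps (d * e)) (bor scale (flip2 G) (r - int k) q p))
      = scale (eps (d * e) * (-1) ^ k) (bor scale (flip2 ?B) r q p)" by simp
  then have "bor scale (flip2 G) (r - int k) q p = scale (eps (d * e) * (-1) ^ k) (bor scale (flip2 ?B) r q p)"
    by simp
  then have 2: "scale ((-1) powi (r - int k)) (bor scale (flip2 G) (r - int k) q p)
      = scale ((-1) powi (r - int k) * (-1) powi int k * eps (d * e)) (bor scale (flip2 ?B) r q p)"
    by (simp add: mult.commute mult.left_commute)
  have "itr scale (subst2 scale G) (r - int k) p q = itr scale (iters u v w) r p q"
    unfolding itr_def I [symmetric] by (simp add: algebra_simps)
  then show ?thesis
    using borcherds_subst2 [OF G, of "r - int k" p q] unfolding 1 2
    by (simp add: power_int_add [symmetric] del: power_int_of_nat)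
qed

lemma prods_add:
  "prods (u + u') v w = (\<lambda>m n. prods u v w m n + prods u' v w m n)"
  "prods u (v + v') w = (\<lambda>m n. prods u v w m n + prods u v' w m n)"
  by (simp_all add: YW_add linear_addD [OF linear_YW])

lemma iters_add:
  "iters (u + u') v w = (\<lambda>m n. iters u v w m n + iters u' v w m n)"
  "iters u (v + v') w = (\<lambda>m n. iters u v w m n + iters u v' w m n)"
  by (simp_all add: VM.YW_add YW_add linear_addD [OF VM.linear_YW])

lemma defect_add:
  "bor scale (prods (u + u') v w) r p q - itr scale (iters (u + u') v w) r p q
    = bor scale (prods u v w) r p q - itr scale (iters u v w) r p q
    + (bor scale (prods u' v w) r p q - itr scale (iters u' v w) r p q)"
  "bor scale (prods u (v + v') w) r p q - itr scale (iters u (v + v') w) r p q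
    = bor scale (prods u v w) r p q - itr scale (iters u v w) r p q
    + (bor scale (prods u v' w) r p q - itr scale (iters u v' w) r p q)"
  unfolding prods_add iters_add bor_add [OF utrunc_prods utrunc_prods] itr_add [OF utrunc_iters utrunc_iters]
  by simp_all

text \<open>The opposite sum involves only modes of \<open>u'\<close> on \<open>w\<close> from
  \<open>p\<close> upwards, so for large \<open>p\<close> it drops out of the Borcherds identity.
  The defect is additive in \<open>u\<close> and in \<open>v\<close>, which reduces the claim to
  vectors with a charge.\<close>

lemma associativity: "\<exists>l::nat. \<forall>p r q. p \<ge> int l \<longrightarrow> bor scale (prods u v w) r p q = itr scale (iters u v w) r p q"
proof -
  have "\<exists>l::nat. \<forall>p r q. p \<ge> int l \<longrightarrow> bor scale (prods u v w) r p q - itr scale (iters u v w) r p q = 0"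
  proof (induction u rule: VA_hom_induct)
    case (add u u')
    obtain l l' :: nat
      where "\<And>p r q. p \<ge> int l \<Longrightarrow> bor scale (prods u v w) r p q - itr scale (iters u v w) r p q = 0"
        and "\<And>p r q. p \<ge> int l' \<Longrightarrow> bor scale (prods u' v w) r p q - itr scale (iters u' v w) r p q = 0"
      using add by blast
    then show ?case unfolding defect_add by (intro exI [of _ "max l l'"]) simp
  next
    case (hom d u)
    show ?case
    proof (induction v rule: VA_hom_induct)
      case (add v v')
      obtain l l' :: nat
        where "\<And>p r q. p \<ge> int l \<Longrightarrow> bor scale (prods u v w) r p q - itr scale (iters u v w) r p q = 0"
          and "\<And>p r q. p \<ge> int l' \<Longrightarrow> bor scale (prods u v' w) r p q - itr scale (iters u v' w) r p q = 0"
        using add by blast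
      then show ?case unfolding defect_add by (intro exI [of _ "max l l'"]) simp
    next
      case (hom e v)
      obtain u' v' where u': "kappa u' = theta (- of_int e) (kappa u)" and v': "kappa v' = theta (of_int d) (kappa v)"
        using kappa_surj by metis
      obtain N where N: "\<And>n. n \<ge> N \<Longrightarrow> YW u' n w = 0" using trunc_YW [of u' w] unfolding trunc_def by blast
      have "bor scale (prods u v w) r p q - itr scale (iters u v w) r p q = 0" if "p \<ge> int (nat N)" for p r q
      proof -
        have "bor scale (flip2 (exps2 scale (- of_int (d * e)) (of_int (d * e)) (flip2 (prods v' u' w)))) r q p = 0"
        proof -
          have "N \<le> p" using that by linarith
          then show ?thesis by (intro bor_vanish exps2_vanish) (simp add: N)
        qed
        then show ?thesis using borcherds [OF \<open>hom d u\<close> hom u' v', of w r p q] by simp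
      qed
      then show ?case by blast
    qed
  qed
  then show ?thesis by simp
qed

end

lemma VM_generator [simp]: "VM.YW (ops VA_Y VA_Ys a (-1) VA_one) n w = ops VA_Y VA_Ys a n w"
  by (rule VM.YW_generator)

lemma ops_one: "n \<ge> 0 \<Longrightarrow> ops VA_Y VA_Ys a n VA_one = 0"
  using VA_one_vacuum [of n a] by (simp add: letter_act_ops)

text \<open>Tensors add by concatenating lists, and the opposite term must equal \<open>D\<close>,
  which is additive in both states. The finiteness in \<open>good\<close> is what makes
  \<open>Sum_any\<close> additive.\<close>

lemma VM_jacobi:
  "\<exists>ts :: (VA \<times> VA \<times> complex fls) list. \<forall>w a b c.
      fprod3 VA_scale delta_L1 (prod_series VM.YW u v w) a b c
      - fprod3 VA_scale delta_L2 (opp_series VA_scale VM.YW ts w) a b c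
      = fprod3 VA_scale delta_R (iter_series VM.YW u v w) a b c"
proof -
  define D where "D u v w a b c = bor VA_scale (VM.prods u v w) (- a - 1) (- b - 1) (- c - 1)
    - itr VA_scale (VM.iters u v w) (- a - 1) (- b - 1) (- c - 1)" for u v w a b c
  define good where "good u v ts \<longleftrightarrow> (\<forall>w a b c. finite {x. VA.opp_term VM.YW ts w a b c x \<noteq> 0} \<and>
      Sum_any (VA.opp_term VM.YW ts w a b c) = D u v w a b c)" for u v ts
  have append: "good x y (ts @ ts')" if "good u v ts" "good u' v' ts'"
    and D: "\<And>w a b c. D x y w a b c = D u v w a b c + D u' v' w a b c" for x y u v u' v' ts ts'
    unfolding good_def
  proof (intro allI conjI)
    fix w a b c
    let ?f = "VA.opp_term VM.YW ts w a b c" and ?g = "VA.opp_term VM.YW ts' w a b c"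
    have fg: "VA.opp_term VM.YW (ts @ ts') w a b c = (\<lambda>x. ?f x + ?g x)"
      by (intro ext) (rule VA.opp_term_append)
    have f: "finite {x. ?f x \<noteq> 0}" and g: "finite {x. ?g x \<noteq> 0}" using that unfolding good_def by blast+
    show "finite {x. VA.opp_term VM.YW (ts @ ts') w a b c x \<noteq> 0}"
      unfolding fg by (rule finite_subset [OF _ finite_UnI [OF f g]]) auto
    show "Sum_any (VA.opp_term VM.YW (ts @ ts') w a b c) = D x y w a b c"
      unfolding fg Sum_any.distrib [OF f g] D using that unfolding good_def by simp
  qed
  have "\<exists>ts. good u v ts"
  proof (induction u rule: VA_hom_induct)
    case (add u u')
    then obtain ts ts' where "good u v ts" "good u' v ts'" by blast
    then have "good (u + u') v (ts @ ts')" by (rule append) (simp add: D_def VM.defect_add)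
    then show ?case by blast
  next
    case (hom d u)
    show ?case
    proof (induction v rule: VA_hom_induct)
      case (add v v')
      then obtain ts ts' where "good u v ts" "good u v' ts'" by blast
      then have "good u (v + v') (ts @ ts')" by (rule append) (simp add: D_def VM.defect_add)
      then show ?case by blast
    next
      case (hom e v)
      obtain u' v' where u': "kappa u' = theta (- of_int e) (kappa u)" and v': "kappa v' = theta (of_int d) (kappa v)"
        using kappa_surj by metis
      let ?ts = "[(v', u', fps_to_fls (Abs_fps (\<lambda>t. eps (d * e) * of_int (d * e) ^ t / fact t)))]"
      have "good u v ?ts"
        unfolding good_def
      proof (intro allI conjI)
        fix w a b c
        have t: "trunc2 (flip2 (VM.prods v' u' w))" "utrunc (flip2 (VM.prods v' u' w))"
          by (rule trunc2_flip [OF VM.trunc2_prods]) (rule VM.utrunc_prods)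
        note f = VA.fprod3_opp_series_exp [OF t, of "eps (d * e)" "of_int (d * e)" a b c]
        show "finite {x. VA.opp_term VM.YW ?ts w a b c x \<noteq> 0}" by (rule f(1))
        show "Sum_any (VA.opp_term VM.YW ?ts w a b c) = D u v w a b c"
          unfolding f(2) D_def using VM.borcherds [OF \<open>hom d u\<close> hom u' v', of w "- a - 1" "- b - 1" "- c - 1"]
          by (simp add: algebra_simps)
      qed
      then show ?case by blast
    qed
  qed
  then obtain ts where "good u v ts" by blast
  then show ?thesis
    unfolding VA.fprod3_prod_series VA.fprod3_iter_series VA.fprod3_opp_term good_def D_def
    by (intro exI [of _ ts]) simp
qed

text \<open>On the vacuum the Borcherds identity for a generator and \<open>u\<close> with
  \<open>p = 0\<close> has no opposite sum, as nonnegative modes of the generator vanish there.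
  Since fields depend on \<open>u\<close> only through \<open>kappa u\<close>, the result also shows
  that \<open>kappa\<close> is injective.\<close>

lemma VM_creation: "(\<forall>n\<ge>0. VM.YW u n VA_one = 0) \<and> VM.YW u (-1) VA_one = u"
proof (induction u rule: VA_word_induct)
  case (add u v) then show ?case by (simp add: VM.YW_add)
next
  case (scale c u) then show ?case by (simp add: VM.YW_scale)
next
  case one then show ?case by (simp add: VM.YW_one)
next
  case (ops a r d u)
  let ?g = "ops VA_Y VA_Ys a (-1) VA_one"
  have g: "hom (charge a) ?g" using hom_ops [OF hom_one] by simp
  \<comment> \<open>A flow does not move the state of a generator: the higher terms of its
    exponential are nonnegative modes on the vacuum.\<close>
  have g': "kappa ?g = theta (- of_int d) (kappa ?g)"
    unfolding kappa_generator theta F.flow_def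
    by (simp add: F.exps_eq [where K = 1] psi_fvac)
  obtain v' where v': "kappa v' = theta (of_int (charge a)) (kappa u)" using kappa_surj by metis
  let ?e = "of_int (charge a * d) :: complex"
  have *: "VM.YW (ops VA_Y VA_Ys a r u) q VA_one = bor VA_scale (VM.prods ?g u VA_one) r 0 q" for q
  proof -
    have "bor VA_scale (flip2 (exps2 VA_scale (- ?e) ?e (flip2 (VM.prods v' ?g VA_one)))) r q 0 = 0"
      by (intro VA.bor_vanish VA.exps2_vanish) (simp add: ops_one)
    then show ?thesis
      using VM.borcherds [OF g ops(1) g' v', of VA_one r 0 q] by (simp add: VA.itr_0)
  qed
  have "VM.YW (ops VA_Y VA_Ys a r u) q VA_one = 0" if "q \<ge> 0" for q
    unfolding * using that ops.IH by (intro VA.bor_vanish) simp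
  moreover have "VM.YW (ops VA_Y VA_Ys a r u) (-1) VA_one = ops VA_Y VA_Ys a r u"
    unfolding * by (subst VA.bor_eq [where K = 1]) (use ops.IH in simp_all)
  ultimately show ?case by simp
qed

lemma VM_weak_quantum_vertex_algebra: "weak_quantum_vertex_algebra VA_scale VM.YW VA_one"
proof (intro weak_quantum_vertex_algebra.intro weak_quantum_vertex_algebra_axioms.intro VA.vector_space_axioms
    VM.linear_YW_left VM.linear_YW VM.YW_one VM_jacobi)
  show "\<exists>N. \<forall>n\<ge>N. VM.YW v n w = 0" for v w using VM.trunc_YW [of v w] by (simp add: trunc_def)
qed (simp_all add: VM_creation)

section \<open>Module structures and uniqueness\<close>

context module_ops
begin

lemma weak_associativity:
  "\<exists>l. \<forall>a b. mult_pow scale l (shifted_prod scale YW u v w) a b = mult_pow scale l (shifted_iter VM.YW YW u v w) a b"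
proof -
  obtain l where l: "\<And>r q. bor scale (prods u v w) r (int l) q = itr scale (iters u v w) r (int l) q"
    using associativity [of u v w] by blast
  have "mult_pow scale l (shifted_prod scale YW u v w) a b = bor scale (prods u v w) (- a - 1) (int l) (- b - 1)" for a b
    by (rule mult_pow_step [where J = "\<lambda>r p q. bor scale (prods u v w) r p q"])
      (rule shifted_prod_bor, rule bor_step [OF utrunc_prods])
  moreover have "mult_pow scale l (shifted_iter VM.YW YW u v w) a b = itr scale (iters u v w) (- a - 1) (int l) (- b - 1)" for a b
    by (rule mult_pow_step [where J = "\<lambda>r p q. itr scale (iters u v w) r p q"])
      (simp add: itr_0 shifted_iter_def, rule itr_step [OF utrunc_iters])
  ultimately show ?thesis using l by (intro exI [of _ l]) simp
qed

lemma YW_module: "weak_quantum_vertex_algebra_module VA_scale VM.YW VA_one scale YW"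
proof (intro weak_quantum_vertex_algebra_module.intro weak_quantum_vertex_algebra_module_axioms.intro
    VM_weak_quantum_vertex_algebra vector_space_axioms linear_YW_left linear_YW YW_one weak_associativity)
  show "\<exists>N. \<forall>n\<ge>N. YW v n w = 0" for v w using trunc_YW [of v w] by (simp add: trunc_def)
qed

text \<open>\<open>assoc\<close> is a common consequence of weak associativity and of the Jacobi
  identity, so both uniqueness claims reduce to this one. The products with a generator are known by
  induction, and \<open>itr_unique\<close> extracts the single modes of a_r u.\<close>

lemma YW_unique:
  assumes lin: "\<And>n w. Vector_Spaces.linear VA_scale scale (\<lambda>u. Z u n w)"
    and one: "\<And>n w. Z VA_one n w = (if n = -1 then w else 0)"
    and gen: "\<And>a n w. Z (ops VA_Y VA_Ys a (-1) VA_one) n w = A a n w"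
    and trunc: "\<And>u w. trunc (\<lambda>n. Z u n w)"
    and assoc: "\<And>a u w. \<exists>l::nat. \<forall>r q. bor scale (\<lambda>m n. Z (ops VA_Y VA_Ys a (-1) VA_one) m (Z u n w)) r (int l) q
      = itr scale (\<lambda>r q. Z (ops VA_Y VA_Ys a r u) q w) r (int l) q"
  shows "Z = YW"
proof -
  have "\<forall>n w. Z u n w = YW u n w" for u
  proof (induction u rule: VA_word_induct)
    case (add u v) then show ?case by (simp add: YW_add linear_addD [OF lin])
  next
    case (scale c u) then show ?case by (simp add: YW_scale linear_scaleD [OF lin])
  next
    case one show ?case by (simp add: YW_one assms(2))
  next
    case (ops a r d u)
    let ?g = "ops VA_Y VA_Ys a (-1) VA_one"
    have "Z (ops VA_Y VA_Ys a r u) q w = YW (ops VA_Y VA_Ys a r u) q w" for r q w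
    proof -
      let ?P = "prods ?g u w" and ?I = "iters ?g u w" and ?J = "\<lambda>r q. Z (ops VA_Y VA_Ys a r u) q w"
      have P: "(\<lambda>m n. Z ?g m (Z u n w)) = ?P"
        using ops.IH by (simp add: gen YW_generator)
      obtain l where l: "\<And>r q. bor scale ?P r (int l) q = itr scale ?J r (int l) q"
        using assoc [of a u w] unfolding P by blast
      obtain l' where l': "\<And>r q. bor scale ?P r (int l') q = itr scale ?I r (int l') q"
        using associativity [of ?g u w] by blast
      obtain N where "\<And>n. n \<ge> N \<Longrightarrow> ops VA_Y VA_Ys a n u = 0"
        using VM.trunc_A [of a u] unfolding trunc_def by blast
      then have J: "utrunc ?J" unfolding utrunc_def by (intro exI [of _ N]) (simp add: linear_zeroD [OF lin])
      have "itr scale ?J r (int (max l l')) q = itr scale ?I r (int (max l l')) q" for r q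
        using bor_itr_mono [OF utrunc_prods J max.cobounded1 l]
          bor_itr_mono [OF utrunc_prods utrunc_iters max.cobounded2 l'] by metis
      then have "?J r q = ?I r q" by (rule itr_unique [OF J utrunc_iters])
      then show ?thesis by simp
    qed
    then show ?case by blast
  qed
  then show ?thesis by (intro ext) simp
qed

lemma YW_module_unique:
  assumes "weak_quantum_vertex_algebra_module VA_scale VM.YW VA_one scale Z"
    and gen: "\<And>a n w. Z (ops VA_Y VA_Ys a (-1) VA_one) n w = A a n w"
  shows "Z = YW"
proof (rule YW_unique)
  interpret Z: weak_quantum_vertex_algebra_module VA_scale VM.YW VA_one scale Z by fact
  show lin: "Vector_Spaces.linear VA_scale scale (\<lambda>u. Z u n w)" for n w by (rule Z.module_linear_left)
  show "Z VA_one n w = (if n = -1 then w else 0)" for n w by (rule Z.module_vacuum)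
  show tr: "trunc (\<lambda>n. Z u n w)" for u w using Z.module_truncation [of u w] by (simp add: trunc_def)
  fix a u w
  let ?g = "ops VA_Y VA_Ys a (-1) VA_one"
  let ?P = "\<lambda>m n. Z ?g m (Z u n w)" and ?J = "\<lambda>r q. Z (ops VA_Y VA_Ys a r u) q w"
  obtain N where "\<And>n. n \<ge> N \<Longrightarrow> ops VA_Y VA_Ys a n u = 0"
    using VM.trunc_A [of a u] unfolding trunc_def by blast
  then have J: "utrunc ?J" unfolding utrunc_def by (intro exI [of _ N]) (simp add: linear_zeroD [OF lin])
  obtain M where "\<And>n. n \<ge> M \<Longrightarrow> Z u n w = 0" using tr [of u w] unfolding trunc_def by blast
  then have P: "utrunc (flip2 ?P)"
    unfolding utrunc_def by (intro exI [of _ M]) (simp add: linear_zeroD [OF Z.module_linear_right])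
  obtain l where l: "\<And>a b. mult_pow scale l (shifted_prod scale Z ?g u w) a b = mult_pow scale l (shifted_iter VM.YW Z ?g u w) a b"
    using Z.weak_associativity by blast
  have 1: "mult_pow scale l (shifted_prod scale Z ?g u w) a b = bor scale ?P (- a - 1) (int l) (- b - 1)" for a b
    by (rule mult_pow_step [where J = "\<lambda>r p q. bor scale ?P r p q"])
      (rule shifted_prod_bor, rule bor_step [OF P])
  have 2: "mult_pow scale l (shifted_iter VM.YW Z ?g u w) a b = itr scale ?J (- a - 1) (int l) (- b - 1)" for a b
    by (rule mult_pow_step [where J = "\<lambda>r p q. itr scale ?J r p q"])
      (simp add: itr_0 shifted_iter_def, rule itr_step [OF J])
  show "\<exists>l::nat. \<forall>r q. bor scale ?P r (int l) q = itr scale ?J r (int l) q"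
  proof (intro exI allI)
    fix r q
    show "bor scale ?P r (int l) q = itr scale ?J r (int l) q"
      using l [of "- r - 1" "- q - 1"] unfolding 1 2 by simp
  qed
qed (rule gen)

end

lemma VM_unique:
  assumes "weak_quantum_vertex_algebra VA_scale Z VA_one"
    and gen: "\<And>a n w. Z (ops VA_Y VA_Ys a (-1) VA_one) n w = ops VA_Y VA_Ys a n w"
  shows "Z = VM.YW"
proof (rule VM.YW_unique)
  interpret Z: weak_quantum_vertex_algebra VA_scale Z VA_one by fact
  show "Vector_Spaces.linear VA_scale VA_scale (\<lambda>u. Z u n w)" for n w by (rule Z.linear_left)
  show "Z VA_one n w = (if n = -1 then w else 0)" for n w by (rule Z.vacuum)
  show tr: "trunc (\<lambda>n. Z u n w)" for u w using Z.truncation [of u w] by (simp add: trunc_def)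
  fix a u w
  let ?g = "ops VA_Y VA_Ys a (-1) VA_one"
  obtain ts :: "(VA \<times> VA \<times> complex fls) list" where ts: "\<And>w a b c.
      fprod3 VA_scale delta_L1 (prod_series Z ?g u w) a b c
      - fprod3 VA_scale delta_L2 (opp_series VA_scale Z ts w) a b c
      = fprod3 VA_scale delta_R (iter_series Z ?g u w) a b c"
    using Z.jacobi by blast
  \<comment> \<open>The tensor is a finite sum, so one bound truncates all \<open>u'\<close> on
    \<open>w\<close>; at \<open>p\<close> equal to that bound the opposite term of the Jacobi
    identity is zero and associativity remains.\<close>
  have "\<exists>N. \<forall>(v', u', f)\<in>set ts. \<forall>n\<ge>N. Z u' n w = 0"
  proof (induction ts)
    case (Cons x ts)
    obtain v' u' f where x: "x = (v', u', f)" by (cases x)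
    obtain N where N: "\<forall>(v', u', f)\<in>set ts. \<forall>n\<ge>N. Z u' n w = 0" using Cons by blast
    obtain K where "\<forall>n\<ge>K. Z u' n w = 0" using Z.truncation by blast
    with N show ?case by (intro exI [of _ "max N K"]) (auto simp: x)
  qed simp
  then obtain N where N: "\<And>v' u' f n. (v', u', f) \<in> set ts \<Longrightarrow> n \<ge> N \<Longrightarrow> Z u' n w = 0" by blast
  have opp: "VA.opp_term Z ts w a b c x = 0" if "- b - 1 \<ge> N" for a b c x
  proof (cases x)
    case (fields p q r)
    show ?thesis
    proof (cases "q \<ge> 0")
      case True
      then have "Z v' (- (c - r) - 1) (Z u' (- (b - q) - 1) w) = 0" if "(v', u', f) \<in> set ts" for v' u' f
        using N [OF that, of "- (b - q) - 1"] \<open>- b - 1 \<ge> N\<close> by (simp add: linear_zeroD [OF Z.linear_right])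
      then have "map (\<lambda>(v', u', f). VA_scale ((-1) powi (a - p) * fls_nth f (a - p))
          (Z v' (- (c - r) - 1) (Z u' (- (b - q) - 1) w))) ts = map (\<lambda>_. 0) ts"
        by (intro map_cong refl) (auto simp del: minus_diff_eq)
      then have "opp_series VA_scale Z ts w (a - p) (b - q) (c - r) = 0"
        unfolding opp_series_def by (simp only: sum_list_0)
      then show ?thesis by (simp add: VA.opp_term_def fields)
    next
      case False
      then show ?thesis by (simp add: VA.opp_term_def fields delta_L2_def delta3_def binexp_def)
    qed
  qed
  show "\<exists>l::nat. \<forall>r q. bor VA_scale (\<lambda>m n. Z ?g m (Z u n w)) r (int l) q
      = itr VA_scale (\<lambda>r q. Z (ops VA_Y VA_Ys a r u) q w) r (int l) q"
  proof (intro exI allI)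
    fix r q
    have "fprod3 VA_scale delta_L2 (opp_series VA_scale Z ts w) (- r - 1) (- int (nat N) - 1) (- q - 1) = 0"
      unfolding VA.fprod3_opp_term by (simp add: opp)
    then show "bor VA_scale (\<lambda>m n. Z ?g m (Z u n w)) r (int (nat N)) q
      = itr VA_scale (\<lambda>r q. Z (ops VA_Y VA_Ys a r u) q w) r (int (nat N)) q"
      using ts [of w "- r - 1" "- int (nat N) - 1" "- q - 1"]
      unfolding VA.fprod3_prod_series VA.fprod3_iter_series by (simp add: gen)
  qed
qed (rule gen)

lemma generators: "VA_a = ops VA_Y VA_Ys Yl (-1) VA_one" "VA_b = ops VA_Y VA_Ys Ysl (-1) VA_one"
  by (simp_all add: VA_a_def VA_b_def)

lemma generators_iff:
  "(\<forall>n. Z VA_a n = Y n) \<and> (\<forall>n. Z VA_b n = Ys n) \<longleftrightarrow> (\<forall>a n w. Z (ops VA_Y VA_Ys a (-1) VA_one) n w = ops Y Ys a n w)"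
  unfolding generators fun_eq_iff by (auto simp: ops_def split: letter.splits)

theorem proposition4p8:
  shows "(vacuum_A_module VA_scale VA_Y VA_Ys VA_one \<and>
      (\<forall>(scaleW :: complex \<Rightarrow> 'w::ab_group_add \<Rightarrow> 'w) Y Ys v.
         vacuum_A_module scaleW Y Ys v \<longrightarrow>
         (\<exists>!f. A_module_hom VA_scale VA_Y VA_Ys scaleW Y Ys f \<and> f VA_one = v))) \<and>
    (\<exists>!YV. weak_quantum_vertex_algebra VA_scale YV VA_one \<and>
           (\<forall>n. YV VA_a n = VA_Y n) \<and> (\<forall>n. YV VA_b n = VA_Ys n)) \<and>
    (\<forall>YV. weak_quantum_vertex_algebra VA_scale YV VA_one \<and>
           (\<forall>n. YV VA_a n = VA_Y n) \<and> (\<forall>n. YV VA_b n = VA_Ys n) \<longrightarrow>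
      (\<forall>(scaleM :: complex \<Rightarrow> 'm::ab_group_add \<Rightarrow> 'm) Y Ys.
         restricted_A_module scaleM Y Ys \<longrightarrow>
         (\<exists>!YW. weak_quantum_vertex_algebra_module VA_scale YV VA_one scaleM YW \<and>
                (\<forall>n. YW VA_a n = Y n) \<and> (\<forall>n. YW VA_b n = Ys n))))"
proof (intro conjI allI impI)
  show "vacuum_A_module VA_scale VA_Y VA_Ys VA_one"
  proof (intro vacuum_A_module.intro vacuum_A_module_axioms.intro VA.A_module_axioms VA_one_neq_0 VA_generated)
    show "n \<ge> 0 \<Longrightarrow> VA_Y n VA_one = 0" "n \<ge> 0 \<Longrightarrow> VA_Ys n VA_one = 0" for n
      using ops_one [of n Yl] ops_one [of n Ysl] by simp_all
  qed
next
  fix scaleW :: "complex \<Rightarrow> 'w \<Rightarrow> 'w" and Y Ys v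
  assume "vacuum_A_module scaleW Y Ys v"
  then interpret W: vacuum_A_module scaleW Y Ys v .
  have "\<exists>f. A_module_hom VA_scale VA_Y VA_Ys scaleW Y Ys f \<and> f VA_one = v"
    by (rule W.VA_hom) (rename_tac a n, case_tac a, simp_all add: W.vac_Y W.vac_Ys)
  then show "\<exists>!f. A_module_hom VA_scale VA_Y VA_Ys scaleW Y Ys f \<and> f VA_one = v"
    using VA_hom_unique by metis
next
  show "\<exists>!YV. weak_quantum_vertex_algebra VA_scale YV VA_one \<and>
           (\<forall>n. YV VA_a n = VA_Y n) \<and> (\<forall>n. YV VA_b n = VA_Ys n)"
    unfolding generators_iff
    by (rule ex1I [of _ VM.YW]) (auto simp: VM_weak_quantum_vertex_algebra intro: VM_unique)
next
  fix YV and scaleM :: "complex \<Rightarrow> 'm \<Rightarrow> 'm" and Y Ys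
  assume "weak_quantum_vertex_algebra VA_scale YV VA_one \<and>
           (\<forall>n. YV VA_a n = VA_Y n) \<and> (\<forall>n. YV VA_b n = VA_Ys n)"
  \<comment> \<open>The algebra structure is unique, so the module claim for an arbitrary one is the
    claim for \<open>VM.YW\<close>.\<close>
  then have YV: "YV = VM.YW" unfolding generators_iff by (auto intro: VM_unique)
  assume "restricted_A_module scaleM Y Ys"
  then interpret M: module_ops scaleM "ops Y Ys" by (rule module_ops_restricted)
  show "\<exists>!YW. weak_quantum_vertex_algebra_module VA_scale YV VA_one scaleM YW \<and>
                (\<forall>n. YW VA_a n = Y n) \<and> (\<forall>n. YW VA_b n = Ys n)"
    unfolding generators_iff YV
    by (rule ex1I [of _ M.YW]) (auto simp: M.YW_module M.YW_generator intro: M.YW_module_unique)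
qed

end
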